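(* \textsc{Max-Min Fair Matching} is polynomial-time solvable on instances with $\Delta_U\le 1$, on instances with $\Delta_V\le 2$, and on instances with $(\Delta_U,\Delta_V)=(2,3)$, in all these cases even with the non-emptiness constraint. It is NP-hard on instances with $\Delta_U=a$ and $\Delta_V=b$ for every other pair of integers $(a,b)$, i.e., whenever $a\ge 2$, $b\ge 3$ and $(a,b)\ne(2,3)$.
   Context: Let $G=(U\cup V,E)$ be a bipartite graph with left side $U$ and right side $V$ ($U\cap V=\emptyset$); $\Delta_U$ (resp. $\Delta_V$) denotes the maximum degree of a vertex of $U$ (resp. $V$). For a vertex $w$ and $M\subseteq E$, let $M(w)=\{w' \mid \{w,w'\}\in M\}$. A many-to-one matching is a set $M\subseteq E$ with $|M(u)|\le 1$ for every $u\in U$; it is left-perfect if $|M(u)|=1$ for every $u\in U$. Let $C$ be a finite set of colors and $\mathrm{col}\colon U\to C$; for $U'\subseteq U$ and $c\in C$ let $U'_c=\{u\in U'\mid \mathrm{col}(u)=c\}$. Define $\mathrm{MaxMin}(U')=\max_{c\in C}|U'_c|-\min_{c\in C}|U'_c|$ (over all colors of $C$). For an integer $\ell\ge0$, $U'$ is $\ell$-fair if $\mathrm{MaxMin}(U')\le\ell$, and $M$ is $\ell$-fair if $M(v)$ is $\ell$-fair for every $v\in V$. \textsc{Max-Min Fair Matching}: given $G$, $C$, $\mathrm{col}$, $\ell\in\mathbb{N}$, decide whether there is an $\ell$-fair left-perfect many-to-one matching in $G$. With the non-emptiness constraint one additionally requires $M(v)\ne\emptyset$ for every $v\in V$. *)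

theory Defs
  imports "HOL-Computational_Algebra.Polynomial"
begin

section \<open>Deterministic multi-tape Turing machines\<close>

text \<open>
  Tapes are infinite in both directions. Tape symbols are natural numbers, 0 being the blank and
  1, 2 standing for the input bits False, True; further symbols are at the disposal of the machine.
  State 0 is initial; 1 and 2 are the accepting and the rejecting halting state.
\<close>

datatype move = Left | Stay | Right

fun shift :: "move \<Rightarrow> int" where
  "shift Left = -1"
| "shift Stay = 0"
| "shift Right = 1"

record tm =
  num_tapes :: nat
  num_states :: nat
  num_symbols :: nat
  delta :: "nat \<Rightarrow> nat list \<Rightarrow> nat \<times> (nat \<times> move) list"

text \<open>
  Only the restriction of the transition function to the finitely many pairs of a state and a list
  of scanned symbols matters, and on these it must stay within the declared finite sets.
\<close>

definition turing_machine :: "tm \<Rightarrow> bool" where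
  "turing_machine M \<longleftrightarrow>
     num_tapes M \<ge> 1 \<and> num_states M \<ge> 3 \<and> num_symbols M \<ge> 3 \<and>
     (\<forall>q<num_states M. \<forall>ss. length ss = num_tapes M \<and> set ss \<subseteq> {..<num_symbols M} \<longrightarrow>
        (case delta M q ss of (q', as) \<Rightarrow>
           q' < num_states M \<and> length as = num_tapes M \<and> fst ` set as \<subseteq> {..<num_symbols M}))"

type_synonym tape = "(int \<Rightarrow> nat) \<times> int"
type_synonym config = "nat \<times> tape list"

fun scan :: "tape \<Rightarrow> nat" where
  "scan (t, h) = t h"

fun act :: "nat \<times> move \<Rightarrow> tape \<Rightarrow> tape" where
  "act (s, d) (t, h) = (t(h := s), h + shift d)"

definition accepting :: "config \<Rightarrow> bool" where
  "accepting c \<longleftrightarrow> fst c = 1"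

definition rejecting :: "config \<Rightarrow> bool" where
  "rejecting c \<longleftrightarrow> fst c = 2"

definition halted :: "config \<Rightarrow> bool" where
  "halted c \<longleftrightarrow> accepting c \<or> rejecting c"

definition step :: "tm \<Rightarrow> config \<Rightarrow> config" where
  "step M c =
     (if halted c then c
      else case delta M (fst c) (map scan (snd c)) of (q', as) \<Rightarrow> (q', map2 act as (snd c)))"

definition contents :: "bool list \<Rightarrow> int \<Rightarrow> nat" where
  "contents x i = (if 0 \<le> i \<and> i < int (length x) then (if x ! nat i then 2 else 1) else 0)"

definition initial :: "tm \<Rightarrow> bool list \<Rightarrow> config" where
  "initial M x = (0, (contents x, 0) # replicate (num_tapes M - 1) (\<lambda>_. 0, 0))"

definition run :: "tm \<Rightarrow> bool list \<Rightarrow> nat \<Rightarrow> config" where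
  "run M x t = (step M ^^ t) (initial M x)"


section \<open>Polynomial time, NP and NP-hardness\<close>

text \<open>
  A problem restricted to certain instances is given by the set \<open>D\<close> of the strings encoding the
  admitted instances and a set \<open>Y\<close> containing those that encode yes-instances. Only the
  behaviour on \<open>D\<close> matters; unrestricted languages are the case \<open>D = UNIV\<close>.
\<close>

definition poly_time_solvable :: "bool list set \<Rightarrow> bool list set \<Rightarrow> bool" where
  "poly_time_solvable D Y \<longleftrightarrow>
     (\<exists>M (p :: nat poly). turing_machine M \<and>
        (\<forall>x\<in>D. halted (run M x (poly p (length x))) \<and>
               (accepting (run M x (poly p (length x))) \<longleftrightarrow> x \<in> Y)))"

text \<open>The value of a computed function is what is left on the last tape.\<close>

definition poly_time_computable :: "(bool list \<Rightarrow> bool list) \<Rightarrow> bool" where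
  "poly_time_computable f \<longleftrightarrow>
     (\<exists>M (p :: nat poly). turing_machine M \<and>
        (\<forall>x. halted (run M x (poly p (length x))) \<and>
             fst (last (snd (run M x (poly p (length x))))) = contents (f x)))"

definition pair_code :: "bool list \<Rightarrow> bool list \<Rightarrow> bool list" where
  "pair_code x w = concat (map (\<lambda>b. [True, b]) x) @ [False] @ w"

definition in_NP :: "bool list set \<Rightarrow> bool" where
  "in_NP L \<longleftrightarrow>
     (\<exists>R (q :: nat poly). poly_time_solvable UNIV R \<and>
        (\<forall>x. x \<in> L \<longleftrightarrow> (\<exists>w. length w \<le> poly q (length x) \<and> pair_code x w \<in> R)))"

definition NP_hard :: "bool list set \<Rightarrow> bool list set \<Rightarrow> bool" where
  "NP_hard D Y \<longleftrightarrow>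
     (\<forall>L. in_NP L \<longrightarrow>
        (\<exists>f. poly_time_computable f \<and> (\<forall>x. f x \<in> D \<and> (x \<in> L \<longleftrightarrow> f x \<in> Y))))"


section \<open>Fair matchings\<close>

record ('v, 'c) fm_instance =
  lside :: "'v set"
  rside :: "'v set"
  edges :: "'v set set"
  colors :: "'c set"
  col :: "'v \<Rightarrow> 'c"
  ell :: nat

text \<open>
  The set of colors must be non-empty, since otherwise there is no maximum and no minimum over all
  colors. This only excludes instances without left vertices.
\<close>

definition fm_instance :: "('v, 'c) fm_instance \<Rightarrow> bool" where
  "fm_instance I \<longleftrightarrow>
     finite (lside I) \<and> finite (rside I) \<and> lside I \<inter> rside I = {} \<and>
     (\<forall>e\<in>edges I. \<exists>u\<in>lside I. \<exists>v\<in>rside I. e = {u, v}) \<and>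
     finite (colors I) \<and> colors I \<noteq> {} \<and> col I ` lside I \<subseteq> colors I"

definition nbrs :: "'v set set \<Rightarrow> 'v \<Rightarrow> 'v set" where
  "nbrs M w = {w'. {w, w'} \<in> M}"

text \<open>The maximum over an empty side is 0.\<close>

definition max_degree :: "'v set set \<Rightarrow> 'v set \<Rightarrow> nat" where
  "max_degree E W = Max (insert 0 ((\<lambda>w. card (nbrs E w)) ` W))"

definition Delta_U :: "('v, 'c) fm_instance \<Rightarrow> nat" where
  "Delta_U I = max_degree (edges I) (lside I)"

definition Delta_V :: "('v, 'c) fm_instance \<Rightarrow> nat" where
  "Delta_V I = max_degree (edges I) (rside I)"

definition many_to_one_matching :: "('v, 'c) fm_instance \<Rightarrow> 'v set set \<Rightarrow> bool" where
  "many_to_one_matching I M \<longleftrightarrow> M \<subseteq> edges I \<and> (\<forall>u\<in>lside I. card (nbrs M u) \<le> 1)"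

definition left_perfect :: "('v, 'c) fm_instance \<Rightarrow> 'v set set \<Rightarrow> bool" where
  "left_perfect I M \<longleftrightarrow> (\<forall>u\<in>lside I. card (nbrs M u) = 1)"

definition color_class :: "('v, 'c) fm_instance \<Rightarrow> 'v set \<Rightarrow> 'c \<Rightarrow> 'v set" where
  "color_class I U' c = {u \<in> U'. col I u = c}"

definition MaxMin :: "('v, 'c) fm_instance \<Rightarrow> 'v set \<Rightarrow> nat" where
  "MaxMin I U' =
     (MAX c\<in>colors I. card (color_class I U' c)) - (MIN c\<in>colors I. card (color_class I U' c))"

definition fair_set :: "('v, 'c) fm_instance \<Rightarrow> 'v set \<Rightarrow> bool" where
  "fair_set I U' \<longleftrightarrow> MaxMin I U' \<le> ell I"

definition fair_matching :: "('v, 'c) fm_instance \<Rightarrow> 'v set set \<Rightarrow> bool" where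
  "fair_matching I M \<longleftrightarrow> (\<forall>v\<in>rside I. fair_set I (nbrs M v))"

definition max_min_fair_matching :: "('v, 'c) fm_instance \<Rightarrow> bool" where
  "max_min_fair_matching I \<longleftrightarrow>
     (\<exists>M. many_to_one_matching I M \<and> left_perfect I M \<and> fair_matching I M)"

definition max_min_fair_matching_nonempty :: "('v, 'c) fm_instance \<Rightarrow> bool" where
  "max_min_fair_matching_nonempty I \<longleftrightarrow>
     (\<exists>M. many_to_one_matching I M \<and> left_perfect I M \<and> fair_matching I M \<and>
          (\<forall>v\<in>rside I. nbrs M v \<noteq> {}))"


section \<open>Encoding of instances\<close>

text \<open>
  Vertices and colors are named by natural numbers. The encoding is a sequence of two-bit tokens:
  a binary digit is preceded by True, [False, False] ends a number and [False, True] ends a list of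
  numbers. Numbers, including the fairness bound, are written in binary, least significant bit
  first. The sets that make up an instance are listed without repetitions, in any order.
\<close>

fun bits :: "nat \<Rightarrow> bool list" where
  "bits n = (if n = 0 then [] else odd n # bits (n div 2))"

declare bits.simps [simp del]

definition nat_code :: "nat \<Rightarrow> bool list" where
  "nat_code n = concat (map (\<lambda>b. [True, b]) (bits n)) @ [False, False]"

definition list_code :: "nat list \<Rightarrow> bool list" where
  "list_code ns = concat (map nat_code ns) @ [False, True]"

definition pairs_code :: "(nat \<times> nat) list \<Rightarrow> bool list" where
  "pairs_code ps = list_code (concat (map (\<lambda>(m, n). [m, n]) ps))"

definition encodes :: "bool list \<Rightarrow> (nat, nat) fm_instance \<Rightarrow> bool" where
  "encodes s I \<longleftrightarrow>
     (\<exists>us vs es cs.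
        distinct us \<and> set us = lside I \<and>
        distinct vs \<and> set vs = rside I \<and>
        distinct es \<and> set es = {(u, v). u \<in> lside I \<and> v \<in> rside I \<and> {u, v} \<in> edges I} \<and>
        distinct cs \<and> set cs = colors I \<and>
        s = pairs_code (map (\<lambda>u. (u, col I u)) us) @ list_code vs @ pairs_code es @
            list_code cs @ nat_code (ell I))"

lemma foldr_bits: "foldr (\<lambda>b k. of_bool b + 2 * k) (bits n) 0 = n"
proof (induction n rule: bits.induct)
  case (1 n)
  show ?case
  proof (cases "n = 0")
    case False
    then have "foldr (\<lambda>b k. of_bool b + 2 * k) (bits n) 0 = of_bool (odd n) + 2 * (n div 2)"
      using 1 by (subst bits.simps) simp
    then show ?thesis
      by (cases "odd n") auto
  qed (simp add: bits.simps)
qed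

lemma bits_eq_iff: "bits m = bits n \<longleftrightarrow> m = n"
  by (metis foldr_bits)

lemma nat_code_append_eq_iff: "nat_code m @ r = nat_code n @ r' \<longleftrightarrow> m = n \<and> r = r'"
proof -
  have *: "concat (map (\<lambda>b. [True, b]) xs) @ [False, False] @ r =
        concat (map (\<lambda>b. [True, b]) ys) @ [False, False] @ r' \<Longrightarrow> xs = ys \<and> r = r'" for xs ys
  proof (induction xs arbitrary: ys)
    case Nil
    then show ?case by (cases ys) auto
  next
    case (Cons x xs)
    obtain z zs where ys: "ys = z # zs"
      using Cons.prems by (cases ys) simp_all
    show ?case
      using Cons.prems Cons.IH[of zs] unfolding ys by (simp only: list.map concat.simps) simp
  qed
  show ?thesis
    using *[of "bits m" "bits n"] by (auto simp: nat_code_def bits_eq_iff)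
qed

lemma nat_code_append_neq: "nat_code n @ r \<noteq> False # True # r'"
  by (cases "bits n") (auto simp: nat_code_def)

lemma list_code_append_eq_iff: "list_code ms @ r = list_code ns @ r' \<longleftrightarrow> ms = ns \<and> r = r'"
proof
  show "list_code ms @ r = list_code ns @ r' \<Longrightarrow> ms = ns \<and> r = r'"
  proof (induction ms arbitrary: ns)
    case Nil
    then show ?case
      by (cases ns) (auto simp: list_code_def nat_code_append_neq[symmetric])
  next
    case (Cons m ms)
    have code: "list_code (k # ks) @ t = nat_code k @ list_code ks @ t" for k ks t
      by (simp add: list_code_def)
    show ?case
    proof (cases ns)
      case Nil
      then show ?thesis
        using Cons.prems nat_code_append_neq[of m "list_code ms @ r" r']
        by (simp add: code list_code_def[of "[]"])
    next
      case ns: (Cons n ns')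
      from Cons.prems have "m = n" "list_code ms @ r = list_code ns' @ r'"
        by (simp_all add: ns code nat_code_append_eq_iff)
      with Cons.IH[of ns'] show ?thesis
        by (simp add: ns)
    qed
  qed
qed simp

lemma pairs_code_append_eq_iff: "pairs_code ps @ r = pairs_code qs @ r' \<longleftrightarrow> ps = qs \<and> r = r'"
proof -
  have *: "concat (map (\<lambda>(m, n). [m, n]) ps) = concat (map (\<lambda>(m, n). [m, n]) qs) \<Longrightarrow> ps = qs"
    for ps qs :: "(nat \<times> nat) list"
  proof (induction ps arbitrary: qs)
    case Nil
    then show ?case by (cases qs) auto
  next
    case (Cons p ps)
    obtain q qs' where qs: "qs = q # qs'"
      using Cons.prems by (cases p; cases qs) simp_all
    show ?case
      using Cons.prems Cons.IH[of qs'] unfolding qs by (cases p; cases q) simp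
  qed
  show ?thesis
    using *[of ps qs] by (auto simp: pairs_code_def list_code_append_eq_iff)
qed

text \<open>A string encodes at most one instance (up to irrelevant values of \<open>col\<close>).\<close>

lemma encodes_unique:
  assumes "fm_instance I" "encodes s I" "fm_instance J" "encodes s J"
  shows "lside I = lside J" "rside I = rside J" "edges I = edges J" "colors I = colors J"
    and "ell I = ell J" "\<forall>u\<in>lside I. col I u = col J u"
proof -
  obtain us vs es cs where I:
    "set us = lside I" "set vs = rside I" "set cs = colors I"
    "set es = {(u, v). u \<in> lside I \<and> v \<in> rside I \<and> {u, v} \<in> edges I}"
    "s = pairs_code (map (\<lambda>u. (u, col I u)) us) @ list_code vs @ pairs_code es @
           list_code cs @ nat_code (ell I)"
    using assms(2) unfolding encodes_def by blast
  obtain us' vs' es' cs' where J: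
    "set us' = lside J" "set vs' = rside J" "set cs' = colors J"
    "set es' = {(u, v). u \<in> lside J \<and> v \<in> rside J \<and> {u, v} \<in> edges J}"
    "s = pairs_code (map (\<lambda>u. (u, col J u)) us') @ list_code vs' @ pairs_code es' @
           list_code cs' @ nat_code (ell J)"
    using assms(4) unfolding encodes_def by blast
  have *: "map (\<lambda>u. (u, col I u)) us = map (\<lambda>u. (u, col J u)) us'"
    "vs = vs'" "es = es'" "cs = cs'" "ell I = ell J"
  proof -
    from trans[OF I(5)[symmetric] J(5)]
    have "map (\<lambda>u. (u, col I u)) us = map (\<lambda>u. (u, col J u)) us' \<and> vs = vs' \<and> es = es' \<and>
          cs = cs' \<and> nat_code (ell I) = nat_code (ell J)"
      unfolding pairs_code_append_eq_iff list_code_append_eq_iff .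
    with nat_code_append_eq_iff[of "ell I" "[]" "ell J" "[]"]
    show "map (\<lambda>u. (u, col I u)) us = map (\<lambda>u. (u, col J u)) us'"
      "vs = vs'" "es = es'" "cs = cs'" "ell I = ell J"
      by (simp_all only: append_Nil2 simp_thms)
  qed
  from *(1) have "map fst (map (\<lambda>u. (u, col I u)) us) = map fst (map (\<lambda>u. (u, col J u)) us')"
    by (rule arg_cong)
  then have us: "us = us'"
    by (simp add: comp_def)
  show "lside I = lside J"
    using I(1) J(1) us by simp
  show "rside I = rside J"
    using I(2) J(2) *(2) by simp
  show "colors I = colors J"
    using I(3) J(3) *(4) by simp
  show "ell I = ell J"
    by (fact *(5))
  show "\<forall>u\<in>lside I. col I u = col J u"
    using *(1) unfolding us[symmetric] I(1)[symmetric] by simp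
  have edges_eq: "edges K = (\<lambda>(u, v). {u, v}) ` {(u, v). u \<in> lside K \<and> v \<in> rside K \<and> {u, v} \<in> edges K}"
    (is "_ = _ ` ?pairs K") if K: "fm_instance K" for K :: "(nat, nat) fm_instance"
  proof (intro set_eqI iffI)
    fix e assume e: "e \<in> edges K"
    then obtain u v where uv: "u \<in> lside K" "v \<in> rside K" "e = {u, v}"
      using K unfolding fm_instance_def by meson
    have "(u, v) \<in> ?pairs K"
      using uv(1,2) e unfolding uv(3) by blast
    then show "e \<in> (\<lambda>(u, v). {u, v}) ` ?pairs K"
      unfolding uv(3) by (rule rev_image_eqI) (rule prod.case[symmetric])
  next
    fix e assume "e \<in> (\<lambda>(u, v). {u, v}) ` ?pairs K"
    then show "e \<in> edges K"
      by (elim imageE) (simp only: case_prod_beta mem_Collect_eq)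
  qed
  have "edges I = (\<lambda>(u, v). {u, v}) ` set es"
    unfolding I(4) by (rule edges_eq[OF assms(1)])
  moreover have "edges J = (\<lambda>(u, v). {u, v}) ` set es"
    unfolding *(3) J(4) by (rule edges_eq[OF assms(3)])
  ultimately show "edges I = edges J"
    by (rule trans[OF _ sym])
qed

definition encodings :: "((nat, nat) fm_instance \<Rightarrow> bool) \<Rightarrow> bool list set" where
  "encodings P = {s. \<exists>I. fm_instance I \<and> P I \<and> encodes s I}"

end

theory Submission
  imports Defs
begin

text \<open>
  A left-perfect matching assigns every left vertex to one of its neighbours. In the polynomial
  cases, fairness at a vertex with few neighbours amounts to capacities: the left vertices have to
  be given distinct places, and an auction decides whether they can be. Vertices
  with three neighbours of three colours and bound 0 receive all or none of them, which gives parity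
  equations. With two colours and bound 1, the non-emptiness constraint leads to a problem whose
  half-integral relaxation can always be rounded.

  For the hardness, the runs of a nondeterministic machine are described by clauses, the clauses by
  sets of at most three variables of which exactly one is true, and these sets by graphs with three
  colours and bound 0: the vertices for the occurrences of a variable form a cycle of triples that
  are used alternately, and the remaining vertices of these triples have to be matched elsewhere for
  exactly one of the two truth values. Running times are treated by means of a class of functions on
  encoded data with suitable closure properties, whose members are compiled to Turing machines.
\<close>

section \<open>A stack language and its compilation to Turing machines\<close>

text \<open>The exceptional cases come from counting: a colour with more than \<open>l\<close>
  elements in a fair set forces all other colours to occur, so such a set has at least
  \<open>l + card C\<close> elements. With fewer neighbours, or with a single colour, each colour
  can be bounded separately. For degree at most 3 this leaves two colours with bound 0 or 1, and
  three colours with bound 0.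

  The hard one is bound 1 with the non-emptiness constraint: a lower bound on the load, and the rule
  that two vertices of one colour need the third vertex, are not capacities. It is solved by a
  permutation that moves every node of an auxiliary graph to a neighbour. Such a permutation and its
  inverse average to half-integral loads, so the procedure for distinct representatives serves here,
  too. Left degree 2 is essential for the rounding, since a half vertex then has exactly two ends,
  and for expressing a choice by a parity equation.

  On the hard side, only the degree pairs (3, 3) and (2, 4) have gadgets of their own. All other
  pairs follow by adding a disjoint solvable graph that attains the two maximum degrees
  exactly.\<close>

datatype com = Skip | Push nat bool | Pop nat | Emit nat bool | Seq com com
  | Cond nat com com com | While nat com

type_synonym store = "nat \<Rightarrow> bool list"

text \<open>The cost is the exact number of machine steps. A push costs two because the head has to
  leave the old top before the new one is written; sequences, tests and loop tests cost one step
  that only rearranges the continuation.\<close>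

inductive exec :: "com \<Rightarrow> store \<Rightarrow> nat \<Rightarrow> store \<Rightarrow> bool" where
  exec_Skip: "exec Skip s 1 s"
| exec_Push: "exec (Push i b) s 2 (s(i := b # s i))"
| exec_Pop: "exec (Pop i) s 1 (s(i := tl (s i)))"
| exec_Emit: "exec (Emit i b) s 1 (s(i := s i @ [b]))"
| exec_Seq: "exec a s m s1 \<Longrightarrow> exec b s1 n s2 \<Longrightarrow> exec (Seq a b) s (1 + m + n) s2"
| exec_Cond: "exec (case s i of [] \<Rightarrow> a | x # _ \<Rightarrow> if x then b else c) s m s1 \<Longrightarrow>
    exec (Cond i a b c) s (1 + m) s1"
| exec_While_end: "s i = [] \<Longrightarrow> exec (While i c) s 1 s"
| exec_While: "s i \<noteq> [] \<Longrightarrow> exec c s m s1 \<Longrightarrow> exec (While i c) s1 n s2 \<Longrightarrow>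
    exec (While i c) s (1 + m + n) s2"

text \<open>The program may use the stacks below \<open>k\<close> and append to the output stack \<open>k\<close>.\<close>

fun uses :: "nat \<Rightarrow> com \<Rightarrow> bool" where
  "uses k Skip = True"
| "uses k (Push i b) = (i < k)"
| "uses k (Pop i) = (i < k)"
| "uses k (Emit i b) = (i = k)"
| "uses k (Seq a b) = (uses k a \<and> uses k b)"
| "uses k (Cond i a b c) = (i < k \<and> uses k a \<and> uses k b \<and> uses k c)"
| "uses k (While i a) = (i < k \<and> uses k a)"

text \<open>The continuation stacks that occur in front of \<open>K\<close> while \<open>c\<close> is executed.\<close>

fun conts :: "com \<Rightarrow> com list \<Rightarrow> com list set" where
  "conts (Seq a b) K = insert (Seq a b # K) (conts a (b # K) \<union> conts b K)"
| "conts (Cond i a b c) K = insert (Cond i a b c # K) (conts a K \<union> conts b K \<union> conts c K)"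
| "conts (While i a) K = insert (While i a # K) (conts a (While i a # K))"
| "conts c K = {c # K}"

lemma finite_conts: "finite (conts c K)"
  by (induction c arbitrary: K) auto

definition sym :: "bool \<Rightarrow> nat" where
  "sym b = (if b then 2 else 1)"

definition top_sym :: "bool list \<Rightarrow> nat" where
  "top_sym xs = (case xs of [] \<Rightarrow> 0 | x # _ \<Rightarrow> sym x)"

text \<open>A push takes two steps: the flag marks that the head has already been moved.\<close>

definition com_act :: "com \<Rightarrow> bool \<Rightarrow> nat list \<Rightarrow> (nat \<times> move) list" where
  "com_act c fl ss = (case c of
     Push i b \<Rightarrow> (map (\<lambda>s. (s, Stay)) ss)[i := if fl then (sym b, Stay) else (ss ! i, Left)]
   | Pop i \<Rightarrow> (map (\<lambda>s. (s, Stay)) ss)[i := (0, Right)]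
   | Emit i b \<Rightarrow> (map (\<lambda>s. (s, Stay)) ss)[i := (sym b, Right)]
   | _ \<Rightarrow> map (\<lambda>s. (s, Stay)) ss)"

fun com_next :: "com \<Rightarrow> com list \<Rightarrow> bool \<Rightarrow> nat list \<Rightarrow> com list \<times> bool" where
  "com_next (Push i b) K fl ss = (if fl then (K, False) else (Push i b # K, True))"
| "com_next (Seq a b) K fl ss = (a # b # K, False)"
| "com_next (Cond i a b c) K fl ss =
     ((if ss ! i = 0 then a else if ss ! i = 2 then b else c) # K, False)"
| "com_next (While i a) K fl ss = (if ss ! i = 0 then K else a # While i a # K, False)"
| "com_next _ K fl ss = (K, False)"

text \<open>The finite control stores the list of commands that remain to be executed, which takes
  only finitely many values by \<open>finite_conts\<close>. \<open>S\<close> enumerates these values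
  together with the push flag, and the position in \<open>S\<close> numbers the states.\<close>

locale compiled =
  fixes k :: nat and c0 :: com and S :: "(com list \<times> bool) list"
  assumes k: "k > 0"
    and S: "set S = (insert [] (conts c0 [])) \<times> UNIV" and dist: "distinct S"
begin

text \<open>The offset 3 skips the predefined states. The default 1 makes
  \<open>state_of_less\<close> hold for every argument, so \<open>turing_machine\<close> can be
  shown without proving that \<open>S\<close> is closed under \<open>com_next\<close>.\<close>

definition state_of :: "com list \<times> bool \<Rightarrow> nat" where
  "state_of x = (if x \<in> set S then 3 + (THE i. i < length S \<and> S ! i = x) else 1)"

lemma state_of_nth: "i < length S \<Longrightarrow> state_of (S ! i) = 3 + i"
proof -
  assume i: "i < length S"
  then have "(THE j. j < length S \<and> S ! j = S ! i) = i"
    using dist by (auto simp: nth_eq_iff_index_eq)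
  then show ?thesis using i by (simp add: state_of_def)
qed

lemma state_of_less: "state_of x < 3 + length S"
proof (cases "x \<in> set S")
  case True
  then obtain i where "i < length S" "S ! i = x"
    by (auto simp: in_set_conv_nth)
  then show ?thesis using state_of_nth[of i] by simp
qed (simp add: state_of_def)

text \<open>The empty continuation marks the end of the program. The answer is then the top bit of
  stack 0, which is also the first bit of an encoded truth value.\<close>

definition machine :: tm where
  "machine = \<lparr>num_tapes = k + 1, num_states = 3 + length S, num_symbols = 3,
     delta = (\<lambda>q ss.
       if q < 3 \<or> q \<ge> 3 + length S then (state_of ([c0], False), map (\<lambda>s. (s, Stay)) ss)
       else case S ! (q - 3) of
         ([], fl) \<Rightarrow> (if ss ! 0 = 2 then 1 else 2, map (\<lambda>s. (s, Stay)) ss)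
       | (c # K, fl) \<Rightarrow> (state_of (com_next c K fl ss), com_act c fl ss))\<rparr>"

lemma machine_simps [simp]: "num_tapes machine = k + 1" "num_states machine = 3 + length S"
  "num_symbols machine = 3"
  by (simp_all add: machine_def)

lemma com_act: "length (com_act c fl ss) = length ss"
  "set ss \<subseteq> {..<3} \<Longrightarrow> fst ` set (com_act c fl ss) \<subseteq> {..<3}"
proof -
  show "length (com_act c fl ss) = length ss"
    by (auto simp: com_act_def split: com.splits)
  assume ss: "set ss \<subseteq> {..<3}"
  have *: "fst ` set ((map (\<lambda>s. (s, Stay)) ss)[i := x]) \<subseteq> {..<3}"
    if "i < length ss \<Longrightarrow> fst x < 3" for i x
  proof (cases "i < length ss")
    case True
    have "set ((map (\<lambda>s. (s, Stay)) ss)[i := x]) \<subseteq> insert x (set (map (\<lambda>s. (s, Stay)) ss))"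
      by (rule set_update_subset_insert)
    then show ?thesis using that ss True by force
  next
    case False
    then show ?thesis using ss by (auto simp: list_update_beyond)
  qed
  have "ss ! i < 3" if "i < length ss" for i
    using ss that nth_mem by blast
  then show "fst ` set (com_act c fl ss) \<subseteq> {..<3}"
    using ss * by (cases c) (auto simp add: com_act_def sym_def image_image)
qed

lemma turing_machine: "turing_machine machine"
proof -
  have *: "case delta machine q ss of (q', as) \<Rightarrow>
     q' < 3 + length S \<and> length as = k + 1 \<and> fst ` set as \<subseteq> {..<3}"
    if ss: "length ss = k + 1" "set ss \<subseteq> {..<3}" for q ss
  proof -
    have stay: "fst ` set (map (\<lambda>s. (s, Stay)) ss) \<subseteq> {..<3}"
      using ss(2) by auto
    show ?thesis
      using ss(1) stay com_act(1)[where ss = ss] com_act(2)[OF ss(2)] state_of_less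
      unfolding machine_def by (simp split: list.split prod.split)
  qed
  then show ?thesis
    using * by (simp add: turing_machine_def)
qed

text \<open>A stack may lie anywhere on its tape as long as its top is under the head, so that
  pushing and popping shift nothing. The output grows to the right instead and is anchored at 0,
  because its tape has to equal \<open>contents\<close> of the result.\<close>

definition rep :: "store \<Rightarrow> tape list \<Rightarrow> bool" where
  "rep s tps \<longleftrightarrow> length tps = k + 1 \<and>
     (\<forall>i<k. \<exists>h. tps ! i = (\<lambda>p. contents (s i) (p - h), h)) \<and>
     tps ! k = (contents (s k), int (length (s k)))"

lemma rep_scan: "rep s tps \<Longrightarrow> i < k \<Longrightarrow> map scan tps ! i = top_sym (s i)"
proof -
  assume a: "rep s tps" "i < k"
  then obtain h where "tps ! i = (\<lambda>p. contents (s i) (p - h), h)" "length tps = k + 1"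
    by (auto simp: rep_def)
  then show ?thesis
    using a by (cases "s i") (auto simp: top_sym_def contents_def sym_def)
qed

lemma act_stay: "length xs = length tps \<Longrightarrow> (\<And>i. i < length xs \<Longrightarrow> xs ! i = (scan (tps ! i), Stay)) \<Longrightarrow>
    map2 act xs tps = tps"
proof (rule nth_equalityI)
  fix i assume "length xs = length tps" "\<And>i. i < length xs \<Longrightarrow> xs ! i = (scan (tps ! i), Stay)"
    "i < length (map2 act xs tps)"
  then show "map2 act xs tps ! i = tps ! i"
    by (cases "tps ! i") auto
qed simp

lemma act_stay_map: "map2 act (map (\<lambda>s. (s, Stay)) (map scan tps)) tps = tps"
  by (rule act_stay) auto

lemma act_update:
  assumes "i < length tps"
  shows "map2 act ((map (\<lambda>s. (s, Stay)) (map scan tps))[i := x]) tps = tps[i := act x (tps ! i)]"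
proof (rule nth_equalityI)
  fix j assume "j < length (map2 act ((map (\<lambda>s. (s, Stay)) (map scan tps))[i := x]) tps)"
  then show "map2 act ((map (\<lambda>s. (s, Stay)) (map scan tps))[i := x]) tps ! j =
      tps[i := act x (tps ! i)] ! j"
    using assms by (cases "tps ! j"; cases "i = j") (auto simp: nth_list_update)
qed simp

abbreviation reaches :: "config \<Rightarrow> nat \<Rightarrow> config \<Rightarrow> bool" where
  "reaches c t c' \<equiv> (step machine ^^ t) c = c'"

lemma reaches_trans: "reaches a m b \<Longrightarrow> reaches b n c \<Longrightarrow> reaches a (m + n) c"
  by (auto simp: funpow_add add.commute[of m])

lemma step_state:
  assumes "(c # K, fl) \<in> set S"
  shows "step machine (state_of (c # K, fl), tps) =
    (state_of (com_next c K fl (map scan tps)), map2 act (com_act c fl (map scan tps)) tps)"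
proof -
  obtain i where i: "i < length S" "S ! i = (c # K, fl)"
    using assms by (auto simp: in_set_conv_nth)
  then have "state_of (c # K, fl) = 3 + i"
    using state_of_nth by metis
  then show ?thesis
    using i by (simp add: step_def halted_def accepting_def rejecting_def machine_def)
qed

lemma step_stay:
  assumes "(c # K, False) \<in> set S" "\<And>ss. com_act c False ss = map (\<lambda>s. (s, Stay)) ss"
  shows "step machine (state_of (c # K, False), tps) = (state_of (com_next c K False (map scan tps)), tps)"
  unfolding step_state[OF assms(1)] assms(2) act_stay_map ..

lemma rep_update:
  assumes "rep s tps" "i < k" "\<And>h. tps ! i = (\<lambda>p. contents (s i) (p - h), h) \<Longrightarrow>
     \<exists>h'. y = (\<lambda>p. contents x (p - h'), h')"
  shows "rep (s(i := x)) (tps[i := y])"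
proof -
  obtain h where "tps ! i = (\<lambda>p. contents (s i) (p - h), h)"
    using assms(1,2) by (auto simp: rep_def)
  from assms(3)[OF this] show ?thesis
    using assms(1,2) by (auto simp: rep_def nth_list_update)
qed

lemma contents_Cons: "contents (b # xs) i = (if i = 0 then sym b else contents xs (i - 1))"
proof (cases "i > 0")
  case True
  then have "nat i = Suc (nat (i - 1))" by simp
  then show ?thesis using True by (auto simp: contents_def sym_def)
qed (auto simp: contents_def sym_def)

lemma contents_tl: "contents (tl xs) i = (if i = -1 then 0 else contents xs (i + 1))"
  by (cases xs) (auto simp: contents_Cons, auto simp: contents_def)

lemma contents_snoc: "contents (xs @ [b]) i = (if i = int (length xs) then sym b else contents xs i)"
  by (auto simp: contents_def sym_def nth_append)

text \<open>The continuation \<open>K\<close> is arbitrary, as a command inside a sequence or a loop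
  runs in front of a longer continuation than the command around it. The number of machine steps is
  exactly the cost.\<close>

lemma exec_simulated:
  assumes "exec c s t s'" "uses k c" "conts c K \<times> UNIV \<subseteq> set S" "rep s tps"
  shows "\<exists>tps'. reaches (state_of (c # K, False), tps) t (state_of (K, False), tps') \<and> rep s' tps'"
  using assms
proof (induction arbitrary: K tps rule: exec.induct)
  case (exec_Skip s)
  then have "(Skip # K, False) \<in> set S" by auto
  then show ?case
    using exec_Skip.prems(3) by (auto simp: step_stay com_act_def)
next
  case (exec_Push i b s)
  then have i: "i < k" "i < length tps" by (auto simp: rep_def)
  have in_S: "(Push i b # K, fl) \<in> set S" for fl
    using exec_Push.prems by auto
  obtain h where h: "tps ! i = (\<lambda>p. contents (s i) (p - h), h)"
    using exec_Push.prems i by (auto simp: rep_def)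
  define tps1 where "tps1 = tps[i := act (scan (tps ! i), Left) (tps ! i)]"
  define tps2 where "tps2 = tps1[i := act (sym b, Stay) (tps1 ! i)]"
  have 1: "step machine (state_of (Push i b # K, False), tps) = (state_of (Push i b # K, True), tps1)"
    using act_update[OF i(2)] i by (simp add: step_state[OF in_S] com_act_def tps1_def del: map_map)
  have 2: "step machine (state_of (Push i b # K, True), tps1) = (state_of (K, False), tps2)"
    using act_update[of i tps1] i by (simp add: step_state[OF in_S] com_act_def tps1_def tps2_def del: map_map)
  \<comment> \<open>The new stack starts one cell to the left of the old one, which is where the
    head stands after the first of the two steps.\<close>
  have "tps2 = tps[i := (\<lambda>p. contents (b # s i) (p - (h - 1)), h - 1)]"
    using i by (auto simp: tps1_def tps2_def h contents_Cons fun_eq_iff intro!: arg_cong[of _ _ "list_update tps i"])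
  then have "rep (s(i := b # s i)) tps2"
    using rep_update[OF exec_Push.prems(3) i(1), of "(\<lambda>p. contents (b # s i) (p - (h - 1)), h - 1)" "b # s i"] by auto
  moreover have "reaches (state_of (Push i b # K, False), tps) 2 (state_of (K, False), tps2)"
    using 1 2 by (simp add: numeral_2_eq_2)
  ultimately show ?case by blast
next
  case (exec_Pop i s)
  then have i: "i < k" "i < length tps" by (auto simp: rep_def)
  have in_S: "(Pop i # K, False) \<in> set S"
    using exec_Pop.prems by auto
  have "rep (s(i := tl (s i))) (tps[i := act (0, Right) (tps ! i)])"
  proof (rule rep_update[OF exec_Pop.prems(3) i(1)])
    fix h assume h: "tps ! i = (\<lambda>p. contents (s i) (p - h), h)"
    have "act (0, Right) (tps ! i) = (\<lambda>p. contents (tl (s i)) (p - (h + 1)), h + 1)"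
      by (auto simp: h contents_tl fun_eq_iff)
    then show "\<exists>h'. act (0, Right) (tps ! i) = (\<lambda>p. contents (tl (s i)) (p - h'), h')"
      by blast
  qed
  moreover have "reaches (state_of (Pop i # K, False), tps) 1 (state_of (K, False), tps[i := act (0, Right) (tps ! i)])"
    using act_update[OF i(2)] by (simp add: step_state[OF in_S] com_act_def del: map_map)
  ultimately show ?case by blast
next
  case (exec_Emit i b s)
  then have i: "i = k" "i < length tps" by (auto simp: rep_def)
  have in_S: "(Emit i b # K, False) \<in> set S"
    using exec_Emit.prems by auto
  have "rep (s(i := s i @ [b])) (tps[i := act (sym b, Right) (tps ! i)])"
    using exec_Emit.prems(3) i by (auto simp: rep_def contents_snoc fun_eq_iff)
  moreover have "reaches (state_of (Emit i b # K, False), tps) 1 (state_of (K, False), tps[i := act (sym b, Right) (tps ! i)])"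
    using act_update[OF i(2)] by (simp add: step_state[OF in_S] com_act_def del: map_map)
  ultimately show ?case by blast
next
  case (exec_Seq a s m s1 b n s2)
  have "step machine (state_of (Seq a b # K, False), tps) = (state_of (a # b # K, False), tps)"
    using exec_Seq.prems by (subst step_stay) (auto simp: com_act_def)
  then have 0: "reaches (state_of (Seq a b # K, False), tps) 1 (state_of (a # b # K, False), tps)"
    by simp
  obtain tps1 where 1: "reaches (state_of (a # b # K, False), tps) m (state_of (b # K, False), tps1)"
    "rep s1 tps1"
    using exec_Seq.IH(1)[of "b # K" tps] exec_Seq.prems by auto
  obtain tps2 where 2: "reaches (state_of (b # K, False), tps1) n (state_of (K, False), tps2)"
    "rep s2 tps2"
    using exec_Seq.IH(2)[of K tps1] exec_Seq.prems 1 by auto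
  show ?case
    using reaches_trans[OF reaches_trans[OF 0 1(1)] 2(1)] 2(2) by blast
next
  case (exec_Cond s i a b c m s1)
  let ?d = "case s i of [] \<Rightarrow> a | x # _ \<Rightarrow> if x then b else c"
  have "rep s tps" "i < k" "(Cond i a b c # K, False) \<in> set S"
    using exec_Cond.prems by auto
  then have "step machine (state_of (Cond i a b c # K, False), tps) = (state_of (?d # K, False), tps)"
    using rep_scan[of s tps i]
    by (subst step_stay) (auto simp: com_act_def top_sym_def sym_def simp del: nth_map split: list.splits)
  then have 0: "reaches (state_of (Cond i a b c # K, False), tps) 1 (state_of (?d # K, False), tps)"
    by simp
  have d: "uses k ?d" "conts ?d K \<times> UNIV \<subseteq> set S"
    using exec_Cond.prems(1,2) by (auto split: list.splits if_splits)
  obtain tps1 where 1: "reaches (state_of (?d # K, False), tps) m (state_of (K, False), tps1)"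
    "rep s1 tps1"
    using exec_Cond.IH[of K tps] \<open>rep s tps\<close> d by blast
  show ?case
    using reaches_trans[OF 0 1(1)] 1(2) by blast
next
  case (exec_While_end s i c)
  then have "rep s tps" "i < k" "(While i c # K, False) \<in> set S"
    by auto
  then have "step machine (state_of (While i c # K, False), tps) = (state_of (K, False), tps)"
    using rep_scan[of s tps i] exec_While_end
    by (subst step_stay) (auto simp: com_act_def top_sym_def simp del: nth_map)
  then show ?case
    using \<open>rep s tps\<close> by auto
next
  case (exec_While s i c m s1 n s2)
  have "rep s tps" "i < k" "(While i c # K, False) \<in> set S"
    using exec_While.prems by auto
  then have "step machine (state_of (While i c # K, False), tps) = (state_of (c # While i c # K, False), tps)"
    using rep_scan[of s tps i] \<open>s i \<noteq> []\<close>
    by (subst step_stay) (auto simp: com_act_def top_sym_def sym_def simp del: nth_map split: list.splits)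
  then have 0: "reaches (state_of (While i c # K, False), tps) 1 (state_of (c # While i c # K, False), tps)"
    by simp
  obtain tps1 where 1: "reaches (state_of (c # While i c # K, False), tps) m (state_of (While i c # K, False), tps1)"
    "rep s1 tps1"
    using exec_While.IH(1)[of "While i c # K" tps] exec_While.prems by auto
  obtain tps2 where 2: "reaches (state_of (While i c # K, False), tps1) n (state_of (K, False), tps2)"
    "rep s2 tps2"
    using exec_While.IH(2)[of K tps1] exec_While.prems 1 by auto
  show ?case
    using reaches_trans[OF reaches_trans[OF 0 1(1)] 2(1)] 2(2) by blast
qed

text \<open>The two additional steps enter the program and turn its answer into a halting state.
  Halting configurations are fixed by \<open>step\<close>, so every later time gives the same
  result.\<close>

lemma run_machine:
  assumes "exec c0 ((\<lambda>_. [])(0 := x)) t s'" "uses k c0" "t' \<ge> t + 2"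
  shows "halted (run machine x t')" "accepting (run machine x t') \<longleftrightarrow> s' 0 \<noteq> [] \<and> hd (s' 0)"
    "fst (last (snd (run machine x t'))) = contents (s' k)"
proof -
  let ?s = "(\<lambda>_. [])(0 := x)"
  have empty: "contents [] = (\<lambda>_. 0)"
    by (auto simp: contents_def)
  let ?tps = "(contents x, 0) # replicate k (\<lambda>_. 0, 0)"
  have rep: "rep ?s ?tps"
    unfolding rep_def
  proof (intro conjI allI impI)
    fix i assume "i < k"
    then show "\<exists>h. ?tps ! i = (\<lambda>p. contents (?s i) (p - h), h)"
      by (intro exI[of _ 0], cases i) (auto simp: empty)
  next
    show "?tps ! k = (contents (?s k), int (length (?s k)))"
      using k by (cases k) (auto simp: empty simp del: replicate_Suc)
  qed simp
  have "step machine (0, ?tps) = (state_of ([c0], False), ?tps)"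
    using act_stay_map[of ?tps] by (simp add: step_def halted_def accepting_def rejecting_def machine_def)
  then have 0: "reaches (initial machine x) 1 (state_of ([c0], False), ?tps)"
    by (simp add: initial_def)
  obtain tps where 1: "reaches (state_of ([c0], False), ?tps) t (state_of ([], False), tps)"
    and tps: "rep s' tps"
    using exec_simulated[OF assms(1,2) _ rep, of "[]"] S by auto
  obtain i where i: "i < length S" "S ! i = ([], False)"
    using S by (metis UNIV_I in_set_conv_nth insertI1 mem_Sigma_iff)
  then have "state_of ([], False) = 3 + i"
    using state_of_nth by metis
  moreover have "scan (tps ! 0) = map scan tps ! 0"
    using tps by (simp add: rep_def)
  ultimately have "step machine (state_of ([], False), tps) = (if top_sym (s' 0) = 2 then 1 else 2, tps)"
    using i act_stay_map[of tps] rep_scan[OF tps, of 0] k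
    by (simp add: step_def halted_def accepting_def rejecting_def machine_def)
  then have 2: "reaches (state_of ([], False), tps) 1 (if top_sym (s' 0) = 2 then 1 else 2, tps)"
    by simp
  let ?fin = "(if top_sym (s' 0) = 2 then 1 else 2 :: nat, tps)"
  have "reaches ?fin n ?fin" for n
    by (induction n) (auto simp: step_def halted_def accepting_def rejecting_def)
  then have "reaches ?fin (t' - (t + 2)) ?fin" .
  from reaches_trans[OF reaches_trans[OF reaches_trans[OF 0 1] 2] this]
  have "reaches (initial machine x) (1 + t + 1 + (t' - (t + 2))) ?fin" .
  moreover have "1 + t + 1 + (t' - (t + 2)) = t'"
    using assms(3) by simp
  ultimately have run: "run machine x t' = ?fin"
    by (simp only: run_def)
  show "halted (run machine x t')"
    by (simp add: run halted_def accepting_def rejecting_def)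
  show "accepting (run machine x t') \<longleftrightarrow> s' 0 \<noteq> [] \<and> hd (s' 0)"
    by (cases "s' 0") (auto simp: run accepting_def top_sym_def sym_def)
  have "last tps = tps ! k"
    using tps by (metis One_nat_def add_diff_cancel_right' last_conv_nth list.size(3) rep_def Suc_eq_plus1 Zero_not_Suc)
  then show "fst (last (snd (run machine x t'))) = contents (s' k)"
    using tps by (simp add: run rep_def)
qed

end

lemma exec_turing_machine:
  assumes "uses k c" "k > 0"
  obtains M where "turing_machine M"
    "\<And>x t s' t'. exec c ((\<lambda>_. [])(0 := x)) t s' \<Longrightarrow> t' \<ge> t + 2 \<Longrightarrow>
      halted (run M x t') \<and> (accepting (run M x t') \<longleftrightarrow> s' 0 \<noteq> [] \<and> hd (s' 0)) \<and>
      fst (last (snd (run M x t'))) = contents (s' k)"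
proof -
  have "finite ((insert [] (conts c [])) \<times> (UNIV :: bool set))"
    by (simp add: finite_conts)
  then obtain S where "set S = (insert [] (conts c [])) \<times> (UNIV :: bool set)" "distinct S"
    using finite_distinct_list by metis
  then interpret compiled k c S
    using assms by unfold_locales auto
  show thesis
    using that[OF turing_machine] run_machine assms(1) by blast
qed

section \<open>Polynomial-time functions on encoded data\<close>

text \<open>All data become binary trees. The preorder code of a tree is self-delimiting, so the two
  parts of a pair can be separated without markers.\<close>

datatype tree = Leaf | Node tree tree

fun code :: "tree \<Rightarrow> bool list" where
  "code Leaf = [False]"
| "code (Node a b) = True # code a @ code b"

class enc =
  fixes enc :: "'a \<Rightarrow> tree"
  assumes enc_eq_iff [simp]: "enc x = enc y \<longleftrightarrow> x = y"

instantiation tree :: enc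
begin
definition enc_tree :: "tree \<Rightarrow> tree" where [simp]: "enc_tree t = t"
instance by standard simp
end

instantiation unit :: enc
begin
definition enc_unit :: "unit \<Rightarrow> tree" where [simp]: "enc_unit _ = Leaf"
instance by standard simp
end

instantiation bool :: enc
begin
definition enc_bool :: "bool \<Rightarrow> tree" where "enc_bool b = (if b then Node Leaf Leaf else Leaf)"
instance by standard (simp add: enc_bool_def)
end

lemma enc_bool_simps [simp]: "enc True = Node Leaf Leaf" "enc False = Leaf"
  by (simp_all add: enc_bool_def)

text \<open>Numbers are encoded in unary.\<close>

instantiation nat :: enc
begin
fun enc_nat :: "nat \<Rightarrow> tree" where
  "enc_nat 0 = Leaf"
| "enc_nat (Suc n) = Node Leaf (enc_nat n)"
instance
proof
  show "enc x = enc y \<longleftrightarrow> x = y" for x y :: nat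
    by (induction x arbitrary: y; case_tac y) auto
qed
end

instantiation prod :: (enc, enc) enc
begin
definition enc_prod :: "'a \<times> 'b \<Rightarrow> tree" where "enc_prod p = Node (enc (fst p)) (enc (snd p))"
instance by standard (auto simp: enc_prod_def prod_eq_iff)
end

lemma enc_Pair [simp]: "enc (a, b) = Node (enc a) (enc b)"
  by (simp add: enc_prod_def)

instantiation list :: (enc) enc
begin
primrec enc_list :: "'a list \<Rightarrow> tree" where
  "enc_list [] = Leaf"
| "enc_list (x # xs) = Node (enc x) (enc_list xs)"
instance
proof
  show "enc x = enc y \<longleftrightarrow> x = y" for x y :: "'a list"
    by (induction x arbitrary: y; case_tac y) auto
qed
end

definition sz :: "'a :: enc \<Rightarrow> nat" where
  "sz x = length (code (enc x))"

lemma sz_simps [simp]: "sz () = 1" "sz (0::nat) = 1" "sz (Suc n) = 2 + sz n" "sz (a, b) = 1 + sz a + sz b"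
  "sz ([] :: 'c list) = 1" "sz (x # xs) = 1 + sz x + sz xs" for a :: "'a :: enc" and b :: "'b :: enc"
  and x :: "'c :: enc"
  by (simp_all add: sz_def)

lemma sz_pos: "sz x > 0"
  unfolding sz_def by (cases "enc x") simp_all

lemma sz_bool: "sz (b::bool) \<le> 3"
  by (cases b) (simp_all add: sz_def)

lemma sz_nat: "sz (n::nat) = 2 * n + 1"
  by (induction n) simp_all

lemma length_le_sz: "length xs < sz xs"
  by (induction xs) simp_all

lemma sz_append: "sz (xs @ ys) + 1 = sz xs + sz ys"
  by (induction xs) simp_all

lemma sz_rev: "sz (rev xs) = sz xs"
proof (induction xs)
  case (Cons x xs)
  then show ?case using sz_append[of "rev xs" "[x]"] by simp
qed simp

lemma sz_mem: "x \<in> set xs \<Longrightarrow> sz x < sz xs"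
  by (induction xs) (auto intro: less_le_trans)

lemma sz_map_le: "(\<And>x. x \<in> set xs \<Longrightarrow> sz (f x) \<le> b) \<Longrightarrow> sz (map f xs) \<le> 1 + length xs * (1 + b)"
proof (induction xs)
  case (Cons x xs)
  then have "sz (map f xs) \<le> 1 + length xs * (1 + b)" "sz (f x) \<le> b"
    by auto
  then show ?case by simp
qed simp

subsection \<open>Polynomial bounds\<close>

text \<open>As the base is at least 2, powers of \<open>sz x + 2\<close> dominate constants and sums
  as well as products, and a single exponent describes the bound.\<close>

definition pbd :: "('a :: enc \<Rightarrow> nat) \<Rightarrow> bool" where
  "pbd f \<longleftrightarrow> (\<exists>e. \<forall>x. f x \<le> (sz x + 2) ^ e)"

named_theorems pbd_intros

lemma pbdI: "(\<And>x. f x \<le> (sz x + 2) ^ e) \<Longrightarrow> pbd f"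
  by (auto simp: pbd_def)

lemma pbd_mono: "pbd g \<Longrightarrow> (\<And>x. f x \<le> g x) \<Longrightarrow> pbd f"
  unfolding pbd_def by (meson le_trans)

lemma pbd_const [pbd_intros]: "pbd (\<lambda>_. c)"
proof (rule pbdI[where e = c])
  fix x :: 'a
  have "c \<le> 2 ^ c" by (rule less_imp_le, rule less_exp)
  also have "\<dots> \<le> (sz x + 2) ^ c" by (rule power_mono) auto
  finally show "c \<le> (sz x + 2) ^ c" .
qed

lemma pbd_sz: "pbd sz"
  by (rule pbdI[where e = 1]) simp

lemma pbd_mult [pbd_intros]: "pbd f \<Longrightarrow> pbd g \<Longrightarrow> pbd (\<lambda>x. f x * g x)"
proof -
  assume "pbd f" "pbd g"
  then obtain d e where "\<And>x. f x \<le> (sz x + 2) ^ d" "\<And>x. g x \<le> (sz x + 2) ^ e"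
    by (auto simp: pbd_def)
  then have "f x * g x \<le> (sz x + 2) ^ (d + e)" for x
    by (simp add: power_add mult_mono)
  then show ?thesis by (rule pbdI)
qed

lemma pbd_add [pbd_intros]: "pbd f \<Longrightarrow> pbd g \<Longrightarrow> pbd (\<lambda>x. f x + g x)"
proof -
  assume "pbd f" "pbd g"
  then obtain d e where d: "\<And>x. f x \<le> (sz x + 2) ^ d" and e: "\<And>x. g x \<le> (sz x + 2) ^ e"
    by (auto simp: pbd_def)
  have "f x + g x \<le> (sz x + 2) ^ (d + e + 1)" for x
  proof -
    have "(sz x + 2) ^ d \<le> (sz x + 2) ^ (d + e)" "(sz x + 2) ^ e \<le> (sz x + 2) ^ (d + e)"
      by (simp_all add: power_increasing)
    then have "f x + g x \<le> 2 * (sz x + 2) ^ (d + e)"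
      using d[of x] e[of x] by linarith
    also have "\<dots> \<le> (sz x + 2) * (sz x + 2) ^ (d + e)"
      by (rule mult_right_mono) auto
    finally show ?thesis by simp
  qed
  then show ?thesis by (rule pbdI)
qed

lemma pbd_power [pbd_intros]: "pbd f \<Longrightarrow> pbd (\<lambda>x. f x ^ n)"
  by (induction n) (auto intro: pbd_intros)

lemma pbd_Suc [pbd_intros]: "pbd f \<Longrightarrow> pbd (\<lambda>x. Suc (f x))"
  using pbd_add[OF pbd_const[of 1]] by simp

lemma pbd_comp: "pbd f \<Longrightarrow> pbd (\<lambda>x. sz (g x)) \<Longrightarrow> pbd (\<lambda>x. f (g x))"
proof -
  assume "pbd f" and g: "pbd (\<lambda>x. sz (g x))"
  then obtain e where e: "\<And>x. f x \<le> (sz x + 2) ^ e"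
    by (auto simp: pbd_def)
  have "pbd (\<lambda>x. (sz (g x) + 2) ^ e)"
    by (intro pbd_intros g)
  then show ?thesis by (rule pbd_mono) (rule e)
qed

subsection \<open>Programs with a time bound\<close>

fun regs :: "nat \<Rightarrow> com \<Rightarrow> bool" where
  "regs k Skip = True"
| "regs k (Push i b) = (i < k)"
| "regs k (Pop i) = (i < k)"
| "regs k (Emit i b) = False"
| "regs k (Seq a b) = (regs k a \<and> regs k b)"
| "regs k (Cond i a b c) = (i < k \<and> regs k a \<and> regs k b \<and> regs k c)"
| "regs k (While i a) = (i < k \<and> regs k a)"

lemma regs_mono: "regs k c \<Longrightarrow> k \<le> k' \<Longrightarrow> regs k' c"
  by (induction c) auto

lemma regs_uses: "regs k c \<Longrightarrow> uses k c"
  by (induction c) auto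

text \<open>Upper bounds replace exact costs from here on, so that they can be rounded up and
  combined freely.\<close>

definition ex :: "com \<Rightarrow> store \<Rightarrow> nat \<Rightarrow> store \<Rightarrow> bool" where
  "ex c s n s' \<longleftrightarrow> (\<exists>t\<le>n. exec c s t s')"

text \<open>Time bounds size: this limits the size of every value that a program computes, see
  \<open>pbd_PF\<close>.\<close>

lemma exec_length: "exec c s t s' \<Longrightarrow> length (s' i) \<le> length (s i) + t"
  by (induction rule: exec.induct) auto

lemma ex_length: "ex c s t s' \<Longrightarrow> length (s' i) \<le> length (s i) + t"
  unfolding ex_def using exec_length by (meson add_left_mono le_trans)

lemma ex_mono: "ex c s m s' \<Longrightarrow> m \<le> n \<Longrightarrow> ex c s n s'"
  unfolding ex_def by (meson le_trans)

lemma ex_eqI: "ex c s n s1 \<Longrightarrow> s1 = s2 \<Longrightarrow> ex c s n s2"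
  by simp

lemma ex_Skip: "ex Skip s 1 s"
  unfolding ex_def using exec_Skip by blast

lemma ex_Push: "ex (Push i b) s 2 (s(i := b # s i))"
  unfolding ex_def using exec_Push by blast

lemma ex_Pop: "ex (Pop i) s 1 (s(i := tl (s i)))"
  unfolding ex_def using exec_Pop by blast

lemma ex_Emit: "ex (Emit i b) s 1 (s(i := s i @ [b]))"
  unfolding ex_def using exec_Emit by blast

lemma ex_Seq: "ex a s m s1 \<Longrightarrow> ex b s1 n s2 \<Longrightarrow> ex (Seq a b) s (1 + m + n) s2"
  unfolding ex_def by (meson exec_Seq add_le_mono le_refl)

lemma ex_Cond: "ex (case s i of [] \<Rightarrow> a | x # _ \<Rightarrow> if x then b else c) s m s1 \<Longrightarrow>
    ex (Cond i a b c) s (1 + m) s1"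
proof -
  assume "ex (case s i of [] \<Rightarrow> a | x # _ \<Rightarrow> if x then b else c) s m s1"
  then obtain t where t: "t \<le> m" "exec (case s i of [] \<Rightarrow> a | x # _ \<Rightarrow> if x then b else c) s t s1"
    by (auto simp: ex_def)
  from exec_Cond[OF t(2)] t(1) show ?thesis
    unfolding ex_def by (intro exI[of _ "1 + t"]) simp
qed

lemma ex_While_end: "s i = [] \<Longrightarrow> ex (While i c) s 1 s"
  unfolding ex_def using exec_While_end by blast

lemma ex_While: "s i \<noteq> [] \<Longrightarrow> ex c s m s1 \<Longrightarrow> ex (While i c) s1 n s2 \<Longrightarrow>
    ex (While i c) s (1 + m + n) s2"
  unfolding ex_def by (meson exec_While add_le_mono le_refl)

lemma ex_Push': "s' = s(i := b # s i) \<Longrightarrow> ex (Push i b) s 2 s'"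
  using ex_Push by simp

lemma ex_Pop': "s' = s(i := tl (s i)) \<Longrightarrow> ex (Pop i) s 1 s'"
  using ex_Pop by simp

fun seq :: "com list \<Rightarrow> com" where
  "seq [] = Skip"
| "seq (c # cs) = Seq c (seq cs)"

lemma ex_seq_Nil: "ex (seq []) s 1 s"
  using ex_Skip by simp

lemma ex_seq_Cons: "ex c s m s1 \<Longrightarrow> ex (seq cs) s1 n s2 \<Longrightarrow> ex (seq (c # cs)) s (1 + m + n) s2"
  using ex_Seq by simp

lemma ex_seq_last: "ex c s m s' \<Longrightarrow> ex (seq [c]) s (1 + m + 1) s'"
  by (rule ex_seq_Cons[OF _ ex_seq_Nil])

section \<open>Stack operations: clearing, moving, copying, writing constants\<close>

definition clear :: "nat \<Rightarrow> com" where
  "clear i = While i (Pop i)"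

lemma ex_clear: "s' = s(i := []) \<Longrightarrow> ex (clear i) s (2 * length (s i) + 1) s'"
proof (induction "s i" arbitrary: s)
  case Nil
  then have "s' = s" by auto
  then show ?case using Nil ex_While_end[of s i] by (simp add: clear_def)
next
  case (Cons x xs)
  have "ex (clear i) (s(i := tl (s i))) (2 * length xs + 1) s'"
    using Cons.hyps(1)[of "s(i := tl (s i))"] Cons.hyps(2)[symmetric] Cons.prems by simp
  from ex_While[OF _ ex_Pop this[unfolded clear_def]]
  show ?case using Cons.hyps(2)[symmetric] by (simp add: clear_def)
qed

text \<open>Moving reverses a stack. Two moves restore the order, and data that are only put aside
  stay reversed in between.\<close>

definition move :: "nat \<Rightarrow> nat \<Rightarrow> com" where
  "move i j = While i (Cond i Skip (seq [Pop i, Push j True]) (seq [Pop i, Push j False]))"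

lemma ex_move: "i \<noteq> j \<Longrightarrow> s' = s(i := [], j := rev (s i) @ s j) \<Longrightarrow> ex (move i j) s (8 * length (s i) + 1) s'"
proof (induction "s i" arbitrary: s)
  case Nil
  then have "s' = s" by auto
  then show ?case using Nil ex_While_end[of s i] by (simp add: move_def)
next
  case (Cons x xs)
  let ?s = "s(i := tl (s i), j := x # s j)"
  have "ex (move i j) ?s (8 * length xs + 1) s'"
    using Cons.hyps(1)[of ?s] Cons.hyps(2)[symmetric] Cons.prems by (simp add: fun_upd_twist)
  moreover have "ex (seq [Pop i, Push j x]) s 6 ?s"
    using \<open>i \<noteq> j\<close>
    by (intro ex_mono[OF ex_seq_Cons[OF ex_Pop ex_seq_Cons[OF ex_Push' ex_seq_Nil]]]) (auto simp: fun_eq_iff)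
  then have "ex (Cond i Skip (seq [Pop i, Push j True]) (seq [Pop i, Push j False])) s (1 + 6) ?s"
    using Cons.hyps(2)[symmetric] by (intro ex_Cond) (cases x; simp)
  ultimately have "ex (move i j) s (1 + (1 + 6) + (8 * length xs + 1)) s'"
    unfolding move_def using Cons.hyps(2)[symmetric] by (intro ex_While) auto
  then show ?case using Cons.hyps(2)[symmetric] by simp
qed

text \<open>After a \<open>move\<close>, this yields two copies of a stack in its original
  order.\<close>

definition move2 :: "nat \<Rightarrow> nat \<Rightarrow> nat \<Rightarrow> com" where
  "move2 i j l = While i (Cond i Skip (seq [Pop i, Push j True, Push l True])
     (seq [Pop i, Push j False, Push l False]))"

lemma ex_move2: "distinct [i, j, l] \<Longrightarrow> s' = s(i := [], j := rev (s i) @ s j, l := rev (s i) @ s l) \<Longrightarrow>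
  ex (move2 i j l) s (11 * length (s i) + 1) s'"
proof (induction "s i" arbitrary: s)
  case Nil
  then have "s' = s" by auto
  then show ?case using Nil ex_While_end[of s i] by (simp add: move2_def)
next
  case (Cons x xs)
  let ?s = "s(i := tl (s i), j := x # s j, l := x # s l)"
  have "ex (move2 i j l) ?s (11 * length xs + 1) s'"
    using Cons.hyps(1)[of ?s] Cons.hyps(2)[symmetric] Cons.prems by (simp add: fun_upd_twist)
  moreover have "ex (seq [Pop i, Push j x, Push l x]) s 9 ?s"
    using Cons.prems(1)
    by (intro ex_mono[OF ex_seq_Cons[OF ex_Pop ex_seq_Cons[OF ex_Push ex_seq_Cons[OF ex_Push' ex_seq_Nil]]]])
      (auto simp: fun_eq_iff)
  then have "ex (Cond i Skip (seq [Pop i, Push j True, Push l True]) (seq [Pop i, Push j False, Push l False])) s (1 + 9) ?s"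
    using Cons.hyps(2)[symmetric] by (intro ex_Cond) (cases x; simp)
  ultimately have "ex (move2 i j l) s (1 + (1 + 9) + (11 * length xs + 1)) s'"
    unfolding move2_def using Cons.hyps(2)[symmetric] by (intro ex_While) auto
  then show ?case using Cons.hyps(2)[symmetric] by simp
qed

fun pushes :: "nat \<Rightarrow> bool list \<Rightarrow> com" where
  "pushes i [] = Skip"
| "pushes i (b # w) = Seq (pushes i w) (Push i b)"

lemma ex_pushes: "s' = s(i := w @ s i) \<Longrightarrow> ex (pushes i w) s (3 * length w + 1) s'"
proof (induction w arbitrary: s')
  case Nil
  then show ?case using ex_Skip by simp
next
  case (Cons b w)
  show ?case
    unfolding pushes.simps
    by (intro ex_mono[OF ex_Seq[OF Cons.IH[OF refl] ex_Push']]) (use Cons.prems in \<open>auto simp: fun_eq_iff\<close>)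
qed

lemma regs_macros [simp]: "regs k (clear i) \<longleftrightarrow> i < k" "regs k (move i j) \<longleftrightarrow> i < k \<and> j < k"
  "regs k (move2 i j l) \<longleftrightarrow> i < k \<and> j < k \<and> l < k"
  by (auto simp: clear_def move_def move2_def)

lemma regs_pushes [simp]: "i < k \<Longrightarrow> regs k (pushes i w)"
  by (induction w) auto

subsection \<open>The class of polynomial-time functions\<close>

text \<open>Input and output share stack 0. The final store differs from the initial one only there,
  so the work stacks are empty again and all stacks from \<open>k\<close> on are preserved. This
  lets programs be composed while other data wait on higher stacks.\<close>

definition comp_by :: "com \<Rightarrow> nat \<Rightarrow> ('a \<Rightarrow> nat) \<Rightarrow> ('a :: enc \<Rightarrow> 'b :: enc) \<Rightarrow> bool" where
  "comp_by c k q f \<longleftrightarrow> 0 < k \<and> regs k c \<and> pbd q \<and>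
     (\<forall>x s. s 0 = code (enc x) \<longrightarrow> (\<forall>i. 0 < i \<longrightarrow> i < k \<longrightarrow> s i = []) \<longrightarrow>
        ex c s (q x) (s(0 := code (enc (f x)))))"

definition PF :: "('a :: enc \<Rightarrow> 'b :: enc) \<Rightarrow> bool" where
  "PF f \<longleftrightarrow> (\<exists>c k q. comp_by c k q f)"

named_theorems pf_intros

lemma comp_byD:
  assumes "comp_by c k q f"
  shows "0 < k" "regs k c" "pbd q"
    "\<And>x s. s 0 = code (enc x) \<Longrightarrow> (\<And>i. 0 < i \<Longrightarrow> i < k \<Longrightarrow> s i = []) \<Longrightarrow> ex c s (q x) (s(0 := code (enc (f x))))"
  using assms unfolding comp_by_def by simp_all

lemma PFI:
  assumes "0 < k" "regs k c" "pbd q"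
    "\<And>x s. s 0 = code (enc x) \<Longrightarrow> (\<And>i. 0 < i \<Longrightarrow> i < k \<Longrightarrow> s i = []) \<Longrightarrow> ex c s (q x) (s(0 := code (enc (f x))))"
  shows "PF f"
proof -
  have "comp_by c k q f"
    unfolding comp_by_def using assms by simp
  then show ?thesis unfolding PF_def by blast
qed

text \<open>A program sees only codes, so functions that agree on codes share a program even if
  their types differ. In this way pairs serve as list cells, and lists of units as numbers.\<close>

lemma PF_transfer:
  assumes "PF f" "\<And>y. \<exists>x. enc y = enc x \<and> enc (g y) = enc (f x)"
  shows "PF g"
proof -
  obtain c k q where "comp_by c k q f"
    using assms(1) unfolding PF_def by blast
  note c = comp_byD[OF this]
  obtain h where h: "\<And>y. enc y = enc (h y) \<and> enc (g y) = enc (f (h y))"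
    using assms(2) by metis
  have "pbd (\<lambda>y. sz (h y))"
    by (rule pbd_mono[OF pbd_sz]) (simp add: sz_def flip: h)
  then have "pbd (\<lambda>y. q (h y))"
    by (rule pbd_comp[OF c(3)])
  then show ?thesis
    by (rule PFI[OF c(1,2)]) (metis c(4) h)
qed

lemma pbd_PF [pbd_intros]:
  assumes "PF f"
  shows "pbd (\<lambda>x. sz (f x))"
proof -
  obtain c k q where "comp_by c k q f"
    using assms(1) unfolding PF_def by blast
  note c = comp_byD[OF this]
  have "sz (f x) \<le> sz x + q x" for x
    using ex_length[OF c(4)[of "(\<lambda>_. [])(0 := code (enc x))" x], of 0] by (simp add: sz_def)
  then show ?thesis
    by (rule pbd_mono[OF pbd_add[OF pbd_sz c(3)]])
qed

lemma PF_id [pf_intros]: "PF (\<lambda>x. x)"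
proof (rule PFI[of 1 Skip "\<lambda>_. 1"])
  fix x :: 'a and s :: store
  assume "s 0 = code (enc x)"
  then have "s(0 := code (enc x)) = s" by auto
  then show "ex Skip s 1 (s(0 := code (enc x)))" using ex_Skip by simp
qed (auto intro: pbd_intros)

lemma PF_comp:
  fixes f :: "'b :: enc \<Rightarrow> 'c :: enc" and g :: "'a :: enc \<Rightarrow> 'b"
  assumes "PF f" "PF g"
  shows "PF (\<lambda>x. f (g x))"
proof -
  obtain c k q where "comp_by c k q f"
    using assms(1) unfolding PF_def by blast
  note c = comp_byD[OF this]
  obtain d l r where "comp_by d l r g"
    using assms(2) unfolding PF_def by blast
  note d = comp_byD[OF this]
  show ?thesis
  proof (rule PFI)
    show "0 < max k l" "regs (max k l) (Seq d c)"
      using c(1,2) d(2) by (auto intro: regs_mono)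
    show "pbd (\<lambda>x. 1 + r x + q (g x))"
      by (intro pbd_intros d(3) pbd_comp[OF c(3)] assms)
    fix x :: 'a and s :: store
    assume s: "s 0 = code (enc x)" "\<And>i. 0 < i \<Longrightarrow> i < max k l \<Longrightarrow> s i = []"
    have "ex d s (r x) (s(0 := code (enc (g x))))"
      using s by (intro d(4)) auto
    moreover have "ex c (s(0 := code (enc (g x)))) (q (g x)) ((s(0 := code (enc (g x))))(0 := code (enc (f (g x)))))"
      using s by (intro c(4)) auto
    ultimately show "ex (Seq d c) s (1 + r x + q (g x)) (s(0 := code (enc (f (g x)))))"
      using ex_Seq by fastforce
  qed
qed

lemma PF_const [pf_intros]:
  fixes y :: "'b :: enc"
  shows "PF (\<lambda>_ :: 'a :: enc. y)"
proof (rule PFI[of 1 "Seq (clear 0) (pushes 0 (code (enc y)))" "\<lambda>x. 1 + (2 * sz x + 1) + (3 * length (code (enc y)) + 1)"])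
  show "pbd (\<lambda>x. 1 + (2 * sz x + 1) + (3 * length (code (enc y)) + 1))"
    by (intro pbd_intros pbd_sz)
  fix x :: 'a and s :: store
  assume s: "s 0 = code (enc x)"
  show "ex (Seq (clear 0) (pushes 0 (code (enc y)))) s
      (1 + (2 * sz x + 1) + (3 * length (code (enc y)) + 1)) (s(0 := code (enc y)))"
    unfolding sz_def s[symmetric] by (intro ex_Seq ex_clear ex_pushes) auto
qed auto

text \<open>The input is copied to stack \<open>m\<close>, and the first result waits reversed on
  stack \<open>m + 1\<close>. Both lie above the work stacks of the two programs, so each of these
  starts on clean stacks. The final \<open>True\<close> is the code of the pairing node.\<close>

lemma PF_Pair [pf_intros]:
  fixes f :: "'a :: enc \<Rightarrow> 'b :: enc" and g :: "'a \<Rightarrow> 'c :: enc"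
  assumes "PF f" "PF g"
  shows "PF (\<lambda>x. (f x, g x))"
proof -
  obtain c k q where "comp_by c k q f"
    using assms(1) unfolding PF_def by blast
  note c = comp_byD[OF this]
  obtain d l r where "comp_by d l r g"
    using assms(2) unfolding PF_def by blast
  note d = comp_byD[OF this]
  define m where "m = max k l"
  have m: "0 < m" "k \<le> m" "l \<le> m" using c(1) by (auto simp: m_def)
  define p where "p = seq [move 0 (m+1), move2 (m+1) 0 m, c, move 0 (m+1), move m (m+2), move (m+2) 0, d, move (m+1) 0, Push 0 True]"
  define T where "T x = 1 + (8 * sz x + 1) + (1 + (11 * sz x + 1) + (1 + q x + (1 + (8 * sz (f x) + 1) + (1 + (8 * sz x + 1) +
     (1 + (8 * sz x + 1) + (1 + r x + (1 + (8 * sz (f x) + 1) + (1 + 2 + 1))))))))" for x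
  show ?thesis
  proof (rule PFI)
    show "0 < m + 3" by simp
    show "regs (m + 3) p"
      using c(2) d(2) m by (auto simp: p_def intro: regs_mono)
    show "pbd T"
      unfolding T_def by (intro pbd_intros c(3) d(3) pbd_sz assms)
    fix x :: 'a and s :: store
    assume s0: "s 0 = code (enc x)" and s: "\<And>i. 0 < i \<Longrightarrow> i < m + 3 \<Longrightarrow> s i = []"
    let ?x = "code (enc x)" and ?f = "code (enc (f x))" and ?g = "code (enc (g x))"
    define s1 where "s1 = s(0 := [], m+1 := rev ?x)"
    define s2 where "s2 = s(0 := ?x, m := ?x)"
    define s3 where "s3 = s(0 := ?f, m := ?x)"
    define s4 where "s4 = s(0 := [], m := ?x, m+1 := rev ?f)"
    define s5 where "s5 = s(0 := [], m+1 := rev ?f, m+2 := rev ?x)"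
    define s6 where "s6 = s(0 := ?x, m+1 := rev ?f)"
    define s7 where "s7 = s(0 := ?g, m+1 := rev ?f)"
    define s8 where "s8 = s(0 := ?f @ ?g)"
    have sm: "s m = []" "s (m+1) = []" "s (m+2) = []" using s m by auto
    have lens: "sz x = length (s 0)" "sz x = length (s1 (m+1))" "sz (f x) = length (s3 0)"
      "sz x = length (s4 m)" "sz x = length (s5 (m+2))" "sz (f x) = length (s7 (m+1))"
      using m by (simp_all add: sz_def s0 s1_def s3_def s4_def s5_def s7_def)
    have 1: "ex (move 0 (m+1)) s (8 * sz x + 1) s1"
      unfolding lens(1) by (rule ex_move) (use sm s0 in \<open>auto simp: s1_def\<close>)
    have 2: "ex (move2 (m+1) 0 m) s1 (11 * sz x + 1) s2"
      unfolding lens(2) by (rule ex_move2) (use sm s0 m in \<open>auto simp: s1_def s2_def fun_eq_iff\<close>)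
    have "ex c s2 (q x) (s2(0 := ?f))"
      by (rule c(4)) (use s m in \<open>auto simp: s2_def\<close>)
    then have 3: "ex c s2 (q x) s3"
      by (rule ex_eqI) (use m in \<open>auto simp: s2_def s3_def fun_eq_iff\<close>)
    have 4: "ex (move 0 (m+1)) s3 (8 * sz (f x) + 1) s4"
      unfolding lens(3) by (rule ex_move) (use sm m in \<open>auto simp: s3_def s4_def\<close>)
    have 5: "ex (move m (m+2)) s4 (8 * sz x + 1) s5"
      unfolding lens(4) by (rule ex_move) (use sm m in \<open>auto simp: s4_def s5_def\<close>)
    have 6: "ex (move (m+2) 0) s5 (8 * sz x + 1) s6"
      unfolding lens(5) by (rule ex_move) (use sm m in \<open>auto simp: s5_def s6_def\<close>)
    have "ex d s6 (r x) (s6(0 := ?g))"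
      by (rule d(4)) (use s m in \<open>auto simp: s6_def\<close>)
    then have 7: "ex d s6 (r x) s7"
      by (rule ex_eqI) (use m in \<open>auto simp: s6_def s7_def fun_eq_iff\<close>)
    have 8: "ex (move (m+1) 0) s7 (8 * sz (f x) + 1) s8"
      unfolding lens(6) by (rule ex_move) (use sm m in \<open>auto simp: s7_def s8_def\<close>)
    have 9: "ex (Push 0 True) s8 2 (s(0 := code (enc (f x, g x))))"
      by (rule ex_Push') (auto simp: s8_def)
    show "ex p s (T x) (s(0 := code (enc (f x, g x))))"
      unfolding p_def T_def by (intro ex_seq_Cons[OF 1] ex_seq_Cons[OF 2] ex_seq_Cons[OF 3] ex_seq_Cons[OF 4] ex_seq_Cons[OF 5] ex_seq_Cons[OF 6] ex_seq_Cons[OF 7] ex_seq_Cons[OF 8] ex_seq_Cons[OF 9] ex_seq_Nil)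
  qed
qed

text \<open>The first bit of a code distinguishes a leaf from a node, so one inspection of stack 0
  decides. The value of the test is then cleared and the saved input restored before the branch is
  executed.\<close>

lemma PF_If_gen:
  fixes t :: "'a :: enc \<Rightarrow> 'c :: enc" and f g :: "'a \<Rightarrow> 'b :: enc"
  assumes "PF t" "PF f" "PF g"
  shows "PF (\<lambda>x. if enc (t x) = Leaf then f x else g x)"
proof -
  obtain b j u where "comp_by b j u t"
    using assms(1) unfolding PF_def by blast
  note b = comp_byD[OF this]
  obtain c k q where "comp_by c k q f"
    using assms(2) unfolding PF_def by blast
  note c = comp_byD[OF this]
  obtain d l r where "comp_by d l r g"
    using assms(3) unfolding PF_def by blast
  note d = comp_byD[OF this]
  define m where "m = max j (max k l)"
  have m: "0 < m" "j \<le> m" "k \<le> m" "l \<le> m" using b(1) by (auto simp: m_def)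
  define br where "br e = seq [clear 0, move m (m+1), move (m+1) 0, e]" for e
  define p where "p = seq [move 0 (m+1), move2 (m+1) 0 m, b, Cond 0 Skip (br d) (br c)]"
  define T where "T x = 1 + (8 * sz x + 1) + (1 + (11 * sz x + 1) + (1 + u x + (1 + (1 +
     (1 + (2 * sz (t x) + 1) + (1 + (8 * sz x + 1) + (1 + (8 * sz x + 1) + (1 + (q x + r x) + 1))))) + 1)))" for x
  show ?thesis
  proof (rule PFI)
    show "0 < m + 2" by simp
    show "regs (m + 2) p"
      using b(2) c(2) d(2) m by (auto simp: p_def br_def intro: regs_mono)
    show "pbd T"
      unfolding T_def by (intro pbd_intros b(3) c(3) d(3) pbd_sz assms)
    fix x :: 'a and s :: store
    assume s0: "s 0 = code (enc x)" and s: "\<And>i. 0 < i \<Longrightarrow> i < m + 2 \<Longrightarrow> s i = []"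
    let ?x = "code (enc x)" and ?t = "code (enc (t x))"
    define s1 where "s1 = s(0 := [], m+1 := rev ?x)"
    define s2 where "s2 = s(0 := ?x, m := ?x)"
    define s3 where "s3 = s(0 := ?t, m := ?x)"
    define s4 where "s4 = s(0 := [], m := ?x)"
    define s5 where "s5 = s(0 := [], m+1 := rev ?x)"
    have sm: "s m = []" "s (m+1) = []" using s m by auto
    have lens: "sz x = length (s 0)" "sz x = length (s1 (m+1))" "sz (t x) = length (s3 0)"
      "sz x = length (s4 m)" "sz x = length (s5 (m+1))"
      using m by (simp_all add: sz_def s0 s1_def s3_def s4_def s5_def)
    have 1: "ex (move 0 (m+1)) s (8 * sz x + 1) s1"
      unfolding lens(1) by (rule ex_move) (use sm s0 in \<open>auto simp: s1_def\<close>)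
    have 2: "ex (move2 (m+1) 0 m) s1 (11 * sz x + 1) s2"
      unfolding lens(2) by (rule ex_move2) (use sm s0 m in \<open>auto simp: s1_def s2_def fun_eq_iff\<close>)
    have "ex b s2 (u x) (s2(0 := ?t))"
      by (rule b(4)) (use s m in \<open>auto simp: s2_def\<close>)
    then have 3: "ex b s2 (u x) s3"
      by (rule ex_eqI) (use m in \<open>auto simp: s2_def s3_def fun_eq_iff\<close>)
    have 4: "ex (clear 0) s3 (2 * sz (t x) + 1) s4"
      unfolding lens(3) by (rule ex_clear) (use m in \<open>auto simp: s3_def s4_def fun_eq_iff\<close>)
    have 5: "ex (move m (m+1)) s4 (8 * sz x + 1) s5"
      unfolding lens(4) by (rule ex_move) (use sm m in \<open>auto simp: s4_def s5_def\<close>)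
    have 6: "ex (move (m+1) 0) s5 (8 * sz x + 1) s"
      unfolding lens(5) by (rule ex_move) (use sm m s0 in \<open>auto simp: s5_def\<close>)
    have s30: "s3 0 = ?t"
      using m by (simp add: s3_def)
    have c': "ex c s (q x + r x) (s(0 := code (enc (f x))))"
      by (rule ex_mono[OF c(4)]) (use s s0 m in auto)
    have d': "ex d s (q x + r x) (s(0 := code (enc (g x))))"
      by (rule ex_mono[OF d(4)]) (use s s0 m in auto)
    let ?r = "if enc (t x) = Leaf then f x else g x"
    have "ex (br (if enc (t x) = Leaf then c else d)) s3 (1 + (2 * sz (t x) + 1) + (1 + (8 * sz x + 1) + (1 + (8 * sz x + 1) + (1 + (q x + r x) + 1))))
       (s(0 := code (enc ?r)))"
      unfolding br_def using c' d' by (intro ex_seq_Cons[OF 4] ex_seq_Cons[OF 5] ex_seq_Cons[OF 6] ex_seq_Cons[OF _ ex_seq_Nil]) auto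
    then have "ex (Cond 0 Skip (br d) (br c)) s3 (1 + (1 + (2 * sz (t x) + 1) + (1 + (8 * sz x + 1) + (1 + (8 * sz x + 1) + (1 + (q x + r x) + 1)))))
       (s(0 := code (enc ?r)))"
      by (intro ex_Cond) (cases "enc (t x)"; simp add: s30)
    then show "ex p s (T x) (s(0 := code (enc ?r)))"
      unfolding p_def T_def by (intro ex_seq_Cons[OF 1] ex_seq_Cons[OF 2] ex_seq_Cons[OF 3] ex_seq_Cons[OF _ ex_seq_Nil])
  qed
qed

text \<open>Stack 1 counts, in unary, the trees that remain to be read.\<close>

definition split_loop :: com where
  "split_loop = While 1 (Cond 0 Skip (seq [Pop 0, Push 2 True, Push 1 True]) (seq [Pop 0, Push 2 False, Pop 1]))"

text \<open>Reading a leaf completes one pending tree, reading a node replaces one pending tree by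
  two. Hence the loop, started with one pending tree, stops precisely at the end of the first code.
  The arbitrary \<open>n\<close> and \<open>s'\<close> allow the induction to continue with the rest
  of the loop.\<close>

lemma split_loop:
  "s 0 = code t @ r \<Longrightarrow> s 1 = True # cs \<Longrightarrow>
   ex split_loop (s(0 := r, 1 := cs, 2 := rev (code t) @ s 2)) n s' \<Longrightarrow>
   ex split_loop s (11 * length (code t) + n) s'"
proof (induction t arbitrary: s r cs n)
  case Leaf
  let ?s = "s(0 := r, 1 := cs, 2 := rev (code Leaf) @ s 2)"
  have "ex (seq [Pop 0, Push 2 False, Pop 1]) s (1 + 1 + (1 + 2 + (1 + 1 + 1))) ?s"
    by (intro ex_seq_Cons[OF ex_Pop] ex_seq_Cons[OF ex_Push] ex_seq_last ex_Pop')
      (use Leaf in \<open>auto simp: fun_eq_iff\<close>)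
  then have "ex (Cond 0 Skip (seq [Pop 0, Push 2 True, Push 1 True]) (seq [Pop 0, Push 2 False, Pop 1])) s
     (1 + (1 + 1 + (1 + 2 + (1 + 1 + 1)))) ?s"
    using Leaf by (intro ex_Cond) simp
  from ex_While[OF _ this Leaf.prems(3)[unfolded split_loop_def]]
  have "ex split_loop s (1 + (1 + (1 + 1 + (1 + 2 + (1 + 1 + 1)))) + n) s'"
    using Leaf.prems(2) unfolding split_loop_def by simp
  then show ?case by (rule ex_mono) simp
next
  case (Node a b)
  let ?s = "s(0 := code a @ code b @ r, 1 := True # s 1, 2 := True # s 2)"
  let ?s1 = "?s(0 := code b @ r, 1 := s 1, 2 := rev (code a) @ ?s 2)"
  have "ex (seq [Pop 0, Push 2 True, Push 1 True]) s (1 + 1 + (1 + 2 + (1 + 2 + 1))) ?s"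
    by (intro ex_seq_Cons[OF ex_Pop] ex_seq_Cons[OF ex_Push] ex_seq_last ex_Push')
      (use Node in \<open>auto simp: fun_eq_iff\<close>)
  then have *: "ex (Cond 0 Skip (seq [Pop 0, Push 2 True, Push 1 True]) (seq [Pop 0, Push 2 False, Pop 1])) s
     (1 + (1 + 1 + (1 + 2 + (1 + 2 + 1)))) ?s"
    using Node.prems by (intro ex_Cond) simp
  have eq: "s(0 := r, 1 := cs, 2 := rev (code (Node a b)) @ s 2) = ?s1(0 := r, 1 := cs, 2 := rev (code b) @ ?s1 2)"
    by (auto simp: fun_eq_iff)
  have "ex split_loop ?s1 (11 * length (code b) + n) s'"
    by (rule Node.IH(2)[OF _ _ Node.prems(3)[unfolded eq]]) (use Node.prems in auto)
  then have "ex split_loop ?s (11 * length (code a) + (11 * length (code b) + n)) s'"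
    by (rule Node.IH(1)[rotated 2]) auto
  from ex_While[OF _ * this[unfolded split_loop_def]] have "ex split_loop s (1 + (1 + (1 + 1 + (1 + 2 + (1 + 2 + 1)))) + (11 * length (code a) + (11 * length (code b) + n))) s'"
    using Node.prems(2) unfolding split_loop_def by simp
  then show ?case by (rule ex_mono) simp
qed

definition split_com :: com where
  "split_com = seq [Pop 0, Push 1 True, split_loop]"

lemma ex_split:
  assumes "s 0 = code (Node a b)" "s 1 = []" "s 2 = []"
  shows "ex split_com s (11 * length (code a) + 8) (s(0 := code b, 2 := rev (code a)))"
proof -
  let ?s1 = "s(0 := code a @ code b, 1 := [True])" and ?s2 = "s(0 := code b, 2 := rev (code a))"
  have "?s1(0 := code b, 1 := [], 2 := rev (code a) @ ?s1 2) = ?s2"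
    using assms by (auto simp: fun_eq_iff)
  moreover have "ex split_loop ?s2 1 ?s2"
    unfolding split_loop_def by (rule ex_While_end) (use assms in auto)
  ultimately have "ex split_loop ?s1 (11 * length (code a) + 1) ?s2"
    using assms by (intro split_loop[of ?s1 a "code b" "[]" 1]) auto
  note 3 = this
  have 1: "ex (Pop 0) s 1 (s(0 := code a @ code b))"
    by (rule ex_Pop') (use assms in auto)
  have 2: "ex (Push 1 True) (s(0 := code a @ code b)) 2 ?s1"
    by (rule ex_Push') (use assms in auto)
  have "ex split_com s (1 + 1 + (1 + 2 + (1 + (11 * length (code a) + 1) + 1))) ?s2"
    unfolding split_com_def by (intro ex_seq_Cons[OF 1] ex_seq_Cons[OF 2] ex_seq_Cons[OF 3] ex_seq_Nil)
  then show ?thesis by (rule ex_mono) simp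
qed

lemma regs_split: "regs 4 split_com"
  by (simp add: split_com_def split_loop_def)

lemma PF_fst_base: "PF (fst :: 'a :: enc \<times> 'b :: enc \<Rightarrow> 'a)"
proof (rule PFI[of 4 "seq [split_com, clear 0, move 2 0]"
      "\<lambda>x. 1 + (11 * sz x + 8) + (1 + (2 * sz x + 1) + (1 + (8 * sz x + 1) + 1))"])
  show "pbd (\<lambda>x. 1 + (11 * sz x + 8) + (1 + (2 * sz x + 1) + (1 + (8 * sz x + 1) + 1)))"
    by (intro pbd_intros pbd_sz)
  show "regs 4 (seq [split_com, clear 0, move 2 0])" using regs_split by simp
  fix x :: "'a \<times> 'b" and s :: store
  assume s0: "s 0 = code (enc x)" and s: "\<And>i. 0 < i \<Longrightarrow> i < 4 \<Longrightarrow> s i = []"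
  obtain a b where x: "x = (a, b)" by (cases x)
  let ?s1 = "s(0 := code (enc b), 2 := rev (code (enc a)))" and ?s2 = "s(0 := [], 2 := rev (code (enc a)))"
  have 1: "ex split_com s (11 * sz x + 8) ?s1"
    by (rule ex_mono[OF ex_split]) (use s0 s in \<open>auto simp: x sz_def\<close>)
  have 2: "ex (clear 0) ?s1 (2 * sz x + 1) ?s2"
    by (rule ex_mono[OF ex_clear]) (use s0 in \<open>auto simp: x sz_def\<close>)
  have 3: "ex (move 2 0) ?s2 (8 * sz x + 1) (s(0 := code (enc (fst x))))"
    by (rule ex_mono[OF ex_move]) (use s0 s in \<open>auto simp: x sz_def fun_eq_iff\<close>)
  show "ex (seq [split_com, clear 0, move 2 0]) s
     (1 + (11 * sz x + 8) + (1 + (2 * sz x + 1) + (1 + (8 * sz x + 1) + 1))) (s(0 := code (enc (fst x))))"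
    by (intro ex_seq_Cons[OF 1] ex_seq_Cons[OF 2] ex_seq_Cons[OF 3] ex_seq_Nil)
qed auto

lemma PF_snd_base: "PF (snd :: 'a :: enc \<times> 'b :: enc \<Rightarrow> 'b)"
proof (rule PFI[of 4 "seq [split_com, clear 2]"
      "\<lambda>x. 1 + (11 * sz x + 8) + (1 + (2 * sz x + 1) + 1)"])
  show "pbd (\<lambda>x. 1 + (11 * sz x + 8) + (1 + (2 * sz x + 1) + 1))"
    by (intro pbd_intros pbd_sz)
  show "regs 4 (seq [split_com, clear 2])" using regs_split by simp
  fix x :: "'a \<times> 'b" and s :: store
  assume s0: "s 0 = code (enc x)" and s: "\<And>i. 0 < i \<Longrightarrow> i < 4 \<Longrightarrow> s i = []"
  obtain a b where x: "x = (a, b)" by (cases x)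
  let ?s1 = "s(0 := code (enc b), 2 := rev (code (enc a)))"
  have 1: "ex split_com s (11 * sz x + 8) ?s1"
    by (rule ex_mono[OF ex_split]) (use s0 s in \<open>auto simp: x sz_def\<close>)
  have 2: "ex (clear 2) ?s1 (2 * sz x + 1) (s(0 := code (enc (snd x))))"
    by (rule ex_mono[OF ex_clear]) (use s0 s in \<open>auto simp: x sz_def fun_eq_iff\<close>)
  show "ex (seq [split_com, clear 2]) s
     (1 + (11 * sz x + 8) + (1 + (2 * sz x + 1) + 1)) (s(0 := code (enc (snd x))))"
    by (intro ex_seq_Cons[OF 1] ex_seq_Cons[OF 2] ex_seq_Nil)
qed auto

text \<open>Stack 1 is a flag that is cleared at the first difference, including the case that stack
  0 is exhausted. The loop runs on until stack 3 is empty, so that the work stacks are left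
  clean.\<close>

definition cmp_loop :: com where
  "cmp_loop = While 3 (Cond 3 Skip
     (Seq (Pop 3) (Cond 0 (clear 1) (Pop 0) (Seq (Pop 0) (clear 1))))
     (Seq (Pop 3) (Cond 0 (clear 1) (Seq (Pop 0) (clear 1)) (Pop 0))))"

lemma cmp_loop:
  assumes "s 3 = xs" "length (s 1) \<le> 1"
    "s' = s(0 := drop (length xs) (s 0), 3 := [], 1 := if take (length xs) (s 0) = xs then s 1 else [])"
  shows "ex cmp_loop s (10 * length xs + 1) s'"
  using assms
proof (induction xs arbitrary: s)
  case Nil
  then have "s' = s" by auto
  then show ?case using Nil ex_While_end[of s 3] by (simp add: cmp_loop_def)
next
  case (Cons x xs)
  let ?s1 = "s(3 := xs)"
  let ?ok = "s 0 \<noteq> [] \<and> hd (s 0) = x"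
  let ?s2 = "s(3 := xs, 0 := tl (s 0), 1 := if ?ok then s 1 else [])"
  let ?C = "Cond 0 (clear 1) (if x then Pop 0 else Seq (Pop 0) (clear 1)) (if x then Seq (Pop 0) (clear 1) else Pop 0)"
  have cl: "s'' = u(1 := []) \<Longrightarrow> u 1 = s 1 \<Longrightarrow> ex (clear 1) u 3 s''" for u s''
    by (rule ex_mono[OF ex_clear]) (use Cons.prems in auto)
  have "ex (case ?s1 0 of [] \<Rightarrow> clear 1 | y # _ \<Rightarrow> if y then if x then Pop 0 else Seq (Pop 0) (clear 1)
      else if x then Seq (Pop 0) (clear 1) else Pop 0) ?s1 5 ?s2"
  proof (cases "s 0")
    case Nil
    have "ex (clear 1) ?s1 5 ?s2"
      by (rule ex_mono[OF cl]) (use Nil in \<open>auto simp: fun_eq_iff\<close>)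
    then show ?thesis using Nil by simp
  next
    case (Cons y ys)
    have "ex (if x = y then Pop 0 else Seq (Pop 0) (clear 1)) ?s1 5 ?s2"
    proof (cases "x = y")
      case True
      have "ex (Pop 0) ?s1 5 ?s2"
        by (rule ex_mono[OF ex_Pop']) (use Cons True in \<open>auto simp: fun_eq_iff\<close>)
      then show ?thesis using True by simp
    next
      case False
      have "ex (clear 1) (?s1(0 := tl (?s1 0))) 3 ?s2"
        by (rule cl) (use Cons False in \<open>auto simp: fun_eq_iff\<close>)
      from ex_Seq[OF ex_Pop this] show ?thesis using False by simp
    qed
    then show ?thesis using Cons by (cases x; cases y) simp_all
  qed
  then have "ex ?C ?s1 (1 + 5) ?s2"
    by (rule ex_Cond)
  moreover have "ex (Pop 3) s 1 ?s1"
    by (rule ex_Pop') (use Cons.prems in auto)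
  ultimately have "ex (Seq (Pop 3) ?C) s (1 + 1 + (1 + 5)) ?s2"
    by (rule ex_Seq[rotated])
  then have 1: "ex (Cond 3 Skip
     (Seq (Pop 3) (Cond 0 (clear 1) (Pop 0) (Seq (Pop 0) (clear 1))))
     (Seq (Pop 3) (Cond 0 (clear 1) (Seq (Pop 0) (clear 1)) (Pop 0)))) s (1 + (1 + 1 + (1 + 5))) ?s2"
    using Cons.prems(1) by (intro ex_Cond) (cases x; simp)
  have "ex cmp_loop ?s2 (10 * length xs + 1) s'"
    by (rule Cons.IH) (use Cons.prems in \<open>cases "s 0"; auto simp: fun_eq_iff\<close>)+
  moreover have "s 3 \<noteq> []" using Cons.prems(1) by simp
  ultimately have "ex cmp_loop s (1 + (1 + (1 + 1 + (1 + 5))) + (10 * length xs + 1)) s'"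
    using ex_While[OF _ 1] unfolding cmp_loop_def by blast
  then show ?case by (rule ex_mono) simp
qed

lemma code_not_Nil [simp]: "code t \<noteq> []"
  by (cases t) auto

lemma code_append_eq_iff: "code a @ r = code b @ r' \<longleftrightarrow> a = b \<and> r = r'"
proof
  show "code a @ r = code b @ r' \<Longrightarrow> a = b \<and> r = r'"
  proof (induction a arbitrary: b r r')
    case Leaf
    then show ?case by (cases b) auto
  next
    case (Node a1 a2)
    obtain b1 b2 where b: "b = Node b1 b2"
      using Node.prems by (cases b) auto
    then have "code a1 @ (code a2 @ r) = code b1 @ (code b2 @ r')"
      using Node.prems by simp
    from Node.IH(1)[OF this] have 1: "a1 = b1" "code a2 @ r = code b2 @ r'"
      by simp_all
    from Node.IH(2)[OF 1(2)] 1(1) b show ?case by simp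
  qed
qed auto

lemma code_eq_iff [simp]: "code a = code b \<longleftrightarrow> a = b"
  using code_append_eq_iff[of a "[]" b "[]"] by simp

lemma PF_eq_base: "PF (\<lambda>(x::'a::enc, y). x = y)"
proof -
  define fin where "fin = seq [Cond 0 Skip (clear 1) (clear 1), clear 0, Cond 1 (Push 0 False) (Seq (Pop 1) (pushes 0 [True, False, False])) Skip]"
  define p where "p = seq [split_com, move 2 3, Push 1 True, cmp_loop, fin]"
  define T where "T n = 1 + (11 * n + 8) + (1 + (8 * n + 1) + (1 + 2 + (1 + (10 * n + 1) + (1 + (1 + (1 + 3) +
      (1 + (2 * n + 1) + (1 + (1 + 12) + 1))) + 1))))" for n :: nat
  show ?thesis
  proof (rule PFI[of 4 p "\<lambda>x. T (sz x)"])
    show "pbd (\<lambda>x. T (sz x))"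
      unfolding T_def by (intro pbd_intros pbd_sz)
    show "regs 4 p"
      using regs_split by (simp add: p_def fin_def cmp_loop_def)
    fix x :: "'a \<times> 'a" and s :: store
    assume s0: "s 0 = code (enc x)" and s: "\<And>i. 0 < i \<Longrightarrow> i < 4 \<Longrightarrow> s i = []"
    obtain a b where x: "x = (a, b)" by (cases x)
    define A B where "A = code (enc a)" and "B = code (enc b)"
    have le: "length A \<le> sz x" "length B \<le> sz x"
      by (auto simp: x A_def B_def sz_def)
    define s1 where "s1 = s(0 := B, 2 := rev A)"
    define s2 where "s2 = s(0 := B, 3 := A)"
    define s3 where "s3 = s(0 := B, 3 := A, 1 := [True])"
    define s4 where "s4 = s(0 := drop (length A) B, 1 := if take (length A) B = A then [True] else [])"
    define s5 where "s5 = s(0 := drop (length A) B, 1 := if a = b then [True] else [])"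
    define s6 where "s6 = s(1 := if a = b then [True] else [], 0 := [])"
    \<comment> \<open>The loop has compared only a prefix; equality also requires that nothing of
      the second code is left.\<close>
    have ab: "a = b \<longleftrightarrow> drop (length A) B = [] \<and> take (length A) B = A"
      by (metis A_def B_def append_Nil2 append_take_drop_id code_eq_iff drop_all enc_eq_iff order_refl take_all)
    have 1: "ex split_com s (11 * sz x + 8) s1"
      unfolding s1_def A_def B_def by (rule ex_mono[OF ex_split]) (use s0 s in \<open>auto simp: x sz_def\<close>)
    have 2: "ex (move 2 3) s1 (8 * sz x + 1) s2"
      by (rule ex_mono[OF ex_move]) (use s le in \<open>auto simp: s1_def s2_def fun_eq_iff\<close>)
    have 3: "ex (Push 1 True) s2 2 s3"
      by (rule ex_Push') (use s in \<open>auto simp: s2_def s3_def fun_eq_iff\<close>)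
    have 4: "ex cmp_loop s3 (10 * sz x + 1) s4"
      by (rule ex_mono[OF cmp_loop[of s3 A s4]]) (use s le in \<open>auto simp: s3_def s4_def fun_eq_iff\<close>)
    have d: "s4 0 = drop (length A) B" by (simp add: s4_def)
    have "ex (case s4 0 of [] \<Rightarrow> Skip | y # _ \<Rightarrow> if y then clear 1 else clear 1) s4 3 s5"
    proof (cases "s4 0")
      case Nil
      then have "s5 = s4" using ab unfolding d by (simp add: s4_def s5_def)
      then show ?thesis using ex_mono[OF ex_Skip[of s4], of 3] Nil by simp
    next
      case (Cons y ys)
      then have "a \<noteq> b" using ab d by auto
      then have "ex (clear 1) s4 3 s5"
        by (intro ex_mono[OF ex_clear]) (auto simp: s4_def s5_def)
      then show ?thesis using Cons by simp
    qed
    then have 5: "ex (Cond 0 Skip (clear 1) (clear 1)) s4 (1 + 3) s5"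
      by (rule ex_Cond)
    have 6: "ex (clear 0) s5 (2 * sz x + 1) s6"
      by (rule ex_mono[OF ex_clear]) (use le in \<open>auto simp: s5_def s6_def fun_eq_iff\<close>)
    let ?s = "s(0 := code (enc (a = b)))"
    have "ex (if a = b then Seq (Pop 1) (pushes 0 [True, False, False]) else Push 0 False) s6 12 ?s"
    proof (cases "a = b")
      case True
      have "ex (Seq (Pop 1) (pushes 0 [True, False, False])) s6 (1 + 1 + (3 * 3 + 1)) ?s"
        by (rule ex_Seq[OF ex_Pop]) (rule ex_mono[OF ex_pushes], use True s in \<open>auto simp: s6_def fun_eq_iff\<close>)
      then show ?thesis using True by simp
    next
      case False
      have "ex (Push 0 False) s6 12 ?s"
        by (rule ex_mono[OF ex_Push']) (use False s in \<open>auto simp: s6_def fun_eq_iff\<close>)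
      then show ?thesis using False by simp
    qed
    then have 7: "ex (Cond 1 (Push 0 False) (Seq (Pop 1) (pushes 0 [True, False, False])) Skip) s6 (1 + 12) ?s"
      by (intro ex_Cond) (auto simp: s6_def split: list.splits if_splits)
    have "ex p s (T (sz x)) ?s"
      unfolding p_def fin_def T_def
      by (intro ex_seq_Cons[OF 1] ex_seq_Cons[OF 2] ex_seq_Cons[OF 3] ex_seq_Cons[OF 4] ex_seq_Cons[OF 5]
            ex_seq_Cons[OF 6] ex_seq_Cons[OF 7] ex_seq_Cons[OF _ ex_seq_Nil] ex_seq_Nil)
    then show "ex p s (T (sz x)) (s(0 := code (enc (case x of (x, y) \<Rightarrow> x = y))))"
      by (simp add: x)
  qed auto
qed

text \<open>A non-empty list already has the code of the pair of its head and tail, so only the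
  empty list has to be replaced.\<close>

lemma PF_uncons_base: "PF (\<lambda>l. case l of [] \<Rightarrow> (y :: 'a :: enc, []) | z # zs \<Rightarrow> (z, zs))"
proof -
  let ?w = "code (enc (y, [] :: 'a list))"
  show ?thesis
  proof (rule PFI[of 1 "Cond 0 Skip Skip (Seq (Pop 0) (pushes 0 ?w))" "\<lambda>_. 1 + (1 + 1 + (3 * length ?w + 1))"])
    fix x :: "'a list" and s :: store
    assume s: "s 0 = code (enc x)"
    let ?s = "s(0 := code (enc (case x of [] \<Rightarrow> (y, []) | z # zs \<Rightarrow> (z, zs))))"
    have "ex (if x = [] then (Seq (Pop 0) (pushes 0 ?w)) else Skip) s (1 + 1 + (3 * length ?w + 1)) ?s"
    proof (cases x)
      case Nil
      then have "ex (Seq (Pop 0) (pushes 0 ?w)) s (1 + 1 + (3 * length ?w + 1)) ?s"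
        by (intro ex_Seq[OF ex_Pop] ex_pushes) (use s in auto)
      then show ?thesis using Nil by simp
    next
      case (Cons z zs)
      then have "?s = s" using s by auto
      then show ?thesis using Cons ex_mono[OF ex_Skip] by simp
    qed
    then show "ex (Cond 0 Skip Skip (Seq (Pop 0) (pushes 0 ?w))) s (1 + (1 + 1 + (3 * length ?w + 1))) ?s"
      using s by (intro ex_Cond) (cases x; simp)
  qed (auto intro: pbd_intros)
qed

text \<open>A copy of the code of the start value is the clock: one of its bits is removed in each
  round. The bound \<open>h\<close> on all intermediate values is a hypothesis because iterating a
  polynomial-time function may produce values of exponential size.\<close>

lemma PF_iter:
  fixes f :: "'b :: enc \<Rightarrow> 'b" and a :: "'a :: enc \<Rightarrow> 'b"
  assumes "PF f" "PF a" "pbd h" and h: "\<And>e i. i \<le> sz (a e) \<Longrightarrow> sz ((f ^^ i) (a e)) \<le> h e"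
  shows "PF (\<lambda>e. (f ^^ sz (a e)) (a e))"
proof -
  obtain c k q where "comp_by c k q f"
    using assms(1) unfolding PF_def by blast
  note c = comp_byD[OF this]
  obtain d l r where "comp_by d l r a"
    using assms(2) unfolding PF_def by blast
  note d = comp_byD[OF this]
  obtain e where e: "\<And>x. q x \<le> (sz x + 2) ^ e"
    using c(3) by (auto simp: pbd_def)
  define m where "m = max k l"
  have m: "0 < m" "k \<le> m" "l \<le> m" using c(1) by (auto simp: m_def)
  define lp where "lp = While m (Seq (Pop m) c)"
  define p where "p = seq [d, move 0 (m+1), move2 (m+1) 0 m, lp]"
  define B where "B x = 1 + 1 + (h x + 2) ^ e" for x
  define T where "T x = 1 + r x + (1 + (8 * sz (a x) + 1) + (1 + (11 * sz (a x) + 1) + (1 + (sz (a x) * (1 + B x) + 1) + 1)))" for x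
  show ?thesis
  proof (rule PFI)
    show "0 < m + 2" by simp
    show "regs (m + 2) p"
      using c(2) d(2) m by (auto simp: p_def lp_def intro: regs_mono)
    show "pbd T"
      unfolding T_def B_def by (intro pbd_intros c(3) d(3) pbd_sz assms)
    fix x :: 'a and s :: store
    assume s0: "s 0 = code (enc x)" and s: "\<And>i. 0 < i \<Longrightarrow> i < m + 2 \<Longrightarrow> s i = []"
    let ?a = "code (enc (a x))"
    define s1 where "s1 = s(0 := ?a)"
    define s2 where "s2 = s(0 := [], m+1 := rev ?a)"
    define s3 where "s3 = s(0 := ?a, m := ?a)"
    let ?fin = "s(0 := code (enc ((f ^^ sz (a x)) (a x))))"
    have sm: "s m = []" "s (m+1) = []" using s m by auto
    have loop: "ex lp (s(0 := code (enc ((f ^^ i) (a x))), m := w)) (length w * (1 + B x) + 1) ?fin"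
      if "i + length w = sz (a x)" for i w
      using that
    proof (induction w arbitrary: i)
      case Nil
      then have eq: "s(0 := code (enc ((f ^^ i) (a x))), m := []) = ?fin"
        using sm m by (auto simp: fun_eq_iff)
      have "ex lp ?fin 1 ?fin"
        unfolding lp_def by (rule ex_While_end) (use sm m in simp)
      then show ?case unfolding eq by (rule ex_mono) simp
    next
      case (Cons b w)
      let ?u = "s(0 := code (enc ((f ^^ i) (a x))), m := b # w)"
      let ?u1 = "s(0 := code (enc ((f ^^ i) (a x))), m := w)"
      let ?u2 = "s(0 := code (enc ((f ^^ Suc i) (a x))), m := w)"
      have "ex c ?u1 (q ((f ^^ i) (a x))) (?u1(0 := code (enc (f ((f ^^ i) (a x))))))"
        by (rule c(4)) (use s m in auto)
      moreover have "?u1(0 := code (enc (f ((f ^^ i) (a x))))) = ?u2"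
        using m by (auto simp: fun_eq_iff)
      moreover have "q ((f ^^ i) (a x)) \<le> (h x + 2) ^ e"
        using Cons.prems by (intro order_trans[OF e] power_mono add_mono h) auto
      ultimately have "ex c ?u1 ((h x + 2) ^ e) ?u2"
        using ex_mono by metis
      moreover have "ex (Pop m) ?u 1 ?u1"
        by (rule ex_Pop') auto
      ultimately have 1: "ex (Seq (Pop m) c) ?u (B x) ?u2"
        unfolding B_def by (intro ex_Seq)
      have "ex lp ?u2 (length w * (1 + B x) + 1) ?fin"
        using Cons.prems by (intro Cons.IH) auto
      moreover have "?u m \<noteq> []" by simp
      ultimately have "ex lp ?u (1 + B x + (length w * (1 + B x) + 1)) ?fin"
        using ex_While[OF _ 1] unfolding lp_def by blast
      then show ?case by (rule ex_mono) simp
    qed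
    have 1: "ex d s (r x) s1"
      unfolding s1_def by (rule d(4)) (use s0 s m in auto)
    have 2: "ex (move 0 (m+1)) s1 (8 * sz (a x) + 1) s2"
      by (rule ex_mono[OF ex_move]) (use sm in \<open>auto simp: s1_def s2_def sz_def\<close>)
    have 3: "ex (move2 (m+1) 0 m) s2 (11 * sz (a x) + 1) s3"
      by (rule ex_mono[OF ex_move2]) (use sm m in \<open>auto simp: s2_def s3_def fun_eq_iff sz_def\<close>)
    have 4: "ex lp s3 (sz (a x) * (1 + B x) + 1) ?fin"
      unfolding s3_def using loop[of 0 ?a] by (simp add: sz_def)
    show "ex p s (T x) ?fin"
      unfolding p_def T_def by (intro ex_seq_Cons[OF 1] ex_seq_Cons[OF 2] ex_seq_Cons[OF 3] ex_seq_Cons[OF 4] ex_seq_Nil)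
  qed
qed

text \<open>\<open>[True, True, False, False]\<close> and \<open>[True, False]\<close> are a list
  node followed by the code of \<open>True\<close> or \<open>False\<close>. The input is reversed
  first, because the code is built up from the end of the list.\<close>

definition quote_com :: com where
  "quote_com = seq [move 0 1, Push 0 False, While 1 (Cond 1 Skip
     (Seq (Pop 1) (pushes 0 [True, True, False, False])) (Seq (Pop 1) (pushes 0 [True, False])))]"

lemma ex_quote:
  assumes "s 0 = w" "s 1 = []"
  shows "ex quote_com s (25 * length w + 20) (s(0 := code (enc w)))"
proof -
  let ?C = "Cond 1 Skip (Seq (Pop 1) (pushes 0 [True, True, False, False])) (Seq (Pop 1) (pushes 0 [True, False]))"
  have loop: "u 1 = rev xs \<Longrightarrow> u 0 = code (enc ys) \<Longrightarrow> u' = u(0 := code (enc (xs @ ys)), 1 := []) \<Longrightarrow>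
     ex (While 1 ?C) u (17 * length xs + 1) u'"
    for u u' :: store and xs ys
  proof (induction xs arbitrary: u ys rule: rev_induct)
    case Nil
    then have "u' = u" by auto
    then show ?case using Nil ex_While_end[of u 1] by simp
  next
    case (snoc x xs)
    let ?u = "u(0 := code (enc (x # ys)), 1 := rev xs)"
    have "ex (Seq (Pop 1) (pushes 0 (if x then [True, True, False, False] else [True, False]))) u (1 + 1 + 13) ?u"
      by (rule ex_Seq[OF ex_Pop], rule ex_mono[OF ex_pushes]) (use snoc.prems in \<open>auto simp: fun_eq_iff\<close>)
    then have 1: "ex ?C u (1 + (1 + 1 + 13)) ?u"
      using snoc.prems by (intro ex_Cond) (cases x; simp)
    have "ex (While 1 ?C) ?u (17 * length xs + 1) u'"
      by (rule snoc.IH[of _ "x # ys"]) (use snoc.prems in \<open>auto simp: fun_eq_iff\<close>)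
    have "ex (While 1 ?C) u (1 + (1 + (1 + 1 + 13)) + (17 * length xs + 1)) u'"
      by (rule ex_While[OF _ 1 \<open>ex (While 1 ?C) ?u _ u'\<close>]) (use snoc.prems in simp)
    then show ?case by (rule ex_mono) simp
  qed
  have 1: "ex (move 0 1) s (8 * length w + 1) (s(0 := [], 1 := rev w))"
    by (rule ex_mono[OF ex_move]) (use assms in auto)
  have 2: "ex (Push 0 False) (s(0 := [], 1 := rev w)) 2 (s(0 := [False], 1 := rev w))"
    by (rule ex_Push') auto
  have 3: "ex (While 1 ?C) (s(0 := [False], 1 := rev w)) (17 * length w + 1) (s(0 := code (enc w)))"
    by (rule loop[where ys = "[]"]) (use assms in \<open>auto simp: fun_eq_iff\<close>)
  have "ex quote_com s (1 + (8 * length w + 1) + (1 + 2 + (1 + (17 * length w + 1) + 1))) (s(0 := code (enc w)))"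
    unfolding quote_com_def by (intro ex_seq_Cons[OF 1] ex_seq_Cons[OF 2] ex_seq_Cons[OF 3] ex_seq_Nil)
  then show ?thesis by (rule ex_mono) simp
qed

lemma regs_quote: "regs 2 quote_com"
  by (simp add: quote_com_def)

text \<open>The code of the argument is literally the content of stack 0, so quoting that stack
  turns it into a value.\<close>

lemma PF_code_base: "PF (\<lambda>x. code (enc x))"
proof (rule PFI[of 2 quote_com "\<lambda>x. 25 * sz x + 20"])
  show "pbd (\<lambda>x. 25 * sz x + 20)"
    by (intro pbd_intros pbd_sz)
  fix x :: 'a and s :: store
  assume "s 0 = code (enc x)" "\<And>i. 0 < i \<Longrightarrow> i < 2 \<Longrightarrow> s i = []"
  then show "ex quote_com s (25 * sz x + 20) (s(0 := code (enc (code (enc x)))))"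
    unfolding sz_def by (intro ex_quote) auto
qed (use regs_quote in auto)

subsection \<open>From the class to Turing machines\<close>

text \<open>This inverts quoting: each round removes a list node and the code of one bit, which has
  length 3 or 1, and appends the bit to the output.\<close>

definition emit_com :: "nat \<Rightarrow> com" where
  "emit_com k = While 0 (Cond 0 Skip
     (Seq (Pop 0) (Cond 0 Skip (seq [Pop 0, Pop 0, Pop 0, Emit k True]) (seq [Pop 0, Emit k False])))
     (Pop 0))"

lemma ex_emit:
  assumes "0 < k"
  shows "s 0 = code (enc (w :: bool list)) \<Longrightarrow> ex (emit_com k) s (20 * length w + 10) (s(0 := [], k := s k @ w))"
proof (induction w arbitrary: s)
  case Nil
  let ?s = "s(0 := [], k := s k @ [])"
  have "ex (Pop 0) s 1 ?s"
    by (rule ex_Pop') (use Nil assms in \<open>auto simp: fun_eq_iff\<close>)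
  then have 1: "ex (Cond 0 Skip
     (Seq (Pop 0) (Cond 0 Skip (seq [Pop 0, Pop 0, Pop 0, Emit k True]) (seq [Pop 0, Emit k False])))
     (Pop 0)) s (1 + 1) ?s"
    using Nil by (intro ex_Cond) simp
  have 2: "ex (emit_com k) ?s 1 ?s"
    unfolding emit_com_def by (rule ex_While_end) (use assms in auto)
  have "s 0 \<noteq> []" using Nil by simp
  from ex_While[OF this 1 2[unfolded emit_com_def]] show ?case
    unfolding emit_com_def by (rule ex_mono) simp
next
  case (Cons b w)
  let ?s1 = "s(0 := tl (s 0))"
  let ?s2 = "s(0 := code (enc w), k := s k @ [b])"
  have "ex (case ?s1 0 of [] \<Rightarrow> Skip | b # _ \<Rightarrow> if b then seq [Pop 0, Pop 0, Pop 0, Emit k True] else seq [Pop 0, Emit k False]) ?s1 10 ?s2"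
  proof (cases b)
    case True
    have 1: "ex (Pop 0) ?s1 1 (s(0 := False # False # code (enc w)))"
      by (rule ex_Pop') (use Cons True in \<open>auto simp: fun_eq_iff\<close>)
    have 2: "ex (Pop 0) (s(0 := False # False # code (enc w))) 1 (s(0 := False # code (enc w)))"
      by (rule ex_Pop') (auto simp: fun_eq_iff)
    have 3: "ex (Pop 0) (s(0 := False # code (enc w))) 1 (s(0 := code (enc w)))"
      by (rule ex_Pop') (auto simp: fun_eq_iff)
    have 4: "ex (Emit k True) (s(0 := code (enc w))) 1 ?s2"
      by (rule ex_eqI[OF ex_Emit]) (use True assms in \<open>auto simp: fun_eq_iff\<close>)
    have "ex (seq [Pop 0, Pop 0, Pop 0, Emit k True]) ?s1 (1 + 1 + (1 + 1 + (1 + 1 + (1 + 1 + 1)))) ?s2"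
      by (intro ex_seq_Cons[OF 1] ex_seq_Cons[OF 2] ex_seq_Cons[OF 3] ex_seq_Cons[OF 4] ex_seq_Nil)
    then have "ex (seq [Pop 0, Pop 0, Pop 0, Emit k True]) ?s1 10 ?s2"
      by (rule ex_mono) simp
    then show ?thesis using Cons.prems True by simp
  next
    case False
    have 1: "ex (Pop 0) ?s1 1 (s(0 := code (enc w)))"
      by (rule ex_Pop') (use Cons False in \<open>auto simp: fun_eq_iff\<close>)
    have 4: "ex (Emit k False) (s(0 := code (enc w))) 1 ?s2"
      by (rule ex_eqI[OF ex_Emit]) (use False assms in \<open>auto simp: fun_eq_iff\<close>)
    have "ex (seq [Pop 0, Emit k False]) ?s1 (1 + 1 + (1 + 1 + 1)) ?s2"
      by (intro ex_seq_Cons[OF 1] ex_seq_Cons[OF 4] ex_seq_Nil)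
    then have "ex (seq [Pop 0, Emit k False]) ?s1 10 ?s2"
      by (rule ex_mono) simp
    then show ?thesis using Cons.prems False by simp
  qed
  then have "ex (Cond 0 Skip (seq [Pop 0, Pop 0, Pop 0, Emit k True]) (seq [Pop 0, Emit k False])) ?s1 (1 + 10) ?s2"
    by (rule ex_Cond)
  with ex_Pop have "ex (Seq (Pop 0) (Cond 0 Skip (seq [Pop 0, Pop 0, Pop 0, Emit k True]) (seq [Pop 0, Emit k False]))) s
      (1 + 1 + (1 + 10)) ?s2"
    by (rule ex_Seq)
  then have 1: "ex (Cond 0 Skip
     (Seq (Pop 0) (Cond 0 Skip (seq [Pop 0, Pop 0, Pop 0, Emit k True]) (seq [Pop 0, Emit k False])))
     (Pop 0)) s (1 + (1 + 1 + (1 + 10))) ?s2"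
    using Cons.prems by (intro ex_Cond) simp
  have "ex (emit_com k) ?s2 (20 * length w + 10) (?s2(0 := [], k := ?s2 k @ w))"
    by (rule Cons.IH) (use assms in simp)
  then have 2: "ex (emit_com k) ?s2 (20 * length w + 10) (s(0 := [], k := s k @ b # w))"
    by (rule ex_eqI) (use assms in \<open>auto simp: fun_eq_iff\<close>)
  have "s 0 \<noteq> []" using Cons.prems by simp
  from ex_While[OF this 1 2[unfolded emit_com_def]] show ?case
    unfolding emit_com_def by (rule ex_mono) simp
qed

lemma sz_bool_list: "sz (x :: bool list) \<le> 4 * length x + 1"
proof (induction x)
  case (Cons b x)
  then show ?case using sz_bool[of b] by simp
qed simp


lemma PF_run:
  fixes f :: "bool list \<Rightarrow> 'b :: enc"
  assumes "PF f"
  obtains c k p where "0 < k" "regs k c"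
    "\<And>x. ex c ((\<lambda>_. [])(0 := x)) (poly p (length x)) ((\<lambda>_. [])(0 := code (enc (f x))))"
    "\<And>x. sz (f x) \<le> poly p (length x)"
proof -
  obtain c k q where "comp_by c k q f"
    using assms unfolding PF_def by blast
  note c = comp_byD[OF this]
  obtain e where e: "\<And>x. q x \<le> (sz x + 2) ^ e"
    using c(3) by (auto simp: pbd_def)
  \<comment> \<open>The encoded input has size at most \<open>4 * length x + 1\<close>, whence the
    base \<open>4 * length x + 3\<close>. The linear summand pays for quoting the input.\<close>
  let ?p = "[:3, 4:] ^ e + [:30, 30:] :: nat poly"
  have q: "q x + 25 * length x + 22 \<le> poly ?p (length x)" for x :: "bool list"
  proof -
    have "q x \<le> (sz x + 2) ^ e" by (rule e)
    also have "\<dots> \<le> (4 * length x + 3) ^ e"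
      using sz_bool_list[of x] by (intro power_mono) auto
    finally show ?thesis by (simp add: poly_power algebra_simps)
  qed
  show thesis
  proof (rule that[of "max 2 k" "Seq quote_com c" ?p])
    show "0 < max 2 k" by simp
    show "regs (max 2 k) (Seq quote_com c)"
      using regs_quote c(2) by (auto intro: regs_mono)
    fix x :: "bool list"
    let ?s = "(\<lambda>_. [])(0 := x) :: store"
    have "ex quote_com ?s (25 * length x + 20) (?s(0 := code (enc x)))"
      by (rule ex_quote) auto
    then have 1: "ex quote_com ?s (25 * length x + 20) ((\<lambda>_. [])(0 := code (enc x)))"
      by (rule ex_eqI) auto
    have "ex c ((\<lambda>_. [])(0 := code (enc x))) (q x) (((\<lambda>_. [])(0 := code (enc x)))(0 := code (enc (f x))))"
      by (rule c(4)) auto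
    then have 2: "ex c ((\<lambda>_. [])(0 := code (enc x))) (q x) ((\<lambda>_. [])(0 := code (enc (f x))))"
      by (rule ex_eqI) auto
    from ex_Seq[OF 1 2]
    show "ex (Seq quote_com c) ?s (poly ?p (length x)) ((\<lambda>_. [])(0 := code (enc (f x))))"
      by (rule ex_mono) (use q[of x] in linarith)
    show "sz (f x) \<le> poly ?p (length x)"
      using ex_length[OF 2, of 0] q[of x] sz_bool_list[of x] by (simp add: sz_def)
  qed
qed

theorem PF_poly_time_solvable:
  assumes "PF d" "\<And>x. x \<in> D \<Longrightarrow> d x \<longleftrightarrow> x \<in> Y"
  shows "poly_time_solvable D Y"
proof -
  obtain c k p where c: "0 < k" "regs k c"
    "\<And>x. ex c ((\<lambda>_. [])(0 := x)) (poly p (length x)) ((\<lambda>_. [])(0 := code (enc (d x))))"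
    by (rule PF_run[OF assms(1)]) blast
  obtain M where M: "turing_machine M" "\<And>x t s' t'. exec c ((\<lambda>_. [])(0 := x)) t s' \<Longrightarrow> t' \<ge> t + 2 \<Longrightarrow>
      halted (run M x t') \<and> (accepting (run M x t') \<longleftrightarrow> s' 0 \<noteq> [] \<and> hd (s' 0)) \<and>
      fst (last (snd (run M x t'))) = contents (s' k)"
    using exec_turing_machine[OF regs_uses[OF c(2)] c(1)] by metis
  have "halted (run M x (poly (p + [:2:]) (length x))) \<and>
     (accepting (run M x (poly (p + [:2:]) (length x))) \<longleftrightarrow> d x)" for x
  proof -
    obtain t where "exec c ((\<lambda>_. [])(0 := x)) t ((\<lambda>_. [])(0 := code (enc (d x))))" "t \<le> poly p (length x)"
      using c(3)[of x] unfolding ex_def by blast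
    from M(2)[OF this(1), of "poly (p + [:2:]) (length x)"] this(2)
    show ?thesis by (cases "d x") auto
  qed
  then show ?thesis
    unfolding poly_time_solvable_def using M(1) assms(2) by blast
qed

theorem PF_poly_time_computable:
  assumes "PF f"
  shows "poly_time_computable f"
proof -
  obtain c k p where c: "0 < k" "regs k c"
    "\<And>x. ex c ((\<lambda>_. [])(0 := x)) (poly p (length x)) ((\<lambda>_. [])(0 := code (enc (f x))))"
    "\<And>x. sz (f x) \<le> poly p (length x)"
    by (rule PF_run[OF assms]) blast
  let ?c = "Seq c (emit_com k)"
  have u: "uses k ?c"
    using c(1) regs_uses[OF c(2)] by (simp add: emit_com_def)
  obtain M where M: "turing_machine M" "\<And>x t s' t'. exec ?c ((\<lambda>_. [])(0 := x)) t s' \<Longrightarrow> t' \<ge> t + 2 \<Longrightarrow>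
      halted (run M x t') \<and> (accepting (run M x t') \<longleftrightarrow> s' 0 \<noteq> [] \<and> hd (s' 0)) \<and>
      fst (last (snd (run M x t'))) = contents (s' k)"
    using exec_turing_machine[OF u c(1)] by metis
  \<comment> \<open>The output is shorter than \<open>poly p (length x)\<close>, and writing it
    costs 20 steps per bit and 10 more; 1 step joins the programs and 2 are overhead of the
    machine.\<close>
  let ?p = "[:21:] * p + [:13:]"
  have "halted (run M x (poly ?p (length x))) \<and>
     fst (last (snd (run M x (poly ?p (length x))))) = contents (f x)" for x
  proof -
    let ?s = "(\<lambda>_. [])(0 := code (enc (f x))) :: store"
    have "ex (emit_com k) ?s (20 * length (f x) + 10) (?s(0 := [], k := ?s k @ f x))"
      by (rule ex_emit) (use c(1) in auto)
    from ex_Seq[OF c(3) this]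
    obtain t where t: "exec ?c ((\<lambda>_. [])(0 := x)) t (?s(0 := [], k := ?s k @ f x))"
      "t \<le> 1 + poly p (length x) + (20 * length (f x) + 10)"
      unfolding ex_def by blast
    have "t + 2 \<le> poly ?p (length x)"
      using t(2) c(4)[of x] length_le_sz[of "f x"] by simp
    from M(2)[OF t(1) this] show ?thesis
      using c(1) by simp
  qed
  then show ?thesis
    unfolding poly_time_computable_def using M(1) by blast
qed

subsection \<open>Closure properties\<close>

lemma PF_fst [pf_intros]: "PF f \<Longrightarrow> PF (\<lambda>x. fst (f x))"
  by (rule PF_comp[OF PF_fst_base])

lemma PF_snd [pf_intros]: "PF f \<Longrightarrow> PF (\<lambda>x. snd (f x))"
  by (rule PF_comp[OF PF_snd_base])

lemma PF_app2: "PF (\<lambda>p. h (fst p) (snd p)) \<Longrightarrow> PF f \<Longrightarrow> PF g \<Longrightarrow> PF (\<lambda>x. h (f x) (g x))"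
  using PF_comp[OF _ PF_Pair, of "\<lambda>p. h (fst p) (snd p)" f g] by simp

lemma PF_case_prod [pf_intros]:
  "PF p \<Longrightarrow> PF (\<lambda>q. f (fst q) (fst (snd q)) (snd (snd q))) \<Longrightarrow> PF (\<lambda>x. case p x of (a, b) \<Rightarrow> f x a b)"
  using PF_comp[OF _ PF_Pair[OF PF_id], of "\<lambda>q. f (fst q) (fst (snd q)) (snd (snd q))" p]
  by (simp add: case_prod_beta)

lemma PF_Let [pf_intros]:
  "PF v \<Longrightarrow> PF (\<lambda>q. f (fst q) (snd q)) \<Longrightarrow> PF (\<lambda>x. let y = v x in f x y)"
  using PF_comp[OF _ PF_Pair[OF PF_id], of "\<lambda>q. f (fst q) (snd q)" v] by simp

lemma PF_Cons [pf_intros]: "PF f \<Longrightarrow> PF g \<Longrightarrow> PF (\<lambda>x. f x # g x)"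
  by (rule PF_transfer[OF PF_Pair[of f g]]) auto

lemma PF_If [pf_intros]:
  assumes "PF b" "PF f" "PF g"
  shows "PF (\<lambda>x. if b x then f x else g x)"
proof -
  have "(\<lambda>x. if enc (b x) = Leaf then g x else f x) = (\<lambda>x. if b x then f x else g x)"
    by (auto simp: enc_bool_def)
  then show ?thesis using PF_If_gen[OF assms(1) assms(3,2)] by simp
qed

lemma PF_case_list [pf_intros]:
  assumes "PF l" "PF n" "PF (\<lambda>q. c (fst q) (fst (snd q)) (snd (snd q)))"
  shows "PF (\<lambda>x. case l x of [] \<Rightarrow> n x | y # ys \<Rightarrow> c x y ys)"
proof -
  let ?u = "\<lambda>l. case l of [] \<Rightarrow> (undefined, []) | z # zs \<Rightarrow> (z, zs)"
  let ?c = "\<lambda>q. c (fst q) (fst (snd q)) (snd (snd q))"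
  have "PF (\<lambda>x. if enc (l x) = Leaf then n x else ?c (x, ?u (l x)))"
    by (intro PF_If_gen assms PF_comp[OF assms(3)] PF_Pair PF_id PF_comp[OF PF_uncons_base])
  moreover have "(\<lambda>x. if enc (l x) = Leaf then n x else ?c (x, ?u (l x))) =
      (\<lambda>x. case l x of [] \<Rightarrow> n x | y # ys \<Rightarrow> c x y ys)"
    by (auto split: list.splits)
  ultimately show ?thesis by simp
qed

lemma PF_eq [pf_intros]: "PF f \<Longrightarrow> PF g \<Longrightarrow> PF (\<lambda>x. f x = g x)"
  using PF_comp[OF PF_eq_base PF_Pair[of f g]] by simp

lemma PF_not [pf_intros]: "PF b \<Longrightarrow> PF (\<lambda>x. \<not> b x)"
proof -
  assume "PF b"
  then have "PF (\<lambda>x. if b x then False else True)"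
    by (intro PF_If PF_const)
  moreover have "(\<lambda>x. if b x then False else True) = (\<lambda>x. \<not> b x)" by auto
  ultimately show ?thesis by simp
qed

lemma PF_conj [pf_intros]: "PF b \<Longrightarrow> PF c \<Longrightarrow> PF (\<lambda>x. b x \<and> c x)"
proof -
  assume "PF b" "PF c"
  then have "PF (\<lambda>x. if b x then c x else False)"
    by (intro PF_If PF_const)
  moreover have "(\<lambda>x. if b x then c x else False) = (\<lambda>x. b x \<and> c x)" by auto
  ultimately show ?thesis by simp
qed

lemma PF_disj [pf_intros]: "PF b \<Longrightarrow> PF c \<Longrightarrow> PF (\<lambda>x. b x \<or> c x)"
  using PF_not[OF PF_conj[OF PF_not[of b] PF_not[of c]]] by simp

lemma PF_imp [pf_intros]: "PF b \<Longrightarrow> PF c \<Longrightarrow> PF (\<lambda>x. b x \<longrightarrow> c x)"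
  unfolding imp_conv_disj by (intro PF_disj PF_not)

text \<open>Unary numbers are the same trees as lists of units. Recursion on numbers thereby reduces
  to recursion on lists, and numbers can serve as clocks of \<open>fold\<close>.\<close>

lemma enc_replicate_unit: "enc (replicate n ()) = enc n"
  by (induction n) auto

lemma PF_units: "PF n \<Longrightarrow> PF (\<lambda>x. replicate (n x) ())"
  by (erule PF_transfer) (auto simp: enc_replicate_unit)

lemma PF_length_units: "PF (length :: unit list \<Rightarrow> nat)"
proof (rule PF_transfer[OF PF_id])
  fix y :: "unit list"
  have "enc y = enc (length y)"
    by (induction y) auto
  then show "\<exists>x :: nat. enc y = enc x \<and> enc (length y) = enc x" by blast
qed

lemma PF_Suc [pf_intros]: "PF f \<Longrightarrow> PF (\<lambda>x. Suc (f x))"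
  by (rule PF_transfer[OF PF_Pair[of "\<lambda>_. ()" f]]) (auto intro: PF_const)

lemma PF_case_nat [pf_intros]:
  assumes "PF n" "PF z" "PF (\<lambda>q. s (fst q) (snd q))"
  shows "PF (\<lambda>x. case n x of 0 \<Rightarrow> z x | Suc m \<Rightarrow> s x m)"
proof -
  have "PF (\<lambda>x. case replicate (n x) () of [] \<Rightarrow> z x | _ # us \<Rightarrow> s x (length us))"
    by (intro PF_case_list PF_units assms PF_app2[OF assms(3)] pf_intros PF_comp[OF PF_length_units])
  moreover have "(\<lambda>x. case replicate (n x) () of [] \<Rightarrow> z x | _ # us \<Rightarrow> s x (length us)) =
     (\<lambda>x. case n x of 0 \<Rightarrow> z x | Suc m \<Rightarrow> s x m)"
    by (auto split: nat.splits simp: fun_eq_iff)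
  ultimately show ?thesis by simp
qed

text \<open>The iterated state carries the environment, the rest of the list and the accumulator.
  Its initial size exceeds the length of the list, and further rounds change nothing once the list
  is used up. The accumulators of all prefixes have to be bounded by \<open>h\<close>.\<close>

lemma PF_fold:
  fixes g :: "'e :: enc \<Rightarrow> 'x :: enc \<Rightarrow> 'a :: enc \<Rightarrow> 'a"
  assumes "PF l" "PF a" "PF (\<lambda>p. g (fst p) (fst (snd p)) (snd (snd p)))" "pbd h"
    and h: "\<And>e xs ys. l e = xs @ ys \<Longrightarrow> sz (fold (g e) xs (a e)) \<le> h e"
  shows "PF (\<lambda>e. fold (g e) (l e) (a e))"
proof -
  define st :: "'e \<times> 'x list \<times> 'a \<Rightarrow> 'e \<times> 'x list \<times> 'a" where
    "st = (\<lambda>p. case fst (snd p) of [] \<Rightarrow> p | y # ys \<Rightarrow> (fst p, ys, g (fst p) y (snd (snd p))))"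
  let ?i = "\<lambda>e. (e, l e, a e)"
  have st: "(st ^^ i) (e, xs, b) = (e, drop i xs, fold (g e) (take i xs) b)" for i e xs b
  proof (induction i arbitrary: xs b)
    case (Suc i)
    show ?case
      unfolding funpow_Suc_right comp_apply using Suc by (cases xs) (auto simp: st_def)
  qed simp
  have i: "PF ?i"
    by (intro pf_intros assms)
  have s: "PF st"
    unfolding st_def
    by (intro PF_case_list PF_Pair PF_fst PF_snd PF_id PF_comp[OF assms(3), of "\<lambda>q. (fst (fst q), fst (snd q), snd (snd (fst q)))", simplified])
  have "PF (\<lambda>e. (st ^^ sz (?i e)) (?i e))"
  proof (rule PF_iter[OF s i])
    show "pbd (\<lambda>e. sz e + (sz (l e)) + h e + 2)"
      by (intro pbd_intros pbd_sz assms)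
    fix e i
    have "sz (fold (g e) (take i (l e)) (a e)) \<le> h e"
      by (rule h[of _ _ "drop i (l e)"]) simp
    moreover have "sz (drop i (l e)) \<le> sz (l e)"
      using sz_append[of "take i (l e)" "drop i (l e)"] sz_pos[of "take i (l e)"] by simp
    ultimately show "sz ((st ^^ i) (?i e)) \<le> sz e + sz (l e) + h e + 2"
      by (simp add: st)
  qed
  then have "PF (\<lambda>e. snd (snd ((st ^^ sz (?i e)) (?i e))))"
    by (intro pf_intros)
  moreover have "take (sz (?i e)) (l e) = l e" for e
    using length_le_sz[of "l e"] by simp
  ultimately show ?thesis by (simp only: st snd_conv)
qed

lemma PF_rev [pf_intros]:
  fixes l :: "'e :: enc \<Rightarrow> 'x :: enc list"
  assumes "PF l"
  shows "PF (\<lambda>e. rev (l e))"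
proof -
  have *: "fold Cons xs [] = rev xs" for xs :: "'x list"
    by (simp add: fold_Cons_rev)
  have "PF (\<lambda>e. fold (\<lambda>x acc. x # acc) (l e) [])"
  proof (rule PF_fold[where h = "\<lambda>e. sz (l e)"])
    fix e xs ys
    assume "l e = xs @ ys"
    then show "sz (fold (\<lambda>x acc. x # acc) xs []) \<le> sz (l e)"
      using sz_append[of xs ys] sz_pos[of ys] by (simp add: * sz_rev)
  qed (intro pf_intros pbd_intros assms)+
  then show ?thesis by (simp add: *)
qed

lemma PF_append [pf_intros]:
  fixes l :: "'e :: enc \<Rightarrow> 'x :: enc list"
  assumes "PF l" "PF m"
  shows "PF (\<lambda>e. l e @ m e)"
proof -
  have *: "fold Cons xs zs = rev xs @ zs" for xs zs :: "'x list"
    by (simp add: fold_Cons_rev)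
  have "PF (\<lambda>e. fold (\<lambda>x acc. x # acc) (rev (l e)) (m e))"
  proof (rule PF_fold[where h = "\<lambda>e. sz (l e) + sz (m e)"])
    fix e xs ys
    assume l: "rev (l e) = xs @ ys"
    have "sz (rev xs @ m e) \<le> sz xs + sz (m e)"
      using sz_append[of "rev xs" "m e"] by (simp add: sz_rev)
    moreover have "sz xs \<le> sz (rev (l e))"
      unfolding l using sz_append[of xs ys] sz_pos[of ys] by simp
    ultimately show "sz (fold (\<lambda>x acc. x # acc) xs (m e)) \<le> sz (l e) + sz (m e)"
      by (simp add: * sz_rev)
  qed (intro pf_intros pbd_intros assms)+
  then show ?thesis by (simp add: *)
qed

lemma PF_map [pf_intros]:
  fixes g :: "'e :: enc \<Rightarrow> 'x :: enc \<Rightarrow> 'y :: enc"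
  assumes "PF l" "PF (\<lambda>p. g (fst p) (snd p))"
  shows "PF (\<lambda>e. map (g e) (l e))"
proof -
  obtain k where k: "\<And>p. sz (g (fst p) (snd p)) \<le> (sz p + 2) ^ k"
    using pbd_PF[OF assms(2)] unfolding pbd_def by blast
  \<comment> \<open>One bound for all results: every element is smaller than the list that contains
    it.\<close>
  define B where "B e = (sz e + sz (l e) + 3) ^ k" for e
  have *: "fold (\<lambda>x acc. g e x # acc) xs ys = rev (map (g e) xs) @ ys" for e xs ys
    by (induction xs arbitrary: ys) auto
  have "PF (\<lambda>e. fold (\<lambda>x acc. g e x # acc) (l e) [])"
  proof (rule PF_fold[where h = "\<lambda>e. 1 + sz (l e) * (1 + B e)"])
    show "PF (\<lambda>p. g (fst p) (fst (snd p)) # snd (snd p))"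
      by (intro pf_intros PF_app2[OF assms(2)])
    show "pbd (\<lambda>e. 1 + sz (l e) * (1 + B e))"
      unfolding B_def by (intro pbd_intros pbd_sz assms)
    fix e xs ys
    assume l: "l e = xs @ ys"
    have "sz (map (g e) xs) \<le> 1 + length xs * (1 + B e)"
    proof (rule sz_map_le)
      fix x assume "x \<in> set xs"
      then have "sz x < sz (l e)"
        by (intro sz_mem) (simp add: l)
      then have "(sz (e, x) + 2) ^ k \<le> B e"
        unfolding B_def by (intro power_mono) auto
      then show "sz (g e x) \<le> B e"
        using k[of "(e, x)"] by simp
    qed
    also have "\<dots> \<le> 1 + sz (l e) * (1 + B e)"
      using length_le_sz[of "l e"] by (intro add_mono mult_right_mono) (auto simp: l)
    finally show "sz (fold (\<lambda>x acc. g e x # acc) xs []) \<le> 1 + sz (l e) * (1 + B e)"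
      by (simp add: * sz_rev)
  qed (intro pf_intros assms)+
  then have "PF (\<lambda>e. rev (fold (\<lambda>x acc. g e x # acc) (l e) []))"
    by (rule PF_rev)
  then show ?thesis by (simp add: *)
qed

lemma PF_concat [pf_intros]:
  fixes l :: "'e :: enc \<Rightarrow> 'x :: enc list list"
  assumes "PF l"
  shows "PF (\<lambda>e. concat (l e))"
proof -
  have *: "fold (\<lambda>x acc. acc @ x) xs ys = ys @ concat xs" for xs and ys :: "'x list"
    by (induction xs arbitrary: ys) auto
  have s: "sz (concat xs) \<le> sz xs" for xs :: "'x list list"
  proof (induction xs)
    case (Cons x xs)
    then show ?case using sz_append[of x "concat xs"] by simp
  qed simp
  have "PF (\<lambda>e. fold (\<lambda>x acc. acc @ x) (l e) [])"
  proof (rule PF_fold[where h = "\<lambda>e. sz (l e)"])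
    fix e xs ys
    assume "l e = xs @ ys"
    then show "sz (fold (\<lambda>x acc. acc @ x) xs []) \<le> sz (l e)"
      using sz_append[of xs ys] sz_pos[of ys] s[of xs] by (simp add: *)
  qed (intro pf_intros pbd_intros assms)+
  then show ?thesis by (simp add: *)
qed

lemma PF_filter [pf_intros]:
  assumes "PF l" "PF (\<lambda>p. g (fst p) (snd p))"
  shows "PF (\<lambda>e. filter (g e) (l e))"
proof -
  have *: "concat (map (\<lambda>x. if P x then [x] else []) xs) = filter P xs" for P and xs :: "'b list"
    by (induction xs) auto
  have "PF (\<lambda>e. concat (map (\<lambda>x. if g e x then [x] else []) (l e)))"
    by (intro pf_intros assms)
  then show ?thesis by (simp add: *)
qed

lemma PF_bex [pf_intros]:
  assumes "PF l" "PF (\<lambda>p. g (fst p) (snd p))"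
  shows "PF (\<lambda>e. \<exists>x\<in>set (l e). g e x)"
proof -
  have "PF (\<lambda>e. \<not> (filter (g e) (l e) = []))"
    by (intro pf_intros assms)
  moreover have "(\<lambda>e. \<not> (filter (g e) (l e) = [])) = (\<lambda>e. \<exists>x\<in>set (l e). g e x)"
    by (auto simp: filter_empty_conv)
  ultimately show ?thesis by simp
qed

lemma PF_ball [pf_intros]:
  assumes "PF l" "PF (\<lambda>p. g (fst p) (snd p))"
  shows "PF (\<lambda>e. \<forall>x\<in>set (l e). g e x)"
  using PF_not[OF PF_bex[OF assms(1) PF_not[OF assms(2)]]] by simp

lemma PF_member [pf_intros]:
  assumes "PF x" "PF l"
  shows "PF (\<lambda>e. x e \<in> set (l e))"
proof -
  have "PF (\<lambda>e. \<exists>y\<in>set (l e). y = x e)"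
    by (intro pf_intros assms PF_comp[OF assms(1)])
  then show ?thesis by simp
qed

lemma PF_length [pf_intros]:
  assumes "PF l"
  shows "PF (\<lambda>e. length (l e))"
proof -
  have "PF (\<lambda>e. length (map (\<lambda>_. ()) (l e)))"
    by (intro PF_comp[OF PF_length_units] pf_intros assms)
  then show ?thesis by simp
qed

lemma PF_plus [pf_intros]:
  assumes "PF m" "PF n"
  shows "PF (\<lambda>e. m e + n e :: nat)"
  using PF_length[OF PF_append[OF PF_units[OF assms(1)] PF_units[OF assms(2)]]] by simp

lemma PF_times [pf_intros]:
  assumes "PF m" "PF n"
  shows "PF (\<lambda>e. m e * n e :: nat)"
proof -
  have "length (concat (map (\<lambda>_. replicate n ()) (replicate m ()))) = m * n" for m n
    by (induction m) auto
  moreover have "PF (\<lambda>e. length (concat (map (\<lambda>_. replicate (n e) ()) (replicate (m e) ()))))"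
    by (intro pf_intros PF_units assms PF_comp[OF assms(2)])
  ultimately show ?thesis by simp
qed

lemma PF_poly [pf_intros]: "PF n \<Longrightarrow> PF (\<lambda>e. poly p (n e) :: nat)"
  by (induction p) (auto intro!: pf_intros)

lemma PF_minus [pf_intros]:
  assumes "PF m" "PF n"
  shows "PF (\<lambda>e. m e - n e :: nat)"
proof -
  have *: "fold (\<lambda>_ k. case k of 0 \<Rightarrow> 0 | Suc j \<Rightarrow> j) us k = k - length us" for us :: "unit list" and k :: nat
    by (induction us arbitrary: k) (auto split: nat.splits)
  have "PF (\<lambda>e. fold (\<lambda>_ k. case k of 0 \<Rightarrow> 0 | Suc j \<Rightarrow> j) (replicate (n e) ()) (m e))"
  proof (rule PF_fold[where h = "\<lambda>e. sz (m e)"])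
    show "sz (fold (\<lambda>_ k. case k of 0 \<Rightarrow> 0 | Suc j \<Rightarrow> j) xs (m e)) \<le> sz (m e)" for e and xs :: "unit list"
      by (simp add: * sz_nat)
  qed (intro pf_intros pbd_intros PF_units assms)+
  then show ?thesis unfolding * by simp
qed

lemma PF_le [pf_intros]: "PF m \<Longrightarrow> PF n \<Longrightarrow> PF (\<lambda>e. (m e :: nat) \<le> n e)"
  using PF_eq[OF PF_minus[of m n] PF_const[of 0]] by simp

lemma PF_less [pf_intros]: "PF m \<Longrightarrow> PF n \<Longrightarrow> PF (\<lambda>e. (m e :: nat) < n e)"
  using PF_not[OF PF_le[of n m]] by (simp add: not_le)

lemma PF_upt [pf_intros]:
  assumes "PF n"
  shows "PF (\<lambda>e. [0..<n e])"
proof -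
  have *: "fold (\<lambda>_ acc. acc @ [length acc]) us [] = [0..<length us]" for us :: "unit list"
    by (induction us rule: rev_induct) auto
  have s: "sz [0..<m] \<le> 1 + m * (2 * m + 2)" for m
  proof -
    have "sz (map id [0..<m]) \<le> 1 + length [0..<m] * (1 + (2 * m + 1))"
      by (rule sz_map_le) (auto simp: sz_nat)
    then show ?thesis by simp
  qed
  have "PF (\<lambda>e. fold (\<lambda>_ acc. acc @ [length acc]) (replicate (n e) ()) [])"
  proof (rule PF_fold[where h = "\<lambda>e. 1 + sz (n e) * (2 * sz (n e) + 2)"])
    fix e and xs ys :: "unit list"
    assume "replicate (n e) () = xs @ ys"
    then have "length (replicate (n e) ()) = length (xs @ ys)" by (rule arg_cong)
    then have "length xs \<le> sz (n e)"
      by (simp add: sz_nat)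
    then have "1 + length xs * (2 * length xs + 2) \<le> 1 + sz (n e) * (2 * sz (n e) + 2)"
      by (intro add_mono mult_mono) auto
    then show "sz (fold (\<lambda>_ acc. acc @ [length acc]) xs []) \<le> 1 + sz (n e) * (2 * sz (n e) + 2)"
      using s[of "length xs"] by (simp add: *)
  qed (intro pf_intros pbd_intros PF_units assms)+
  then show ?thesis unfolding * by simp
qed

lemma PF_remdups [pf_intros]:
  fixes l :: "'e :: enc \<Rightarrow> 'x :: enc list"
  assumes "PF l"
  shows "PF (\<lambda>e. remdups (l e))"
proof -
  have *: "fold (\<lambda>x acc. if x \<in> set acc then acc else x # acc) xs [] = remdups (rev xs)" for xs :: "'x list"
    by (induction xs rule: rev_induct) auto
  have s: "sz (remdups xs) \<le> sz xs" for xs :: "'x list"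
    by (induction xs) auto
  have "PF (\<lambda>e. fold (\<lambda>x acc. if x \<in> set acc then acc else x # acc) (rev (l e)) [])"
  proof (rule PF_fold[where h = "\<lambda>e. sz (rev (l e))"])
    fix e xs ys
    assume l: "rev (l e) = xs @ ys"
    then show "sz (fold (\<lambda>x acc. if x \<in> set acc then acc else x # acc) xs []) \<le> sz (rev (l e))"
      using sz_append[of xs ys] sz_pos[of ys] s[of "rev xs"] unfolding l by (simp add: * sz_rev)
  qed (intro pf_intros pbd_intros assms)+
  then show ?thesis by (simp add: *)
qed

lemma PF_enc [pf_intros]: "PF f \<Longrightarrow> PF (\<lambda>x. enc (f x))"
  by (erule PF_transfer) auto

lemma PF_code [pf_intros]: "PF f \<Longrightarrow> PF (\<lambda>x. code (f x))"
  using PF_comp[OF PF_code_base, of f] by simp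

lemma PF_tl [pf_intros]: "PF l \<Longrightarrow> PF (\<lambda>x. tl (l x))"
  using PF_case_list[of l "\<lambda>_. []" "\<lambda>_ _ ys. ys"]
  by (simp add: tl_def pf_intros)

lemma PF_zip [pf_intros]:
  fixes l :: "'e :: enc \<Rightarrow> 'x :: enc list" and m :: "'e \<Rightarrow> 'y :: enc list"
  assumes "PF l" "PF m"
  shows "PF (\<lambda>e. zip (l e) (m e))"
proof -
  let ?f = "\<lambda>x p. case snd p of [] \<Rightarrow> p | y # ys \<Rightarrow> ((x, y) # fst p, ys)"
  have *: "fold ?f xs (acc, ys) = (rev (zip xs ys) @ acc, drop (length xs) ys)"
    for xs :: "'x list" and ys :: "'y list" and acc
    by (induction xs arbitrary: ys acc) (auto split: list.splits)
  have s: "sz (zip xs ys) + sz (drop (length xs) ys) \<le> 2 * sz xs + 2 * sz ys" for xs :: "'x list" and ys :: "'y list"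
  proof (induction xs arbitrary: ys)
    case (Cons x xs)
    show ?case
    proof (cases ys)
      case (Cons y ys')
      then show ?thesis using Cons.IH[of ys'] by simp
    qed simp
  qed simp
  have "PF (\<lambda>e. fold ?f (l e) ([], m e))"
  proof (rule PF_fold[where h = "\<lambda>e. 2 * sz (l e) + 2 * sz (m e) + 1"])
    fix e xs ys
    assume l: "l e = xs @ ys"
    have "sz xs \<le> sz (l e)" unfolding l using sz_append[of xs ys] sz_pos[of ys] by simp
    then show "sz (fold ?f xs ([], m e)) \<le> 2 * sz (l e) + 2 * sz (m e) + 1"
      using s[of xs "m e"] by (simp add: * sz_rev)
  qed (intro pf_intros pbd_intros assms)+
  then have "PF (\<lambda>e. rev (fst (fold ?f (l e) ([], m e))))"
    by (intro pf_intros)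
  then show ?thesis by (simp add: *)
qed

section \<open>Systems of distinct representatives\<close>

definition has_sdr :: "'i set \<Rightarrow> ('i \<Rightarrow> 'b set) \<Rightarrow> bool" where
  "has_sdr X N \<longleftrightarrow> (\<exists>g. inj_on g X \<and> (\<forall>i\<in>X. g i \<in> N i))"

text \<open>
  An auction: an unmatched item bids for a cheapest of its candidates, replacing the present owner,
  and thereby raises the price, which is the number of bids made so far. A state consists of the
  current matching and the list of all bids.
\<close>

definition price :: "'b list \<Rightarrow> 'b \<Rightarrow> nat" where
  "price H v = length (filter (\<lambda>w. w = v) H)"

definition bid :: "(nat \<times> 'b list) list \<Rightarrow> ((nat \<times> 'b list) \<times> 'b) list \<times> 'b list \<Rightarrow>
    ((nat \<times> 'b list) \<times> 'b) list \<times> 'b list" where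
  "bid ps s = (case filter (\<lambda>p. p \<notin> set (map fst (fst s))) ps of [] \<Rightarrow> s
     | p # _ \<Rightarrow> (case filter (\<lambda>v. \<forall>w\<in>set (snd p). price (snd s) v \<le> price (snd s) w) (snd p) of [] \<Rightarrow> s
        | v # _ \<Rightarrow> ((p, v) # filter (\<lambda>e. snd e \<noteq> v) (fst s), v # snd s)))"

text \<open>As long as an item is unmatched, each round makes a bid. If all items can be matched, no
  price exceeds the number of candidates by more than one, so \<open>m * (m + 1)\<close> bids are
  the maximum for \<open>m\<close> candidates. The number of rounds exceeds this, as
  \<open>m\<close> is at most \<open>length (concat L)\<close>.\<close>

definition auction :: "'b list list \<Rightarrow> ((nat \<times> 'b list) \<times> 'b) list \<times> 'b list" where
  "auction L = fold (\<lambda>_. bid (zip [0..<length L] L))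
     (replicate (length (concat L) * (length (concat L) + 1) + 1) ()) ([], [])"

definition sdr :: "'b list list \<Rightarrow> bool" where
  "sdr L \<longleftrightarrow> (\<forall>p\<in>set (zip [0..<length L] L). p \<in> set (map fst (fst (auction L))))"

text \<open>The item that holds a candidate pays at most one more than it would have to pay
  elsewhere. The last conjunct holds because a candidate, once bid for, only changes its
  owner.\<close>

definition auction_inv :: "(nat \<times> 'b list) set \<Rightarrow> ((nat \<times> 'b list) \<times> 'b) list \<times> 'b list \<Rightarrow> bool" where
  "auction_inv P s \<longleftrightarrow>
     (\<forall>(p, v)\<in>set (fst s). p \<in> P \<and> v \<in> set (snd p) \<and> (\<forall>w\<in>set (snd p). price (snd s) v \<le> price (snd s) w + 1)) \<and>
     (\<forall>p v w. (p, v) \<in> set (fst s) \<longrightarrow> (p, w) \<in> set (fst s) \<longrightarrow> v = w) \<and>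
     (\<forall>p q v. (p, v) \<in> set (fst s) \<longrightarrow> (q, v) \<in> set (fst s) \<longrightarrow> p = q) \<and>
     set (snd s) = snd ` set (fst s)"

lemma price_Cons: "price (w # H) v = (if w = v then 1 else 0) + price H v"
  by (simp add: price_def)

lemma price_pos: "price H v > 0 \<longleftrightarrow> v \<in> set H"
  by (induction H) (auto simp: price_Cons price_def)

lemma bid_cases:
  obtains (matched) "\<And>p. p \<in> set ps \<Longrightarrow> p \<in> fst ` set (fst s)" "bid ps s = s"
  | (nobid) p where "p \<in> set ps" "p \<notin> fst ` set (fst s)" "snd p = []" "bid ps s = s"
  | (bids) p v where "p \<in> set ps" "p \<notin> fst ` set (fst s)" "v \<in> set (snd p)"
      "\<forall>w\<in>set (snd p). price (snd s) v \<le> price (snd s) w"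
      "bid ps s = ((p, v) # filter (\<lambda>e. snd e \<noteq> v) (fst s), v # snd s)"
proof (cases "filter (\<lambda>p. p \<notin> set (map fst (fst s))) ps")
  case Nil
  then show ?thesis
    by (intro matched) (auto simp: bid_def filter_empty_conv)
next
  case (Cons p ps')
  then have "p \<in> set (filter (\<lambda>p. p \<notin> set (map fst (fst s))) ps)" by simp
  then have p: "p \<in> set ps" "p \<notin> fst ` set (fst s)" by auto
  show ?thesis
  proof (cases "filter (\<lambda>v. \<forall>w\<in>set (snd p). price (snd s) v \<le> price (snd s) w) (snd p)")
    case Nil
    have "snd p = []"
    proof (rule ccontr)
      assume "snd p \<noteq> []"
      then have f: "finite (price (snd s) ` set (snd p))" "price (snd s) ` set (snd p) \<noteq> {}" by auto
      obtain v where v: "v \<in> set (snd p)" "Min (price (snd s) ` set (snd p)) = price (snd s) v"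
        using Min_in[OF f] by auto
      have "\<forall>w\<in>set (snd p). price (snd s) v \<le> price (snd s) w"
        using Min_le[OF f(1)] unfolding v(2) by blast
      with v(1) have "v \<in> set (filter (\<lambda>v. \<forall>w\<in>set (snd p). price (snd s) v \<le> price (snd s) w) (snd p))" by simp
      then show False unfolding Nil by simp
    qed
    then show ?thesis using p Nil Cons by (intro nobid[of p]) (auto simp: bid_def)
  next
    case v: (Cons v vs)
    then have "v \<in> set (filter (\<lambda>v. \<forall>w\<in>set (snd p). price (snd s) v \<le> price (snd s) w) (snd p))" by simp
    then have "v \<in> set (snd p)" "\<forall>w\<in>set (snd p). price (snd s) v \<le> price (snd s) w"
      by simp_all
    then show ?thesis using p v Cons by (intro bids[of p v]) (auto simp: bid_def)
  qed
qed

lemma auction_inv_bid: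
  assumes "auction_inv (set ps) s"
  shows "auction_inv (set ps) (bid ps s)"
proof (cases rule: bid_cases[of ps s])
  case (bids p v)
  let ?s = "((p, v) # filter (\<lambda>e. snd e \<noteq> v) (fst s), v # snd s)"
  note inv = assms[unfolded auction_inv_def]
  have 1: "q \<in> set ps \<and> w \<in> set (snd q) \<and> (\<forall>u\<in>set (snd q). price (v # snd s) w \<le> price (v # snd s) u + 1)"
    if "(q, w) \<in> set (fst ?s)" for q w
  proof (cases "(q, w) = (p, v)")
    case True
    then show ?thesis using bids by (auto simp: price_Cons)
  next
    case False
    then have "(q, w) \<in> set (fst s)" "w \<noteq> v" using that by auto
    then show ?thesis using inv by (fastforce simp: price_Cons)
  qed
  have "auction_inv (set ps) ?s"
    unfolding auction_inv_def
  proof (intro conjI)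
    show "\<forall>(q, w)\<in>set (fst ?s). q \<in> set ps \<and> w \<in> set (snd q) \<and>
        (\<forall>u\<in>set (snd q). price (snd ?s) w \<le> price (snd ?s) u + 1)"
    proof
      fix e assume e: "e \<in> set (fst ?s)"
      obtain q w where qw: "e = (q, w)" by (cases e)
      have "q \<in> set ps \<and> w \<in> set (snd q) \<and> (\<forall>u\<in>set (snd q). price (v # snd s) w \<le> price (v # snd s) u + 1)"
        by (rule 1) (use e qw in simp)
      then show "case e of (q, w) \<Rightarrow> q \<in> set ps \<and> w \<in> set (snd q) \<and>
          (\<forall>u\<in>set (snd q). price (snd ?s) w \<le> price (snd ?s) u + 1)"
        unfolding qw by simp
    qed
    show "\<forall>q w w'. (q, w) \<in> set (fst ?s) \<longrightarrow> (q, w') \<in> set (fst ?s) \<longrightarrow> w = w'"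
    proof (intro allI impI)
      fix q w w' assume qw: "(q, w) \<in> set (fst ?s)" "(q, w') \<in> set (fst ?s)"
      have "(q = p \<and> u = v) \<or> (q, u) \<in> set (fst s) \<and> q \<noteq> p" if "(q, u) \<in> set (fst ?s)" for u
        using bids(2) that by force
      from this[OF qw(1)] this[OF qw(2)] show "w = w'" using inv by blast
    qed
    show "\<forall>q q' w. (q, w) \<in> set (fst ?s) \<longrightarrow> (q', w) \<in> set (fst ?s) \<longrightarrow> q = q'"
      using inv by auto
    have "snd ` set (filter (\<lambda>e. snd e \<noteq> v) (fst s)) = snd ` set (fst s) - {v}"
      by auto
    then show "set (snd ?s) = snd ` set (fst ?s)"
      using inv by auto
  qed
  then show ?thesis using bids by simp
qed (use assms in simp_all)

text \<open>
  If the bid of an unmatched item costs more than there are candidates, some price level is not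
  attained, and the items holding the candidates above this level together with the bidder violate
  Hall's condition.
\<close>

lemma auction_price_bound:
  assumes inv: "auction_inv P s" and P: "finite P" and g: "inj_on g P" "\<forall>p\<in>P. g p \<in> set (snd p)"
    and cand: "\<forall>p\<in>P. set (snd p) \<subseteq> S" "finite S"
    and p: "p \<in> P" "p \<notin> fst ` set (fst s)"
  shows "\<exists>v\<in>set (snd p). price (snd s) v \<le> card S"
proof (rule ccontr)
  assume "\<not> ?thesis"
  then have big: "\<forall>v\<in>set (snd p). price (snd s) v > card S" by auto
  have "\<not> {0..card S} \<subseteq> price (snd s) ` S"
  proof
    assume "{0..card S} \<subseteq> price (snd s) ` S"
    then have "card {0..card S} \<le> card S"
      using cand(2) by (meson card_image_le card_mono finite_imageI le_trans)
    then show False by simp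
  qed
  then obtain j where "j \<in> {0..card S}" "j \<notin> price (snd s) ` S" by blast
  then have j: "j \<le> card S" "\<forall>v\<in>S. price (snd s) v \<noteq> j" by auto
  define T where "T = {v\<in>S. price (snd s) v > j}"
  define X where "X = {q. \<exists>v\<in>T. (q, v) \<in> set (fst s)}"
  have T: "finite T" using cand(2) by (simp add: T_def)
  have XP: "X \<subseteq> P" using inv by (auto simp: X_def auction_inv_def)
  then have X: "finite X" using P finite_subset by blast
  \<comment> \<open>The price of \<open>g q\<close> is at least \<open>j\<close>, as
    \<open>q\<close> holds a candidate of price above \<open>j\<close> and this is cheapest up to
    one unit; and the level \<open>j\<close> is not attained.\<close>
  have XT: "g q \<in> T" if qX: "q \<in> X" for q
  proof -
    obtain v where v: "v \<in> T" "(q, v) \<in> set (fst s)" using qX unfolding X_def by blast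
    have q: "q \<in> P" using qX XP by auto
    then have "price (snd s) v \<le> price (snd s) (g q) + 1"
      using v inv g(2) by (auto simp: auction_inv_def)
    moreover have "price (snd s) v > j" using v by (simp add: T_def)
    moreover have "g q \<in> S" using q g(2) cand(1) by auto
    moreover from this have "price (snd s) (g q) \<noteq> j" using j(2) by blast
    ultimately show ?thesis unfolding T_def by simp
  qed
  have "g p \<in> T"
    using big g(2) p(1) cand(1) j(1) by (auto simp: T_def intro: le_less_trans)
  have "p \<notin> X" using p(2) by (force simp: X_def)
  have "card (insert p X) = card (g ` insert p X)"
    by (rule card_image[symmetric], rule inj_on_subset[OF g(1)]) (use XP p(1) in blast)
  also have "\<dots> \<le> card T"
    using XT \<open>g p \<in> T\<close> T by (intro card_mono) auto
  \<comment> \<open>The prices in \<open>T\<close> are positive, so these candidates have been bid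
    for and are therefore still held.\<close>
  also have "card T \<le> card X"
  proof -
    have "\<exists>q. (q, v) \<in> set (fst s)" if "v \<in> T" for v
    proof -
      have "v \<in> set (snd s)" using that price_pos[of "snd s" v] by (auto simp: T_def)
      then have "v \<in> snd ` set (fst s)" using inv by (simp add: auction_inv_def)
      then obtain e where "e \<in> set (fst s)" "v = snd e" by (rule imageE)
      then show ?thesis by (metis prod.collapse)
    qed
    then obtain own where own: "\<And>v. v \<in> T \<Longrightarrow> (own v, v) \<in> set (fst s)" by metis
    have "inj_on own T"
    proof (rule inj_onI)
      fix v w assume "v \<in> T" "w \<in> T" "own v = own w"
      then have "(own v, v) \<in> set (fst s)" "(own v, w) \<in> set (fst s)"
        using own[of v] own[of w] by simp_all
      then show "v = w" using inv unfolding auction_inv_def by blast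
    qed
    moreover have "own ` T \<subseteq> X" using own unfolding X_def by blast
    ultimately show ?thesis using X card_inj_on_le by blast
  qed
  finally show False using X \<open>p \<notin> X\<close> by simp
qed

lemma sum_price: "finite S \<Longrightarrow> set H \<subseteq> S \<Longrightarrow> (\<Sum>v\<in>S. price H v) = length H"
proof (induction H)
  case (Cons w H)
  have "(\<Sum>v\<in>S. price (w # H) v) = (\<Sum>v\<in>S. if w = v then 1 else 0) + (\<Sum>v\<in>S. price H v)"
    by (simp only: price_Cons sum.distrib)
  then show ?case using Cons by (simp add: sum.delta)
qed (simp add: price_def)

text \<open>Items are pairs of an index and a candidate list, because the same list may occur for
  several items.\<close>

lemma sdr_zip_iff:
  "sdr L \<longleftrightarrow> has_sdr (set (zip [0..<length L] L)) (\<lambda>p. set (snd p))"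
proof
  let ?ps = "zip [0..<length L] L"
  let ?it = "\<lambda>n. fold (\<lambda>_. bid ?ps) (replicate n ()) ([], [])"
  have it_Suc: "?it (Suc n) = bid ?ps (?it n)" for n
    by (subst replicate_Suc, subst replicate_append_same[symmetric], simp)
  have inv: "auction_inv (set ?ps) (?it n)" for n
  proof (induction n)
    case 0
    then show ?case by (simp add: auction_inv_def)
  next
    case (Suc n)
    then show ?case unfolding it_Suc by (rule auction_inv_bid)
  qed
  let ?S = "set (concat L)"
  let ?K = "length (concat L) * (length (concat L) + 1) + 1"
  have cand: "\<forall>p\<in>set ?ps. set (snd p) \<subseteq> ?S"
    using set_zip_rightD by fastforce
  show "has_sdr (set ?ps) (\<lambda>p. set (snd p))" if "sdr L"
  proof -
    have "\<exists>v. (p, v) \<in> set (fst (?it ?K))" if "p \<in> set ?ps" for p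
    proof -
      have "p \<in> fst ` set (fst (?it ?K))"
        using \<open>sdr L\<close> that unfolding sdr_def auction_def set_map by blast
      then obtain e where "e \<in> set (fst (?it ?K))" "p = fst e" by (rule imageE)
      then show ?thesis by (metis prod.collapse)
    qed
    then obtain g where g: "\<And>p. p \<in> set ?ps \<Longrightarrow> (p, g p) \<in> set (fst (?it ?K))" by metis
    have "inj_on g (set ?ps)"
    proof (rule inj_onI)
      fix p q assume "p \<in> set ?ps" "q \<in> set ?ps" "g p = g q"
      then have "(p, g p) \<in> set (fst (?it ?K))" "(q, g p) \<in> set (fst (?it ?K))"
        using g[of p] g[of q] by simp_all
      then show "p = q" using inv[of ?K] unfolding auction_inv_def by blast
    qed
    moreover have "\<forall>p\<in>set ?ps. g p \<in> set (snd p)"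
      using g inv[of ?K] unfolding auction_inv_def by blast
    ultimately show ?thesis unfolding has_sdr_def by blast
  qed
  show "sdr L" if sdr: "has_sdr (set ?ps) (\<lambda>p. set (snd p))"
  proof (rule ccontr)
    assume neg: "\<not> sdr L"
    obtain g where g: "inj_on g (set ?ps)" "\<forall>p\<in>set ?ps. g p \<in> set (snd p)"
      using sdr unfolding has_sdr_def by blast
    let ?m = "card ?S"
    \<comment> \<open>Either everything is matched, or each of the \<open>n\<close> rounds so far
      has made a bid. A bid is made at a price of at most \<open>?m\<close>, so prices stay below
      \<open>?m + 2\<close>.\<close>
    have main: "(\<forall>p\<in>set ?ps. p \<in> fst ` set (fst (?it n))) \<or>
        length (snd (?it n)) = n \<and> set (snd (?it n)) \<subseteq> ?S \<and> (\<forall>v\<in>?S. price (snd (?it n)) v \<le> ?m + 1)" for n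
    proof (induction n)
      case 0
      then show ?case by (simp add: price_def)
    next
      case (Suc n)
      show ?case
      proof (cases rule: bid_cases[of ?ps "?it n"])
        case matched
        then show ?thesis unfolding it_Suc by simp
      next
        case (nobid p)
        then show ?thesis using g(2) by fastforce
      next
        case (bids p v)
        obtain w where "w \<in> set (snd p)" "price (snd (?it n)) w \<le> ?m"
          using auction_price_bound[OF inv _ g cand _ bids(1,2)] by auto
        then have pv: "price (snd (?it n)) v \<le> ?m" using bids(4) by (meson le_trans)
        have "v \<in> ?S" using bids(1,3) cand by blast
        have "length (snd (?it n)) = n \<and> set (snd (?it n)) \<subseteq> ?S \<and> (\<forall>v\<in>?S. price (snd (?it n)) v \<le> ?m + 1)"
          using Suc bids(1,2) by auto
        then show ?thesis
          unfolding it_Suc bids(5) using pv \<open>v \<in> ?S\<close> by (auto simp: price_Cons)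
      qed
    qed
    have "\<not> (\<forall>p\<in>set ?ps. p \<in> fst ` set (fst (?it ?K)))"
      using neg unfolding sdr_def auction_def set_map .
    with main[of ?K] have *: "length (snd (?it ?K)) = ?K" "set (snd (?it ?K)) \<subseteq> ?S"
      "\<forall>v\<in>?S. price (snd (?it ?K)) v \<le> ?m + 1" by blast+
    have "?K = (\<Sum>v\<in>?S. price (snd (?it ?K)) v)"
      using sum_price[of ?S "snd (?it ?K)"] * by simp
    also have "\<dots> \<le> (\<Sum>v\<in>?S. ?m + 1)"
      using *(3) by (intro sum_mono) auto
    also have "\<dots> = ?m * (?m + 1)" by simp
    also have "\<dots> \<le> length (concat L) * (length (concat L) + 1)"
      using card_length[of "concat L"] by (intro mult_mono) auto
    finally show False by simp
  qed
qed

lemma has_sdr_reindex: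
  assumes "bij_betw h X Y" "\<And>x. x \<in> X \<Longrightarrow> N (h x) = N' x"
  shows "has_sdr X N' \<longleftrightarrow> has_sdr Y N"
proof
  assume "has_sdr X N'"
  then obtain g where g: "inj_on g X" "\<forall>x\<in>X. g x \<in> N' x" by (auto simp: has_sdr_def)
  let ?k = "the_inv_into X h"
  have k: "bij_betw ?k Y X" using assms(1) by (rule bij_betw_the_inv_into)
  have "inj_on (g \<circ> ?k) Y"
    using g(1) k by (intro comp_inj_on) (auto simp: bij_betw_def)
  moreover have "\<forall>y\<in>Y. (g \<circ> ?k) y \<in> N y"
  proof
    fix y assume y: "y \<in> Y"
    then have "?k y \<in> X" using k by (auto simp: bij_betw_def)
    moreover have "h (?k y) = y" using y assms(1) by (auto simp: bij_betw_def intro: f_the_inv_into_f)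
    ultimately show "(g \<circ> ?k) y \<in> N y" using g(2) assms(2)[of "?k y"] by auto
  qed
  ultimately show "has_sdr Y N" unfolding has_sdr_def by blast
next
  assume "has_sdr Y N"
  then obtain g where g: "inj_on g Y" "\<forall>y\<in>Y. g y \<in> N y" by (auto simp: has_sdr_def)
  have "inj_on (g \<circ> h) X"
    using g(1) assms(1) by (intro comp_inj_on) (auto simp: bij_betw_def)
  moreover have "\<forall>x\<in>X. (g \<circ> h) x \<in> N' x"
    using g(2) assms by (auto simp: bij_betw_def)
  ultimately show "has_sdr X N'" unfolding has_sdr_def by blast
qed

theorem sdr_map_iff:
  assumes "distinct xs"
  shows "sdr (map F xs) \<longleftrightarrow> has_sdr (set xs) (\<lambda>x. set (F x))"
proof -
  let ?ps = "zip [0..<length (map F xs)] (map F xs)"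
  have "?ps = map (\<lambda>i. (i, F (xs ! i))) [0..<length xs]"
    by (rule nth_equalityI) auto
  then have ps: "set ?ps = (\<lambda>i. (i, F (xs ! i))) ` {..<length xs}"
    by (simp add: lessThan_atLeast0)
  have "bij_betw (\<lambda>i. (i, F (xs ! i))) {..<length xs} (set ?ps)"
    unfolding ps by (intro inj_on_imp_bij_betw) (auto simp: inj_on_def)
  then have 1: "has_sdr {..<length xs} (\<lambda>i. set (F (xs ! i))) \<longleftrightarrow> has_sdr (set ?ps) (\<lambda>p. set (snd p))"
    by (rule has_sdr_reindex) simp
  have "bij_betw ((!) xs) {..<length xs} (set xs)"
    by (rule bij_betw_nth[OF assms]) auto
  then have 2: "has_sdr {..<length xs} (\<lambda>i. set (F (xs ! i))) \<longleftrightarrow> has_sdr (set xs) (\<lambda>x. set (F x))"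
    by (rule has_sdr_reindex) simp
  show ?thesis unfolding sdr_zip_iff using 1 2 by simp
qed

section \<open>Running time of the auction\<close>

lemma PF_price [pf_intros]: "PF H \<Longrightarrow> PF v \<Longrightarrow> PF (\<lambda>x. price (H x) (v x))"
  by (rule PF_app2[where h = price]) (unfold price_def, intro pf_intros)

lemma PF_bid [pf_intros]: "PF ps \<Longrightarrow> PF s \<Longrightarrow> PF (\<lambda>x. bid (ps x) (s x))"
  by (rule PF_app2[where h = bid]) (unfold bid_def, intro pf_intros)

text \<open>A round adds at most one entry to the matching and one to the list of bids, and all
  entries are taken from the instance. This bounds the size of the states.\<close>

lemma PF_sdr [pf_intros]:
  fixes L :: "'e :: enc \<Rightarrow> 'b :: enc list list"
  assumes "PF L"
  shows "PF (\<lambda>x. sdr (L x))"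
proof -
  let ?ps = "\<lambda>L :: 'b list list. zip [0..<length L] L"
  let ?K = "\<lambda>L :: 'b list list. length (concat L) * (length (concat L) + 1) + 1"
  have ps: "PF ?ps" and K: "PF ?K"
    by (intro pf_intros)+
  have sub: "set (fst (bid ps s)) \<subseteq> {(p, v). p \<in> set ps \<and> v \<in> set (snd p)} \<and> length (fst (bid ps s)) \<le> Suc n \<and>
      set (snd (bid ps s)) \<subseteq> (\<Union>p\<in>set ps. set (snd p)) \<and> length (snd (bid ps s)) \<le> Suc n"
    if "set (fst s) \<subseteq> {(p, v). p \<in> set ps \<and> v \<in> set (snd p)} \<and> length (fst s) \<le> n \<and>
      set (snd s) \<subseteq> (\<Union>p\<in>set ps. set (snd p)) \<and> length (snd s) \<le> n" for ps :: "(nat \<times> 'b list) list" and s n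
  proof (cases rule: bid_cases[of ps s])
    case (bids p v)
    have "length (filter (\<lambda>e. snd e \<noteq> v) (fst s)) \<le> n"
      using that length_filter_le le_trans by blast
    then show ?thesis using that bids by auto
  qed (use that in auto)
  have it: "set (fst (fold (\<lambda>_. bid ps) us ([], []))) \<subseteq> {(p, v). p \<in> set ps \<and> v \<in> set (snd p)} \<and>
      length (fst (fold (\<lambda>_. bid ps) us ([], []))) \<le> length us \<and>
      set (snd (fold (\<lambda>_. bid ps) us ([], []))) \<subseteq> (\<Union>p\<in>set ps. set (snd p)) \<and>
      length (snd (fold (\<lambda>_. bid ps) us ([], []))) \<le> length us"
    for ps :: "(nat \<times> 'b list) list" and us :: "unit list"
  proof (induction us rule: rev_induct)
    case (snoc u us)
    from sub[OF snoc] show ?case by simp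
  qed simp
  have "PF (auction :: 'b list list \<Rightarrow> _)"
    unfolding auction_def
  proof (rule PF_fold[where h = "\<lambda>L. 1 + (1 + sz (?K L) * (1 + (1 + sz (?ps L) + sz (?ps L))) + (1 + sz (?K L) * (1 + sz (?ps L))))"])
    show "pbd (\<lambda>L. 1 + (1 + sz (?K L) * (1 + (1 + sz (?ps L) + sz (?ps L))) + (1 + sz (?K L) * (1 + sz (?ps L)))))"
      by (intro pbd_intros ps K)
    show "PF (\<lambda>L. replicate (?K L) ())"
      by (intro PF_units K)
    show "PF (\<lambda>p. bid (?ps (fst p)) (snd (snd p)) :: _ \<times> 'b list)"
      by (intro pf_intros)
    fix L :: "'b list list" and xs ys :: "unit list"
    assume "replicate (?K L) () = xs @ ys"
    then have "length (replicate (?K L) ()) = length (xs @ ys)" by (rule arg_cong)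
    then have le: "length xs \<le> sz (?K L)" by (simp add: sz_nat)
    let ?s = "fold (\<lambda>_. bid (?ps L)) xs ([], [])"
    note it' = it[of "?ps L" xs]
    have pv: "sz p < sz (?ps L) \<and> sz v < sz (?ps L)" if "p \<in> set (?ps L)" "v \<in> set (snd p)" for p v
    proof -
      have "sz p < sz (?ps L)" using that(1) by (rule sz_mem)
      moreover have "sz v < sz (snd p)" using that(2) by (rule sz_mem)
      moreover have "sz (snd p) < sz p" by (cases p) simp
      ultimately show ?thesis by simp
    qed
    have "sz (map id (fst ?s)) \<le> 1 + length (fst ?s) * (1 + (1 + sz (?ps L) + sz (?ps L)))"
      by (rule sz_map_le) (use it' pv in fastforce)
    also have "\<dots> \<le> 1 + sz (?K L) * (1 + (1 + sz (?ps L) + sz (?ps L)))"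
      using it' le by (intro add_mono mult_mono) linarith+
    finally have 1: "sz (fst ?s) \<le> 1 + sz (?K L) * (1 + (1 + sz (?ps L) + sz (?ps L)))" by simp
    have "sz (map id (snd ?s)) \<le> 1 + length (snd ?s) * (1 + sz (?ps L))"
      by (rule sz_map_le) (use it' pv in fastforce)
    also have "\<dots> \<le> 1 + sz (?K L) * (1 + sz (?ps L))"
      using it' le by (intro add_mono mult_mono) linarith+
    finally have 2: "sz (snd ?s) \<le> 1 + sz (?K L) * (1 + sz (?ps L))" by simp
    have "sz ?s = 1 + sz (fst ?s) + sz (snd ?s)" by (cases ?s) simp
    then show "sz ?s \<le> 1 + (1 + sz (?K L) * (1 + (1 + sz (?ps L) + sz (?ps L))) + (1 + sz (?K L) * (1 + sz (?ps L))))"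
      using 1 2 by linarith
  qed (intro pf_intros)
  note auction = PF_comp[OF this]
  have "PF (sdr :: 'b list list \<Rightarrow> _)"
    unfolding sdr_def by (intro pf_intros auction)
  then show ?thesis by (rule PF_comp[OF _ assms])
qed

section \<open>Fair assignments\<close>

text \<open>A left-perfect many-to-one matching is an assignment of the left vertices to neighbours.\<close>

locale fair_assignment =
  fixes W :: "'x set" and V :: "'v set" and A :: "'x \<Rightarrow> 'v \<Rightarrow> bool" and col :: "'x \<Rightarrow> 'c"
    and C :: "'c set" and l :: nat
  assumes finite: "finite W" "finite V" "finite C"
    and C: "C \<noteq> {}" "col ` W \<subseteq> C"
begin

definition inc :: "'v \<Rightarrow> 'x set" where "inc v = {x\<in>W. A x v}"

definition adj :: "'x \<Rightarrow> 'v set" where "adj x = {v\<in>V. A x v}"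

definition cnt :: "'x set \<Rightarrow> 'c \<Rightarrow> nat" where "cnt S c = card {x\<in>S. col x = c}"

definition fair :: "'x set \<Rightarrow> bool" where
  "fair S \<longleftrightarrow> (\<forall>c\<in>C. \<forall>d\<in>C. cnt S c \<le> cnt S d + l)"

definition slot :: "('x \<Rightarrow> 'v) \<Rightarrow> 'v \<Rightarrow> 'x set" where "slot f v = {x\<in>W. f x = v}"

definition feasible :: "('x \<Rightarrow> 'v) \<Rightarrow> bool" where
  "feasible f \<longleftrightarrow> (\<forall>x\<in>W. f x \<in> adj x) \<and> (\<forall>v\<in>V. fair (slot f v))"

definition covers :: "('x \<Rightarrow> 'v) \<Rightarrow> bool" where
  "covers f \<longleftrightarrow> (\<forall>v\<in>V. slot f v \<noteq> {})"

lemma finite_sub: "S \<subseteq> W \<Longrightarrow> finite S" "finite (inc v)" "finite (adj x)" "finite (slot f v)"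
  using finite finite_subset by (auto simp: inc_def adj_def slot_def)

lemma at_inc: "feasible f \<Longrightarrow> slot f v \<subseteq> inc v"
  by (auto simp: feasible_def slot_def inc_def adj_def)

lemma sum_cnt:
  assumes "S \<subseteq> W"
  shows "(\<Sum>c\<in>C. cnt S c) = card S"
proof -
  have "S = (\<Union>c\<in>C. {x\<in>S. col x = c})"
    using assms C(2) by auto
  then have "card S = card (\<Union>c\<in>C. {x\<in>S. col x = c})" by simp
  also have "\<dots> = (\<Sum>c\<in>C. card {x\<in>S. col x = c})"
    using finite_sub(1)[OF assms] finite by (intro card_UN_disjoint) auto
  finally show ?thesis by (simp add: cnt_def)
qed

lemma cnt_le: "finite S \<Longrightarrow> cnt S c \<le> card S"
  unfolding cnt_def by (intro card_mono) auto

lemma cnt_mono: "finite T \<Longrightarrow> S \<subseteq> T \<Longrightarrow> cnt S c \<le> cnt T c"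
  unfolding cnt_def by (intro card_mono) auto

lemma cnt_outside: "S \<subseteq> W \<Longrightarrow> c \<notin> C \<Longrightarrow> cnt S c = 0"
  using C(2) by (auto simp: cnt_def card_eq_0_iff)

lemma sum_at:
  assumes "\<forall>x\<in>S. f x \<in> V" "S \<subseteq> W"
  shows "(\<Sum>v\<in>V. card {x\<in>S. f x = v}) = card S"
proof -
  have "S = (\<Union>v\<in>V. {x\<in>S. f x = v})"
    using assms by auto
  then have "card S = card (\<Union>v\<in>V. {x\<in>S. f x = v})" by simp
  also have "\<dots> = (\<Sum>v\<in>V. card {x\<in>S. f x = v})"
    using finite_sub(1)[OF assms(2)] finite by (intro card_UN_disjoint) auto
  finally show ?thesis by simp
qed

subsection \<open>Few neighbours: every colour has bounded multiplicity\<close>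

definition cap :: "nat \<Rightarrow> nat" where
  "cap d = (if card C = 1 \<or> d \<le> l then d else l)"

text \<open>If a colour occurs \<open>l + 1\<close> times in a fair set, the other
  \<open>card C - 1\<close> colours occur, too, which makes \<open>l + card C\<close> elements, too
  many for \<open>d\<close>. With one colour, or with \<open>d \<le> l\<close>, every such set is
  fair and the cap \<open>d\<close> excludes nothing.\<close>

lemma fair_iff_cap:
  assumes "card C = 1 \<or> d < l + card C" and S: "S \<subseteq> W" "card S \<le> d"
  shows "fair S \<longleftrightarrow> (\<forall>c. cnt S c \<le> cap d)"
proof (cases "card C = 1 \<or> d \<le> l")
  case True
  have le: "cnt S c \<le> d" for c
    using cnt_le[OF finite_sub(1)[OF S(1)], of c] S(2) by simp
  have "fair S"
  proof (cases "card C = 1")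
    case True
    then show ?thesis by (auto simp: fair_def card_1_singleton_iff)
  next
    case False
    then show ?thesis using le True by (auto simp: fair_def intro: trans_le_add2 order_trans)
  qed
  then show ?thesis using True le by (simp add: cap_def)
next
  case False
  have "cnt S c \<le> l" if f: "fair S" for c
  proof (rule ccontr)
    assume c: "\<not> cnt S c \<le> l"
    then have cC: "c \<in> C" using cnt_outside[OF S(1)] by force
    have "card (C - {c}) = (\<Sum>d\<in>C - {c}. 1)" by simp
    also have "\<dots> \<le> (\<Sum>d\<in>C - {c}. cnt S d)"
    proof (rule sum_mono)
      fix d assume "d \<in> C - {c}"
      then have "cnt S c \<le> cnt S d + l" using f cC by (auto simp: fair_def)
      then show "1 \<le> cnt S d" using c by simp
    qed
    finally have "cnt S c + card (C - {c}) \<le> (\<Sum>d\<in>C. cnt S d)"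
      using finite cC by (simp add: sum.remove[of C c])
    then have "l + card C \<le> card S"
      using c cC finite sum_cnt[OF S(1)] by (simp add: card_Diff_singleton)
    then show False using assms False by simp
  qed
  then show ?thesis using False by (fastforce simp: cap_def fair_def intro: trans_le_add2)
qed

text \<open>A place consists of a right vertex, a colour and a number below the cap; the numbers
  keep vertices of the same colour apart.\<close>

theorem feasible_iff_sdr:
  assumes d: "card C = 1 \<or> d < l + card C" "\<forall>v\<in>V. card (inc v) \<le> d"
  shows "(\<exists>f. feasible f) \<longleftrightarrow> has_sdr W (\<lambda>x. adj x \<times> {col x} \<times> {..<cap d})"
proof
  assume "\<exists>f. feasible f"
  then obtain f where f: "feasible f" by blast
  have "\<exists>h. inj_on h {x\<in>slot f v. col x = c} \<and> h ` {x\<in>slot f v. col x = c} \<subseteq> {..<cap d}" if "v \<in> V" for v c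
  proof -
    have "card (slot f v) \<le> d"
      using d(2) that card_mono[OF finite_sub(2) at_inc[OF f]] by (meson le_trans)
    then have "cnt (slot f v) c \<le> cap d"
      using fair_iff_cap[OF d(1), of "slot f v"] f that by (auto simp: feasible_def slot_def)
    then show ?thesis
      unfolding cnt_def using finite_sub(4)[of f v] 
      by (intro inj_on_iff_card_le[THEN iffD2]) auto
  qed
  note ex = this
  define h where "h v c = (SOME h. inj_on h {x\<in>slot f v. col x = c} \<and> h ` {x\<in>slot f v. col x = c} \<subseteq> {..<cap d})" for v c
  have h: "inj_on (h v c) {x\<in>slot f v. col x = c}" "h v c ` {x\<in>slot f v. col x = c} \<subseteq> {..<cap d}"
    if "v \<in> V" for v c
    using someI_ex[OF ex[OF that, of c]] unfolding h_def by blast+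
  let ?g = "\<lambda>x. (f x, col x, h (f x) (col x) x)"
  have fV: "f x \<in> V" "x \<in> slot f (f x)" if "x \<in> W" for x
    using f that by (auto simp: feasible_def adj_def slot_def)
  have "inj_on ?g W"
  proof (rule inj_onI)
    fix x y assume xy: "x \<in> W" "y \<in> W" "?g x = ?g y"
    then have "x \<in> {z\<in>slot f (f x). col z = col x}" "y \<in> {z\<in>slot f (f x). col z = col x}"
      using fV(2)[of x] fV(2)[of y] by auto
    then show "x = y" using h(1)[OF fV(1)[OF xy(1)], of "col x"] xy(3) by (auto dest: inj_onD)
  qed
  moreover have "\<forall>x\<in>W. ?g x \<in> adj x \<times> {col x} \<times> {..<cap d}"
  proof
    fix x assume x: "x \<in> W"
    then have "x \<in> {z\<in>slot f (f x). col z = col x}" using fV by auto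
    then have "h (f x) (col x) x \<in> {..<cap d}" using h(2)[OF fV(1)[OF x], of "col x"] by blast
    then show "?g x \<in> adj x \<times> {col x} \<times> {..<cap d}" using x f by (auto simp: feasible_def)
  qed
  ultimately show "has_sdr W (\<lambda>x. adj x \<times> {col x} \<times> {..<cap d})"
    unfolding has_sdr_def by blast
next
  assume "has_sdr W (\<lambda>x. adj x \<times> {col x} \<times> {..<cap d})"
  then obtain g where g: "inj_on g W" "\<forall>x\<in>W. g x \<in> adj x \<times> {col x} \<times> {..<cap d}"
    unfolding has_sdr_def by blast
  let ?f = "fst \<circ> g"
  have a: "\<forall>x\<in>W. ?f x \<in> adj x" using g(2) by auto
  have "fair (slot ?f v)" if v: "v \<in> V" for v
  proof -
    have "slot ?f v \<subseteq> inc v" using a by (auto simp: slot_def inc_def adj_def)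
    then have "card (slot ?f v) \<le> d"
      using d(2) v card_mono[OF finite_sub(2)] by (meson le_trans)
    moreover have "cnt (slot ?f v) c \<le> cap d" for c
    proof -
      let ?S = "{x\<in>slot ?f v. col x = c}"
      have "inj_on g ?S" using g(1) by (rule inj_on_subset) (auto simp: slot_def)
      moreover have "g ` ?S \<subseteq> {v} \<times> {c} \<times> {..<cap d}"
        using g(2) by (fastforce simp: slot_def)
      ultimately have "card ?S \<le> card ({v} \<times> {c} \<times> {..<cap d})"
        by (intro card_inj_on_le) auto
      then show ?thesis by (simp add: cnt_def)
    qed
    ultimately show ?thesis using fair_iff_cap[OF d(1), of "slot ?f v"] by (auto simp: slot_def)
  qed
  then have "feasible ?f" using a by (simp add: feasible_def)
  then show "\<exists>f. feasible f" by blast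
qed

text \<open>
  Among the feasible assignments consider one that agrees as often as possible with an injective
  choice of a neighbour for every right vertex: giving an empty right vertex its chosen neighbour
  would be an improvement.
\<close>

theorem covering_iff_sdr:
  assumes d: "card C = 1 \<or> d < l + card C" "\<forall>v\<in>V. card (inc v) \<le> d"
  shows "(\<exists>f. feasible f \<and> covers f) \<longleftrightarrow> (\<exists>f. feasible f) \<and> has_sdr V inc"
proof (intro iffI conjI)
  assume "\<exists>f. feasible f \<and> covers f"
  then obtain f where f: "feasible f" "covers f" by blast
  then show "\<exists>f. feasible f" by blast
  have "\<forall>v\<in>V. \<exists>x. x \<in> slot f v" using f(2) by (auto simp: covers_def)
  then obtain g where g: "\<And>v. v \<in> V \<Longrightarrow> g v \<in> slot f v" by metis
  have "inj_on g V"
    by (rule inj_onI) (use g in \<open>auto simp: slot_def\<close>, metis)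
  moreover have "\<forall>v\<in>V. g v \<in> inc v" using g at_inc[OF f(1)] by auto
  ultimately show "has_sdr V inc" unfolding has_sdr_def by blast
next
  assume *: "(\<exists>f. feasible f) \<and> has_sdr V inc"
  then obtain g where g: "inj_on g V" "\<forall>v\<in>V. g v \<in> inc v" by (auto simp: has_sdr_def)
  let ?\<Phi> = "\<lambda>f. card {v\<in>V. f (g v) = v}"
  obtain f0 where f0: "feasible f0" using * by blast
  have "?\<Phi> f' \<le> card V" for f'
    using finite by (intro card_mono) auto
  then have "\<exists>f. feasible f \<and> (\<forall>f'. feasible f' \<longrightarrow> ?\<Phi> f' \<le> ?\<Phi> f)"
    using f0 by (intro ex_has_greatest_nat[of feasible f0 ?\<Phi> "Suc (card V)"]) (auto simp: less_Suc_eq_le)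
  then obtain f where f: "feasible f" and max: "\<And>f'. feasible f' \<Longrightarrow> ?\<Phi> f' \<le> ?\<Phi> f" by auto
  have "covers f"
    unfolding covers_def
  proof (intro ballI notI)
    fix v assume v: "v \<in> V" "slot f v = {}"
    let ?f = "f(g v := v)"
    have gv: "g v \<in> W" "A (g v) v" using g(2) v by (auto simp: inc_def)
    have small: "card (slot h w) \<le> d" if "w \<in> V" "\<forall>x\<in>W. h x \<in> adj x" for w h
    proof -
      have "slot h w \<subseteq> inc w" using that by (auto simp: slot_def inc_def adj_def)
      then show ?thesis using d(2) that card_mono[OF finite_sub(2)] by (meson le_trans)
    qed
    have fa: "\<forall>x\<in>W. f x \<in> adj x" and ff: "\<And>w. w \<in> V \<Longrightarrow> fair (slot f w)" using f by (auto simp: feasible_def)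
    have fa': "\<forall>x\<in>W. ?f x \<in> adj x" using fa gv v by (auto simp: adj_def)
    have fair_cap: "fair (slot h w) \<longleftrightarrow> (\<forall>c. cnt (slot h w) c \<le> cap d)" if "w \<in> V" "\<forall>x\<in>W. h x \<in> adj x" for h w
      by (rule fair_iff_cap[OF d(1) _ small[OF that]]) (auto simp: slot_def)
    \<comment> \<open>The vertex \<open>g v\<close> is already placed somewhere by the fair
      assignment \<open>f\<close>, so the cap leaves room for at least one vertex of a
      colour.\<close>
    have cap: "cap d \<ge> 1"
    proof -
      have "f (g v) \<in> V" using fa gv by (auto simp: adj_def)
      then have "cnt (slot f (f (g v))) (col (g v)) \<le> cap d"
        using fair_cap[OF _ fa] ff by blast
      moreover have "g v \<in> {x\<in>slot f (f (g v)). col x = col (g v)}" using gv by (simp add: slot_def)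
      then have "cnt (slot f (f (g v))) (col (g v)) \<noteq> 0"
        unfolding cnt_def using finite_sub(4)[of f "f (g v)"] by (auto simp: card_eq_0_iff)
      ultimately show ?thesis by simp
    qed
    have "fair (slot ?f w)" if w: "w \<in> V" for w
    proof -
      have "cnt (slot ?f w) c \<le> cap d" for c
      proof (cases "w = v")
        case True
        have "slot ?f w \<subseteq> {g v}" using v True by (auto simp: slot_def)
        then have "card {x\<in>slot ?f w. col x = c} \<le> card {g v}" by (intro card_mono) auto
        then show ?thesis using cap by (simp add: cnt_def)
      next
        case False
        then have "slot ?f w \<subseteq> slot f w" by (auto simp: slot_def)
        then have "cnt (slot ?f w) c \<le> cnt (slot f w) c" by (intro cnt_mono finite_sub)
        then show ?thesis using fair_cap[OF w fa] ff[OF w] by (meson le_trans)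
      qed
      then show ?thesis using fair_cap[OF w fa'] by blast
    qed
    then have "feasible ?f" using fa' by (simp add: feasible_def)
    moreover have "{u\<in>V. ?f (g u) = u} = insert v {u\<in>V. f (g u) = u}"
      using v g(1) by (auto simp: inj_on_def)
    moreover have "f (g v) \<noteq> v" using v gv by (auto simp: slot_def)
    ultimately show False using max[of ?f] finite v by (simp add: card_insert_if)
  qed
  then show "\<exists>f. feasible f \<and> covers f" using f by blast
qed

subsection \<open>Two colours in equal numbers\<close>

text \<open>With bound 0 and at most three neighbours, a right vertex receives nothing or one vertex
  of each colour. A feasible assignment is therefore a bijection between the colour classes along
  common neighbours, and it covers \<open>V\<close> iff there are as many pairs as right
  vertices.\<close>

theorem feasible_two_colours:
  assumes C2: "C = {a, b}" "a \<noteq> b" and l: "l = 0" and d: "\<forall>v\<in>V. card (inc v) \<le> 3"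
  shows "(\<exists>f. feasible f) \<longleftrightarrow> card {x\<in>W. col x = a} = card {x\<in>W. col x = b} \<and>
      has_sdr {x\<in>W. col x = a} (\<lambda>x. {y\<in>W. col y = b \<and> (\<exists>v\<in>V. A x v \<and> A y v)})"
    and "(\<exists>f. feasible f \<and> covers f) \<longleftrightarrow> (\<exists>f. feasible f) \<and> card {x\<in>W. col x = a} = card V"
proof -
  let ?R = "{x\<in>W. col x = a}" and ?B = "{x\<in>W. col x = b}"
  have fair: "fair S \<longleftrightarrow> cnt S a = cnt S b" for S
    unfolding fair_def using C2 l by auto
  have R_at: "card {x\<in>?R. f x = v} = cnt (slot f v) a" "card {x\<in>?B. f x = v} = cnt (slot f v) b" for f v
    by (auto simp: cnt_def slot_def intro!: arg_cong[of _ _ card])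
  have at1: "cnt (slot f v) a = cnt (slot f v) b" "cnt (slot f v) a \<le> 1" if f: "feasible f" and v: "v \<in> V" for f v
  proof -
    show e: "cnt (slot f v) a = cnt (slot f v) b" using f v fair by (auto simp: feasible_def)
    have "cnt (slot f v) a + cnt (slot f v) b = card (slot f v)"
      using sum_cnt[of "slot f v"] C2 by (simp add: slot_def)
    also have "\<dots> \<le> 3"
      using d v card_mono[OF finite_sub(2) at_inc[OF f]] by (meson le_trans)
    finally show "cnt (slot f v) a \<le> 1" using e by simp
  qed
  have cards: "card ?R = (\<Sum>v\<in>V. cnt (slot f v) a)" "card ?B = (\<Sum>v\<in>V. cnt (slot f v) b)"
    if "\<forall>x\<in>W. f x \<in> adj x" for f
  proof -
    have "\<forall>x\<in>?R. f x \<in> V" "\<forall>x\<in>?B. f x \<in> V" using that by (auto simp: adj_def)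
    from this[THEN sum_at] show "card ?R = (\<Sum>v\<in>V. cnt (slot f v) a)" "card ?B = (\<Sum>v\<in>V. cnt (slot f v) b)"
      unfolding R_at by auto
  qed
  show "(\<exists>f. feasible f) \<longleftrightarrow> card ?R = card ?B \<and>
      has_sdr ?R (\<lambda>x. {y\<in>W. col y = b \<and> (\<exists>v\<in>V. A x v \<and> A y v)})" (is "_ \<longleftrightarrow> _ \<and> has_sdr ?R ?N")
  proof (intro iffI conjI)
    assume "\<exists>f. feasible f"
    then obtain f where f: "feasible f" by blast
    then have fa: "\<forall>x\<in>W. f x \<in> adj x" by (simp add: feasible_def)
    show "card ?R = card ?B" using cards[OF fa] at1(1)[OF f] by simp
    have "\<exists>y. y \<in> ?B \<and> f y = f x" if x: "x \<in> ?R" for x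
    proof -
      have v: "f x \<in> V" using fa x by (auto simp: adj_def)
      have "x \<in> {y\<in>slot f (f x). col y = a}" using x by (auto simp: slot_def)
      then have "cnt (slot f (f x)) a \<noteq> 0"
        unfolding cnt_def using finite_sub(4)[of f "f x"] by (auto simp: card_eq_0_iff)
      then have "cnt (slot f (f x)) b \<noteq> 0" using at1(1)[OF f v] by simp
      then have "{y\<in>slot f (f x). col y = b} \<noteq> {}" unfolding cnt_def by (metis card.empty)
      then show ?thesis by (auto simp: slot_def)
    qed
    then obtain g where g: "\<And>x. x \<in> ?R \<Longrightarrow> g x \<in> ?B \<and> f (g x) = f x" by metis
    have "inj_on g ?R"
    proof (rule inj_onI)
      fix x y assume xy: "x \<in> ?R" "y \<in> ?R" "g x = g y"
      then have "f x = f y" using g[of x] g[of y] by metis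
      moreover have v: "f x \<in> V" using fa xy by (auto simp: adj_def)
      ultimately have "{x, y} \<subseteq> {z\<in>slot f (f x). col z = a}" using xy by (auto simp: slot_def)
      then have "card {x, y} \<le> 1"
        using at1(2)[OF f v] card_mono[of "{z\<in>slot f (f x). col z = a}" "{x, y}"] finite_sub(4)[of f "f x"]
        unfolding cnt_def by auto
      then show "x = y" by (cases "x = y") auto
    qed
    moreover have "\<forall>x\<in>?R. g x \<in> ?N x"
    proof
      fix x assume x: "x \<in> ?R"
      then have "g x \<in> ?B" "f (g x) = f x" using g[OF x] by auto
      moreover have "f x \<in> adj x" "f (g x) \<in> adj (g x)" using fa x \<open>g x \<in> ?B\<close> by auto
      ultimately show "g x \<in> ?N x" by (auto simp: adj_def)
    qed
    ultimately show "has_sdr ?R ?N" unfolding has_sdr_def by blast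
  next
    assume *: "card ?R = card ?B \<and> has_sdr ?R ?N"
    then obtain g where g: "inj_on g ?R" "\<forall>x\<in>?R. g x \<in> ?N x" unfolding has_sdr_def by blast
    have "g ` ?R = ?B"
    proof (rule card_subset_eq)
      show "g ` ?R \<subseteq> ?B" using g(2) by auto
      show "card (g ` ?R) = card ?B" using * card_image[OF g(1)] by simp
    qed (use finite in auto)
    have "\<forall>x\<in>?R. \<exists>v\<in>V. A x v \<and> A (g x) v" using g(2) by auto
    then obtain h where h: "\<And>x. x \<in> ?R \<Longrightarrow> h x \<in> V \<and> A x (h x) \<and> A (g x) (h x)" by metis
    define f where "f x = (if col x = a then h x else h (the_inv_into ?R g x))" for x
    have fR: "f x = h x" "f (g x) = h x" if x: "x \<in> ?R" for x
    proof -
      show "f x = h x" using x by (simp add: f_def)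
      have "col (g x) = b" using x g(2) by auto
      then show "f (g x) = h x" using x C2 the_inv_into_f_f[OF g(1) x] by (simp add: f_def)
    qed
    have "f x \<in> adj x" if x: "x \<in> W" for x
    proof -
      have "x \<in> ?R \<or> x \<in> g ` ?R" using x C C2 \<open>g ` ?R = ?B\<close> by auto
      then show ?thesis
      proof
        assume "x \<in> ?R" then show ?thesis using fR(1) h by (auto simp: adj_def)
      next
        assume "x \<in> g ` ?R"
        then obtain y where "y \<in> ?R" "x = g y" by blast
        then show ?thesis using fR(2)[of y] h[of y] by (auto simp: adj_def)
      qed
    qed
    moreover have "fair (slot f v)" if "v \<in> V" for v
    proof -
      have "{x\<in>?B. f x = v} = g ` {x\<in>?R. f x = v}"
        using \<open>g ` ?R = ?B\<close> fR by fastforce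
      moreover have "inj_on g {x\<in>?R. f x = v}" using g(1) by (rule inj_on_subset) auto
      ultimately have "card {x\<in>?B. f x = v} = card {x\<in>?R. f x = v}" by (simp add: card_image)
      then show ?thesis unfolding fair R_at by simp
    qed
    ultimately show "\<exists>f. feasible f" unfolding feasible_def by blast
  qed
  have "covers f \<longleftrightarrow> card ?R = card V" if f: "feasible f" for f
  proof -
    have fa: "\<forall>x\<in>W. f x \<in> adj x" using f by (simp add: feasible_def)
    have ne: "slot f v \<noteq> {} \<longleftrightarrow> cnt (slot f v) a = 1" if v: "v \<in> V" for v
    proof
      assume "slot f v \<noteq> {}"
      then have "card (slot f v) \<noteq> 0" using finite_sub(4) by auto
      moreover have "cnt (slot f v) a + cnt (slot f v) b = card (slot f v)"
        using sum_cnt[of "slot f v"] C2 by (simp add: slot_def)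
      ultimately show "cnt (slot f v) a = 1" using at1[OF f v] by simp
    qed (auto simp: cnt_def)
    have "covers f \<longleftrightarrow> (\<forall>v\<in>V. cnt (slot f v) a = 1)" using ne by (auto simp: covers_def)
    also have "\<dots> \<longleftrightarrow> (\<Sum>v\<in>V. cnt (slot f v) a) = (\<Sum>v\<in>V. 1)"
    proof
      assume s: "(\<Sum>v\<in>V. cnt (slot f v) a) = (\<Sum>v\<in>V. 1)"
      show "\<forall>v\<in>V. cnt (slot f v) a = 1"
      proof (rule ccontr)
        assume "\<not> (\<forall>v\<in>V. cnt (slot f v) a = 1)"
        then obtain v where "v \<in> V" "cnt (slot f v) a < 1" using at1(2)[OF f] by (force simp: le_less)
        then have "(\<Sum>v\<in>V. cnt (slot f v) a) < (\<Sum>v\<in>V. 1)"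
          using at1(2)[OF f] finite by (intro sum_strict_mono_ex1) auto
        then show False using s by simp
      qed
    qed simp
    also have "\<dots> \<longleftrightarrow> card ?R = card V" using cards(1)[OF fa] by simp
    finally show ?thesis .
  qed
  then show "(\<exists>f. feasible f \<and> covers f) \<longleftrightarrow> (\<exists>f. feasible f) \<and> card ?R = card V" by blast
qed

subsection \<open>Three colours in equal numbers\<close>

definition rainbow :: "'v \<Rightarrow> bool" where
  "rainbow v \<longleftrightarrow> (\<forall>c\<in>C. \<exists>x\<in>inc v. col x = c)"

text \<open>A non-empty fair set contains all three colours, hence is the entire neighbourhood and
  contains each colour once. An assignment is thus given by the set \<open>\<sigma>\<close> of the
  right vertices that are used, which has to cover each left vertex exactly once.\<close>

theorem feasible_three_colours:
  assumes C3: "card C = 3" and l: "l = 0" and d: "\<forall>v\<in>V. card (inc v) \<le> 3"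
  shows "(\<exists>f. feasible f) \<longleftrightarrow> (\<exists>\<sigma>. \<forall>x\<in>W. \<exists>!v. v \<in> adj x \<and> rainbow v \<and> \<sigma> v)"
    and "(\<exists>f. feasible f \<and> covers f) \<longleftrightarrow> (\<exists>\<sigma>. (\<forall>x\<in>W. \<exists>!v. v \<in> adj x \<and> rainbow v \<and> \<sigma> v) \<and> (\<forall>v\<in>V. rainbow v \<and> \<sigma> v))"
proof -
  have cnt_inc: "cnt (inc v) c = 1" if v: "v \<in> V" "rainbow v" "c \<in> C" for v c
  proof -
    have ge: "cnt (inc v) d \<ge> 1" if dC: "d \<in> C" for d
    proof -
      obtain x where "x \<in> inc v" "col x = d" using v dC by (auto simp: rainbow_def)
      then have "{x\<in>inc v. col x = d} \<noteq> {}" by auto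
      then show ?thesis unfolding cnt_def using finite_sub(2)[of v] by (simp add: Suc_le_eq card_gt_0_iff)
    qed
    have "cnt (inc v) c + (\<Sum>d\<in>C - {c}. cnt (inc v) d) \<le> 3"
      using sum_cnt[of "inc v"] d v finite by (simp add: inc_def sum.remove[of C c, symmetric])
    moreover have "(\<Sum>d\<in>C - {c}. 1) \<le> (\<Sum>d\<in>C - {c}. cnt (inc v) d)"
      using ge by (intro sum_mono) auto
    moreover have "card (C - {c}) = 2" using C3 v finite by simp
    ultimately show ?thesis using ge[OF v(3)] by simp
  qed
  have fair_rainbow: "S = {} \<or> rainbow v \<and> S = inc v" if f: "fair S" and S: "S \<subseteq> inc v" and v: "v \<in> V" for S v
  proof (rule disjCI)
    assume ne: "\<not> (rainbow v \<and> S = inc v)"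
    show "S = {}"
    proof (rule ccontr)
      assume "S \<noteq> {}"
      then obtain x where x: "x \<in> S" by blast
      have SW: "S \<subseteq> W" using S by (auto simp: inc_def)
      have "col x \<in> C" using x SW C(2) by auto
      have "x \<in> {y\<in>S. col y = col x}" using x by auto
      then have x0: "cnt S (col x) > 0"
        unfolding cnt_def using finite_sub(1)[OF SW] by (auto simp: card_gt_0_iff)
      have pos: "cnt S c > 0" if "c \<in> C" for c
      proof -
        have "cnt S (col x) \<le> cnt S c + l" using f that \<open>col x \<in> C\<close> unfolding fair_def by blast
        then show ?thesis using x0 l by simp
      qed
      then have "\<exists>y\<in>S. col y = c" if "c \<in> C" for c
        using that unfolding cnt_def card_gt_0_iff by blast
      then have r: "rainbow v" using S by (fastforce simp: rainbow_def)
      have "(\<Sum>c\<in>C. 1) \<le> (\<Sum>c\<in>C. cnt S c)" using pos by (intro sum_mono) (auto simp: Suc_le_eq)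
      then have "3 \<le> card S" using sum_cnt[OF SW] C3 by simp
      then have "card (inc v) \<le> card S" using d v by fastforce
      then have "S = inc v" using S finite_sub(2) by (metis card_seteq)
      then show False using r ne by simp
    qed
  qed
  have fair_empty: "fair {}" by (simp add: fair_def cnt_def)
  have fair_inc: "fair (inc v)" if "v \<in> V" "rainbow v" for v
    using cnt_inc[OF that] by (simp add: fair_def)
  define sol where "sol \<sigma> \<longleftrightarrow> (\<forall>x\<in>W. \<exists>!v. v \<in> adj x \<and> rainbow v \<and> \<sigma> v)" for \<sigma>
  have 1: "sol (\<lambda>v. slot f v \<noteq> {})" "v \<in> V \<Longrightarrow> slot f v \<noteq> {} \<Longrightarrow> rainbow v" if f: "feasible f" for f v
  proof -
    have r: "slot f v = {} \<or> rainbow v \<and> slot f v = inc v" if "v \<in> V" for v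
      using f that by (intro fair_rainbow at_inc) (auto simp: feasible_def)
    then show "v \<in> V \<Longrightarrow> slot f v \<noteq> {} \<Longrightarrow> rainbow v" by blast
    show "sol (\<lambda>v. slot f v \<noteq> {})"
      unfolding sol_def
    proof
      fix x assume x: "x \<in> W"
      have fx: "f x \<in> adj x" "x \<in> slot f (f x)" using f x by (auto simp: feasible_def slot_def)
      show "\<exists>!v. v \<in> adj x \<and> rainbow v \<and> slot f v \<noteq> {}"
      proof (rule ex1I[of _ "f x"])
        show "f x \<in> adj x \<and> rainbow (f x) \<and> slot f (f x) \<noteq> {}"
          using fx r[of "f x"] by (auto simp: adj_def)
        fix v assume v: "v \<in> adj x \<and> rainbow v \<and> slot f v \<noteq> {}"
        then have "slot f v = inc v" using r[of v] by (auto simp: adj_def)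
        moreover have "x \<in> inc v" using v x by (auto simp: adj_def inc_def)
        ultimately show "v = f x" by (auto simp: slot_def)
      qed
    qed
  qed
  have 2: "\<exists>f. feasible f \<and> (\<forall>v\<in>V. rainbow v \<and> \<sigma> v \<longrightarrow> slot f v \<noteq> {})" if s: "sol \<sigma>" for \<sigma>
  proof -
    obtain f where f: "\<And>x. x \<in> W \<Longrightarrow> f x \<in> adj x \<and> rainbow (f x) \<and> \<sigma> (f x)"
      and u: "\<And>x v. x \<in> W \<Longrightarrow> v \<in> adj x \<and> rainbow v \<and> \<sigma> v \<Longrightarrow> v = f x"
      using s unfolding sol_def by metis
    have at_eq: "slot f v = inc v" if "v \<in> V" "rainbow v" "\<sigma> v" for v
      using that f u by (fastforce simp: slot_def inc_def adj_def)
    have at_empty: "slot f v = {}" if "\<not> (rainbow v \<and> \<sigma> v)" for v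
      using that f by (auto simp: slot_def)
    have "fair (slot f v)" if "v \<in> V" for v
      using at_eq[OF that] at_empty[of v] fair_empty fair_inc[OF that] by metis
    then have "feasible f" using f by (auto simp: feasible_def)
    moreover have "slot f v \<noteq> {}" if "v \<in> V" "rainbow v" "\<sigma> v" for v
      using at_eq[OF that] that(2) C(1) by (auto simp: rainbow_def)
    ultimately show ?thesis by blast
  qed
  show "(\<exists>f. feasible f) \<longleftrightarrow> (\<exists>\<sigma>. \<forall>x\<in>W. \<exists>!v. v \<in> adj x \<and> rainbow v \<and> \<sigma> v)"
    unfolding sol_def[symmetric]
  proof
    assume "\<exists>f. feasible f"
    then show "\<exists>\<sigma>. sol \<sigma>" using 1(1) by (elim exE) (rule exI)
  next
    assume "\<exists>\<sigma>. sol \<sigma>"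
    then show "\<exists>f. feasible f" using 2 by (elim exE) blast
  qed
  show "(\<exists>f. feasible f \<and> covers f) \<longleftrightarrow> (\<exists>\<sigma>. (\<forall>x\<in>W. \<exists>!v. v \<in> adj x \<and> rainbow v \<and> \<sigma> v) \<and> (\<forall>v\<in>V. rainbow v \<and> \<sigma> v))"
    unfolding sol_def[symmetric]
  proof
    assume "\<exists>f. feasible f \<and> covers f"
    then obtain f where f: "feasible f" "covers f" by blast
    show "\<exists>\<sigma>. sol \<sigma> \<and> (\<forall>v\<in>V. rainbow v \<and> \<sigma> v)"
      by (rule exI[of _ "\<lambda>v. slot f v \<noteq> {}"]) (use 1[OF f(1)] f(2) in \<open>auto simp: covers_def\<close>)
  next
    assume "\<exists>\<sigma>. sol \<sigma> \<and> (\<forall>v\<in>V. rainbow v \<and> \<sigma> v)"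
    then obtain \<sigma> where s: "sol \<sigma>" "\<forall>v\<in>V. rainbow v \<and> \<sigma> v" by blast
    from 2[OF s(1)] s(2) show "\<exists>f. feasible f \<and> covers f" by (auto simp: covers_def)
  qed
qed

end

subsection \<open>Systems of parity equations\<close>

text \<open>The equation \<open>(a, b, p)\<close> says that the values of \<open>a\<close> and \<open>b\<close> differ iff \<open>p\<close> holds.\<close>

definition parity_sat :: "('n \<Rightarrow> bool) \<Rightarrow> ('n \<times> 'n \<times> bool) list \<Rightarrow> bool" where
  "parity_sat \<tau> E \<longleftrightarrow> (\<forall>(a, b, p)\<in>set E. (\<tau> a \<noteq> \<tau> b) = p)"

text \<open>The first equation is solved for \<open>a\<close>, whose value is that of
  \<open>b\<close>, negated if \<open>p\<close> holds. If \<open>a\<close> occurs on both sides of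
  the second equation, the two negations cancel.\<close>

definition parity_subst :: "'n \<times> 'n \<times> bool \<Rightarrow> 'n \<times> 'n \<times> bool \<Rightarrow> 'n \<times> 'n \<times> bool" where
  "parity_subst e e' = (case e of (a, b, p) \<Rightarrow> case e' of (c, d, q) \<Rightarrow>
     (if c = a then b else c, if d = a then b else d, if (c = a) = (d = a) then q else q \<noteq> p))"

text \<open>Each step removes the first equation by elimination or because it is trivial. A
  contradictory first equation is kept forever, so after as many rounds as there are equations the
  list is empty iff the system is solvable.\<close>

definition parity_step :: "('n \<times> 'n \<times> bool) list \<Rightarrow> ('n \<times> 'n \<times> bool) list" where
  "parity_step E = (case E of [] \<Rightarrow> [] | e # E' \<Rightarrow>
     if fst e = fst (snd e) then if snd (snd e) then E else E' else map (parity_subst e) E')"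

definition parity_solvable :: "('n \<times> 'n \<times> bool) list \<Rightarrow> bool" where
  "parity_solvable E \<longleftrightarrow> fold (\<lambda>_. parity_step) E E = []"

lemma parity_step_sat: "(\<exists>\<tau>. parity_sat \<tau> (parity_step E)) \<longleftrightarrow> (\<exists>\<tau>. parity_sat \<tau> E)"
proof (cases E)
  case (Cons e E')
  obtain a b p where e: "e = (a, b, p)" by (cases e)
  show ?thesis
  proof (cases "a = b")
    case True
    then show ?thesis by (auto simp: parity_step_def Cons e parity_sat_def)
  next
    case False
    have sub: "parity_sat \<tau> (map (parity_subst e) E') \<longleftrightarrow> parity_sat \<tau> E'" if "(\<tau> a \<noteq> \<tau> b) = p" for \<tau>
    proof -
      have "(case parity_subst e e' of (c, d, q) \<Rightarrow> (\<tau> c \<noteq> \<tau> d) = q) \<longleftrightarrow> (case e' of (c, d, q) \<Rightarrow> (\<tau> c \<noteq> \<tau> d) = q)" for e'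
        using that by (cases e') (auto simp: parity_subst_def e)
      then show ?thesis by (simp add: parity_sat_def)
    qed
    have free: "parity_sat (\<tau>(a := y)) (map (parity_subst e) E') \<longleftrightarrow> parity_sat \<tau> (map (parity_subst e) E')" for \<tau> y
    proof -
      have "(case parity_subst e e' of (c, d, q) \<Rightarrow> ((\<tau>(a := y)) c \<noteq> (\<tau>(a := y)) d) = q) \<longleftrightarrow>
          (case parity_subst e e' of (c, d, q) \<Rightarrow> (\<tau> c \<noteq> \<tau> d) = q)" for e'
        using False by (cases e') (auto simp: parity_subst_def e)
      then show ?thesis by (simp add: parity_sat_def)
    qed
    have "(\<exists>\<tau>. parity_sat \<tau> (map (parity_subst e) E')) \<longleftrightarrow> (\<exists>\<tau>. (\<tau> a \<noteq> \<tau> b) = p \<and> parity_sat \<tau> (map (parity_subst e) E'))"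
    proof
      assume "\<exists>\<tau>. parity_sat \<tau> (map (parity_subst e) E')"
      then obtain \<tau> where "parity_sat \<tau> (map (parity_subst e) E')" by blast
      then have "parity_sat (\<tau>(a := (\<tau> b \<noteq> p))) (map (parity_subst e) E')" using free by blast
      moreover have "((\<tau>(a := (\<tau> b \<noteq> p))) a \<noteq> (\<tau>(a := (\<tau> b \<noteq> p))) b) = p" using False by auto
      ultimately show "\<exists>\<tau>. (\<tau> a \<noteq> \<tau> b) = p \<and> parity_sat \<tau> (map (parity_subst e) E')" by blast
    qed blast
    also have "\<dots> \<longleftrightarrow> (\<exists>\<tau>. (\<tau> a \<noteq> \<tau> b) = p \<and> parity_sat \<tau> E')" using sub by blast
    also have "\<dots> \<longleftrightarrow> (\<exists>\<tau>. parity_sat \<tau> E)" by (auto simp: Cons e parity_sat_def)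
    finally show ?thesis using False by (simp add: parity_step_def Cons e)
  qed
qed (simp add: parity_step_def)

lemma parity_step_length:
  "length (parity_step E) \<le> length E"
  "length (parity_step E) < length E \<or> E = [] \<or> parity_step E = E \<and> (\<nexists>\<tau>. parity_sat \<tau> E)"
  by (auto simp: parity_step_def parity_sat_def split: list.split)

theorem parity_solvable_iff: "parity_solvable E \<longleftrightarrow> (\<exists>\<tau>. parity_sat \<tau> E)"
proof -
  have sat: "(\<exists>\<tau>. parity_sat \<tau> (fold (\<lambda>_. parity_step) xs F)) \<longleftrightarrow> (\<exists>\<tau>. parity_sat \<tau> F)"
    for xs :: "('a \<times> 'a \<times> bool) list" and F :: "('a \<times> 'a \<times> bool) list"
    by (induction xs arbitrary: F) (simp_all add: parity_step_sat)
  have len: "fold (\<lambda>_. parity_step) xs F = []"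
    if "length F \<le> length xs" "\<exists>\<tau>. parity_sat \<tau> F" for xs F :: "('a \<times> 'a \<times> bool) list"
    using that
  proof (induction xs arbitrary: F)
    case (Cons x xs)
    have "length (parity_step F) \<le> length xs"
      using Cons.prems parity_step_length[of F] by (auto simp: parity_step_def)
    then show ?case using Cons by (simp add: parity_step_sat)
  qed simp
  show ?thesis
    unfolding parity_solvable_def
  proof
    assume "fold (\<lambda>_. parity_step) E E = []"
    then have "\<exists>\<tau>. parity_sat \<tau> (fold (\<lambda>_. parity_step) E E)" by (simp add: parity_sat_def)
    then show "\<exists>\<tau>. parity_sat \<tau> E" by (rule sat[THEN iffD1])
  next
    assume "\<exists>\<tau>. parity_sat \<tau> E"
    then show "fold (\<lambda>_. parity_step) E E = []" by (rule len[OF order_refl])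
  qed
qed

section \<open>Two colours with difference at most one\<close>

locale two_colours = fair_assignment +
  assumes C2: "card C = 2" and l1: "l = 1"
    and inc3: "v \<in> V \<Longrightarrow> card (inc v) \<le> 3" and adj2: "x \<in> W \<Longrightarrow> card (adj x) \<le> 2"
begin

definition mono :: "'b \<Rightarrow> bool" where
  "mono v \<longleftrightarrow> (\<forall>x\<in>inc v. \<forall>y\<in>inc v. col x = col y)"

definition triple :: "'b \<Rightarrow> bool" where
  "triple v \<longleftrightarrow> \<not> mono v \<and> card (inc v) = 3"

text \<open>The vertex whose colour occurs once at a right vertex with three neighbours of two colours.\<close>

definition single :: "'a \<Rightarrow> 'b \<Rightarrow> bool" where
  "single x v \<longleftrightarrow> triple v \<and> x \<in> inc v \<and> (\<forall>y\<in>inc v. y \<noteq> x \<longrightarrow> col y \<noteq> col x)"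

text \<open>The presence of the single vertex at a triple only relaxes the requirement there. A
  vertex that is single somewhere can therefore always be placed at such a triple and competes for
  no place.\<close>

definition sing :: "'a \<Rightarrow> bool" where
  "sing x \<longleftrightarrow> (\<exists>v\<in>V. single x v)"

lemma two: "c \<in> C \<Longrightarrow> d \<in> C \<Longrightarrow> e \<in> C \<Longrightarrow> c = d \<or> d = e \<or> c = e"
  using C2 by (auto simp: card_2_iff)

lemma col_inc: "x \<in> inc v \<Longrightarrow> col x \<in> C"
  using C by (auto simp: inc_def)

lemma tripleE:
  assumes "triple v"
  obtains r b c where "inc v = {r, b, c}" "r \<noteq> b" "r \<noteq> c" "b \<noteq> c" "col b = col c" "col r \<noteq> col b"
    "single r v" "\<not> single b v" "\<not> single c v"
proof -
  obtain p q s where pqs: "inc v = {p, q, s}" "p \<noteq> q" "p \<noteq> s" "q \<noteq> s"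
    using assms by (auto simp: triple_def card_3_iff)
  have "\<exists>r b c. inc v = {r, b, c} \<and> r \<noteq> b \<and> r \<noteq> c \<and> b \<noteq> c \<and> col b = col c \<and> col r \<noteq> col b"
  proof -
    have nm: "\<not> (col p = col q \<and> col q = col s)"
      using assms pqs by (auto simp: triple_def mono_def)
    have "col p \<in> C" "col q \<in> C" "col s \<in> C" using pqs col_inc by auto
    then consider "col p = col q" | "col q = col s" | "col p = col s"
      using two[of "col p" "col q" "col s"] by blast
    then show ?thesis
    proof cases
      case 1
      have "inc v = {s, p, q}" using pqs(1) by (simp add: insert_commute)
      moreover have "col s \<noteq> col p" using 1 nm by metis
      ultimately show ?thesis using pqs(2-4) 1 by metis
    next
      case 2
      have "inc v = {p, q, s}" using pqs(1) by (simp add: insert_commute)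
      moreover have "col p \<noteq> col q" using 2 nm by metis
      ultimately show ?thesis using pqs(2-4) 2 by metis
    next
      case 3
      have "inc v = {q, p, s}" using pqs(1) by (simp add: insert_commute)
      moreover have "col q \<noteq> col p" using 3 nm by metis
      ultimately show ?thesis using pqs(2-4) 3 by metis
    qed
  qed
  then obtain r b c where rbc: "inc v = {r, b, c}" "r \<noteq> b" "r \<noteq> c" "b \<noteq> c" "col b = col c" "col r \<noteq> col b"
    by blast
  show thesis
    by (rule that[OF rbc]) (use rbc assms in \<open>auto simp: single_def\<close>)
qed

lemma single_unique: "single x v \<Longrightarrow> single y v \<Longrightarrow> x = y"
proof -
  assume s: "single x v" "single y v"
  then have "triple v" by (simp add: single_def)
  then obtain r b c where *: "inc v = {r, b, c}" "\<not> single b v" "\<not> single c v"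
    by (rule tripleE)
  have "z = r" if "single z v" for z
    using that * by (metis insertE singletonD single_def)
  then show ?thesis using s by blast
qed

lemma pairE:
  assumes "v \<in> V" "\<not> mono v" "\<not> triple v"
  obtains x y where "inc v = {x, y}" "x \<noteq> y" "col x \<noteq> col y"
proof -
  have "card (inc v) \<le> 2" using assms inc3[of v] by (auto simp: triple_def)
  obtain x y where xy: "x \<in> inc v" "y \<in> inc v" "col x \<noteq> col y"
    using assms by (auto simp: mono_def)
  then have "x \<noteq> y" by auto
  then have "card {x, y} = 2" by simp
  then have "{x, y} = inc v"
    using xy \<open>card (inc v) \<le> 2\<close> finite_sub(2) by (intro card_seteq) auto
  then show thesis using that[of x y] xy by blast
qed

text \<open>Among at most three vertices of two colours, the numbers differ by two or more only if
  there are at least two vertices and only one colour occurs.\<close>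

lemma fair_iff: 
  assumes S: "S \<subseteq> inc v" and v: "v \<in> V"
  shows "fair S \<longleftrightarrow> card S \<le> 1 \<or> (\<exists>x\<in>S. \<exists>y\<in>S. col x \<noteq> col y)"
proof -
  obtain a b where ab: "C = {a, b}" "a \<noteq> b" using C2 by (auto simp: card_2_iff)
  have SW: "S \<subseteq> W" using S by (auto simp: inc_def)
  have fin: "finite S" using finite_sub(1)[OF SW] .
  have "card S \<le> 3" using inc3[OF v] card_mono[OF finite_sub(2) S] by simp
  have sum: "cnt S a + cnt S b = card S" using sum_cnt[OF SW] ab by simp
  have f: "fair S \<longleftrightarrow> cnt S a \<le> cnt S b + 1 \<and> cnt S b \<le> cnt S a + 1"
    unfolding fair_def using ab l1 by auto
  have ex: "cnt S c > 0 \<longleftrightarrow> (\<exists>x\<in>S. col x = c)" for c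
    unfolding cnt_def using fin by (auto simp: card_gt_0_iff)
  have "(\<exists>x\<in>S. \<exists>y\<in>S. col x \<noteq> col y) \<longleftrightarrow> cnt S a > 0 \<and> cnt S b > 0"
  proof
    assume "\<exists>x\<in>S. \<exists>y\<in>S. col x \<noteq> col y"
    then obtain x y where "x \<in> S" "y \<in> S" "col x \<noteq> col y" by blast
    moreover have "col x \<in> {a, b}" "col y \<in> {a, b}" using calculation SW C(2) ab(1) by auto
    ultimately show "cnt S a > 0 \<and> cnt S b > 0" unfolding ex by auto
  next
    assume "cnt S a > 0 \<and> cnt S b > 0"
    then show "\<exists>x\<in>S. \<exists>y\<in>S. col x \<noteq> col y" unfolding ex using ab(2) by metis
  qed
  then show ?thesis unfolding f using sum \<open>card S \<le> 3\<close> by auto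
qed

lemma fair_mono: "v \<in> V \<Longrightarrow> mono v \<Longrightarrow> S \<subseteq> inc v \<Longrightarrow> fair S \<longleftrightarrow> card S \<le> 1"
  by (subst fair_iff) (auto simp: mono_def)

lemma fair_pair:
  assumes "v \<in> V" "\<not> mono v" "\<not> triple v" "S \<subseteq> inc v"
  shows "fair S"
proof -
  obtain x y where xy: "inc v = {x, y}" "x \<noteq> y" "col x \<noteq> col y"
    using pairE[OF assms(1-3)] .
  then have "S = {} \<or> S = {x} \<or> S = {y} \<or> S = {x, y}" using assms(4) by auto
  then show ?thesis using fair_iff[OF assms(4,1)] xy by auto
qed

lemma fair_triple:
  assumes "v \<in> V" "inc v = {r, b, c}" "r \<noteq> b" "r \<noteq> c" "b \<noteq> c" "col b = col c" "col r \<noteq> col b" "S \<subseteq> inc v"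
  shows "fair S \<longleftrightarrow> (b \<in> S \<and> c \<in> S \<longrightarrow> r \<in> S)"
proof -
  have "S \<in> Pow {r, b, c}" using assms by auto
  then have "S \<in> {{}, {r}, {b}, {c}, {r, b}, {r, c}, {b, c}, {r, b, c}}" by (auto simp: Pow_insert)
  then show ?thesis using fair_iff[OF assms(8,1)] assms(3-7) by auto
qed

subsection \<open>Feasibility\<close>

text \<open>
  A right vertex offers one place; a triple offers a second one, shared by all triples with the same
  single vertex \<open>r\<close>, as it becomes available where \<open>r\<close> is placed. Places are of the form
  \<open>([], [v])\<close>, \<open>([r], [])\<close>, and \<open>([x], [v])\<close> for the two neighbours of a right vertex
  of two colours.
\<close>

definition places :: "'a \<Rightarrow> 'b \<Rightarrow> ('a list \<times> 'b list) set" where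
  "places x v = (if mono v then {([], [v])}
     else if triple v then insert ([], [v]) {([r], []) | r. r \<in> inc v \<and> single r v} else {([x], [v])})"

text \<open>Both vertices of the majority colour can be at a triple only together with its single
  vertex \<open>r\<close>. One of them then takes the place of the triple, the other one the extra
  place of \<open>r\<close>; as \<open>r\<close> goes to one triple only, the extra place is used at
  most once.\<close>

theorem feasible_iff_places:
  "(\<exists>f. feasible f) \<longleftrightarrow> has_sdr {x\<in>W. \<not> sing x} (\<lambda>x. \<Union>v\<in>adj x. places x v)"
proof
  assume "\<exists>f. feasible f"
  then obtain f where f: "feasible f" by blast
  then have fa: "\<And>x. x \<in> W \<Longrightarrow> f x \<in> adj x" and ff: "\<And>v. v \<in> V \<Longrightarrow> fair (slot f v)"
    by (auto simp: feasible_def)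
  \<comment> \<open>At a triple, \<open>m v\<close> is the vertex that takes the place of
    \<open>v\<close> itself; a second one takes the extra place of the single vertex.\<close>
  define m where "m v = (SOME x. x \<in> slot f v \<and> \<not> sing x)" for v
  have m: "m (f x) \<in> slot f (f x) \<and> \<not> sing (m (f x))" if "x \<in> W" "\<not> sing x" for x
    unfolding m_def by (rule someI[of _ x]) (use that in \<open>auto simp: slot_def\<close>)
  define g where "g x = (if mono (f x) then ([], [f x]) else if triple (f x) then
      if x = m (f x) then ([], [f x]) else ([THE r. single r (f x)], []) else ([x], [f x]))" for x
  have the: "(THE r. single r v) = r" if "single r v" for r v
    using that single_unique by blast
  have major: "single r (f x) \<and> f r = f x \<and> slot f (f x) = {r, x, m (f x)}"
    if x: "x \<in> W" "\<not> sing x" "triple (f x)" "x \<noteq> m (f x)" "single r (f x)" for x r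
  proof -
    let ?v = "f x"
    have v: "?v \<in> V" using fa[OF x(1)] by (auto simp: adj_def)
    obtain r' b c where rbc: "inc ?v = {r', b, c}" "r' \<noteq> b" "r' \<noteq> c" "b \<noteq> c" "col b = col c" "col r' \<noteq> col b"
      "single r' ?v" "\<not> single b ?v" "\<not> single c ?v" using tripleE[OF x(3)] .
    have r': "r' = r" using single_unique rbc(7) x(5) by blast
    have sub: "slot f ?v \<subseteq> inc ?v" by (rule at_inc[OF f])
    have mx: "m ?v \<in> slot f ?v" "\<not> sing (m ?v)" "x \<in> slot f ?v" using m[OF x(1,2)] x(1) by (auto simp: slot_def)
    have "\<not> single x ?v" "\<not> single (m ?v) ?v" using x(2) mx(2) v by (auto simp: sing_def)
    then have "x \<in> {b, c}" "m ?v \<in> {b, c}" using sub mx rbc by auto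
    then have bc: "{x, m ?v} = {b, c}" using x(4) by auto
    then have "b \<in> slot f ?v" "c \<in> slot f ?v" using mx by (metis insert_iff singletonD)+
    then have "r' \<in> slot f ?v"
      using fair_triple[OF v rbc(1-6) sub] ff[OF v] by blast
    then show ?thesis using sub rbc(1) bc mx x(5) r' by (auto simp: slot_def)
  qed
  have "inj_on g {x\<in>W. \<not> sing x}"
  proof (rule inj_onI)
    fix x y assume xy: "x \<in> {x\<in>W. \<not> sing x}" "y \<in> {x\<in>W. \<not> sing x}" "g x = g y"
    have vx: "f x \<in> V" "f y \<in> V" using fa xy by (auto simp: adj_def)
    show "x = y"
    proof (cases "f x = f y")
      case True
      show ?thesis
      proof (cases "mono (f x)")
        case True
        then have "card (slot f (f x)) \<le> 1"
          using fair_mono[OF vx(1) True at_inc[OF f]] ff[OF vx(1)] by blast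
        moreover have "{x, y} \<subseteq> slot f (f x)" using xy \<open>f x = f y\<close> by (auto simp: slot_def)
        ultimately have "card {x, y} \<le> 1" using card_mono[OF finite_sub(4)] by (meson le_trans)
        then show ?thesis by (cases "x = y") auto
      next
        case nm: False
        show ?thesis
        proof (cases "triple (f x)")
          case tr: True
          show ?thesis
          proof (rule ccontr)
            assume ne: "x \<noteq> y"
            then have nm': "x \<noteq> m (f x)" "y \<noteq> m (f x)" using xy(3) nm tr True by (auto simp: g_def split: if_splits)
            obtain r where r: "single r (f x)" using tripleE[OF tr] .
            have "slot f (f x) = {r, x, m (f x)}" using major[of x r] xy tr nm' r by blast
            moreover have "y \<in> slot f (f x)" using xy True by (auto simp: slot_def)
            moreover have "y \<noteq> r" using xy(2) r vx(1) by (auto simp: sing_def)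
            ultimately show False using ne nm' by auto
          qed
        next
          case False
          then show ?thesis using xy(3) nm True by (simp add: g_def)
        qed
      qed
    next
      case ne: False
      then have *: "\<not> mono (f x)" "\<not> mono (f y)" "triple (f x)" "triple (f y)" "x \<noteq> m (f x)" "y \<noteq> m (f y)"
        "(THE r. single r (f x)) = (THE r. single r (f y))"
        using xy(3) by (auto simp: g_def split: if_splits)
      obtain r where r: "single r (f x)" using tripleE[OF *(3)] .
      obtain r' where r': "single r' (f y)" using tripleE[OF *(4)] .
      have "r = r'" using *(7) the[OF r] the[OF r'] by simp
      moreover have "f r = f x" using major[of x r] xy * r by blast
      moreover have "f r' = f y" using major[of y r'] xy * r' by blast
      ultimately show ?thesis using ne by simp
    qed
  qed
  moreover have "\<forall>x\<in>{x\<in>W. \<not> sing x}. g x \<in> (\<Union>v\<in>adj x. places x v)"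
  proof
    fix x assume x: "x \<in> {x\<in>W. \<not> sing x}"
    have "g x \<in> places x (f x)"
    proof (cases "triple (f x)")
      case True
      obtain r where r: "single r (f x)" using tripleE[OF True] .
      then show ?thesis using True the[OF r] by (auto simp: g_def places_def triple_def single_def)
    qed (auto simp: g_def places_def)
    then show "g x \<in> (\<Union>v\<in>adj x. places x v)" using fa x by blast
  qed
  ultimately show "has_sdr {x\<in>W. \<not> sing x} (\<lambda>x. \<Union>v\<in>adj x. places x v)"
    unfolding has_sdr_def by blast
next
  assume "has_sdr {x\<in>W. \<not> sing x} (\<lambda>x. \<Union>v\<in>adj x. places x v)"
  then obtain g where g: "inj_on g {x\<in>W. \<not> sing x}" "\<forall>x\<in>{x\<in>W. \<not> sing x}. g x \<in> (\<Union>v\<in>adj x. places x v)"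
    unfolding has_sdr_def by blast
  have "\<forall>x\<in>{x\<in>W. \<not> sing x}. \<exists>v. v \<in> adj x \<and> g x \<in> places x v" using g(2) by blast
  then obtain p where p: "\<And>x. x \<in> W \<Longrightarrow> \<not> sing x \<Longrightarrow> p x \<in> adj x \<and> g x \<in> places x (p x)"
    by (metis (mono_tags, lifting) mem_Collect_eq)
  define used where "used r u \<longleftrightarrow> u \<in> W \<and> \<not> sing u \<and> g u = ([r], [])" for r u
  have used: "single r (p u) \<and> p u \<in> V" if "used r u" for r u
  proof -
    have "g u \<in> places u (p u)" "p u \<in> adj u" using that p[of u] by (auto simp: used_def)
    then show ?thesis using that by (auto simp: used_def places_def adj_def split: if_splits)
  qed
  have used1: "u = u'" if "used r u" "used r u'" for r u u'
    using that inj_onD[OF g(1), of u u'] by (auto simp: used_def)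
  \<comment> \<open>A vertex that is single somewhere goes to the triple where its extra place is in
    use, and otherwise to any triple at which it is single.\<close>
  define f where "f x = (if sing x then if \<exists>u. used x u then p (SOME u. used x u) else SOME v. v \<in> V \<and> single x v else p x)" for x
  have f_used: "f r = p u" if "used r u" for r u
  proof -
    have "(SOME u. used r u) = u" using that used1 by (metis someI)
    moreover have "sing r" using used[OF that] by (auto simp: sing_def)
    ultimately show ?thesis using that by (auto simp: f_def)
  qed
  have f_sing: "f x \<in> V \<and> single x (f x)" if "sing x" for x
  proof (cases "\<exists>u. used x u")
    case True
    then obtain u where "used x u" by blast
    then show ?thesis using used f_used by metis
  next
    case False
    have "f x = (SOME v. v \<in> V \<and> single x v)"
      unfolding f_def if_P[OF that] if_not_P[OF False] ..
    moreover have "\<exists>v. v \<in> V \<and> single x v" using that by (auto simp: sing_def)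
    ultimately show ?thesis using someI_ex[of "\<lambda>v. v \<in> V \<and> single x v"] by simp
  qed
  have f_nonsing: "f x = p x" if "\<not> sing x" for x using that by (simp add: f_def)
  have fa: "f x \<in> adj x" if "x \<in> W" for x
  proof (cases "sing x")
    case True
    then show ?thesis using f_sing[OF True] by (auto simp: single_def inc_def adj_def)
  next
    case False
    then show ?thesis using p[OF that] f_nonsing by auto
  qed
  have sub: "slot f v \<subseteq> inc v" for v using fa by (auto simp: slot_def inc_def adj_def)
  have pl: "g z \<in> places z v" if "z \<in> slot f v" "\<not> sing z" for z v
  proof -
    have "z \<in> W" "v = p z" using that f_nonsing by (auto simp: slot_def)
    then show ?thesis using p[of z] that by blast
  qed
  have "fair (slot f v)" if v: "v \<in> V" for v
  proof -
    consider "mono v" | "triple v" | "\<not> mono v" "\<not> triple v" by (auto simp: triple_def)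
    then show ?thesis
    proof cases
      case 1
      have eq: "x = y" if "x \<in> slot f v" "y \<in> slot f v" for x y
      proof -
        have "\<not> sing z" if "z \<in> slot f v" for z
        proof
          assume "sing z"
          then have "single z (f z)" using f_sing by blast
          then show False using that 1 by (simp add: slot_def single_def triple_def)
        qed
        then have "\<not> sing x" "\<not> sing y" using that by auto
        moreover from this have "g x \<in> places x v" "g y \<in> places y v"
          using that pl by blast+
        then have "g x = g y" using 1 by (simp add: places_def)
        ultimately show "x = y" using that inj_onD[OF g(1), of x y] by (auto simp: slot_def)
      qed
      have "card (slot f v) \<le> 1"
        using eq finite_sub(4) by (intro card_le_Suc0_iff_eq[THEN iffD2, folded One_nat_def]) auto
      then show ?thesis using fair_mono[OF v 1 sub] by blast
    next
      case 2
      obtain r b c where rbc: "inc v = {r, b, c}" "r \<noteq> b" "r \<noteq> c" "b \<noteq> c" "col b = col c" "col r \<noteq> col b"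
        "single r v" "\<not> single b v" "\<not> single c v" using tripleE[OF 2] .
      have gg: "g x = ([], [v]) \<or> used r x" "\<not> sing x" "x \<in> W" if "x \<in> slot f v" "\<not> single x v" for x
      proof -
        show ns: "\<not> sing x" using that f_sing by (auto simp: slot_def)
        show xW: "x \<in> W" using that by (auto simp: slot_def)
        have "g x \<in> places x v" using that pl ns by blast
        then show "g x = ([], [v]) \<or> used r x"
          using 2 ns xW rbc(7) single_unique by (auto simp: places_def used_def triple_def)
      qed
      have "r \<in> slot f v" if bc: "b \<in> slot f v" "c \<in> slot f v"
      proof -
        have "g b \<noteq> g c"
          using gg(2,3)[OF bc(1) rbc(8)] gg(2,3)[OF bc(2) rbc(9)] g(1) rbc(4) by (auto dest: inj_onD)
        then have "used r b \<or> used r c"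
          using gg(1)[OF bc(1) rbc(8)] gg(1)[OF bc(2) rbc(9)] by auto
        then obtain u where u: "used r u" "u \<in> slot f v" using bc by blast
        then have "f u = v" "\<not> sing u" by (auto simp: slot_def used_def)
        then have "f r = v" using f_used[OF u(1)] f_nonsing by simp
        moreover have "r \<in> W" using rbc(1) by (auto simp: inc_def)
        ultimately show ?thesis by (simp add: slot_def)
      qed
      then show ?thesis using fair_triple[OF v rbc(1-6) sub] by blast
    next
      case 3
      then show ?thesis using fair_pair[OF v _ _ sub] by blast
    qed
  qed
  then have "feasible f" using fa by (simp add: feasible_def)
  then show "\<exists>f. feasible f" by blast
qed

subsection \<open>Rounding half-integral covering assignments\<close>

text \<open>
  An assignment of \<open>x\<close> to one of its neighbours is relaxed to a distribution of two units among
  them; \<open>ok v z\<close> relaxes the requirement that \<open>v\<close> receives a non-empty fair set.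
\<close>

definition ok :: "'b \<Rightarrow> ('a \<Rightarrow> nat) \<Rightarrow> bool" where
  "ok v z \<longleftrightarrow> (if mono v then (\<Sum>x\<in>inc v. z x) = 2
     else 2 \<le> (\<Sum>x\<in>inc v. z x) \<and>
       (triple v \<longrightarrow> (\<Sum>x | x \<in> inc v \<and> \<not> single x v. z x) \<le> 2 + (\<Sum>x | x \<in> inc v \<and> single x v. z x)))"

lemma ok_triple:
  assumes "triple v" "inc v = {r, b, c}" "r \<noteq> b" "r \<noteq> c" "b \<noteq> c" "single r v" "\<not> single b v" "\<not> single c v"
  shows "ok v z \<longleftrightarrow> 2 \<le> z r + z b + z c \<and> z b + z c \<le> 2 + z r"
proof -
  have sets: "{x. x \<in> inc v \<and> \<not> single x v} = {b, c}" "{x. x \<in> inc v \<and> single x v} = {r}"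
    using assms by auto
  have "\<not> mono v" using assms(1) by (simp add: triple_def)
  moreover have "(\<Sum>x\<in>inc v. z x) = z r + z b + z c" unfolding assms(2) using assms(3-5) by simp
  moreover have "(\<Sum>x | x \<in> inc v \<and> \<not> single x v. z x) = z b + z c" unfolding sets using assms(5) by simp
  moreover have "(\<Sum>x | x \<in> inc v \<and> single x v. z x) = z r" unfolding sets by simp
  ultimately show ?thesis unfolding ok_def using assms(1) by simp
qed

lemma ok_pair: "v \<in> V \<Longrightarrow> \<not> mono v \<Longrightarrow> \<not> triple v \<Longrightarrow> inc v = {x, y} \<Longrightarrow> x \<noteq> y \<Longrightarrow> ok v z \<longleftrightarrow> 2 \<le> z x + z y"
  by (simp add: ok_def)

lemma ok_mono: "mono v \<Longrightarrow> ok v z \<longleftrightarrow> (\<Sum>x\<in>inc v. z x) = 2"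
  by (simp add: ok_def)

lemma ok_cong: "(\<And>x. x \<in> inc v \<Longrightarrow> z x = z' x) \<Longrightarrow> ok v z \<longleftrightarrow> ok v z'"
proof -
  assume "\<And>x. x \<in> inc v \<Longrightarrow> z x = z' x"
  then have "sum z S = sum z' S" if "S \<subseteq> inc v" for S
    using that by (intro sum.cong) auto
  from this[of "inc v"] this[of "{x. x \<in> inc v \<and> single x v}"] this[of "{x. x \<in> inc v \<and> \<not> single x v}"]
  show ?thesis unfolding ok_def by auto
qed

text \<open>If all other values at \<open>v\<close> were even, a requirement that holds with 1 at
  \<open>x\<close> would by parity hold with 0 and 2 as well. Hence another vertex at
  \<open>v\<close> is half and can be rounded so as to compensate for \<open>x\<close>. If neither
  of the two is single anywhere, it is rounded in the direction opposite to that of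
  \<open>x\<close>.\<close>

lemma repair:
  assumes v: "v \<in> V" and x: "x \<in> inc v" and ok: "ok v (z(x := 1))" "\<not> ok v z" and zx: "z x = 0 \<or> z x = 2"
    and le: "\<And>u. u \<in> inc v \<Longrightarrow> z u \<le> 2"
  obtains u t where "u \<in> inc v" "u \<noteq> x" "z u = 1" "t = 0 \<or> t = 2" "ok v (z(u := t))"
    "\<not> sing x \<Longrightarrow> \<not> sing u \<Longrightarrow> t = 2 - z x"
proof -
  have sum: "(\<Sum>y\<in>inc v. w y) = w x + (\<Sum>y\<in>inc v - {x}. w y)" for w :: "'a \<Rightarrow> nat"
    using finite_sub(2) x by (rule sum.remove)
  consider (mono) "mono v" | (triple) "triple v" | (pair) "\<not> mono v" "\<not> triple v" by (auto simp: triple_def)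
  then show thesis
  proof cases
    case mono
    have "(\<Sum>y\<in>inc v - {x}. (z(x := 1)) y) = (\<Sum>y\<in>inc v - {x}. z y)" by (intro sum.cong) auto
    then have "(\<Sum>y\<in>inc v - {x}. z y) = 1"
      using ok(1) mono by (simp add: ok_mono sum)
    then have "\<exists>u\<in>inc v - {x}. z u = 1 \<and> (\<forall>y\<in>inc v - {x}. u \<noteq> y \<longrightarrow> z y = 0)"
      using sum_eq_1_iff[of "inc v - {x}" z] finite_sub(2)[of v] by simp
    then obtain u where u: "u \<in> inc v - {x}" "z u = 1" "\<forall>y\<in>inc v - {x}. u \<noteq> y \<longrightarrow> z y = 0"
      by blast
    have "(\<Sum>y\<in>inc v - {x}. (z(u := t)) y) = t" for t
    proof -
      have "(\<Sum>y\<in>inc v - {x}. (z(u := t)) y) = (\<Sum>y\<in>inc v - {x}. if u = y then t else 0)"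
        using u(3) by (intro sum.cong) auto
      then show ?thesis using u(1) finite_sub(2)[of v] by (simp add: sum.delta)
    qed
    then have "ok v (z(u := 2 - z x))"
      using mono zx u(1) by (auto simp: ok_mono sum)
    then show thesis using that[of u "2 - z x"] u zx by auto
  next
    case pair
    obtain p q where pq: "inc v = {p, q}" "p \<noteq> q" using pairE[OF v pair] .
    obtain u where u: "inc v = {x, u}" "x \<noteq> u" using pq x by auto
    have "z u = 1" "z x = 0"
      using ok zx le[of u] u by (auto simp: ok_pair[OF v pair u])
    moreover from this have "ok v (z(u := 2))" using u by (simp add: ok_pair[OF v pair u])
    ultimately show thesis using that[of u 2] u by auto
  next
    case triple
    obtain r b c where rbc: "inc v = {r, b, c}" "r \<noteq> b" "r \<noteq> c" "b \<noteq> c" "col b = col c" "col r \<noteq> col b"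
      "single r v" "\<not> single b v" "\<not> single c v" using tripleE[OF triple] .
    note okt = ok_triple[OF triple rbc(1-4,7-9)]
    have sr: "sing r" using rbc(7) v by (auto simp: sing_def)
    have l: "z r \<le> 2" "z b \<le> 2" "z c \<le> 2" using le rbc(1) by auto
    consider "x = r" | "x = b" | "x = c" using x rbc(1) by auto
    then show thesis
    proof cases
      case 1
      have "z r = 0" "z b = 1 \<and> (z c = 0 \<or> z c = 2) \<or> z c = 1 \<and> (z b = 0 \<or> z b = 2)"
        using ok zx l rbc(2-4) unfolding okt 1 by auto
      then show thesis
        using that[of b "2 - z c"] that[of c "2 - z b"] rbc(1-4) sr unfolding okt 1 by auto
    next
      case 2
      have "z r = 1 \<or> z r = 0 \<and> z c = 1"
        using ok zx l rbc(2-4) unfolding okt 2 by auto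
      then show thesis
        using that[of r 2] that[of c "2 - z b"] rbc(1-4) sr zx l unfolding okt 2 by auto
    next
      case 3
      have "z r = 1 \<or> z r = 0 \<and> z b = 1"
        using ok zx l rbc(2-4) unfolding okt 3 by auto
      then show thesis
        using that[of r 2] that[of b "2 - z c"] rbc(1-4) sr zx l unfolding okt 3 by auto
    qed
  qed
qed

text \<open>Only the sums over the single and over the other vertices enter \<open>ok\<close>, so a
  unit may be shifted between two vertices of the latter kind.\<close>

lemma ok_exchange:
  assumes v: "v \<in> V" and x: "x \<in> inc v" "u \<in> inc v" "x \<noteq> u" and ok: "ok v z" and z: "z x = 1" "z u = 1"
    and ns: "\<not> sing x" "\<not> sing u"
  shows "ok v (z(x := 2, u := 0))"
proof -
  let ?z = "z(x := 2, u := 0)"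
  have s: "(\<Sum>y\<in>S. ?z y) = (\<Sum>y\<in>S. z y)" if S: "finite S" "x \<in> S" "u \<in> S" for S
  proof -
    have "(\<Sum>y\<in>S. w y) = w x + (w u + (\<Sum>y\<in>S - {x} - {u}. w y))" for w :: "'a \<Rightarrow> nat"
      using S x(3) by (simp add: sum.remove[of S x] sum.remove[of "S - {x}" u])
    moreover have "(\<Sum>y\<in>S - {x} - {u}. ?z y) = (\<Sum>y\<in>S - {x} - {u}. z y)" by (intro sum.cong) auto
    ultimately show ?thesis using z x(3) by simp
  qed
  have "\<not> single x v" "\<not> single u v" using ns v by (auto simp: sing_def)
  then have "sum ?z {y. y \<in> inc v \<and> single y v} = sum z {y. y \<in> inc v \<and> single y v}"
    by (intro sum.cong) auto
  moreover have "sum ?z {y. y \<in> inc v \<and> \<not> single y v} = sum z {y. y \<in> inc v \<and> \<not> single y v}"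
    by (rule s) (use x finite_sub(2)[of v] \<open>\<not> single x v\<close> \<open>\<not> single u v\<close> in auto)
  moreover have "sum ?z (inc v) = sum z (inc v)" by (rule s[OF finite_sub(2) x(1,2)])
  ultimately show ?thesis using ok unfolding ok_def by (simp only:)
qed

definition dist :: "('a \<Rightarrow> 'b \<Rightarrow> nat) \<Rightarrow> bool" where
  "dist y \<longleftrightarrow> (\<forall>x\<in>W. (\<Sum>v\<in>adj x. y x v) = 2)"

definition half :: "('a \<Rightarrow> 'b \<Rightarrow> nat) \<Rightarrow> 'a set" where
  "half y = {x\<in>W. \<exists>v\<in>adj x. y x v = 1}"

definition put :: "'a \<Rightarrow> 'b \<Rightarrow> nat \<Rightarrow> ('a \<Rightarrow> 'b \<Rightarrow> nat) \<Rightarrow> 'a \<Rightarrow> 'b \<Rightarrow> nat" where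
  "put x v t y = y(x := (\<lambda>u. if u = v then t else 2 - t))"

lemma inc_adj: "v \<in> V \<Longrightarrow> x \<in> inc v \<longleftrightarrow> x \<in> W \<and> v \<in> adj x"
  by (auto simp: inc_def adj_def)

lemma halfE:
  assumes "dist y" "x \<in> W" "v \<in> adj x" "y x v = 1"
  obtains w where "adj x = {v, w}" "w \<noteq> v" "y x w = 1"
proof -
  have "(\<Sum>u\<in>adj x. y x u) = 1 + (\<Sum>u\<in>adj x - {v}. y x u)"
    using assms finite_sub(3)[of x] by (simp add: sum.remove)
  then have s: "(\<Sum>u\<in>adj x - {v}. y x u) = 1" using assms by (simp add: dist_def)
  then have "\<exists>w\<in>adj x - {v}. y x w = 1"
    using sum_eq_1_iff[of "adj x - {v}" "y x"] finite_sub(3)[of x] by auto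
  then obtain w where w: "w \<in> adj x - {v}" "y x w = 1" by blast
  have "{v, w} = adj x"
    using w assms(2,3) adj2[of x] finite_sub(3)[of x] by (intro card_seteq) auto
  then show thesis using that[of w] w by blast
qed

lemma put:
  assumes y: "dist y" and x: "x \<in> W" "adj x = {v, w}" "w \<noteq> v" and t: "t = 0 \<or> t = 2"
  shows "dist (put x v t y)" "half (put x v t y) = half y - {x}"
    "put x v t y x v = t" "put x v t y x w = 2 - t" "u \<noteq> x \<Longrightarrow> put x v t y u = y u"
proof -
  show "dist (put x v t y)"
    using y x t by (auto simp: dist_def put_def)
  show "half (put x v t y) = half y - {x}"
    using x t by (auto simp: half_def put_def)
qed (use x in \<open>auto simp: put_def\<close>)

lemma dist_le: "dist y \<Longrightarrow> x \<in> W \<Longrightarrow> v \<in> adj x \<Longrightarrow> y x v \<le> 2"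
  unfolding dist_def using member_le_sum[of v "adj x" "y x"] finite_sub(3)[of x] by fastforce

text \<open>The value of \<open>x\<close> has been changed at both ends, and only one end, \<open>w\<close>, may be violated.\<close>

lemma push_one:
  assumes "dist y" "w \<in> V" "x \<in> inc w" "y x w = 0 \<or> y x w = 2" "ok w ((\<lambda>u. y u w)(x := 1))"
    "\<And>v. v \<in> V \<Longrightarrow> v \<noteq> w \<Longrightarrow> ok v (\<lambda>u. y u v)"
  shows "\<exists>y'. dist y' \<and> (\<forall>v\<in>V. ok v (\<lambda>u. y' u v)) \<and> half y' \<subseteq> half y"
  using assms
proof (induction "card (half y)" arbitrary: y w x rule: less_induct)
  case less
  show ?case
  proof (cases "ok w (\<lambda>u. y u w)")
    case True
    then show ?thesis using less.prems by blast
  next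
    case False
    have le: "y u w \<le> 2" if "u \<in> inc w" for u
      using that less.prems(1,2) dist_le inc_adj by blast
    obtain u t where u: "u \<in> inc w" "u \<noteq> x" "y u w = 1" "t = 0 \<or> t = 2" "ok w ((\<lambda>u. y u w)(u := t))"
      using repair[OF less.prems(2,3,5) False less.prems(4) le] .
    have uW: "u \<in> W" "w \<in> adj u" using u(1) less.prems(2) inc_adj by auto
    obtain w' where w': "adj u = {w, w'}" "w' \<noteq> w" "y u w' = 1"
      using halfE[OF less.prems(1) uW u(3)] .
    \<comment> \<open>Rounding \<open>u\<close> satisfies \<open>w\<close> and leaves
      \<open>w'\<close>, where \<open>u\<close> was half before, as the only vertex that may be
      violated. The number of half vertices has decreased.\<close>
    let ?y = "put u w t y"
    note P = put[OF less.prems(1) uW(1) w'(1,2) u(4)]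
    have w'V: "w' \<in> V" "u \<in> inc w'" using w'(1) uW(1) by (auto simp: adj_def inc_def)
    have "u \<in> half y" using uW u(3) by (auto simp: half_def)
    then have "card (half ?y) < card (half y)"
      unfolding P(2) using finite by (intro psubset_card_mono) (auto simp: half_def)
    moreover have "ok w' ((\<lambda>a. ?y a w')(u := 1))"
    proof -
      have "((\<lambda>a. ?y a w')(u := 1)) = (\<lambda>a. y a w')" using w'(3) P(5) by (auto simp: fun_eq_iff)
      then show ?thesis using less.prems(6)[OF w'V(1) w'(2)] by simp
    qed
    moreover have "ok v (\<lambda>a. ?y a v)" if v: "v \<in> V" "v \<noteq> w'" for v
    proof (cases "v = w")
      case True
      have "(\<lambda>a. ?y a w) = (\<lambda>a. y a w)(u := t)" using P(3,5) by (auto simp: fun_eq_iff)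
      then show ?thesis using u(5) True by simp
    next
      case False
      have "ok v (\<lambda>a. ?y a v) \<longleftrightarrow> ok v (\<lambda>a. y a v)"
      proof (rule ok_cong)
        fix a assume "a \<in> inc v"
        then have "a \<noteq> u" using v False w'(1) inc_adj by auto
        then show "?y a v = y a v" using P(5) by simp
      qed
      then show ?thesis using less.prems(6) v False by simp
    qed
    ultimately have "\<exists>y'. dist y' \<and> (\<forall>v\<in>V. ok v (\<lambda>u. y' u v)) \<and> half y' \<subseteq> half ?y"
      using u(4) P(1,4) w'V by (intro less.hyps[of ?y w' u]) auto
    then show ?thesis unfolding P(2) by blast
  qed
qed

text \<open>
  If no vertex that is single somewhere is half, a deficit at \<open>w\<close> moves on until it is absorbed,
  possibly by the surplus at \<open>w'\<close>.
\<close>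

lemma push_two:
  assumes "dist y" "w \<in> V" "w' \<in> V" "w \<noteq> w'" "x \<in> inc w" "x' \<in> inc w'" "y x w = 0" "y x' w' = 2"
    "ok w ((\<lambda>u. y u w)(x := 1))" "ok w' ((\<lambda>u. y u w')(x' := 1))"
    "\<And>v. v \<in> V \<Longrightarrow> v \<noteq> w \<Longrightarrow> v \<noteq> w' \<Longrightarrow> ok v (\<lambda>u. y u v)"
    "\<And>u. u \<in> half y \<Longrightarrow> \<not> sing u" "\<not> sing x" "\<not> sing x'"
  shows "\<exists>y'. dist y' \<and> (\<forall>v\<in>V. ok v (\<lambda>u. y' u v)) \<and> half y' \<subseteq> half y"
  using assms
proof (induction "card (half y)" arbitrary: y w x rule: less_induct)
  case less
  show ?case
  proof (cases "ok w (\<lambda>u. y u w)")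
    case True
    \<comment> \<open>The deficit has been absorbed, so only the surplus at \<open>w'\<close> may
      remain.\<close>
    then show ?thesis
      using less.prems by (intro push_one[of y w' x']) auto
  next
    case False
    have le: "y u w \<le> 2" if "u \<in> inc w" for u
      using that less.prems(1,2) dist_le inc_adj by blast
    have zx: "y x w = 0 \<or> y x w = 2" using less.prems by simp
    obtain u t where u: "u \<in> inc w" "u \<noteq> x" "y u w = 1" "ok w ((\<lambda>u. y u w)(u := t))"
      "\<not> sing x \<Longrightarrow> \<not> sing u \<Longrightarrow> t = 2 - y x w"
      using repair[OF less.prems(2,5,9) False zx le] by metis
    have uW: "u \<in> W" "w \<in> adj u" using u(1) less.prems(2) inc_adj by auto
    then have uh: "u \<in> half y" using u(3) by (auto simp: half_def)
    then have t: "t = 2" using u(5) less.prems(7,12,13) by auto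
    obtain w2 where w2: "adj u = {w, w2}" "w2 \<noteq> w" "y u w2 = 1"
      using halfE[OF less.prems(1) uW u(3)] .
    let ?y = "put u w t y"
    have t': "t = 0 \<or> t = 2" using t by simp
    note P = put[OF less.prems(1) uW(1) w2(1,2) t']
    have w2V: "w2 \<in> V" "u \<in> inc w2" using w2(1) uW(1) by (auto simp: adj_def inc_def)
    have card: "card (half ?y) < card (half y)"
      unfolding P(2) using finite uh by (intro psubset_card_mono) (auto simp: half_def)
    have okw: "ok w (\<lambda>a. ?y a w)"
    proof -
      have "(\<lambda>a. ?y a w) = (\<lambda>a. y a w)(u := t)" using P(3,5) by (auto simp: fun_eq_iff)
      then show ?thesis using u(4) by simp
    qed
    have same: "ok v (\<lambda>a. ?y a v) \<longleftrightarrow> ok v (\<lambda>a. y a v)" if v: "v \<in> V" "v \<noteq> w" "v \<noteq> w2" for v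
    proof (rule ok_cong)
      fix a assume "a \<in> inc v"
      then have "a \<noteq> u" using v w2(1) inc_adj by auto
      then show "?y a v = y a v" using P(5) by simp
    qed
    show ?thesis
    proof (cases "w2 = w'")
      case True
      have ne: "x' \<noteq> u" using less.prems(8) w2(3) True by auto
      \<comment> \<open>Here the deficit meets the surplus: starting from \<open>?z\<close>, which
        satisfies \<open>w'\<close>, one unit is added at \<open>x'\<close> and one is removed at
        \<open>u\<close>.\<close>
      let ?z = "(\<lambda>a. y a w')(x' := 1)"
      have "ok w' (?z(x' := 2, u := 0))"
        by (rule ok_exchange[OF less.prems(3,6) _ ne less.prems(10)])
          (use w2V True ne w2(3) less.prems(12,14) uh in auto)
      moreover have "(\<lambda>a. ?y a w') = ?z(x' := 2, u := 0)"
        using less.prems(8) P(4,5) True t ne by (auto simp: fun_eq_iff)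
      ultimately have "ok w' (\<lambda>a. ?y a w')" by simp
      then have "\<forall>v\<in>V. ok v (\<lambda>a. ?y a v)" using okw same less.prems(11) True by metis
      then show ?thesis using P(1,2) by blast
    next
      case False
      have ok2: "ok w2 ((\<lambda>a. ?y a w2)(u := 1))"
      proof -
        have "((\<lambda>a. ?y a w2)(u := 1)) = (\<lambda>a. y a w2)" using w2(3) P(5) by (auto simp: fun_eq_iff)
        then show ?thesis using less.prems(11)[OF w2V(1) w2(2) False] by simp
      qed
      have x'u: "x' \<noteq> u"
      proof
        assume "x' = u"
        then have "w' \<in> adj u" using less.prems(3,6) inc_adj by auto
        then show False using w2(1) False less.prems(4) by auto
      qed
      have ok': "ok w' ((\<lambda>a. ?y a w')(x' := 1))"
      proof -
        have "ok w' ((\<lambda>a. ?y a w')(x' := 1)) \<longleftrightarrow> ok w' ((\<lambda>a. y a w')(x' := 1))"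
        proof (rule ok_cong)
          fix a assume "a \<in> inc w'"
          then have "a \<noteq> u" using less.prems(3,4) False w2(1) inc_adj by auto
          then show "((\<lambda>a. ?y a w')(x' := 1)) a = ((\<lambda>a. y a w')(x' := 1)) a" using P(5) by simp
        qed
        then show ?thesis using less.prems(10) by simp
      qed
      have "\<exists>y'. dist y' \<and> (\<forall>v\<in>V. ok v (\<lambda>u. y' u v)) \<and> half y' \<subseteq> half ?y"
      proof (rule less.hyps[OF card P(1) w2V(1) less.prems(3) False w2V(2) less.prems(6)])
        show "?y u w2 = 0" using P(4) t by simp
        show "?y x' w' = 2" using P(5)[OF x'u] less.prems(8) by simp
        show "ok w2 ((\<lambda>a. ?y a w2)(u := 1))" by (rule ok2)
        show "ok w' ((\<lambda>a. ?y a w')(x' := 1))" by (rule ok')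
        show "ok v (\<lambda>a. ?y a v)" if "v \<in> V" "v \<noteq> w2" "v \<noteq> w'" for v
          using that okw same[of v] less.prems(11)[of v] by (cases "v = w") auto
        show "\<not> sing a" if "a \<in> half ?y" for a using that less.prems(12) P(2) by auto
        show "\<not> sing u" using less.prems(12) uh by auto
        show "\<not> sing x'" by (rule less.prems(14))
      qed
      then show ?thesis unfolding P(2) by blast
    qed
  qed
qed

text \<open>A half vertex that is single at \<open>v\<close> is rounded towards \<open>v\<close>,
  where it only helps, and one violated end is left to \<open>push_one\<close>. Once no half vertex
  is single anywhere, any half vertex may be rounded: it causes a deficit at one end and a surplus
  at the other, as treated by \<open>push_two\<close>.\<close>

lemma round:
  assumes "dist y" "\<forall>v\<in>V. ok v (\<lambda>u. y u v)"
  shows "\<exists>y'. dist y' \<and> (\<forall>v\<in>V. ok v (\<lambda>u. y' u v)) \<and> half y' = {}"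
  using assms
proof (induction "card (half y)" arbitrary: y rule: less_induct)
  case less
  have step: ?case if "dist y'" "\<forall>v\<in>V. ok v (\<lambda>u. y' u v)" "half y' \<subseteq> half y - {x}" "x \<in> half y" for y' x
  proof -
    have "Finite_Set.finite (half y)" using finite by (simp add: half_def)
    moreover have "half y' \<subset> half y" using that by blast
    ultimately have "card (half y') < card (half y)" by (rule psubset_card_mono)
    then show ?thesis using less.hyps that by blast
  qed
  show ?case
  proof (cases "\<exists>x v. v \<in> V \<and> single x v \<and> y x v = 1")
    case True
    then obtain x v where xv: "v \<in> V" "single x v" "y x v = 1" by blast
    then have x: "x \<in> inc v" "x \<in> W" "v \<in> adj x" using inc_adj by (auto simp: single_def)
    obtain w where w: "adj x = {v, w}" "w \<noteq> v" "y x w = 1" using halfE[OF less.prems(1) x(2,3) xv(3)] .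
    let ?y = "put x v 2 y"
    note P = put[OF less.prems(1) x(2) w(1,2), of 2]
    have wV: "w \<in> V" "x \<in> inc w" using w(1) x by (auto simp: adj_def inc_def)
    \<comment> \<open>With value 2 at the single vertex the upper bound for the other two vertices
      is 4, which is their maximum.\<close>
    have okv: "ok v (\<lambda>a. ?y a v)"
    proof -
      obtain r b c where rbc: "inc v = {r, b, c}" "r \<noteq> b" "r \<noteq> c" "b \<noteq> c" "col b = col c" "col r \<noteq> col b"
        "single r v" "\<not> single b v" "\<not> single c v" using tripleE[of v] xv(2) by (metis single_def)
      have "r = x" using single_unique rbc(7) xv(2) by blast
      moreover have tr: "triple v" using xv(2) by (simp add: single_def)
      moreover have "?y b v \<le> 2" "?y c v \<le> 2"
        using inc_adj[OF xv(1), of b] inc_adj[OF xv(1), of c] rbc(1)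
        by (auto intro!: dist_le[OF P(1)])
      ultimately show ?thesis
        using P(3) by (auto simp: ok_triple[OF tr rbc(1-4,7-9)])
    qed
    have "\<exists>y'. dist y' \<and> (\<forall>v\<in>V. ok v (\<lambda>u. y' u v)) \<and> half y' \<subseteq> half ?y"
    proof (rule push_one[OF P(1) wV])
      have "((\<lambda>a. ?y a w)(x := 1)) = (\<lambda>a. y a w)" using w(3) P(5) by (auto simp: fun_eq_iff)
      then show "ok w ((\<lambda>a. ?y a w)(x := 1))" using less.prems(2) wV(1) by simp
      show "ok u (\<lambda>a. ?y a u)" if u: "u \<in> V" "u \<noteq> w" for u
      proof (cases "u = v")
        case False
        have "ok u (\<lambda>a. ?y a u) \<longleftrightarrow> ok u (\<lambda>a. y a u)"
        proof (rule ok_cong)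
          fix a assume "a \<in> inc u"
          then have "a \<noteq> x" using u False w(1) inc_adj by auto
          then show "?y a u = y a u" using P(5) by simp
        qed
        then show ?thesis using less.prems(2) u by simp
      qed (use okv in simp)
    qed (use P(4) in auto)
    then obtain y' where "dist y'" "\<forall>v\<in>V. ok v (\<lambda>u. y' u v)" "half y' \<subseteq> half ?y" by blast
    moreover have "x \<in> half y" using x xv(3) by (auto simp: half_def)
    ultimately show ?thesis using step[of y' x] P(2) by auto
  next
    case nosing: False
    have ns: "\<not> sing u" if "u \<in> half y" for u
    proof
      assume "sing u"
      then obtain v where v: "v \<in> V" "single u v" by (auto simp: sing_def)
      then have u: "u \<in> W" "v \<in> adj u" using inc_adj by (auto simp: single_def)
      obtain w where w: "w \<in> adj u" "y u w = 1" using \<open>u \<in> half y\<close> by (auto simp: half_def)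
      obtain w' where "adj u = {w, w'}" "y u w' = 1" using halfE[OF less.prems(1) u(1) w] .
      then have "y u v = 1" using u w by auto
      then show False using nosing v by blast
    qed
    show ?thesis
    proof (cases "half y = {}")
      case True
      then show ?thesis using less.prems by blast
    next
      case False
      then obtain x where xh: "x \<in> half y" by blast
      then obtain w where w: "x \<in> W" "w \<in> adj x" "y x w = 1" by (auto simp: half_def)
      obtain w' where w': "adj x = {w, w'}" "w' \<noteq> w" "y x w' = 1" using halfE[OF less.prems(1) w] .
      let ?y = "put x w 0 y"
      note P = put[OF less.prems(1) w(1) w'(1,2), of 0]
      have V: "w \<in> V" "w' \<in> V" "x \<in> inc w" "x \<in> inc w'" using w'(1) w(1) by (auto simp: adj_def inc_def)
      have "\<exists>y'. dist y' \<and> (\<forall>v\<in>V. ok v (\<lambda>u. y' u v)) \<and> half y' \<subseteq> half ?y"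
      proof (rule push_two[OF P(1) V(1,2) w'(2)[symmetric] V(3,4)])
        have "((\<lambda>a. ?y a w)(x := 1)) = (\<lambda>a. y a w)" using w(3) P(5) by (auto simp: fun_eq_iff)
        then show "ok w ((\<lambda>a. ?y a w)(x := 1))" using less.prems(2) V by simp
        have "((\<lambda>a. ?y a w')(x := 1)) = (\<lambda>a. y a w')" using w'(3) P(5) by (auto simp: fun_eq_iff)
        then show "ok w' ((\<lambda>a. ?y a w')(x := 1))" using less.prems(2) V by simp
        show "ok u (\<lambda>a. ?y a u)" if u: "u \<in> V" "u \<noteq> w" "u \<noteq> w'" for u
        proof -
          have "ok u (\<lambda>a. ?y a u) \<longleftrightarrow> ok u (\<lambda>a. y a u)"
          proof (rule ok_cong)
            fix a assume "a \<in> inc u"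
            then have "a \<noteq> x" using u w'(1) inc_adj by auto
            then show "?y a u = y a u" using P(5) by simp
          qed
          then show ?thesis using less.prems(2) u by simp
        qed
        show "\<not> sing u" if "u \<in> half ?y" for u using that ns P(2) by auto
        show "\<not> sing x" "\<not> sing x" using ns xh by auto
      qed (use P(3,4) in auto)
      then obtain y' where "dist y'" "\<forall>v\<in>V. ok v (\<lambda>u. y' u v)" "half y' \<subseteq> half ?y" by blast
      then show ?thesis using step[of y' x] P(2) xh by auto
    qed
  qed
qed

text \<open>After rounding, all values are 0 or 2 and describe an assignment. For such values,
  \<open>ok\<close> expresses that the set received is fair and non-empty: a load of 2 in one colour
  is a single vertex.\<close>

theorem dist_covering:
  assumes "dist y" "\<forall>v\<in>V. ok v (\<lambda>u. y u v)"
  shows "\<exists>f. feasible f \<and> covers f"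
proof -
  obtain y where y: "dist y" "\<forall>v\<in>V. ok v (\<lambda>u. y u v)" "half y = {}" using round[OF assms] by blast
  have val: "y x v = 0 \<or> y x v = 2" if "x \<in> W" "v \<in> adj x" for x v
  proof -
    have "y x v \<le> 2" using dist_le[OF y(1) that] .
    moreover have "y x v \<noteq> 1" using y(3) that by (auto simp: half_def)
    ultimately show ?thesis by auto
  qed
  have ex1: "\<exists>!v. v \<in> adj x \<and> y x v = 2" if x: "x \<in> W" for x
  proof -
    have s: "(\<Sum>v\<in>adj x. y x v) = 2" using y(1) x by (simp add: dist_def)
    have "\<exists>v. v \<in> adj x \<and> y x v = 2"
    proof (rule ccontr)
      assume "\<not> ?thesis"
      then have "(\<Sum>v\<in>adj x. y x v) = 0" using val[OF x] by (intro sum.neutral) auto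
      then show False using s by simp
    qed
    then obtain v where v: "v \<in> adj x" "y x v = 2" by blast
    then have "(\<Sum>u\<in>adj x - {v}. y x u) = 0"
      using s finite_sub(3)[of x] by (simp add: sum.remove[of "adj x" v])
    then have "\<forall>u\<in>adj x - {v}. y x u = 0" using finite_sub(3)[of x] by simp
    then show ?thesis using v by (intro ex1I[of _ v]) (auto, force)
  qed
  define f where "f x = (THE v. v \<in> adj x \<and> y x v = 2)" for x
  have f: "f x \<in> adj x \<and> y x (f x) = 2" if "x \<in> W" for x
    unfolding f_def by (rule theI'[OF ex1[OF that]])
  have slot: "slot f v = {x\<in>inc v. y x v = 2}" if "v \<in> V" for v
    using f ex1 that by (auto simp: slot_def inc_adj adj_def)
  have z: "y x v = (if x \<in> slot f v then 2 else 0)" if "v \<in> V" "x \<in> inc v" for x v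
    using slot[OF that(1)] val[of x v] that inc_adj by auto
  have sub: "slot f v \<subseteq> inc v" if "v \<in> V" for v using slot[OF that] by auto
  have ne: "slot f v \<noteq> {}" if v: "v \<in> V" for v
  proof
    assume "slot f v = {}"
    then have "(\<Sum>x\<in>inc v. y x v) = 0" using z[OF v] by simp
    then show False using y(2) v by (auto simp: ok_def split: if_splits)
  qed
  have "fair (slot f v)" if v: "v \<in> V" for v
  proof -
    consider "mono v" | "triple v" | "\<not> mono v" "\<not> triple v" by (auto simp: triple_def)
    then show ?thesis
    proof cases
      case 1
      have "(\<Sum>x\<in>inc v. y x v) = (\<Sum>x\<in>slot f v. 2)"
        using z[OF v] sub[OF v] finite_sub(2)[of v] by (intro sum.mono_neutral_cong_right) auto
      moreover have "ok v (\<lambda>u. y u v)" using y(2) v by blast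
      then have "(\<Sum>x\<in>inc v. y x v) = 2" by (simp only: ok_mono[OF 1])
      ultimately have "2 * card (slot f v) = 2" by simp
      then show ?thesis using fair_mono[OF v 1 sub[OF v]] by simp
    next
      case 2
      obtain r b c where rbc: "inc v = {r, b, c}" "r \<noteq> b" "r \<noteq> c" "b \<noteq> c" "col b = col c" "col r \<noteq> col b"
        "single r v" "\<not> single b v" "\<not> single c v" using tripleE[OF 2] .
      have "y b v + y c v \<le> 2 + y r v"
        using y(2) v ok_triple[OF 2 rbc(1-4,7-9), of "\<lambda>u. y u v"] by simp
      then show ?thesis
        using fair_triple[OF v rbc(1-6) sub[OF v]] z[OF v] rbc(1) by (auto split: if_splits)
    next
      case 3
      then show ?thesis using fair_pair[OF v _ _ sub[OF v]] by blast
    qed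
  qed
  then have "feasible f" using f by (auto simp: feasible_def)
  moreover have "covers f" using ne by (simp add: covers_def)
  ultimately show ?thesis by blast
qed

end

lemma subset_three:
  assumes "S \<subseteq> {r, b, c}"
  shows "S = {} \<or> S = {r} \<or> S = {b} \<or> S = {c} \<or> S = {r, b} \<or> S = {r, c} \<or> S = {b, c} \<or> S = {r, b, c}"
proof -
  have "S \<in> Pow {r, b, c}" using assms by simp
  then have "S \<in> {{}, {r}, {b}, {c}, {r, b}, {r, c}, {b, c}, {r, b, c}}"
    by (auto simp: Pow_insert)
  then show ?thesis by (simp only: insert_iff empty_iff simp_thms)
qed

context two_colours
begin

subsection \<open>A graph whose fractional perfect matchings are the half-integral assignments\<close>

text \<open>
  A left vertex \<open>x\<close> is represented by \<open>(0, [x], [])\<close>, and a right vertex \<open>v\<close> by nodes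
  \<open>(i, [], [v])\<close>. Nodes 1 and 2 of a triple serve its two vertices \<open>b, c\<close> of equal colour, nodes 3 and
  4 its single vertex \<open>r\<close>. Node 5 is joined to all of them, and 1 to 3, which leaves
  \<open>2 - y\<^sub>1\<^sub>3 - y\<^sub>5\<close> units for \<open>b, c\<close> beyond two and \<open>2 - y\<^sub>1\<^sub>3 + y\<^sub>5\<close> for \<open>r\<close>. Node 6 is
  optional, being joined to itself.
\<close>

abbreviation X :: "'a \<Rightarrow> nat \<times> 'a list \<times> 'b list" where "X x \<equiv> (0, [x], [])"

abbreviation Nd :: "nat \<Rightarrow> 'b \<Rightarrow> nat \<times> 'a list \<times> 'b list" where "Nd i v \<equiv> (i, [], [v])"

definition sl :: "'a \<Rightarrow> 'b \<Rightarrow> nat set" where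
  "sl x v = (if mono v then {1} else if triple v then if single x v then {3, 4, 6} else {1, 2} else {1, 6})"

definition ns :: "'b \<Rightarrow> nat \<Rightarrow> nat set" where
  "ns v i = (if triple v then if i = 1 then {3, 5} else if i = 2 then {5} else if i = 3 then {1, 5}
       else if i = 4 then {5} else if i = 5 then {1, 2, 3, 4} else {6}
     else if \<not> mono v \<and> i = 6 then {6} else {})"

definition nodes :: "'b \<Rightarrow> nat set" where
  "nodes v = (if mono v then {1} else if triple v then {1, 2, 3, 4, 5, 6} else {1, 6})"

definition verts :: "(nat \<times> 'a list \<times> 'b list) set" where
  "verts = X ` W \<union> (\<Union>v\<in>V. (\<lambda>i. Nd i v) ` nodes v)"

definition nbh :: "nat \<times> 'a list \<times> 'b list \<Rightarrow> (nat \<times> 'a list \<times> 'b list) set" where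
  "nbh p = (if fst p = 0 then \<Union>v\<in>adj (hd (fst (snd p))). (\<lambda>j. Nd j v) ` sl (hd (fst (snd p))) v
     else X ` {x\<in>inc (hd (snd (snd p))). fst p \<in> sl x (hd (snd (snd p)))} \<union>
       (\<lambda>j. Nd j (hd (snd (snd p)))) ` ns (hd (snd (snd p))) (fst p))"

lemma nbh_X: "nbh (X x) = (\<Union>v\<in>adj x. (\<lambda>j. Nd j v) ` sl x v)"
  by (simp add: nbh_def)

lemma nbh_Nd: "i > 0 \<Longrightarrow> nbh (Nd i v) = X ` {x\<in>inc v. i \<in> sl x v} \<union> (\<lambda>j. Nd j v) ` ns v i"
  by (simp add: nbh_def)

lemma nodes_pos: "i \<in> nodes v \<Longrightarrow> i > 0"
  by (auto simp: nodes_def split: if_splits)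

lemma sl_nodes: "sl x v \<subseteq> nodes v"
  by (auto simp: sl_def nodes_def)

lemma ns_nodes: "i \<in> nodes v \<Longrightarrow> ns v i \<subseteq> nodes v"
  by (auto simp: ns_def nodes_def triple_def split: if_splits)

lemma ns_sym: "i \<in> nodes v \<Longrightarrow> j \<in> nodes v \<Longrightarrow> j \<in> ns v i \<Longrightarrow> i \<in> ns v j"
  by (auto simp: ns_def nodes_def triple_def split: if_splits)

lemma finite_verts: "Finite_Set.finite verts"
proof -
  have "Finite_Set.finite (nodes v)" for v by (simp add: nodes_def)
  then show ?thesis using finite by (simp add: verts_def)
qed

lemma verts_cases:
  assumes "p \<in> verts"
  obtains (left) x where "x \<in> W" "p = X x" | (right) i v where "v \<in> V" "i \<in> nodes v" "i > 0" "p = Nd i v"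
  using assms nodes_pos by (auto simp: verts_def)

lemma nbh_verts: "p \<in> verts \<Longrightarrow> nbh p \<subseteq> verts"
proof (elim verts_cases)
  fix x assume "x \<in> W" "p = X x"
  then show ?thesis using sl_nodes by (fastforce simp: nbh_X verts_def adj_def)
next
  fix i v assume "v \<in> V" "i \<in> nodes v" "i > 0" "p = Nd i v"
  then show ?thesis using ns_nodes by (fastforce simp: nbh_Nd verts_def inc_def)
qed

lemma nbh_sym:
  assumes "p \<in> verts" "q \<in> verts" "q \<in> nbh p"
  shows "p \<in> nbh q"
  using assms(1)
proof (cases rule: verts_cases)
  case (left x)
  then obtain v j where "v \<in> adj x" "j \<in> sl x v" "q = Nd j v" using assms(3) by (auto simp: nbh_X)
  moreover have "x \<in> inc v" "j > 0"
    using calculation left sl_nodes[of x v] nodes_pos[of j v] by (auto simp: adj_def inc_def)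
  ultimately show ?thesis using left by (simp add: nbh_Nd)
next
  case (right i v)
  then consider x where "x \<in> inc v" "i \<in> sl x v" "q = X x" | j where "j \<in> ns v i" "q = Nd j v"
    using assms(3) by (auto simp: nbh_Nd)
  then show ?thesis
  proof cases
    case 1
    then have "v \<in> adj x" using right(1) by (simp add: inc_adj)
    then show ?thesis using 1 right by (auto simp: nbh_X)
  next
    case 2
    then have "j \<in> nodes v" using ns_nodes right(2) by blast
    then show ?thesis using 2 right ns_sym[of i v j] nodes_pos by (simp add: nbh_Nd)
  qed
qed

text \<open>The nodes of a right vertex and the left vertices placed there have a perfect matching
  along the edges, the optional node 6 possibly with itself. The witnesses at a triple follow the
  four kinds of fair non-empty sets: \<open>r\<close> alone, one majority vertex, \<open>r\<close>
  with one of them, and all three.\<close>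

lemma local_matching:
  assumes f: "feasible f" "covers f" and v: "v \<in> V"
  defines "G \<equiv> (\<lambda>i. Nd i v) ` nodes v \<union> X ` slot f v"
  shows "\<exists>q. \<forall>p\<in>G. q p \<in> G \<and> q p \<in> nbh p \<and> q (q p) = p"
proof -
  have sub: "slot f v \<subseteq> inc v" by (rule at_inc[OF f(1)])
  have ne: "slot f v \<noteq> {}" using f(2) v by (simp add: covers_def)
  have fair: "fair (slot f v)" using f(1) v by (simp add: feasible_def)
  have va: "v \<in> adj x" if "x \<in> inc v" for x using that v inc_adj by blast
  have XN: "Nd j v \<in> nbh (X x)" if "x \<in> inc v" "j \<in> sl x v" for x j
    using va[OF that(1)] that(2) by (auto simp: nbh_X)
  consider (mono) "mono v" | (triple) "triple v" | (pair) "\<not> mono v" "\<not> triple v" by (auto simp: triple_def)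
  then show ?thesis
  proof cases
    case mono
    have "card (slot f v) \<le> 1" using fair fair_mono[OF v mono sub] by blast
    then obtain x where x: "slot f v = {x}"
      using ne finite_sub(4) by (metis card_1_singletonE card_0_eq le_neq_implies_less less_one)
    have G: "G = {Nd 1 v, X x}" using mono x by (auto simp: G_def nodes_def)
    have xi: "x \<in> inc v" using sub x by auto
    have s: "sl x v = {1}" using mono by (simp add: sl_def)
    show ?thesis
      unfolding G by (rule exI[of _ "id(Nd 1 v := X x, X x := Nd 1 v)"])
        (use XN[OF xi] s xi in \<open>auto simp: nbh_Nd\<close>)
  next
    case pair
    obtain x y where xy: "inc v = {x, y}" "x \<noteq> y" using pairE[OF v pair] .
    have s: "sl z v = {1, 6}" for z using pair by (simp add: sl_def)
    have n: "ns v 6 = {6}" using pair by (simp add: ns_def)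
    have "slot f v = {x} \<or> slot f v = {y} \<or> slot f v = {x, y}" using sub ne xy by auto
    then consider z where "z \<in> inc v" "slot f v = {z}" | "slot f v = {x, y}" using xy(1) by auto
    then show ?thesis
    proof cases
      case 1
      have G: "G = {Nd 1 v, Nd 6 v, X z}" using pair 1 by (auto simp: G_def nodes_def)
      show ?thesis
        unfolding G by (rule exI[of _ "id(Nd 1 v := X z, X z := Nd 1 v)"])
          (use XN[OF 1(1)] s n 1 in \<open>auto simp: nbh_Nd\<close>)
    next
      case 2
      have G: "G = {Nd 1 v, Nd 6 v, X x, X y}" using pair 2 by (auto simp: G_def nodes_def)
      have i: "x \<in> inc v" "y \<in> inc v" using xy by auto
      show ?thesis
        unfolding G by (rule exI[of _ "id(Nd 1 v := X x, X x := Nd 1 v, Nd 6 v := X y, X y := Nd 6 v)"])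
          (use XN[OF i(1)] XN[OF i(2)] s n i xy in \<open>auto simp: nbh_Nd\<close>)
    qed
  next
    case triple
    obtain r b c where rbc: "inc v = {r, b, c}" "r \<noteq> b" "r \<noteq> c" "b \<noteq> c" "col b = col c" "col r \<noteq> col b"
      "single r v" "\<not> single b v" "\<not> single c v" using tripleE[OF triple] .
    have nm: "\<not> mono v" using triple by (simp add: triple_def)
    have s: "sl r v = {3, 4, 6}" "sl b v = {1, 2}" "sl c v = {1, 2}" using triple nm rbc by (auto simp: sl_def)
    have n: "ns v 1 = {3, 5}" "ns v 2 = {5}" "ns v 3 = {1, 5}" "ns v 4 = {5}" "ns v 5 = {1, 2, 3, 4}" "ns v 6 = {6}"
      using triple by (auto simp: ns_def)
    have i: "r \<in> inc v" "b \<in> inc v" "c \<in> inc v" using rbc by auto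
    have G: "G = {Nd 1 v, Nd 2 v, Nd 3 v, Nd 4 v, Nd 5 v, Nd 6 v} \<union> X ` slot f v"
      using triple nm by (auto simp: G_def nodes_def)
    have "slot f v \<noteq> {b, c}"
      using fair fair_triple[OF v rbc(1-6) sub] rbc(2,3) by auto
    then consider "slot f v = {r}" | z where "z = b \<or> z = c" "slot f v = {z}" |
      z where "z = b \<or> z = c" "slot f v = {r, z}" | "slot f v = {r, b, c}"
      using ne subset_three[OF sub[unfolded rbc(1)]] by blast
    then show ?thesis
    proof cases
      case 1
      show ?thesis
        unfolding G 1 by (rule exI[of _ "id(Nd 1 v := Nd 3 v, Nd 3 v := Nd 1 v, Nd 2 v := Nd 5 v, Nd 5 v := Nd 2 v,
            Nd 4 v := X r, X r := Nd 4 v)"]) (use XN[OF i(1)] s n i in \<open>auto simp: nbh_Nd\<close>)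
    next
      case 2
      then have z: "z \<in> inc v" "sl z v = {1, 2}" using i s by auto
      show ?thesis
        unfolding G 2 by (rule exI[of _ "id(Nd 1 v := Nd 3 v, Nd 3 v := Nd 1 v, Nd 2 v := X z, X z := Nd 2 v,
            Nd 4 v := Nd 5 v, Nd 5 v := Nd 4 v)"]) (use XN[OF z(1)] z n in \<open>auto simp: nbh_Nd\<close>)
    next
      case 3
      then have z: "z \<in> inc v" "sl z v = {1, 2}" "z \<noteq> r" using i s rbc by auto
      show ?thesis
        unfolding G 3 by (rule exI[of _ "id(Nd 1 v := Nd 3 v, Nd 3 v := Nd 1 v, Nd 2 v := X z, X z := Nd 2 v,
            Nd 4 v := Nd 5 v, Nd 5 v := Nd 4 v, Nd 6 v := X r, X r := Nd 6 v)"])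
          (use XN[OF z(1)] XN[OF i(1)] z n s i in \<open>auto simp: nbh_Nd\<close>)
    next
      case 4
      show ?thesis
        unfolding G 4 by (rule exI[of _ "id(Nd 1 v := X b, X b := Nd 1 v, Nd 2 v := X c, X c := Nd 2 v,
            Nd 3 v := Nd 5 v, Nd 5 v := Nd 3 v, Nd 4 v := X r, X r := Nd 4 v)"])
          (use XN[OF i(1)] XN[OF i(2)] XN[OF i(3)] n s i rbc(2-4) in \<open>auto simp: nbh_Nd\<close>)
    qed
  qed
qed

lemma covering_imp_sdr:
  assumes f: "feasible f" "covers f"
  shows "has_sdr verts nbh"
proof -
  define G where "G v = (\<lambda>i. Nd i v) ` nodes v \<union> X ` slot f v" for v
  have "\<exists>q. \<forall>p\<in>G v. q p \<in> G v \<and> q p \<in> nbh p \<and> q (q p) = p" if "v \<in> V" for v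
    using local_matching[OF f that] by (simp add: G_def)
  then have "\<exists>q. \<forall>v\<in>V. \<forall>p\<in>G v. q v p \<in> G v \<and> q v p \<in> nbh p \<and> q v (q v p) = p"
    by (intro bchoice) blast
  then obtain q where q: "\<And>v p. v \<in> V \<Longrightarrow> p \<in> G v \<Longrightarrow> q v p \<in> G v \<and> q v p \<in> nbh p \<and> q v (q v p) = p"
    by blast
  \<comment> \<open>The sets \<open>G v\<close> partition \<open>verts\<close>, and
    \<open>pos p\<close> is the right vertex whose part contains \<open>p\<close>; so the local
    matchings combine to a permutation.\<close>
  define pos where "pos p = (if fst p = (0 :: nat) then f (hd (fst (snd p))) else hd (snd (snd p)))"
    for p :: "nat \<times> 'a list \<times> 'b list"
  have G: "v = pos p" if pG: "p \<in> G v" for p v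
  proof -
    consider i where "i \<in> nodes v" "p = Nd i v" | x where "x \<in> slot f v" "p = X x"
      using pG by (auto simp: G_def)
    then show ?thesis
    proof cases
      case 1
      then show ?thesis using nodes_pos[of i v] by (simp add: pos_def)
    qed (simp add: pos_def slot_def)
  qed
  have pos: "pos p \<in> V \<and> p \<in> G (pos p)" if "p \<in> verts" for p
    using that
  proof (cases rule: verts_cases)
    case (left x)
    then show ?thesis using f(1) by (auto simp: pos_def G_def slot_def feasible_def adj_def)
  qed (auto simp: pos_def G_def)
  define g where "g p = q (pos p) p" for p
  have gp: "g p \<in> G (pos p)" "g p \<in> nbh p" "q (pos p) (g p) = p" if "p \<in> verts" for p
    using q pos[OF that] by (auto simp: g_def)
  have "inj_on g verts"
  proof (rule inj_onI)
    fix p p' assume p: "p \<in> verts" "p' \<in> verts" "g p = g p'"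
    then have "pos p = pos p'" using G gp(1)[OF p(1)] gp(1)[OF p(2)] by metis
    then show "p = p'" using gp(3)[OF p(1)] gp(3)[OF p(2)] p(3) by metis
  qed
  then show ?thesis using gp(2) by (auto simp: has_sdr_def)
qed

text \<open>By finiteness \<open>g\<close> permutes \<open>verts\<close>. The permutation and its
  inverse together give a symmetric weight with total 2 at each node, and summing the weights
  between \<open>x\<close> and the nodes of \<open>v\<close> yields a distribution that satisfies
  \<open>ok\<close>.\<close>

lemma sdr_imp_covering:
  assumes "has_sdr verts nbh"
  shows "\<exists>f. feasible f \<and> covers f"
proof -
  obtain g where g: "inj_on g verts" "\<And>p. p \<in> verts \<Longrightarrow> g p \<in> nbh p"
    using assms by (auto simp: has_sdr_def)
  have gv: "g ` verts \<subseteq> verts" using g(2) nbh_verts by blast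
  then have gsurj: "g ` verts = verts"
    using finite_verts g(1) by (simp add: endo_inj_surj)
  define h where "h p q = (if g p = q then 1 else 0) + (if g q = p then 1 else 0 :: nat)" for p q
  have hsym: "h p q = h q p" for p q by (simp add: h_def)
  have total: "(\<Sum>q\<in>nbh p. h p q) = 2" if p: "p \<in> verts" for p
  proof -
    have "(\<Sum>q\<in>verts. if g p = q then 1 else 0 :: nat) = 1"
      using gv p finite_verts by (auto simp: sum.delta)
    moreover have "(\<Sum>q\<in>verts. if g q = p then 1 else 0 :: nat) = 1"
    proof -
      have "p \<in> g ` verts" using gsurj p by simp
      then obtain q0 where q0: "q0 \<in> verts" "g q0 = p" by (elim imageE) simp
      have "(\<Sum>q\<in>verts. if g q = p then 1 else 0 :: nat) = (\<Sum>q\<in>verts. if q0 = q then 1 else 0)"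
      proof (rule sum.cong[OF refl])
        fix q assume "q \<in> verts"
        then have "g q = p \<longleftrightarrow> q0 = q" using inj_on_eq_iff[OF g(1) q0(1)] q0(2) by metis
        then show "(if g q = p then 1 else 0 :: nat) = (if q0 = q then 1 else 0)" by simp
      qed
      then show ?thesis using q0 finite_verts by (simp add: sum.delta)
    qed
    ultimately have s: "(\<Sum>q\<in>verts. h p q) = 2" by (simp add: h_def sum.distrib)
    have "(\<Sum>q\<in>nbh p. h p q) = (\<Sum>q\<in>verts. h p q)"
    proof (rule sum.mono_neutral_left)
      show "\<forall>q\<in>verts - nbh p. h p q = 0"
      proof
        fix q assume q: "q \<in> verts - nbh p"
        then have "g p \<noteq> q" using g(2)[OF p] by auto
        moreover have "g q \<noteq> p" using g(2)[of q] nbh_sym[of q p] p q by auto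
        ultimately show "h p q = 0" by (simp add: h_def)
      qed
    qed (use finite_verts nbh_verts[OF p] in auto)
    then show ?thesis using s by simp
  qed
  define y where "y x v = (\<Sum>j\<in>sl x v. h (X x) (Nd j v))" for x v
  have fin_sl: "Finite_Set.finite (sl x v)" for x v by (simp add: sl_def)
  have fin_ns: "Finite_Set.finite (ns v i)" for i v by (simp add: ns_def)
  have "dist y"
    unfolding dist_def
  proof
    fix x assume x: "x \<in> W"
    then have "2 = (\<Sum>q\<in>nbh (X x). h (X x) q)" using total[of "X x"] by (simp add: verts_def)
    also have "\<dots> = (\<Sum>v\<in>adj x. \<Sum>q\<in>(\<lambda>j. Nd j v) ` sl x v. h (X x) q)"
      unfolding nbh_X using finite_sub(3)[of x] fin_sl by (intro sum.UNION_disjoint) auto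
    also have "\<dots> = (\<Sum>v\<in>adj x. y x v)"
      unfolding y_def by (intro sum.cong refl, subst sum.reindex) (auto simp: inj_on_def)
    finally show "(\<Sum>v\<in>adj x. y x v) = 2" by simp
  qed
  moreover have "ok v (\<lambda>u. y u v)" if v: "v \<in> V" for v
  proof -
    have node: "(\<Sum>x | x \<in> inc v \<and> i \<in> sl x v. h (X x) (Nd i v)) + (\<Sum>j\<in>ns v i. h (Nd i v) (Nd j v)) = 2"
      if i: "i \<in> nodes v" for i
    proof -
      have fin: "Finite_Set.finite {x. x \<in> inc v \<and> i \<in> sl x v}" using finite_sub(2)[of v] by simp
      have "Nd i v \<in> verts" using v i by (auto simp: verts_def)
      then have "2 = (\<Sum>q\<in>nbh (Nd i v). h (Nd i v) q)" using total by simp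
      also have "\<dots> = (\<Sum>q\<in>X ` {x\<in>inc v. i \<in> sl x v}. h (Nd i v) q) + (\<Sum>q\<in>(\<lambda>j. Nd j v) ` ns v i. h (Nd i v) q)"
        unfolding nbh_Nd[OF nodes_pos[OF i]] using fin fin_ns by (intro sum.union_disjoint) auto
      also have "(\<Sum>q\<in>X ` {x\<in>inc v. i \<in> sl x v}. h (Nd i v) q) = (\<Sum>x | x \<in> inc v \<and> i \<in> sl x v. h (X x) (Nd i v))"
        by (subst sum.reindex) (auto simp: inj_on_def hsym[of "Nd i v"])
      also have "(\<Sum>q\<in>(\<lambda>j. Nd j v) ` ns v i. h (Nd i v) q) = (\<Sum>j\<in>ns v i. h (Nd i v) (Nd j v))"
        by (subst sum.reindex) (auto simp: inj_on_def)
      finally show ?thesis by simp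
    qed
    consider (mono) "mono v" | (triple) "triple v" | (pair) "\<not> mono v" "\<not> triple v" by (auto simp: triple_def)
    then show ?thesis
    proof cases
      case mono
      have s: "sl x v = {1}" for x using mono by (simp add: sl_def)
      have "ns v 1 = {}" using mono by (simp add: ns_def triple_def)
      then have "(\<Sum>x\<in>inc v. h (X x) (Nd 1 v)) = 2" using node[of 1] mono by (simp add: nodes_def s)
      then show ?thesis using mono by (simp add: ok_mono y_def s)
    next
      case pair
      have s: "sl x v = {1, 6}" for x using pair by (simp add: sl_def)
      have "ns v 1 = {}" using pair by (simp add: ns_def)
      then have "2 = (\<Sum>x\<in>inc v. h (X x) (Nd 1 v))" using node[of 1] pair by (simp add: nodes_def s)
      also have "\<dots> \<le> (\<Sum>x\<in>inc v. y x v)" by (intro sum_mono) (simp add: y_def s)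
      finally show ?thesis using pair by (simp add: ok_def)
    next
      case triple
      obtain r b c where rbc: "inc v = {r, b, c}" "r \<noteq> b" "r \<noteq> c" "b \<noteq> c" "col b = col c" "col r \<noteq> col b"
        "single r v" "\<not> single b v" "\<not> single c v" using tripleE[OF triple] .
      have nm: "\<not> mono v" using triple by (simp add: triple_def)
      have s: "sl r v = {3, 4, 6}" "sl b v = {1, 2}" "sl c v = {1, 2}" using triple nm rbc by (auto simp: sl_def)
      have n: "ns v 1 = {3, 5}" "ns v 2 = {5}" "ns v 3 = {1, 5}" "ns v 4 = {5}" "ns v 5 = {1, 2, 3, 4}"
        using triple by (auto simp: ns_def)
      have "{x. x \<in> inc v \<and> i \<in> sl x v} = (if i = 1 \<or> i = 2 then {b, c} else if i \<in> {3, 4, 6} then {r} else {})" for i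
        unfolding rbc(1) using s rbc(2-4) by auto
      note sets = this
      let ?H = "\<lambda>i j. h (Nd i v) (Nd j v)" and ?h = "\<lambda>x i. h (X x) (Nd i v)"
      have nd: "1 \<in> nodes v" "2 \<in> nodes v" "3 \<in> nodes v" "4 \<in> nodes v" "5 \<in> nodes v"
        using triple nm by (auto simp: nodes_def)
      have 1: "?h b 1 + ?h c 1 + (?H 1 3 + ?H 1 5) = 2" using node[OF nd(1)] rbc(4) unfolding sets n by simp
      have 2: "?h b 2 + ?h c 2 + ?H 2 5 = 2" using node[OF nd(2)] rbc(4) unfolding sets n by simp
      have 3: "?h r 3 + (?H 3 1 + ?H 3 5) = 2" using node[OF nd(3)] unfolding sets n by simp
      have 4: "?h r 4 + ?H 4 5 = 2" using node[OF nd(4)] unfolding sets n by simp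
      have 5: "?H 5 1 + (?H 5 2 + (?H 5 3 + ?H 5 4)) = 2" using node[OF nd(5)] unfolding sets n by simp
      have sym: "?H 3 1 = ?H 1 3" "?H 5 1 = ?H 1 5" "?H 5 2 = ?H 2 5" "?H 5 3 = ?H 3 5" "?H 5 4 = ?H 4 5"
        by (rule hsym)+
      have yy: "y r v = ?h r 3 + (?h r 4 + ?h r 6)" "y b v = ?h b 1 + ?h b 2" "y c v = ?h c 1 + ?h c 2"
        unfolding y_def s by simp_all
      \<comment> \<open>Adding the equations of nodes 1 to 4 and using that of node 5, the total
        load is at least \<open>6 - 2 * ?H 1 3\<close>. This is where the lower bound 2 comes from;
        the other inequality uses only that weights are non-negative.\<close>
      have "?H 1 3 \<le> 2" by (simp add: h_def)
      then show ?thesis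
        unfolding ok_triple[OF triple rbc(1-4,7-9)] yy using 1 2 3 4 5 unfolding sym by linarith
    qed
  qed
  ultimately show ?thesis using dist_covering by blast
qed

theorem covering_iff_graph: "(\<exists>f. feasible f \<and> covers f) \<longleftrightarrow> has_sdr verts nbh"
  using covering_imp_sdr sdr_imp_covering by blast

end

section \<open>The decision procedures\<close>

type_synonym 'a inst = "('a \<times> 'a) list \<times> 'a list \<times> ('a \<times> 'a) list \<times> 'a list \<times> nat"

abbreviation ius :: "'a inst \<Rightarrow> ('a \<times> 'a) list" where "ius J \<equiv> fst J"
abbreviation ivs :: "'a inst \<Rightarrow> 'a list" where "ivs J \<equiv> fst (snd J)"
abbreviation ies :: "'a inst \<Rightarrow> ('a \<times> 'a) list" where "ies J \<equiv> fst (snd (snd J))"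
abbreviation ics :: "'a inst \<Rightarrow> 'a list" where "ics J \<equiv> fst (snd (snd (snd J)))"
abbreviation il :: "'a inst \<Rightarrow> nat" where "il J \<equiv> snd (snd (snd (snd J)))"

definition linc :: "'a inst \<Rightarrow> 'a \<Rightarrow> ('a \<times> 'a) list" where
  "linc J v = filter (\<lambda>x. (fst x, v) \<in> set (ies J)) (ius J)"

definition ladj :: "'a inst \<Rightarrow> 'a \<times> 'a \<Rightarrow> 'a list" where
  "ladj J x = filter (\<lambda>v. (fst x, v) \<in> set (ies J)) (ivs J)"

definition lcnt :: "('a \<times> 'a) list \<Rightarrow> 'a \<Rightarrow> nat" where
  "lcnt S c = length (filter (\<lambda>x. snd x = c) S)"

definition lfair :: "'a inst \<Rightarrow> ('a \<times> 'a) list \<Rightarrow> bool" where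
  "lfair J S \<longleftrightarrow> (\<forall>c\<in>set (ics J). \<forall>d\<in>set (ics J). lcnt S c \<le> lcnt S d + il J)"

definition lcap :: "nat \<Rightarrow> 'a inst \<Rightarrow> nat" where
  "lcap d J = (if length (ics J) = 1 \<or> d \<le> il J then d else il J)"

definition lrainbow :: "'a inst \<Rightarrow> 'a \<Rightarrow> bool" where
  "lrainbow J v \<longleftrightarrow> (\<forall>c\<in>set (ics J). \<exists>x\<in>set (linc J v). snd x = c)"

definition lmono :: "'a inst \<Rightarrow> 'a \<Rightarrow> bool" where
  "lmono J v \<longleftrightarrow> (\<forall>x\<in>set (linc J v). \<forall>y\<in>set (linc J v). snd x = snd y)"

definition ltriple :: "'a inst \<Rightarrow> 'a \<Rightarrow> bool" where
  "ltriple J v \<longleftrightarrow> \<not> lmono J v \<and> length (linc J v) = 3"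

definition lsingle :: "'a inst \<Rightarrow> 'a \<times> 'a \<Rightarrow> 'a \<Rightarrow> bool" where
  "lsingle J x v \<longleftrightarrow> ltriple J v \<and> x \<in> set (linc J v) \<and> (\<forall>y\<in>set (linc J v). y \<noteq> x \<longrightarrow> snd y \<noteq> snd x)"

definition lplaces :: "'a inst \<Rightarrow> 'a \<times> 'a \<Rightarrow> 'a \<Rightarrow> (('a \<times> 'a) list \<times> 'a list) list" where
  "lplaces J x v = (if lmono J v then [([], [v])]
     else if ltriple J v then ([], [v]) # map (\<lambda>r. ([r], [])) (filter (\<lambda>r. lsingle J r v) (linc J v))
     else [([x], [v])])"

definition lsl :: "'a inst \<Rightarrow> 'a \<times> 'a \<Rightarrow> 'a \<Rightarrow> nat list" where
  "lsl J x v = (if lmono J v then [1] else if ltriple J v then if lsingle J x v then [3, 4, 6] else [1, 2] else [1, 6])"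

definition lns :: "'a inst \<Rightarrow> 'a \<Rightarrow> nat \<Rightarrow> nat list" where
  "lns J v i = (if ltriple J v then if i = 1 then [3, 5] else if i = 2 then [5] else if i = 3 then [1, 5]
       else if i = 4 then [5] else if i = 5 then [1, 2, 3, 4] else [6]
     else if \<not> lmono J v \<and> i = 6 then [6] else [])"

definition lnodes :: "'a inst \<Rightarrow> 'a \<Rightarrow> nat list" where
  "lnodes J v = (if lmono J v then [1] else if ltriple J v then [1, 2, 3, 4, 5, 6] else [1, 6])"

definition lverts :: "'a inst \<Rightarrow> (nat \<times> ('a \<times> 'a) list \<times> 'a list) list" where
  "lverts J = map (\<lambda>x. (0, [x], [])) (ius J) @ concat (map (\<lambda>v. map (\<lambda>i. (i, [], [v])) (lnodes J v)) (ivs J))"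

definition lnbh :: "'a inst \<Rightarrow> nat \<times> ('a \<times> 'a) list \<times> 'a list \<Rightarrow> (nat \<times> ('a \<times> 'a) list \<times> 'a list) list" where
  "lnbh J p = (case fst (snd p) of
      x # _ \<Rightarrow> concat (map (\<lambda>v. map (\<lambda>j. (j, [], [v])) (lsl J x v)) (ladj J x))
    | [] \<Rightarrow> (case snd (snd p) of [] \<Rightarrow> [] | v # _ \<Rightarrow>
        map (\<lambda>x. (0, [x], [])) (filter (\<lambda>x. fst p \<in> set (lsl J x v)) (linc J v)) @ map (\<lambda>j. (j, [], [v])) (lns J v (fst p))))"

text \<open>The variable \<open>[]\<close> stands for truth: \<open>([v], [], False)\<close> says
  that \<open>v\<close> is used, and \<open>([], [], True)\<close> is contradictory. A left vertex
  with two rainbow neighbours uses exactly one of them, which is again a parity equation.\<close>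

definition leqs :: "'a inst \<Rightarrow> 'a \<times> 'a \<Rightarrow> ('a list \<times> 'a list \<times> bool) list" where
  "leqs J x = (case filter (lrainbow J) (ladj J x) of [] \<Rightarrow> [([], [], True)]
     | v # G \<Rightarrow> (case G of [] \<Rightarrow> [([v], [], False)] | w # _ \<Rightarrow> [([v], [w], True)]))"

definition dec_deg1 :: "bool \<Rightarrow> 'a inst \<Rightarrow> bool" where
  "dec_deg1 ne J \<longleftrightarrow> (\<forall>x\<in>set (ius J). ladj J x \<noteq> []) \<and> (\<forall>v\<in>set (ivs J). lfair J (linc J v)) \<and>
     (ne \<longrightarrow> (\<forall>v\<in>set (ivs J). linc J v \<noteq> []))"

definition dec_few :: "nat \<Rightarrow> bool \<Rightarrow> 'a inst \<Rightarrow> bool" where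
  "dec_few d ne J \<longleftrightarrow>
     sdr (map (\<lambda>x. concat (map (\<lambda>v. map (\<lambda>i. (v, snd x, i)) [0..<lcap d J]) (ladj J x))) (ius J)) \<and>
     (ne \<longrightarrow> sdr (map (linc J) (ivs J)))"

text \<open>The quantifier merely picks one of the two colours; by symmetry both give the same
  answer.\<close>

definition dec_two :: "bool \<Rightarrow> 'a inst \<Rightarrow> bool" where
  "dec_two ne J \<longleftrightarrow> (\<exists>a\<in>set (ics J).
     let R = filter (\<lambda>x. snd x = a) (ius J); B = filter (\<lambda>x. snd x \<noteq> a) (ius J) in
     length R = length B \<and>
     sdr (map (\<lambda>x. filter (\<lambda>y. \<exists>v\<in>set (ivs J). (fst x, v) \<in> set (ies J) \<and> (fst y, v) \<in> set (ies J)) B) R) \<and>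
     (ne \<longrightarrow> length R = length (ivs J)))"

definition dec_three :: "bool \<Rightarrow> 'a inst \<Rightarrow> bool" where
  "dec_three ne J \<longleftrightarrow> parity_solvable (concat (map (leqs J) (ius J)) @
     (if ne then map (\<lambda>v. if lrainbow J v then ([v], [], False) else ([], [], True)) (ivs J) else []))"

definition dec_diff1 :: "bool \<Rightarrow> 'a inst \<Rightarrow> bool" where
  "dec_diff1 ne J \<longleftrightarrow> (if ne then sdr (map (lnbh J) (lverts J))
     else sdr (map (\<lambda>x. concat (map (lplaces J x) (ladj J x)))
       (filter (\<lambda>x. \<not> (\<exists>v\<in>set (ivs J). lsingle J x v)) (ius J))))"

definition decide :: "nat \<Rightarrow> bool \<Rightarrow> 'a inst \<Rightarrow> bool" where
  "decide d ne J \<longleftrightarrow> (if length (ics J) = 1 \<or> d < il J + length (ics J) then dec_few d ne J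
     else if length (ics J) = 3 then dec_three ne J
     else if il J = 0 then dec_two ne J else dec_diff1 ne J)"

subsection \<open>Their running time\<close>

lemma PF_linc [pf_intros]: "PF J \<Longrightarrow> PF v \<Longrightarrow> PF (\<lambda>x. linc (J x) (v x))"
  by (rule PF_app2[where h = linc]) (unfold linc_def, intro pf_intros)

lemma PF_ladj [pf_intros]: "PF J \<Longrightarrow> PF v \<Longrightarrow> PF (\<lambda>x. ladj (J x) (v x))"
  by (rule PF_app2[where h = ladj]) (unfold ladj_def, intro pf_intros)

lemma PF_lcnt [pf_intros]: "PF S \<Longrightarrow> PF c \<Longrightarrow> PF (\<lambda>x. lcnt (S x) (c x))"
  by (rule PF_app2[where h = lcnt]) (unfold lcnt_def, intro pf_intros)

lemma PF_lfair [pf_intros]: "PF J \<Longrightarrow> PF S \<Longrightarrow> PF (\<lambda>x. lfair (J x) (S x))"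
  by (rule PF_app2[where h = lfair]) (unfold lfair_def, intro pf_intros)

lemma PF_lcap [pf_intros]: "PF J \<Longrightarrow> PF (\<lambda>x. lcap d (J x))"
  by (rule PF_comp[of "lcap d"]) (unfold lcap_def, intro pf_intros)

lemma PF_lrainbow [pf_intros]: "PF J \<Longrightarrow> PF v \<Longrightarrow> PF (\<lambda>x. lrainbow (J x) (v x))"
  by (rule PF_app2[where h = lrainbow]) (unfold lrainbow_def, intro pf_intros)

lemma PF_lmono [pf_intros]: "PF J \<Longrightarrow> PF v \<Longrightarrow> PF (\<lambda>x. lmono (J x) (v x))"
  by (rule PF_app2[where h = lmono]) (unfold lmono_def, intro pf_intros)

lemma PF_ltriple [pf_intros]: "PF J \<Longrightarrow> PF v \<Longrightarrow> PF (\<lambda>x. ltriple (J x) (v x))"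
  by (rule PF_app2[where h = ltriple]) (unfold ltriple_def, intro pf_intros)

lemma PF_app3: "PF (\<lambda>p. h (fst p) (fst (snd p)) (snd (snd p))) \<Longrightarrow> PF f \<Longrightarrow> PF g \<Longrightarrow> PF k \<Longrightarrow>
    PF (\<lambda>x. h (f x) (g x) (k x))"
  using PF_comp[OF _ PF_Pair[OF _ PF_Pair], of "\<lambda>p. h (fst p) (fst (snd p)) (snd (snd p))" f g k] by simp

lemma PF_lsingle [pf_intros]: "PF J \<Longrightarrow> PF y \<Longrightarrow> PF v \<Longrightarrow> PF (\<lambda>x. lsingle (J x) (y x) (v x))"
  by (rule PF_app3[where h = lsingle]) (unfold lsingle_def, intro pf_intros)

lemma PF_lplaces [pf_intros]: "PF J \<Longrightarrow> PF y \<Longrightarrow> PF v \<Longrightarrow> PF (\<lambda>x. lplaces (J x) (y x) (v x))"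
  by (rule PF_app3[where h = lplaces]) (unfold lplaces_def, intro pf_intros)

lemma PF_lsl [pf_intros]: "PF J \<Longrightarrow> PF y \<Longrightarrow> PF v \<Longrightarrow> PF (\<lambda>x. lsl (J x) (y x) (v x))"
  by (rule PF_app3[where h = lsl]) (unfold lsl_def, intro pf_intros)

lemma PF_lns [pf_intros]: "PF J \<Longrightarrow> PF v \<Longrightarrow> PF i \<Longrightarrow> PF (\<lambda>x. lns (J x) (v x) (i x))"
  by (rule PF_app3[where h = lns]) (unfold lns_def, intro pf_intros)

lemma PF_lnodes [pf_intros]: "PF J \<Longrightarrow> PF v \<Longrightarrow> PF (\<lambda>x. lnodes (J x) (v x))"
  by (rule PF_app2[where h = lnodes]) (unfold lnodes_def, intro pf_intros)

lemma PF_lverts [pf_intros]: "PF J \<Longrightarrow> PF (\<lambda>x. lverts (J x))"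
  by (rule PF_comp[of lverts]) (unfold lverts_def, intro pf_intros)

lemma PF_lnbh [pf_intros]: "PF J \<Longrightarrow> PF p \<Longrightarrow> PF (\<lambda>x. lnbh (J x) (p x))"
  by (rule PF_app2[where h = lnbh]) (unfold lnbh_def, intro pf_intros)

lemma PF_leqs [pf_intros]: "PF J \<Longrightarrow> PF v \<Longrightarrow> PF (\<lambda>x. leqs (J x) (v x))"
  by (rule PF_app2[where h = leqs]) (unfold leqs_def, intro pf_intros)

lemma PF_parity_subst [pf_intros]: "PF e \<Longrightarrow> PF f \<Longrightarrow> PF (\<lambda>x. parity_subst (e x) (f x))"
  by (rule PF_app2[where h = parity_subst]) (unfold parity_subst_def, intro pf_intros)

lemma PF_parity_step [pf_intros]: "PF E \<Longrightarrow> PF (\<lambda>x. parity_step (E x))"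
  by (rule PF_comp[of parity_step]) (unfold parity_step_def, intro pf_intros)

text \<open>Substitution introduces no new variables and the number of equations does not grow,
  which bounds the intermediate systems.\<close>

lemma PF_parity_solvable [pf_intros]:
  fixes E :: "'e :: enc \<Rightarrow> ('n :: enc \<times> 'n \<times> bool) list"
  assumes "PF E"
  shows "PF (\<lambda>x. parity_solvable (E x))"
proof -
  define names where "names E = (\<Union>e\<in>set E. {fst e, fst (snd e)})" for E :: "('n \<times> 'n \<times> bool) list"
  have step: "names (parity_step E) \<subseteq> names E" "length (parity_step E) \<le> length E" for E :: "('n \<times> 'n \<times> bool) list"
  proof -
    show "names (parity_step E) \<subseteq> names E"
      by (fastforce simp: names_def parity_step_def parity_subst_def split: list.split prod.splits if_splits)
  qed (rule parity_step_length)
  have it: "names (fold (\<lambda>_. parity_step) xs E) \<subseteq> names E \<and> length (fold (\<lambda>_. parity_step) xs E) \<le> length E"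
    for xs E :: "('n \<times> 'n \<times> bool) list"
  proof (induction xs arbitrary: E)
    case (Cons x xs)
    show ?case using Cons[of "parity_step E"] step[of E] by auto
  qed simp
  have "PF (\<lambda>E :: ('n \<times> 'n \<times> bool) list. fold (\<lambda>_. parity_step) E E)"
  proof (rule PF_fold[where h = "\<lambda>E. 1 + sz E * (1 + (sz E + sz E + 5))"])
    show "pbd (\<lambda>E :: ('n \<times> 'n \<times> bool) list. 1 + sz E * (1 + (sz E + sz E + 5)))"
      by (intro pbd_intros pf_intros)
    fix E xs ys :: "('n \<times> 'n \<times> bool) list"
    let ?F = "fold (\<lambda>_. parity_step) xs E"
    have nm: "sz a < sz E" if an: "a \<in> names E" for a
    proof -
      have "\<exists>e\<in>set E. a = fst e \<or> a = fst (snd e)" using an by (auto simp: names_def)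
      then obtain e where e: "e \<in> set E" "a = fst e \<or> a = fst (snd e)" by blast
      have "sz a < sz e" using e(2) sz_pos[of "fst (snd e)"] by (cases e) auto
      then show ?thesis using sz_mem[OF e(1)] by simp
    qed
    have "sz (map id ?F) \<le> 1 + length ?F * (1 + (sz E + sz E + 5))"
    proof (rule sz_map_le)
      fix e assume "e \<in> set ?F"
      then have "fst e \<in> names ?F" "fst (snd e) \<in> names ?F" by (auto simp: names_def)
      then have "sz (fst e) < sz E" "sz (fst (snd e)) < sz E" using it[of xs E] nm by blast+
      then show "sz (id e) \<le> sz E + sz E + 5"
        using sz_bool[of "snd (snd e)"] by (cases e) auto
    qed
    also have "\<dots> \<le> 1 + sz E * (1 + (sz E + sz E + 5))"
      using it[of xs E] length_le_sz[of E] by (intro add_mono mult_right_mono) auto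
    finally show "sz ?F \<le> 1 + sz E * (1 + (sz E + sz E + 5))" by simp
  qed (intro pf_intros)+
  then have "PF (parity_solvable :: ('n \<times> 'n \<times> bool) list \<Rightarrow> _)"
    unfolding parity_solvable_def by (intro PF_eq PF_const)
  then show ?thesis by (rule PF_comp[OF _ assms])
qed

lemma PF_decide [pf_intros]: "PF J \<Longrightarrow> PF (\<lambda>x. decide d ne (J x))"
  by (rule PF_comp[of "decide d ne"])
    (unfold decide_def dec_few_def dec_three_def dec_two_def dec_diff1_def, intro pf_intros)

lemma PF_dec_deg1 [pf_intros]: "PF J \<Longrightarrow> PF (\<lambda>x. dec_deg1 ne (J x))"
  by (rule PF_comp[of "dec_deg1 ne"]) (unfold dec_deg1_def, intro pf_intros)

subsection \<open>Their correctness\<close>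

locale list_inst =
  fixes J :: "'a inst"
  assumes distinct: "distinct (ius J)" "distinct (ivs J)" "distinct (ics J)"
    and ics: "ics J \<noteq> []" "snd ` set (ius J) \<subseteq> set (ics J)"

sublocale list_inst \<subseteq> fair_assignment "set (ius J)" "set (ivs J)" "\<lambda>x v. (fst x, v) \<in> set (ies J)" snd "set (ics J)" "il J"
  by unfold_locales (use ics in auto)

context list_inst
begin

lemma inc_linc: "inc v = set (linc J v)"
  by (simp add: inc_def linc_def)

lemma adj_ladj: "adj x = set (ladj J x)"
  by (simp add: adj_def ladj_def)

lemma distinct_linc: "distinct (linc J v)" "distinct (ladj J x)"
  using distinct by (simp_all add: linc_def ladj_def)

lemma card_inc: "card (inc v) = length (linc J v)" "card (adj x) = length (ladj J x)"
  "card (set (ics J)) = length (ics J)"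
  using distinct distinct_linc by (simp_all add: inc_linc adj_ladj distinct_card)

lemma cnt_lcnt: "distinct S \<Longrightarrow> cnt (set S) c = lcnt S c"
  unfolding cnt_def lcnt_def using distinct_card[of "filter (\<lambda>x. snd x = c) S"] by simp

lemma fair_lfair: "distinct S \<Longrightarrow> fair (set S) \<longleftrightarrow> lfair J S"
  by (simp add: fair_def lfair_def cnt_lcnt)

text \<open>A left vertex with at most one neighbour has no choice, so each right vertex receives
  its entire neighbourhood.\<close>

theorem dec_deg1_iff:
  assumes "\<forall>x\<in>set (ius J). length (ladj J x) \<le> 1"
  shows "dec_deg1 False J \<longleftrightarrow> (\<exists>f. feasible f)" "dec_deg1 True J \<longleftrightarrow> (\<exists>f. feasible f \<and> covers f)"
proof -
  have slot: "slot f v = inc v" if f: "\<forall>x\<in>set (ius J). f x \<in> adj x" and v: "v \<in> set (ivs J)" for f v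
  proof -
    have "w = f x" if "x \<in> set (ius J)" "w \<in> adj x" for x w
    proof -
      have "card (adj x) \<le> 1" using assms that card_inc(2) by simp
      then show ?thesis using f that finite_sub(3)[of x] by (metis card_le_Suc0_iff_eq One_nat_def)
    qed
    then show ?thesis using f v by (auto simp: slot_def inc_def adj_def)
  qed
  have fair: "fair (inc v) \<longleftrightarrow> lfair J (linc J v)" for v
    unfolding inc_linc by (rule fair_lfair[OF distinct_linc(1)])
  have ex: "(\<exists>f. \<forall>x\<in>set (ius J). f x \<in> adj x) \<longleftrightarrow> (\<forall>x\<in>set (ius J). ladj J x \<noteq> [])"
    unfolding adj_ladj by (subst bchoice_iff[symmetric]) (simp add: ex_in_conv)
  have e: "set (linc J v) = {} \<longleftrightarrow> linc J v = []" for v by simp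
  show "dec_deg1 False J \<longleftrightarrow> (\<exists>f. feasible f)"
    unfolding dec_deg1_def feasible_def ex[symmetric] fair[symmetric] using slot by auto
  show "dec_deg1 True J \<longleftrightarrow> (\<exists>f. feasible f \<and> covers f)"
    unfolding dec_deg1_def feasible_def covers_def ex[symmetric] fair[symmetric] e[symmetric] inc_linc[symmetric]
    using slot by auto
qed

lemma dec_few_iff:
  assumes "length (ics J) = 1 \<or> d < il J + length (ics J)" "\<forall>v\<in>set (ivs J). length (linc J v) \<le> d"
  shows "dec_few d False J \<longleftrightarrow> (\<exists>f. feasible f)" "dec_few d True J \<longleftrightarrow> (\<exists>f. feasible f \<and> covers f)"
proof -
  have cap: "lcap d J = cap d" by (simp add: lcap_def cap_def card_inc)
  have *: "card (set (ics J)) = 1 \<or> d < il J + card (set (ics J))" "\<forall>v\<in>set (ivs J). card (inc v) \<le> d"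
    using assms by (simp_all add: card_inc)
  have 1: "sdr (map (\<lambda>x. concat (map (\<lambda>v. map (\<lambda>i. (v, snd x, i)) [0..<lcap d J]) (ladj J x))) (ius J)) \<longleftrightarrow> (\<exists>f. feasible f)"
    unfolding sdr_map_iff[OF distinct(1)] feasible_iff_sdr[OF *]
    by (rule arg_cong[where f = "has_sdr _"]) (auto simp: adj_ladj cap fun_eq_iff)
  have 2: "sdr (map (linc J) (ivs J)) \<longleftrightarrow> has_sdr (set (ivs J)) inc"
    unfolding sdr_map_iff[OF distinct(2)] inc_linc ..
  show "dec_few d False J \<longleftrightarrow> (\<exists>f. feasible f)" "dec_few d True J \<longleftrightarrow> (\<exists>f. feasible f \<and> covers f)"
    unfolding dec_few_def 1 2 covering_iff_sdr[OF *] by simp_all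
qed

lemma dec_two_iff:
  assumes "length (ics J) = 2" "il J = 0" "\<forall>v\<in>set (ivs J). length (linc J v) \<le> 3"
  shows "dec_two False J \<longleftrightarrow> (\<exists>f. feasible f)" "dec_two True J \<longleftrightarrow> (\<exists>f. feasible f \<and> covers f)"
proof -
  have d3: "\<forall>v\<in>set (ivs J). card (inc v) \<le> 3" using assms by (simp add: card_inc)
  define P where "P ne a \<longleftrightarrow> (let R = filter (\<lambda>x. snd x = a) (ius J); B = filter (\<lambda>x. snd x \<noteq> a) (ius J) in
     length R = length B \<and>
     sdr (map (\<lambda>x. filter (\<lambda>y. \<exists>v\<in>set (ivs J). (fst x, v) \<in> set (ies J) \<and> (fst y, v) \<in> set (ies J)) B) R) \<and>
     (ne \<longrightarrow> length R = length (ivs J)))" for ne a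
  have P: "P False a \<longleftrightarrow> (\<exists>f. feasible f)" "P True a \<longleftrightarrow> (\<exists>f. feasible f \<and> covers f)" if a: "a \<in> set (ics J)" for a
  proof -
    have "card (set (ics J)) = 2" using assms by (simp add: card_inc)
    then obtain b where b: "set (ics J) = {a, b}" "a \<noteq> b" using a by (auto simp: card_2_iff doubleton_eq_iff)
    let ?R = "filter (\<lambda>x. snd x = a) (ius J)" and ?B = "filter (\<lambda>x. snd x \<noteq> a) (ius J)"
    have sR: "set ?R = {x\<in>set (ius J). snd x = a}" by auto
    have sB: "set ?B = {x\<in>set (ius J). snd x = b}" using ics(2) b by auto
    have "distinct ?R" "distinct ?B" using distinct by auto
    then have len: "length ?R = card {x\<in>set (ius J). snd x = a}" "length ?B = card {x\<in>set (ius J). snd x = b}"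
      unfolding sR[symmetric] sB[symmetric] by (simp_all only: distinct_card)
    have lv: "length (ivs J) = card (set (ivs J))" using distinct by (simp add: distinct_card)
    have "sdr (map (\<lambda>x. filter (\<lambda>y. \<exists>v\<in>set (ivs J). (fst x, v) \<in> set (ies J) \<and> (fst y, v) \<in> set (ies J)) ?B) ?R) \<longleftrightarrow>
      has_sdr {x\<in>set (ius J). snd x = a} (\<lambda>x. {y\<in>set (ius J). snd y = b \<and> (\<exists>v\<in>set (ivs J). (fst x, v) \<in> set (ies J) \<and> (fst y, v) \<in> set (ies J))})"
      unfolding sdr_map_iff[OF \<open>distinct ?R\<close>] sR
      by (rule arg_cong[where f = "has_sdr _"]) (use sB in \<open>auto simp: fun_eq_iff\<close>)
    note this' = this
    show "P False a \<longleftrightarrow> (\<exists>f. feasible f)" "P True a \<longleftrightarrow> (\<exists>f. feasible f \<and> covers f)"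
      unfolding P_def Let_def this' len lv feasible_two_colours[OF b assms(2) d3] by auto
  qed
  have "set (ics J) \<noteq> {}" using ics by simp
  then obtain a where "a \<in> set (ics J)" by (meson ex_in_conv)
  show "dec_two False J \<longleftrightarrow> (\<exists>f. feasible f)"
    unfolding dec_two_def P_def[symmetric] using P(1) \<open>a \<in> _\<close> by blast
  show "dec_two True J \<longleftrightarrow> (\<exists>f. feasible f \<and> covers f)"
    unfolding dec_two_def P_def[symmetric] using P(2) \<open>a \<in> _\<close> by blast
qed

lemma dec_three_iff:
  assumes "length (ics J) = 3" "il J = 0" "\<forall>v\<in>set (ivs J). length (linc J v) \<le> 3"
    "\<forall>x\<in>set (ius J). length (ladj J x) \<le> 2"
  shows "dec_three False J \<longleftrightarrow> (\<exists>f. feasible f)" "dec_three True J \<longleftrightarrow> (\<exists>f. feasible f \<and> covers f)"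
proof -
  have d3: "\<forall>v\<in>set (ivs J). card (inc v) \<le> 3" using assms by (simp add: card_inc)
  have C3: "card (set (ics J)) = 3" using assms by (simp add: card_inc)
  have rb: "lrainbow J v \<longleftrightarrow> rainbow v" for v by (simp add: lrainbow_def rainbow_def inc_linc)
  define ok where "ok \<tau> e \<longleftrightarrow> (case e of (a, b, p) \<Rightarrow> (\<tau> a \<noteq> \<tau> b) = p)" for \<tau> :: "'a list \<Rightarrow> bool" and e :: "'a list \<times> 'a list \<times> bool"
  have eqs: "(\<forall>e\<in>set (leqs J x). ok \<tau> e) \<longleftrightarrow> (\<exists>!v. v \<in> adj x \<and> rainbow v \<and> \<tau> [v])"
    if x: "x \<in> set (ius J)" and \<tau>: "\<tau> []" for x \<tau>
  proof -
    let ?G = "filter (lrainbow J) (ladj J x)"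
    have "distinct ?G" using distinct_linc by simp
    have "length ?G \<le> 2" using bspec[OF assms(4) x] length_filter_le[of "lrainbow J" "ladj J x"] by (rule le_trans[rotated])
    have G: "v \<in> adj x \<and> rainbow v \<and> \<tau> [v] \<longleftrightarrow> v \<in> set ?G \<and> \<tau> [v]" for v by (auto simp: adj_ladj rb)
    show ?thesis
      unfolding G
    proof (cases ?G)
      case Nil
      then show "(\<forall>e\<in>set (leqs J x). ok \<tau> e) \<longleftrightarrow> (\<exists>!v. v \<in> set ?G \<and> \<tau> [v])"
        unfolding leqs_def Nil by (auto simp: ok_def)
    next
      case (Cons v G')
      show "(\<forall>e\<in>set (leqs J x). ok \<tau> e) \<longleftrightarrow> (\<exists>!v. v \<in> set ?G \<and> \<tau> [v])"
      proof (cases G')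
        case Nil
        then show ?thesis unfolding leqs_def Cons using \<tau> by (auto simp: ok_def)
      next
        case C: (Cons w G'')
        then have "G'' = []" "v \<noteq> w" using \<open>length ?G \<le> 2\<close> \<open>distinct ?G\<close> Cons by auto
        then show ?thesis unfolding leqs_def Cons C using \<tau> by (auto simp: ok_def)
      qed
    qed
  qed
  have flip: "ok (\<lambda>a. \<tau> a \<noteq> \<tau> []) e \<longleftrightarrow> ok \<tau> e" for \<tau> e
  proof (cases e)
    case (fields a b p)
    then show ?thesis by (cases "\<tau> []") (auto simp: ok_def)
  qed
  have flip': "ok (\<lambda>a. \<tau> a = \<tau> []) e \<longleftrightarrow> ok \<tau> e" for \<tau> e
  proof (cases e)
    case (fields a b p)
    then show ?thesis by (cases "\<tau> []") (auto simp: ok_def)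
  qed
  \<comment> \<open>Complementing all values preserves every equation, so \<open>[]\<close> may be
    assumed to be true.\<close>
  have top: "(\<exists>\<tau>. \<forall>e\<in>S. ok \<tau> e) \<longleftrightarrow> (\<exists>\<tau>. \<tau> [] \<and> (\<forall>e\<in>S. ok \<tau> e))" for S
  proof
    assume "\<exists>\<tau>. \<forall>e\<in>S. ok \<tau> e"
    then obtain \<tau> where "\<forall>e\<in>S. ok \<tau> e" by blast
    then have "\<forall>e\<in>S. ok (\<lambda>a. \<tau> a = \<tau> []) e" unfolding flip' .
    then show "\<exists>\<tau>. \<tau> [] \<and> (\<forall>e\<in>S. ok \<tau> e)" by (intro exI[of _ "\<lambda>a. \<tau> a = \<tau> []"]) simp
  qed blast
  have sol: "parity_solvable E \<longleftrightarrow> (\<exists>\<tau>. \<tau> [] \<and> (\<forall>e\<in>set E. ok \<tau> e))" for E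
    by (subst top[of "set E", symmetric]) (simp add: parity_solvable_iff parity_sat_def ok_def)
  have lift: "(\<exists>\<tau> :: 'a list \<Rightarrow> bool. \<tau> [] \<and> Q (\<lambda>v. \<tau> [v])) \<longleftrightarrow> (\<exists>\<sigma>. Q \<sigma>)" for Q
  proof
    assume "\<exists>\<sigma>. Q \<sigma>"
    then obtain \<sigma> where "Q \<sigma>" by blast
    then show "\<exists>\<tau> :: 'a list \<Rightarrow> bool. \<tau> [] \<and> Q (\<lambda>v. \<tau> [v])"
      by (intro exI[of _ "\<lambda>a. case a of [] \<Rightarrow> True | v # _ \<Rightarrow> \<sigma> v"]) simp
  qed blast
  have ne: "(\<forall>e\<in>set (map (\<lambda>v. if lrainbow J v then ([v], [], False) else ([], [], True)) (ivs J)). ok \<tau> e) \<longleftrightarrow>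
      (\<forall>v\<in>set (ivs J). rainbow v \<and> \<tau> [v])" if "\<tau> []" for \<tau>
  proof -
    have "ok \<tau> (if lrainbow J v then ([v], [], False) else ([], [], True)) \<longleftrightarrow> rainbow v \<and> \<tau> [v]" for v
      using that by (simp add: rb ok_def)
    then show ?thesis by (simp only: set_map ball_simps)
  qed
  have all: "(\<forall>e\<in>set (concat (map (leqs J) (ius J))). ok \<tau> e) \<longleftrightarrow> (\<forall>x\<in>set (ius J). \<exists>!v. v \<in> adj x \<and> rainbow v \<and> \<tau> [v])"
    if "\<tau> []" for \<tau>
    by (simp add: eqs[where \<tau> = \<tau>, OF _ that])
  show "dec_three False J \<longleftrightarrow> (\<exists>f. feasible f)"
    unfolding dec_three_def sol feasible_three_colours(1)[OF C3 assms(2) d3]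
      lift[of "\<lambda>\<sigma>. \<forall>x\<in>set (ius J). \<exists>!v. v \<in> adj x \<and> rainbow v \<and> \<sigma> v", symmetric]
    using all by (simp cong: conj_cong)
  show "dec_three True J \<longleftrightarrow> (\<exists>f. feasible f \<and> covers f)"
    unfolding dec_three_def sol feasible_three_colours(2)[OF C3 assms(2) d3]
      lift[of "\<lambda>\<sigma>. (\<forall>x\<in>set (ius J). \<exists>!v. v \<in> adj x \<and> rainbow v \<and> \<sigma> v) \<and> (\<forall>v\<in>set (ivs J). rainbow v \<and> \<sigma> v)", symmetric]
    unfolding if_True set_append ball_Un by (rule ex_cong1, rule conj_cong, rule refl) (simp only: all ne)
qed

lemma dec_diff1_iff:
  assumes "length (ics J) = 2" "il J = 1" "\<forall>v\<in>set (ivs J). length (linc J v) \<le> 3"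
    "\<forall>x\<in>set (ius J). length (ladj J x) \<le> 2"
  shows "dec_diff1 False J \<longleftrightarrow> (\<exists>f. feasible f)" "dec_diff1 True J \<longleftrightarrow> (\<exists>f. feasible f \<and> covers f)"
proof -
  interpret two_colours "set (ius J)" "set (ivs J)" "\<lambda>x v. (fst x, v) \<in> set (ies J)" snd "set (ics J)" "il J"
    by unfold_locales (use assms in \<open>auto simp: card_inc\<close>)
  have m: "lmono J v \<longleftrightarrow> mono v" for v by (simp add: lmono_def mono_def inc_linc)
  have t: "ltriple J v \<longleftrightarrow> triple v" for v by (simp add: ltriple_def triple_def m card_inc)
  have s: "lsingle J x v \<longleftrightarrow> single x v" for x v by (simp add: lsingle_def single_def t inc_linc)
  have pl: "set (lplaces J x v) = places x v" for x v
    by (auto simp: lplaces_def places_def m t s inc_linc)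
  have d: "distinct (filter (\<lambda>x. \<not> (\<exists>v\<in>set (ivs J). lsingle J x v)) (ius J))" using distinct by simp
  show "dec_diff1 False J \<longleftrightarrow> (\<exists>f. feasible f)"
    unfolding dec_diff1_def feasible_iff_places if_False sdr_map_iff[OF d]
    by (rule arg_cong2[where f = has_sdr]) (auto simp: s sing_def pl adj_ladj)
  have lsl: "set (lsl J x v) = sl x v" for x v by (simp add: lsl_def sl_def m t s)
  have lns: "set (lns J v i) = ns v i" for v i by (simp add: lns_def ns_def m t)
  have lnodes: "set (lnodes J v) = nodes v" for v by (simp add: lnodes_def nodes_def m t)
  have lv: "set (lverts J) = verts" by (auto simp: lverts_def verts_def lnodes)
  have dn: "distinct (lnodes J v)" for v by (simp add: lnodes_def)
  have "distinct (concat (map (\<lambda>v. map (\<lambda>i. (i, [] :: ('a \<times> 'a) list, [v])) (lnodes J v)) vs))" if "distinct vs" for vs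
    using that dn by (induction vs) (auto simp: distinct_map inj_on_def)
  then have dv: "distinct (lverts J)"
    using distinct unfolding lverts_def by (auto simp: distinct_map inj_on_def)
  have "set (lnbh J p) = nbh p" if "p \<in> verts" for p
    using that
  proof (cases rule: verts_cases)
    case (left x)
    then show ?thesis by (auto simp: lnbh_def nbh_X adj_ladj lsl)
  next
    case (right i v)
    then show ?thesis by (auto simp: lnbh_def nbh_Nd inc_linc lsl lns)
  qed
  then have "has_sdr verts (\<lambda>p. set (lnbh J p)) \<longleftrightarrow> has_sdr verts nbh"
    by (auto simp: has_sdr_def)
  then show "dec_diff1 True J \<longleftrightarrow> (\<exists>f. feasible f \<and> covers f)"
    unfolding dec_diff1_def covering_iff_graph if_True sdr_map_iff[OF dv] lv .
qed

theorem decide_iff: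
  assumes "\<forall>v\<in>set (ivs J). length (linc J v) \<le> d" "d = 2 \<or> d = 3 \<and> (\<forall>x\<in>set (ius J). length (ladj J x) \<le> 2)"
  shows "decide d False J \<longleftrightarrow> (\<exists>f. feasible f)" "decide d True J \<longleftrightarrow> (\<exists>f. feasible f \<and> covers f)"
proof -
  have d3: "\<forall>v\<in>set (ivs J). length (linc J v) \<le> 3" using assms by force
  have pos: "length (ics J) > 0" using ics by simp
  \<comment> \<open>Outside the first case there are at least two colours, and bound and number of
    colours add up to at most \<open>d \<le> 3\<close>. This leaves the pairs (2, 0), (3, 0) and (2,
    1) of number of colours and bound, the last two only for \<open>d = 3\<close>.\<close>
  consider (few) "length (ics J) = 1 \<or> d < il J + length (ics J)"
    | (three) "\<not> (length (ics J) = 1 \<or> d < il J + length (ics J))" "length (ics J) = 3" "il J = 0" "d = 3"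
    | (two) "\<not> (length (ics J) = 1 \<or> d < il J + length (ics J))" "length (ics J) = 2" "il J = 0"
    | (diff1) "\<not> (length (ics J) = 1 \<or> d < il J + length (ics J))" "length (ics J) = 2" "il J = 1" "d = 3"
    using assms(2) pos by linarith
  then show "decide d False J \<longleftrightarrow> (\<exists>f. feasible f)" "decide d True J \<longleftrightarrow> (\<exists>f. feasible f \<and> covers f)"
    using dec_few_iff[OF _ assms(1)] dec_three_iff[OF _ _ d3] dec_two_iff[OF _ _ d3] dec_diff1_iff[OF _ _ d3] assms(2)
    by (cases; simp add: decide_def)+
qed

end

section \<open>From instances to lists\<close>

definition assignment :: "('v, 'c) fm_instance \<Rightarrow> ('v \<Rightarrow> 'v) \<Rightarrow> bool" where
  "assignment I h \<longleftrightarrow> (\<forall>u\<in>lside I. h u \<in> rside I \<and> {u, h u} \<in> edges I) \<and>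
     (\<forall>v\<in>rside I. fair_set I {u\<in>lside I. h u = v})"

lemma matching_assignment:
  assumes "fm_instance I" "many_to_one_matching I M" "left_perfect I M"
  obtains h where "\<forall>u\<in>lside I. h u \<in> rside I \<and> {u, h u} \<in> edges I"
    "\<forall>v\<in>rside I. nbrs M v = {u\<in>lside I. h u = v}"
proof -
  have ME: "M \<subseteq> edges I" using assms(2) by (simp add: many_to_one_matching_def)
  have E: "\<exists>u\<in>lside I. \<exists>v\<in>rside I. e = {u, v}" if "e \<in> edges I" for e
    using assms(1) that by (simp add: fm_instance_def)
  have disj: "lside I \<inter> rside I = {}" using assms(1) by (simp add: fm_instance_def)
  have "\<exists>w. nbrs M u = {w}" if "u \<in> lside I" for u
    using assms(3) that by (simp add: left_perfect_def card_1_singleton_iff)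
  then obtain h where h: "nbrs M u = {h u}" if "u \<in> lside I" for u by metis
  have hM: "{u, w} \<in> M \<longleftrightarrow> w = h u" if "u \<in> lside I" for u w
    using h[OF that] by (auto simp: nbrs_def)
  have LR: "u \<in> lside I \<and> w \<in> rside I \<or> w \<in> lside I \<and> u \<in> rside I" if "{u, w} \<in> M" for u w
    using E[of "{u, w}"] that ME by (auto simp: doubleton_eq_iff)
  have "h u \<in> rside I \<and> {u, h u} \<in> edges I" if "u \<in> lside I" for u
    using LR[of u "h u"] hM[OF that] that disj ME by blast
  moreover have "nbrs M v = {u\<in>lside I. h u = v}" if "v \<in> rside I" for v
  proof -
    have "{v, w} \<in> M \<longleftrightarrow> w \<in> lside I \<and> h w = v" for w
      using LR[of v w] hM[of w v] that disj by (auto simp: insert_commute)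
    then show ?thesis by (auto simp: nbrs_def)
  qed
  ultimately show thesis using that by blast
qed

lemma assignment_matching:
  assumes "fm_instance I" "\<forall>u\<in>lside I. h u \<in> rside I \<and> {u, h u} \<in> edges I"
  defines "M \<equiv> (\<lambda>u. {u, h u}) ` lside I"
  shows "many_to_one_matching I M" "left_perfect I M"
    "v \<in> rside I \<Longrightarrow> nbrs M v = {u\<in>lside I. h u = v}"
proof -
  have disj: "lside I \<inter> rside I = {}" using assms(1) by (simp add: fm_instance_def)
  have hl: "h u \<notin> lside I" if "u \<in> lside I" for u using that assms(2) disj by blast
  have "nbrs M u = {h u}" if "u \<in> lside I" for u
    using that hl by (auto simp: nbrs_def M_def doubleton_eq_iff)
  then show "many_to_one_matching I M" "left_perfect I M"
    using assms(2) by (auto simp: many_to_one_matching_def left_perfect_def M_def)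
  show "v \<in> rside I \<Longrightarrow> nbrs M v = {u\<in>lside I. h u = v}"
    using assms(2) disj by (auto simp: nbrs_def M_def doubleton_eq_iff image_iff)
qed

lemma max_min_fair_matching_iff:
  assumes "fm_instance I"
  shows "max_min_fair_matching I \<longleftrightarrow> (\<exists>h. assignment I h)"
proof
  assume "max_min_fair_matching I"
  then obtain M where M: "many_to_one_matching I M" "left_perfect I M" "fair_matching I M"
    unfolding max_min_fair_matching_def by blast
  obtain h where h:
    "\<forall>u\<in>lside I. h u \<in> rside I \<and> {u, h u} \<in> edges I"
    "\<forall>v\<in>rside I. nbrs M v = {u\<in>lside I. h u = v}" by (rule matching_assignment[OF assms M(1,2)]) blast
  have "assignment I h" unfolding assignment_def using h M(3) by (simp add: fair_matching_def)
  then show "\<exists>h. assignment I h" by blast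
next
  assume "\<exists>h. assignment I h"
  then obtain h where h: "assignment I h" by blast
  then have "\<forall>u\<in>lside I. h u \<in> rside I \<and> {u, h u} \<in> edges I" by (simp add: assignment_def)
  note M = assignment_matching[OF assms this]
  have "fair_matching I ((\<lambda>u. {u, h u}) ` lside I)"
    unfolding fair_matching_def using h M(3) by (simp add: assignment_def)
  then show "max_min_fair_matching I" unfolding max_min_fair_matching_def using M(1,2) by blast
qed

lemma max_min_fair_matching_nonempty_iff:
  assumes "fm_instance I"
  shows "max_min_fair_matching_nonempty I \<longleftrightarrow>
    (\<exists>h. assignment I h \<and> (\<forall>v\<in>rside I. {u\<in>lside I. h u = v} \<noteq> {}))"
proof
  assume "max_min_fair_matching_nonempty I"
  then obtain M where M: "many_to_one_matching I M" "left_perfect I M" "fair_matching I M"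
      "\<forall>v\<in>rside I. nbrs M v \<noteq> {}"
    unfolding max_min_fair_matching_nonempty_def by blast
  obtain h where h:
    "\<forall>u\<in>lside I. h u \<in> rside I \<and> {u, h u} \<in> edges I"
    "\<forall>v\<in>rside I. nbrs M v = {u\<in>lside I. h u = v}" by (rule matching_assignment[OF assms M(1,2)]) blast
  have "assignment I h" unfolding assignment_def using h M(3) by (simp add: fair_matching_def)
  moreover have "\<forall>v\<in>rside I. {u\<in>lside I. h u = v} \<noteq> {}" using h(2) M(4) by metis
  ultimately show "\<exists>h. assignment I h \<and> (\<forall>v\<in>rside I. {u\<in>lside I. h u = v} \<noteq> {})" by blast
next
  assume "\<exists>h. assignment I h \<and> (\<forall>v\<in>rside I. {u\<in>lside I. h u = v} \<noteq> {})"
  then obtain h where h: "assignment I h" "\<forall>v\<in>rside I. {u\<in>lside I. h u = v} \<noteq> {}" by blast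
  then have "\<forall>u\<in>lside I. h u \<in> rside I \<and> {u, h u} \<in> edges I" by (simp add: assignment_def)
  note M = assignment_matching[OF assms this]
  have "fair_matching I ((\<lambda>u. {u, h u}) ` lside I)"
    unfolding fair_matching_def using h M(3) by (simp add: assignment_def)
  moreover have "\<forall>v\<in>rside I. nbrs ((\<lambda>u. {u, h u}) ` lside I) v \<noteq> {}" using M(3) h(2) by metis
  ultimately show "max_min_fair_matching_nonempty I"
    unfolding max_min_fair_matching_nonempty_def using M(1,2) by blast
qed

lemma Max_minus_Min_le_iff:
  fixes A :: "nat set"
  assumes "finite A" "A \<noteq> {}"
  shows "Max A - Min A \<le> l \<longleftrightarrow> (\<forall>a\<in>A. \<forall>b\<in>A. a \<le> b + l)"
proof
  show "\<forall>a\<in>A. \<forall>b\<in>A. a \<le> b + l" if "Max A - Min A \<le> l"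
  proof (intro ballI)
    fix a b assume "a \<in> A" "b \<in> A"
    then have "a \<le> Max A" "Min A \<le> b" using assms by simp_all
    then show "a \<le> b + l" using that by linarith
  qed
  show "Max A - Min A \<le> l" if "\<forall>a\<in>A. \<forall>b\<in>A. a \<le> b + l"
    using that Max_in[OF assms] Min_in[OF assms] by fastforce
qed

lemma fair_set_iff:
  assumes "fm_instance I"
  shows "fair_set I S \<longleftrightarrow>
    (\<forall>c\<in>colors I. \<forall>d\<in>colors I. card {u\<in>S. col I u = c} \<le> card {u\<in>S. col I u = d} + ell I)"
  using assms unfolding fair_set_def MaxMin_def color_class_def
  by (subst Max_minus_Min_le_iff) (auto simp: fm_instance_def)

lemma nbrs_edges:
  assumes "fm_instance I"
  shows "u \<in> lside I \<Longrightarrow> nbrs (edges I) u = {v\<in>rside I. {u, v} \<in> edges I}"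
    "v \<in> rside I \<Longrightarrow> nbrs (edges I) v = {u\<in>lside I. {u, v} \<in> edges I}"
proof -
  have E: "u \<in> lside I \<and> w \<in> rside I \<or> w \<in> lside I \<and> u \<in> rside I" if "{u, w} \<in> edges I" for u w
  proof -
    have "\<exists>x\<in>lside I. \<exists>y\<in>rside I. {u, w} = {x, y}" using assms that by (simp add: fm_instance_def)
    then show ?thesis by (auto simp: doubleton_eq_iff)
  qed
  have disj: "lside I \<inter> rside I = {}" using assms by (simp add: fm_instance_def)
  show "u \<in> lside I \<Longrightarrow> nbrs (edges I) u = {v\<in>rside I. {u, v} \<in> edges I}"
    using E disj by (auto simp: nbrs_def)
  have "{v, u} \<in> edges I \<longleftrightarrow> u \<in> lside I \<and> {u, v} \<in> edges I" if "v \<in> rside I" for u v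
    using E[of v u] disj that by (auto simp: insert_commute)
  then show "v \<in> rside I \<Longrightarrow> nbrs (edges I) v = {u\<in>lside I. {u, v} \<in> edges I}"
    by (auto simp: nbrs_def)
qed

lemma card_nbrs_le:
  assumes "fm_instance I"
  shows "u \<in> lside I \<Longrightarrow> card (nbrs (edges I) u) \<le> Delta_U I"
    "v \<in> rside I \<Longrightarrow> card (nbrs (edges I) v) \<le> Delta_V I"
  using assms by (auto simp: Delta_U_def Delta_V_def max_degree_def fm_instance_def intro!: Max_ge)

text \<open>The bound is capped because it is written in binary, while \<open>decide\<close> takes it in unary.\<close>

locale instance_lists = list_inst J for J :: "'a inst" +
  fixes I :: "('v, 'c) fm_instance" and \<beta> :: "'v \<Rightarrow> 'a" and \<gamma> :: "'c \<Rightarrow> 'a"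
  assumes I: "fm_instance I" and inj: "inj \<beta>" "inj \<gamma>"
    and J: "set (ius J) = (\<lambda>u. (\<beta> u, \<gamma> (col I u))) ` lside I" "set (ivs J) = \<beta> ` rside I"
      "set (ies J) = (\<lambda>(u, v). (\<beta> u, \<beta> v)) ` {(u, v). u \<in> lside I \<and> v \<in> rside I \<and> {u, v} \<in> edges I}"
      "set (ics J) = \<gamma> ` colors I" "il J = min (ell I) (card (lside I) + 3)"
begin

abbreviation \<nu> :: "'v \<Rightarrow> 'a \<times> 'a" where "\<nu> u \<equiv> (\<beta> u, \<gamma> (col I u))"

lemma mem_ies: "(\<beta> u, \<beta> v) \<in> set (ies J) \<longleftrightarrow> u \<in> lside I \<and> v \<in> rside I \<and> {u, v} \<in> edges I"
proof -
  have "\<beta> a = \<beta> b \<longleftrightarrow> a = b" for a b using inj by (simp add: inj_eq)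
  then show ?thesis unfolding J(3) by auto
qed

lemma ball_ius: "(\<forall>x\<in>set (ius J). P x) \<longleftrightarrow> (\<forall>u\<in>lside I. P (\<nu> u))"
  by (simp add: J(1))

lemma ball_ivs: "(\<forall>v\<in>set (ivs J). P v) \<longleftrightarrow> (\<forall>v\<in>rside I. P (\<beta> v))"
  by (simp add: J(2))

lemma adj_nu: "u \<in> lside I \<Longrightarrow> adj (\<nu> u) = \<beta> ` nbrs (edges I) u"
  unfolding adj_def unfolding J(2) by (auto simp: mem_ies nbrs_edges[OF I])

lemma inc_beta: "v \<in> rside I \<Longrightarrow> inc (\<beta> v) = \<nu> ` nbrs (edges I) v"
  unfolding inc_def unfolding J(1) by (auto simp: mem_ies nbrs_edges[OF I])

lemma inj_nu: "inj \<nu>"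
  using inj by (auto simp: inj_def)

lemma ladj_le: "\<forall>x\<in>set (ius J). length (ladj J x) \<le> Delta_U I"
  unfolding ball_ius card_inc(2)[symmetric]
  using card_nbrs_le(1)[OF I] by (simp add: adj_nu card_image[OF inj_on_subset[OF inj(1)]])

lemma linc_le: "\<forall>v\<in>set (ivs J). length (linc J v) \<le> Delta_V I"
  unfolding ball_ivs card_inc(1)[symmetric]
  using card_nbrs_le(2)[OF I] by (simp add: inc_beta card_image[OF inj_on_subset[OF inj_nu]])

lemma slot_nu:
  assumes "\<forall>u\<in>lside I. f (\<nu> u) = \<beta> (h u)"
  shows "slot f (\<beta> v) = \<nu> ` {u\<in>lside I. h u = v}"
  unfolding slot_def unfolding J(1) using assms inj by (auto simp: inj_eq)

text \<open>Colour counts never exceed \<open>card (lside I)\<close>, so capping the bound at a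
  larger number does not affect fairness.\<close>

lemma fair_nu:
  assumes "S \<subseteq> lside I"
  shows "fair (\<nu> ` S) \<longleftrightarrow> fair_set I S"
proof -
  have cnt: "cnt (\<nu> ` S) (\<gamma> c) = card {u\<in>S. col I u = c}" for c
  proof -
    have "{x\<in>\<nu> ` S. snd x = \<gamma> c} = \<nu> ` {u\<in>S. col I u = c}" using inj by (auto simp: inj_eq)
    then show ?thesis unfolding cnt_def by (simp only: card_image[OF inj_on_subset[OF inj_nu subset_UNIV]])
  qed
  have le: "card {u\<in>S. col I u = c} \<le> card (lside I)" for c
    using assms I by (intro card_mono) (auto simp: fm_instance_def)
  have "card {u\<in>S. col I u = c} \<le> card {u\<in>S. col I u = d} + il J \<longleftrightarrow>
      card {u\<in>S. col I u = c} \<le> card {u\<in>S. col I u = d} + ell I" for c d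
    using le[of c] by (auto simp: J(5))
  then show ?thesis unfolding fair_def fair_set_iff[OF I] by (simp add: J(4) cnt)
qed

lemma feasible_nu:
  assumes "\<forall>u\<in>lside I. f (\<nu> u) = \<beta> (h u)"
  shows "feasible f \<longleftrightarrow> assignment I h"
    "covers f \<longleftrightarrow> (\<forall>v\<in>rside I. {u\<in>lside I. h u = v} \<noteq> {})"
proof -
  have "f (\<nu> u) \<in> adj (\<nu> u) \<longleftrightarrow> h u \<in> rside I \<and> {u, h u} \<in> edges I" if "u \<in> lside I" for u
    using that assms inj by (auto simp: adj_nu nbrs_edges[OF I] inj_eq)
  moreover have "fair (slot f (\<beta> v)) \<longleftrightarrow> fair_set I {u\<in>lside I. h u = v}" for v
    unfolding slot_nu[OF assms] by (rule fair_nu) blast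
  ultimately show "feasible f \<longleftrightarrow> assignment I h"
    unfolding feasible_def assignment_def ball_ius ball_ivs by simp
  show "covers f \<longleftrightarrow> (\<forall>v\<in>rside I. {u\<in>lside I. h u = v} \<noteq> {})"
    unfolding covers_def ball_ivs slot_nu[OF assms] by simp
qed

lemma matching_iff:
  "max_min_fair_matching I \<longleftrightarrow> (\<exists>f. feasible f)"
  "max_min_fair_matching_nonempty I \<longleftrightarrow> (\<exists>f. feasible f \<and> covers f)"
proof -
  have to: "\<exists>f. \<forall>u\<in>lside I. f (\<nu> u) = \<beta> (h u)" for h
    using inj by (intro exI[of _ "\<lambda>x. \<beta> (h (inv \<beta> (fst x)))"]) simp
  have from': "\<exists>h. \<forall>u\<in>lside I. f (\<nu> u) = \<beta> (h u)" if "feasible f" for f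
  proof -
    have "f (\<nu> u) = \<beta> (inv \<beta> (f (\<nu> u)))" if "u \<in> lside I" for u
    proof -
      have "f (\<nu> u) \<in> adj (\<nu> u)" using that \<open>feasible f\<close> unfolding feasible_def ball_ius by blast
      then have "f (\<nu> u) \<in> range \<beta>" using adj_nu[OF that] by blast
      then show ?thesis by (simp add: f_inv_into_f)
    qed
    then show ?thesis by (intro exI[of _ "\<lambda>u. inv \<beta> (f (\<nu> u))"]) blast
  qed
  have 1: "\<exists>f. feasible f \<and> (covers f \<longleftrightarrow> (\<forall>v\<in>rside I. {u\<in>lside I. h u = v} \<noteq> {}))" if "assignment I h" for h
  proof -
    obtain f where f: "\<forall>u\<in>lside I. f (\<nu> u) = \<beta> (h u)" using to by blast
    show ?thesis using that feasible_nu[OF f] by blast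
  qed
  have 2: "\<exists>h. assignment I h \<and> (covers f \<longleftrightarrow> (\<forall>v\<in>rside I. {u\<in>lside I. h u = v} \<noteq> {}))" if ff: "feasible f" for f
  proof -
    obtain h where h: "\<forall>u\<in>lside I. f (\<nu> u) = \<beta> (h u)" using from'[OF ff] by blast
    show ?thesis using ff feasible_nu[OF h] by blast
  qed
  show "max_min_fair_matching I \<longleftrightarrow> (\<exists>f. feasible f)"
    unfolding max_min_fair_matching_iff[OF I] using 1 2 by blast
  show "max_min_fair_matching_nonempty I \<longleftrightarrow> (\<exists>f. feasible f \<and> covers f)"
    unfolding max_min_fair_matching_nonempty_iff[OF I] using 1 2 by blast
qed

end


section \<open>Parsing\<close>

text \<open>Accumulators that grow at most by a fixed multiple of the element consumed stay linear
  in the input, so the bound required by \<open>PF_fold\<close> is automatic.\<close>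

lemma PF_fold_incr:
  fixes g :: "'e :: enc \<Rightarrow> 'x :: enc \<Rightarrow> 'a :: enc \<Rightarrow> 'a"
  assumes "PF l" "PF a" "PF (\<lambda>p. g (fst p) (fst (snd p)) (snd (snd p)))"
    and k: "\<And>e x a. sz (g e x a) \<le> sz a + k * sz x"
  shows "PF (\<lambda>e. fold (g e) (l e) (a e))"
proof (rule PF_fold[OF assms(1-3), where h = "\<lambda>e. sz (a e) + k * sz (l e)"])
  show "pbd (\<lambda>e. sz (a e) + k * sz (l e))" by (intro pbd_intros assms)
  fix e xs ys assume l: "l e = xs @ ys"
  have "sz (fold (g e) xs b) \<le> sz b + k * sz xs" for b
  proof (induction xs arbitrary: b)
    case (Cons x xs)
    have "sz (fold (g e) xs (g e x b)) \<le> sz (g e x b) + k * sz xs" by (rule Cons)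
    then show ?case using k[of e x b] by (simp add: algebra_simps)
  qed simp
  moreover have "sz xs \<le> sz (l e)" using sz_append[of xs ys] sz_pos[of ys] unfolding l by linarith
  ultimately show "sz (fold (g e) xs (a e)) \<le> sz (a e) + k * sz (l e)"
    by (meson add_left_mono le_trans mult_le_mono2)
qed

type_synonym scanner = "bool list \<times> bool list \<times> bool list list \<times> bool list list list"

text \<open>The components of the scanner are the first bit of an unfinished token, the digits of
  the current number, the finished numbers of the current list, and the finished lists, the last
  three in reverse order.\<close>

definition read_bit :: "bool \<Rightarrow> scanner \<Rightarrow> scanner" where
  "read_bit b s = (case fst s of [] \<Rightarrow> ([b], snd s)
     | a # _ \<Rightarrow> ([], (if a then (b # fst (snd s), snd (snd s))
         else if b then (fst (snd s), [], rev (fst (snd (snd s))) # snd (snd (snd s)))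
         else ([], rev (fst (snd s)) # fst (snd (snd s)), snd (snd (snd s))))))"

lemma read_digits: "fold read_bit (concat (map (\<lambda>b. [True, b]) bs)) ([], cur, r) = ([], rev bs @ cur, r)"
  by (induction bs arbitrary: cur) (simp_all add: read_bit_def)

lemma read_nat_code: "fold read_bit (nat_code n) ([], [], ns, d) = ([], [], bits n # ns, d)"
  by (simp add: nat_code_def read_digits) (simp add: read_bit_def)

lemma read_list_code: "fold read_bit (list_code ns) ([], [], [], d) = ([], [], [], map bits ns # d)"
proof -
  have "fold read_bit (concat (map nat_code ns)) ([], [], ms, d) = ([], [], rev (map bits ns) @ ms, d)" for ms
    by (induction ns arbitrary: ms) (simp_all add: read_nat_code)
  then show ?thesis by (simp add: list_code_def) (simp add: read_bit_def rev_map)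
qed

lemma PF_read: "PF s \<Longrightarrow> PF (\<lambda>x. fold read_bit (s x) ([], [], [], []))"
proof (rule PF_comp[of "\<lambda>s. fold read_bit s ([], [], [], [])"], rule PF_fold_incr[where k = 3])
  show "PF (\<lambda>p :: bool list \<times> bool \<times> scanner. read_bit (fst (snd p)) (snd (snd p)))"
    unfolding read_bit_def by (intro pf_intros)
  show "sz (read_bit b s) \<le> sz s + 3 * sz b" for b s
  proof -
    obtain p c n d where s: "s = (p, c, n, d)" by (cases s) auto
    show ?thesis
      using sz_pos[of True] sz_pos[of False] sz_pos[of "tl p"] by (cases p; cases b) (simp_all add: s read_bit_def sz_rev)
  qed
qed (intro pf_intros)+

definition pair_up :: "'a \<Rightarrow> 'a list \<times> ('a \<times> 'a) list \<Rightarrow> 'a list \<times> ('a \<times> 'a) list" where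
  "pair_up x s = (case fst s of [] \<Rightarrow> ([x], snd s) | a # _ \<Rightarrow> ([], (a, x) # snd s))"

definition unpair :: "'a list \<Rightarrow> ('a \<times> 'a) list" where
  "unpair xs = rev (snd (fold pair_up xs ([], [])))"

lemma unpair_concat: "unpair (concat (map (\<lambda>(a, b). [a, b]) ps)) = ps"
proof -
  have "fold pair_up (concat (map (\<lambda>(a, b). [a, b]) ps)) ([], qs) = ([], rev ps @ qs)" for qs
  proof (induction ps arbitrary: qs)
    case (Cons p ps)
    then show ?case by (cases p) (simp add: pair_up_def)
  qed simp
  then show ?thesis by (simp add: unpair_def)
qed

lemma PF_unpair [pf_intros]:
  fixes xs :: "'e :: enc \<Rightarrow> 'a :: enc list"
  shows "PF xs \<Longrightarrow> PF (\<lambda>e. unpair (xs e))"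
proof (rule PF_comp[of unpair])
  have "PF (\<lambda>xs :: 'a list. fold pair_up xs ([], []))"
  proof (rule PF_fold_incr[where k = 3])
    show "PF (\<lambda>p :: 'a list \<times> 'a \<times> 'a list \<times> ('a \<times> 'a) list. pair_up (fst (snd p)) (snd (snd p)))"
      unfolding pair_up_def by (intro pf_intros)
    show "sz (pair_up x s) \<le> sz s + 3 * sz x" for x :: 'a and s
    proof -
      obtain p q where s: "s = (p, q)" by (cases s) auto
      show ?thesis using sz_pos[of x] by (cases p) (simp_all add: s pair_up_def)
    qed
  qed (intro pf_intros)+
  then show "PF (unpair :: 'a list \<Rightarrow> _)" unfolding unpair_def by (intro pf_intros)
qed

text \<open>Horner's scheme from the most significant bit, capped after each digit: the value is
  unary, so it must never exceed \<open>N\<close>. Capping early is harmless since doubling is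
  monotone.\<close>

definition capped :: "nat \<Rightarrow> bool list \<Rightarrow> nat" where
  "capped N bs = fold (\<lambda>b k. let m = (if b then Suc (k + k) else k + k) in if m \<le> N then m else N) (rev bs) 0"

lemma capped_bits: "capped N (bits n) = min n N"
proof -
  have "foldr (\<lambda>b k. let m = (if b then Suc (k + k) else k + k) in if m \<le> N then m else N) bs 0 =
      min (foldr (\<lambda>b k. of_bool b + 2 * k) bs 0) N" for bs
    by (induction bs) (auto simp: Let_def min_def)
  then show ?thesis by (simp add: capped_def foldr_conv_fold[symmetric] foldr_bits)
qed

lemma PF_capped [pf_intros]: "PF N \<Longrightarrow> PF bs \<Longrightarrow> PF (\<lambda>x. capped (N x) (bs x))"
proof (rule PF_app2[where h = capped])
  let ?g = "\<lambda>(N :: nat) b k. let m = (if b then Suc (k + k) else k + k) in if m \<le> N then m else N"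
  have le: "fold (?g N) xs 0 \<le> N" for N xs
    by (induction xs rule: rev_induct) (auto simp: Let_def)
  show "PF (\<lambda>p. capped (fst p) (snd p))"
    unfolding capped_def
  proof (rule PF_fold[where g = "\<lambda>p. ?g (fst p)" and h = "\<lambda>p. sz (fst p)"])
    show "pbd (\<lambda>p :: nat \<times> bool list. sz (fst p))" by (intro pbd_intros pf_intros)
    show "sz (fold (?g (fst p)) xs 0) \<le> sz (fst p)" for p :: "nat \<times> bool list" and xs
      using le[where N = "fst p" and xs = xs] unfolding sz_nat by (intro add_mono mult_left_mono) simp_all
  qed (intro pf_intros)+
qed

definition head :: "'a list list \<Rightarrow> 'a list" where
  "head xs = (case xs of [] \<Rightarrow> [] | x # _ \<Rightarrow> x)"

lemma PF_head [pf_intros]: "PF xs \<Longrightarrow> PF (\<lambda>x. head (xs x))"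
  by (rule PF_comp[of head]) (unfold head_def, intro pf_intros)

text \<open>Names stay lists of bits, as their unary values could be exponentially large. The
  fairness bound comes last and belongs to no list, so it is found among the finished numbers of the
  list under construction; the lists themselves appear in reverse order.\<close>

definition parse :: "bool list \<Rightarrow> bool list inst" where
  "parse s = (let r = fold read_bit s ([], [], [], []); d = snd (snd (snd r)); us = unpair (head (tl (tl (tl d)))) in
     (us, head (tl (tl d)), unpair (head (tl d)), head d, capped (length us + 3) (head (fst (snd (snd r))))))"

lemma PF_parse [pf_intros]: "PF s \<Longrightarrow> PF (\<lambda>x. parse (s x))"
  by (rule PF_comp[of parse]) (unfold parse_def, intro pf_intros PF_read)

lemma read_pairs_code:
  "fold read_bit (pairs_code ps) ([], [], [], d) =
    ([], [], [], concat (map (\<lambda>(a, b). [a, b]) (map (map_prod bits bits) ps)) # d)"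
  by (simp add: pairs_code_def read_list_code map_concat comp_def case_prod_beta)

lemma parse_code:
  "parse (pairs_code ps @ list_code vs @ pairs_code es @ list_code cs @ nat_code n) =
    (map (map_prod bits bits) ps, map bits vs, map (map_prod bits bits) es, map bits cs, min n (length ps + 3))"
  unfolding parse_def
  by (simp add: read_list_code read_pairs_code read_nat_code unpair_concat capped_bits head_def
      del: map_map list.map)

lemma parse_instance_lists:
  assumes "fm_instance I" "encodes s I"
  shows "instance_lists (parse s) I bits bits"
proof -
  obtain us vs es cs where e: "distinct us" "set us = lside I" "distinct vs" "set vs = rside I"
      "set es = {(u, v). u \<in> lside I \<and> v \<in> rside I \<and> {u, v} \<in> edges I}" "distinct cs" "set cs = colors I"
    and s: "s = pairs_code (map (\<lambda>u. (u, col I u)) us) @ list_code vs @ pairs_code es @ list_code cs @ nat_code (ell I)"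
    using assms(2) unfolding encodes_def by blast
  have inj: "inj bits" by (rule injI) (simp add: bits_eq_iff)
  have p: "parse s = (map (\<lambda>u. (bits u, bits (col I u))) us, map bits vs, map (map_prod bits bits) es,
      map bits cs, min (ell I) (length us + 3))"
    unfolding s parse_code by (simp add: comp_def)
  have c: "colors I \<noteq> {}" "col I ` lside I \<subseteq> colors I" using assms(1) by (simp_all add: fm_instance_def)
  show ?thesis
  proof
    show "distinct (ius (parse s))" using e(1) by (auto simp: p distinct_map inj_on_def bits_eq_iff)
    show "distinct (ivs (parse s))" using e(3) by (auto simp: p distinct_map inj_on_def bits_eq_iff)
    show "distinct (ics (parse s))" using e(6) by (auto simp: p distinct_map inj_on_def bits_eq_iff)
    show "ics (parse s) \<noteq> []" using c(1) e(7) by (auto simp: p)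
    show "snd ` set (ius (parse s)) \<subseteq> set (ics (parse s))" using c(2) e(2,7) by (auto simp: p)
    show "set (ies (parse s)) =
        (\<lambda>(u, v). (bits u, bits v)) ` {(u, v). u \<in> lside I \<and> v \<in> rside I \<and> {u, v} \<in> edges I}"
      unfolding p e(5)[symmetric] by (simp add: map_prod_def)
    show "il (parse s) = min (ell I) (card (lside I) + 3)"
      using distinct_card[OF e(1)] e(2) by (simp add: p)
  qed (use assms(1) inj e in \<open>simp_all add: p\<close>)
qed

definition problem :: "bool \<Rightarrow> ('v, 'c) fm_instance \<Rightarrow> bool" where
  "problem ne = (if ne then max_min_fair_matching_nonempty else max_min_fair_matching)"

lemma poly_time_problem:
  assumes "PF d" "\<And>s I. fm_instance I \<Longrightarrow> encodes s I \<Longrightarrow> Q (Delta_U I) (Delta_V I) \<Longrightarrow>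
    instance_lists (parse s) I bits bits \<Longrightarrow> d (parse s) \<longleftrightarrow> problem ne I"
  shows "poly_time_solvable (encodings (\<lambda>I. Q (Delta_U I) (Delta_V I))) (encodings (problem ne))"
proof (rule PF_poly_time_solvable[where d = "\<lambda>s. d (parse s)"])
  show "PF (\<lambda>s. d (parse s))" by (rule PF_comp[OF assms(1)]) (intro pf_intros)
  fix s assume "s \<in> encodings (\<lambda>I. Q (Delta_U I) (Delta_V I))"
  then obtain I where I: "fm_instance I" "Q (Delta_U I) (Delta_V I)" "encodes s I"
    unfolding encodings_def by blast
  \<comment> \<open>The string may encode another instance than the one that witnesses the degrees,
    but both agree on sides and edges and hence on the degrees.\<close>
  have d: "d (parse s) \<longleftrightarrow> problem ne I'" if I': "fm_instance I'" "encodes s I'" for I'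
  proof (rule assms(2)[OF I' _ parse_instance_lists[OF I']])
    show "Q (Delta_U I') (Delta_V I')"
      using I(2) unfolding Delta_U_def Delta_V_def encodes_unique[OF I' I(1,3)] .
  qed
  show "d (parse s) \<longleftrightarrow> s \<in> encodings (problem ne)"
    unfolding encodings_def using d I by blast
qed

theorem poly_time_cases:
  "poly_time_solvable (encodings (\<lambda>I. Delta_U I \<le> 1)) (encodings (problem ne))"
  "poly_time_solvable (encodings (\<lambda>I. Delta_V I \<le> 2)) (encodings (problem ne))"
  "poly_time_solvable (encodings (\<lambda>I. Delta_U I = 2 \<and> Delta_V I = 3)) (encodings (problem ne))"
proof -
  have ball_le: "\<forall>x\<in>X. f x \<le> b" if "\<forall>x\<in>X. f x \<le> a" "a \<le> b" for X and f :: "'x \<Rightarrow> nat" and a b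
    using that by (meson le_trans)
  show "poly_time_solvable (encodings (\<lambda>I. Delta_U I \<le> 1)) (encodings (problem ne))"
  proof (rule poly_time_problem[where d = "dec_deg1 ne" and Q = "\<lambda>a b. a \<le> 1"])
    fix s and I :: "(nat, nat) fm_instance" assume deg: "Delta_U I \<le> 1" "instance_lists (parse s) I bits bits"
    interpret instance_lists "parse s" I bits bits by (rule deg)
    show "dec_deg1 ne (parse s) \<longleftrightarrow> problem ne I"
      using dec_deg1_iff[OF ball_le[OF ladj_le deg(1)]] matching_iff by (cases ne) (simp_all add: problem_def)
  qed (intro pf_intros)
  show "poly_time_solvable (encodings (\<lambda>I. Delta_V I \<le> 2)) (encodings (problem ne))"
  proof (rule poly_time_problem[where d = "decide 2 ne" and Q = "\<lambda>a b. b \<le> 2"])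
    fix s and I :: "(nat, nat) fm_instance" assume deg: "Delta_V I \<le> 2" "instance_lists (parse s) I bits bits"
    interpret instance_lists "parse s" I bits bits by (rule deg)
    show "decide 2 ne (parse s) \<longleftrightarrow> problem ne I"
      using decide_iff[OF ball_le[OF linc_le deg(1)]] matching_iff by (cases ne) (simp_all add: problem_def)
  qed (intro pf_intros)
  show "poly_time_solvable (encodings (\<lambda>I. Delta_U I = 2 \<and> Delta_V I = 3)) (encodings (problem ne))"
  proof (rule poly_time_problem[where d = "decide 3 ne" and Q = "\<lambda>a b. a = 2 \<and> b = 3"])
    fix s and I :: "(nat, nat) fm_instance" assume deg: "Delta_U I = 2 \<and> Delta_V I = 3" "instance_lists (parse s) I bits bits"
    interpret instance_lists "parse s" I bits bits by (rule deg)
    show "decide 3 ne (parse s) \<longleftrightarrow> problem ne I"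
      using decide_iff[of 3] deg(1) linc_le ladj_le matching_iff by (cases ne) (simp_all add: problem_def)
  qed (intro pf_intros)
qed

section \<open>Nondeterministic polynomial time and propositional logic\<close>

definition holds :: "('v \<Rightarrow> bool) \<Rightarrow> (bool \<times> 'v) list \<Rightarrow> bool" where
  "holds \<tau> cl \<longleftrightarrow> (\<exists>l\<in>set cl. \<tau> (snd l) = fst l)"

definition satisfiable :: "(bool \<times> 'v) list list \<Rightarrow> bool" where
  "satisfiable F \<longleftrightarrow> (\<exists>\<tau>. \<forall>cl\<in>set F. holds \<tau> cl)"

text \<open>Halting states are turned into fixed points, so that the rules need no exception after
  the machine has halted and the answer can be read off at time \<open>T\<close>.\<close>

definition transition :: "tm \<Rightarrow> nat \<Rightarrow> nat list \<Rightarrow> nat \<times> (nat \<times> move) list" where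
  "transition M q ss = (if q = 1 \<or> q = 2 then (q, map (\<lambda>s. (s, Stay)) ss) else delta M q ss)"

text \<open>The index exceeds the displacement by one, so that the new position is
  \<open>p + d - 1\<close> in natural numbers; the truncation is harmless for
  \<open>p \<ge> 1\<close>.\<close>

fun move_index :: "move \<Rightarrow> nat" where
  "move_index Left = 0"
| "move_index Stay = 1"
| "move_index Right = 2"

definition table_entry :: "tm \<Rightarrow> nat \<Rightarrow> nat list \<Rightarrow> nat \<times> (nat \<times> nat) list \<times> nat \<times> (nat \<times> nat \<times> nat) list" where
  "table_entry M q ss = (q, map (\<lambda>j. (j, ss ! j)) [0..<num_tapes M], fst (transition M q ss),
     map (\<lambda>j. (j, fst (snd (transition M q ss) ! j), move_index (snd (snd (transition M q ss) ! j)))) [0..<num_tapes M])"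

definition table :: "tm \<Rightarrow> (nat \<times> (nat \<times> nat) list \<times> nat \<times> (nat \<times> nat \<times> nat) list) list" where
  "table M = concat (map (\<lambda>q. map (table_entry M q) (List.n_lists (num_tapes M) [0..<num_symbols M])) [0..<num_states M])"

lemma ball_table:
  "(\<forall>e\<in>set (table M). P e) \<longleftrightarrow>
    (\<forall>q<num_states M. \<forall>ss. length ss = num_tapes M \<longrightarrow> set ss \<subseteq> {..<num_symbols M} \<longrightarrow> P (table_entry M q ss))"
  unfolding table_def by (auto simp: set_n_lists atLeast0LessThan)

text \<open>
  A variable is a list of a kind and its indices: \<open>[0, t, q]\<close> says that the state at time \<open>t\<close> is
  \<open>q\<close>, \<open>[1, t, j, p]\<close> that head \<open>j\<close> is at position \<open>p\<close>, \<open>[2, t, j, p, s]\<close> that this cell contains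
  \<open>s\<close>, and \<open>[3, t, j, s]\<close>, \<open>[4, t, j, s]\<close>, \<open>[5, t, j, d]\<close> that tape \<open>j\<close> has the scanned symbol \<open>s\<close>,
  the written symbol \<open>s\<close>, the move \<open>d\<close>. Positions are shifted by the time bound \<open>T\<close>. All clauses but
  those for the cells of the witness and for acceptance are Horn, so that every fact of the actual
  run is forced while nothing needs to exclude further true variables.
\<close>

definition step_rules :: "tm \<Rightarrow> nat \<Rightarrow> nat \<Rightarrow> (nat list list \<times> nat list) list" where
  "step_rules M T t =
     concat (map (\<lambda>j. concat (map (\<lambda>p.
       concat (map (\<lambda>s. ([[1, t, j, p], [2, t, j, p, s]], [3, t, j, s]) # ([[1, t, j, p], [4, t, j, s]], [2, t + 1, j, p, s]) #
         map (\<lambda>p'. ([[2, t, j, p, s], [1, t, j, p']], [2, t + 1, j, p, s])) (filter (\<lambda>p'. p \<noteq> p') [0..<2 * T + 1]))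
         [0..<num_symbols M]) @
       map (\<lambda>d. ([[1, t, j, p], [5, t, j, d]], [1, t + 1, j, p + d - 1])) [0, 1, 2]) [0..<2 * T + 1]))
       [0..<num_tapes M]) @
     concat (map (\<lambda>(q, ps, q', as).
       let pre = [0, t, q] # map (\<lambda>(j, s). [3, t, j, s]) ps in
       (pre, [0, t + 1, q']) # map (\<lambda>(j, s, d). (pre, [4, t, j, s])) as @ map (\<lambda>(j, s, d). (pre, [5, t, j, d])) as)
       (table M))"

text \<open>On tape 0 there are \<open>T\<close> blanks, the given input, \<open>Q\<close> cells for
  the witness, and blanks up to a position that covers \<open>2 * T\<close> in any case. A blank
  cell of the witness forces all later cells to be blank, so the witness is a string of length at
  most \<open>Q\<close>.\<close>

definition init_rules :: "tm \<Rightarrow> nat \<Rightarrow> nat \<Rightarrow> bool list \<Rightarrow> (nat list list \<times> nat list) list" where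
  "init_rules M T Q y = ([], [0, 0, 0]) # map (\<lambda>j. ([], [1, 0, j, T])) [0..<num_tapes M] @
     concat (map (\<lambda>j. map (\<lambda>p. ([], [2, 0, j, p, 0])) [0..<2 * T + 1]) [1..<num_tapes M]) @
     map (\<lambda>p. ([], [2, 0, 0, p, 0])) [0..<T] @
     map (\<lambda>(i, b). ([], [2, 0, 0, T + i, if b then 2 else 1])) (zip [0..<length y] y) @
     map (\<lambda>p. ([[2, 0, 0, p, 0]], [2, 0, 0, p + 1, 0])) [T + length y..<T + length y + Q] @
     map (\<lambda>p. ([], [2, 0, 0, p, 0])) [T + length y + Q..<T + length y + Q + 2 * T + 1]"

definition tableau :: "tm \<Rightarrow> nat \<Rightarrow> nat \<Rightarrow> bool list \<Rightarrow> (bool \<times> nat list) list list" where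
  "tableau M T Q y =
     map (\<lambda>r. (True, snd r) # map (\<lambda>v. (False, v)) (fst r))
       (init_rules M T Q y @ concat (map (step_rules M T) [0..<T])) @
     map (\<lambda>p. map (\<lambda>s. (True, [2, 0, 0, p, s])) [0, 1, 2]) [T + length y..<T + length y + Q] @
     map (\<lambda>q. [(False, [0, T, q])]) (filter (\<lambda>q. q \<noteq> 1) [0..<num_states M])"

definition init_model :: "tm \<Rightarrow> nat \<Rightarrow> nat \<Rightarrow> bool list \<Rightarrow> (nat list \<Rightarrow> bool) \<Rightarrow> bool" where
  "init_model M T Q y \<tau> \<longleftrightarrow> \<tau> [0, 0, 0] \<and> (\<forall>j<num_tapes M. \<tau> [1, 0, j, T]) \<and>
      (\<forall>j p. 1 \<le> j \<and> j < num_tapes M \<and> p \<le> 2 * T \<longrightarrow> \<tau> [2, 0, j, p, 0]) \<and> (\<forall>p<T. \<tau> [2, 0, 0, p, 0]) \<and>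
      (\<forall>i<length y. \<tau> [2, 0, 0, T + i, if y ! i then 2 else 1]) \<and>
      (\<forall>p. T + length y \<le> p \<and> p < T + length y + Q \<longrightarrow> \<tau> [2, 0, 0, p, 0] \<longrightarrow> \<tau> [2, 0, 0, p + 1, 0]) \<and>
      (\<forall>p. T + length y + Q \<le> p \<and> p \<le> T + length y + Q + 2 * T \<longrightarrow> \<tau> [2, 0, 0, p, 0])"

definition move_model :: "tm \<Rightarrow> nat \<Rightarrow> (nat list \<Rightarrow> bool) \<Rightarrow> nat \<Rightarrow> bool" where
  "move_model M T \<tau> t \<longleftrightarrow> (\<forall>j<num_tapes M. \<forall>p\<le>2 * T.
        (\<forall>s<num_symbols M. (\<tau> [1, t, j, p] \<and> \<tau> [2, t, j, p, s] \<longrightarrow> \<tau> [3, t, j, s]) \<and>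
          (\<tau> [1, t, j, p] \<and> \<tau> [4, t, j, s] \<longrightarrow> \<tau> [2, t + 1, j, p, s]) \<and>
          (\<forall>p'\<le>2 * T. p \<noteq> p' \<longrightarrow> \<tau> [2, t, j, p, s] \<and> \<tau> [1, t, j, p'] \<longrightarrow> \<tau> [2, t + 1, j, p, s])) \<and>
        (\<forall>d\<in>{0, 1, 2}. \<tau> [1, t, j, p] \<and> \<tau> [5, t, j, d] \<longrightarrow> \<tau> [1, t + 1, j, p + d - 1]))"

definition step_model :: "tm \<Rightarrow> (nat list \<Rightarrow> bool) \<Rightarrow> nat \<Rightarrow> bool" where
  "step_model M \<tau> t \<longleftrightarrow> (\<forall>q<num_states M. \<forall>ss. length ss = num_tapes M \<longrightarrow> set ss \<subseteq> {..<num_symbols M} \<longrightarrow>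
          \<tau> [0, t, q] \<and> (\<forall>j<num_tapes M. \<tau> [3, t, j, ss ! j]) \<longrightarrow>
          \<tau> [0, t + 1, fst (transition M q ss)] \<and>
          (\<forall>j<num_tapes M. \<tau> [4, t, j, fst (snd (transition M q ss) ! j)] \<and>
             \<tau> [5, t, j, move_index (snd (snd (transition M q ss) ! j))]))"

definition model :: "tm \<Rightarrow> nat \<Rightarrow> nat \<Rightarrow> bool list \<Rightarrow> (nat list \<Rightarrow> bool) \<Rightarrow> bool" where
  "model M T Q y \<tau> \<longleftrightarrow> init_model M T Q y \<tau> \<and> (\<forall>t<T. move_model M T \<tau> t \<and> step_model M \<tau> t) \<and>
     (\<forall>p. T + length y \<le> p \<and> p < T + length y + Q \<longrightarrow> (\<exists>s\<in>{0, 1, 2}. \<tau> [2, 0, 0, p, s])) \<and>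
     (\<forall>q<num_states M. q \<noteq> 1 \<longrightarrow> \<not> \<tau> [0, T, q])"

lemma holds_rule: "holds \<tau> ((True, v) # map (\<lambda>v. (False, v)) ps) \<longleftrightarrow> ((\<forall>p\<in>set ps. \<tau> p) \<longrightarrow> \<tau> v)"
  by (auto simp: holds_def)

lemma ball_zip_upt: "(\<forall>x\<in>set (zip [0..<length c] c). P x) \<longleftrightarrow> (\<forall>i<length c. P (i, c ! i))"
proof -
  have "set (zip [0..<length c] c) = (\<lambda>i. (i, c ! i)) ` {..<length c}"
    by (force simp: set_zip image_iff)
  then show ?thesis by auto
qed

lemma tableau_model: "(\<forall>cl\<in>set (tableau M T Q y). holds \<tau> cl) \<longleftrightarrow> model M T Q y \<tau>"
proof -
  let ?P = "\<lambda>r. (\<forall>p\<in>set (fst r). \<tau> p) \<longrightarrow> \<tau> (snd r)"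
  have upt: "(\<forall>x\<in>set [a..<b]. P x) \<longleftrightarrow> (\<forall>x. a \<le> x \<and> x < b \<longrightarrow> P x)" for P a b by auto
  have le: "x < 2 * T + 1 \<longleftrightarrow> x \<le> 2 * T" "x < n + 2 * T + 1 \<longleftrightarrow> x \<le> n + 2 * T" for x n by auto
  have init: "(\<forall>r\<in>set (init_rules M T Q y). ?P r) \<longleftrightarrow> init_model M T Q y \<tau>"
    unfolding init_rules_def init_model_def list.set set_append set_map set_concat ball_Un ball_UN ball_simps ball_zip_upt upt le
    by auto
  have filt: "(\<forall>x\<in>set (filter (\<lambda>p'. p \<noteq> p') [0..<2 * T + 1]). P x) \<longleftrightarrow> (\<forall>x\<le>2 * T. p \<noteq> x \<longrightarrow> P x)" for p P
  proof -
    have "set (filter (\<lambda>p'. p \<noteq> p') [0..<2 * T + 1]) = {x. x \<le> 2 * T \<and> p \<noteq> x}" by auto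
    then show ?thesis by blast
  qed
  have move: "(\<forall>r\<in>set (concat (map (\<lambda>j. concat (map (\<lambda>p.
       concat (map (\<lambda>s. ([[1, t, j, p], [2, t, j, p, s]], [3, t, j, s]) # ([[1, t, j, p], [4, t, j, s]], [2, t + 1, j, p, s]) #
         map (\<lambda>p'. ([[2, t, j, p, s], [1, t, j, p']], [2, t + 1, j, p, s])) (filter (\<lambda>p'. p \<noteq> p') [0..<2 * T + 1]))
         [0..<num_symbols M]) @
       map (\<lambda>d. ([[1, t, j, p], [5, t, j, d]], [1, t + 1, j, p + d - 1])) [0, 1, 2]) [0..<2 * T + 1]))
       [0..<num_tapes M])). ?P r) \<longleftrightarrow> move_model M T \<tau> t" for t
    unfolding move_model_def set_append set_concat set_map ball_Un ball_UN ball_simps filt upt le list.set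
    by simp
  have table: "(\<forall>r\<in>set (concat (map (\<lambda>(q, ps, q', as).
       let pre = [0, t, q] # map (\<lambda>(j, s). [3, t, j, s]) ps in
       (pre, [0, t + 1, q']) # map (\<lambda>(j, s, d). (pre, [4, t, j, s])) as @ map (\<lambda>(j, s, d). (pre, [5, t, j, d])) as)
       (table M))). ?P r) \<longleftrightarrow> step_model M \<tau> t" for t
    unfolding set_concat set_map ball_UN ball_simps ball_table step_model_def
    unfolding table_entry_def Let_def prod.case list.set set_append set_map ball_Un ball_simps fst_conv snd_conv upt
    by (intro all_cong1 imp_cong refl) (simp, blast)
  have step: "(\<forall>r\<in>set (step_rules M T t). ?P r) \<longleftrightarrow> move_model M T \<tau> t \<and> step_model M \<tau> t" for t
    unfolding step_rules_def set_append ball_Un move table ..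
  show ?thesis
    unfolding tableau_def model_def set_append set_map ball_Un ball_simps holds_rule set_concat ball_UN upt init step
    by (auto simp: holds_def)
qed

section \<open>Runs of a Turing machine as models of the clauses\<close>

lemma step_transition:
  "step M c = (fst (transition M (fst c) (map scan (snd c))), map2 act (snd (transition M (fst c) (map scan (snd c)))) (snd c))"
proof -
  have "map2 act (map (\<lambda>s. (s, Stay)) (map scan ts)) ts = ts" for ts :: "tape list"
    by (induction ts) auto
  then show ?thesis
    by (cases c) (auto simp: step_def transition_def halted_def accepting_def rejecting_def split: prod.splits)
qed

definition head_at :: "config \<Rightarrow> nat \<Rightarrow> int" where
  "head_at c j = snd (snd c ! j)"

definition cell_at :: "config \<Rightarrow> nat \<Rightarrow> int \<Rightarrow> nat" where
  "cell_at c j i = fst (snd c ! j) i"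

definition scanned :: "config \<Rightarrow> nat list" where
  "scanned c = map scan (snd c)"

locale machine =
  fixes M :: tm
  assumes M: "turing_machine M"
begin

definition valid :: "config \<Rightarrow> bool" where
  "valid c \<longleftrightarrow> length (snd c) = num_tapes M \<and> fst c < num_states M \<and>
     (\<forall>j<num_tapes M. \<forall>i. cell_at c j i < num_symbols M)"

lemma valid_scanned:
  assumes "valid c"
  shows "length (scanned c) = num_tapes M" "set (scanned c) \<subseteq> {..<num_symbols M}"
    "j < num_tapes M \<Longrightarrow> scanned c ! j = cell_at c j (head_at c j)"
proof -
  show nth: "scanned c ! j = cell_at c j (head_at c j)" if "j < num_tapes M" for j
    using assms that by (cases "snd c ! j") (simp add: valid_def scanned_def cell_at_def head_at_def)
  show len: "length (scanned c) = num_tapes M" using assms by (simp add: valid_def scanned_def)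
  show "set (scanned c) \<subseteq> {..<num_symbols M}"
    using assms nth len by (auto simp: in_set_conv_nth valid_def)
qed

lemma transition_bounds:
  assumes "q < num_states M" "length ss = num_tapes M" "set ss \<subseteq> {..<num_symbols M}"
  shows "fst (transition M q ss) < num_states M" "length (snd (transition M q ss)) = num_tapes M"
    "j < num_tapes M \<Longrightarrow> fst (snd (transition M q ss) ! j) < num_symbols M"
proof -
  have *: "case delta M q ss of (q', as) \<Rightarrow> q' < num_states M \<and> length as = num_tapes M \<and> fst ` set as \<subseteq> {..<num_symbols M}"
  proof -
    have "\<forall>q<num_states M. \<forall>ss. length ss = num_tapes M \<and> set ss \<subseteq> {..<num_symbols M} \<longrightarrow>
        (case delta M q ss of (q', as) \<Rightarrow> q' < num_states M \<and> length as = num_tapes M \<and> fst ` set as \<subseteq> {..<num_symbols M})"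
      using M unfolding turing_machine_def by (elim conjE)
    from this[rule_format, OF assms(1) conjI[OF assms(2,3)]] show ?thesis .
  qed
  show "fst (transition M q ss) < num_states M" and l: "length (snd (transition M q ss)) = num_tapes M"
    using * assms by (auto simp: transition_def)
  have "fst ` set (snd (transition M q ss)) \<subseteq> {..<num_symbols M}"
  proof (cases "q = 1 \<or> q = 2")
    case True
    then show ?thesis using assms by (auto simp: transition_def)
  next
    case False
    then show ?thesis using * by (simp add: transition_def split: prod.splits)
  qed
  moreover have "fst (snd (transition M q ss) ! j) \<in> fst ` set (snd (transition M q ss))" if "j < num_tapes M"
    using that l by (intro imageI nth_mem) simp
  ultimately show "j < num_tapes M \<Longrightarrow> fst (snd (transition M q ss) ! j) < num_symbols M" by blast
qed

definition action :: "config \<Rightarrow> nat \<Rightarrow> nat \<times> move" where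
  "action c j = snd (transition M (fst c) (scanned c)) ! j"

lemma step_facts:
  assumes "valid c"
  shows "fst (step M c) = fst (transition M (fst c) (scanned c))"
    "j < num_tapes M \<Longrightarrow> head_at (step M c) j = head_at c j + shift (snd (action c j))"
    "j < num_tapes M \<Longrightarrow> cell_at (step M c) j i = (if i = head_at c j then fst (action c j) else cell_at c j i)"
    "valid (step M c)"
proof -
  have v: "fst c < num_states M" using assms by (simp add: valid_def)
  note b = transition_bounds[OF v valid_scanned(1,2)[OF assms]]
  show q: "fst (step M c) = fst (transition M (fst c) (scanned c))"
    by (simp add: step_transition scanned_def)
  have t: "snd (step M c) ! j = act (action c j) (snd c ! j)" if "j < num_tapes M" for j
    using that b(2) assms by (simp add: step_transition action_def scanned_def valid_def)
  show "j < num_tapes M \<Longrightarrow> head_at (step M c) j = head_at c j + shift (snd (action c j))" for j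
    using t[of j] by (cases "snd c ! j"; cases "action c j") (simp add: head_at_def)
  show cell: "j < num_tapes M \<Longrightarrow> cell_at (step M c) j i = (if i = head_at c j then fst (action c j) else cell_at c j i)" for j i
    using t[of j] by (cases "snd c ! j"; cases "action c j") (simp add: cell_at_def head_at_def)
  have "length (snd (step M c)) = num_tapes M"
    using b(2) assms by (simp add: step_transition scanned_def valid_def)
  then show "valid (step M c)"
    using assms b(1,3) cell unfolding valid_def q by (simp add: action_def)
qed

lemma run_Suc: "run M x (Suc t) = step M (run M x t)"
  by (simp add: run_def)

lemma initial_facts:
  "valid (initial M x)" "fst (initial M x) = 0" "j < num_tapes M \<Longrightarrow> head_at (initial M x) j = 0"
  "j < num_tapes M \<Longrightarrow> cell_at (initial M x) j i = (if j = 0 then contents x i else 0)"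
proof -
  show "fst (initial M x) = 0" by (simp add: initial_def)
  have k: "num_tapes M \<ge> 1" "num_states M \<ge> 3" "num_symbols M \<ge> 3" using M by (simp_all add: turing_machine_def)
  show "j < num_tapes M \<Longrightarrow> head_at (initial M x) j = 0" by (cases j) (simp_all add: initial_def head_at_def)
  show cell: "j < num_tapes M \<Longrightarrow> cell_at (initial M x) j i = (if j = 0 then contents x i else 0)" for i j
    by (cases j) (simp_all add: initial_def cell_at_def)
  show "valid (initial M x)"
    using k cell by (simp add: valid_def) (auto simp: initial_def contents_def)
qed

lemma run_facts: "valid (run M x t)" "j < num_tapes M \<Longrightarrow> \<bar>head_at (run M x t) j\<bar> \<le> int t"
proof -
  show v: "valid (run M x t)" for t
    by (induction t) (simp_all add: run_Suc step_facts(4), simp add: run_def initial_facts)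
  show "j < num_tapes M \<Longrightarrow> \<bar>head_at (run M x t) j\<bar> \<le> int t"
  proof (induction t)
    case 0
    then show ?case by (simp add: run_def initial_facts)
  next
    case (Suc t)
    have "\<bar>shift d\<bar> \<le> 1" for d by (cases d) auto
    then have "\<bar>shift (snd (action (run M x t) j))\<bar> \<le> 1" .
    then show ?case using Suc step_facts(2)[OF v[of t], of j] by (simp add: run_Suc)
  qed
qed

lemma move_index: "p \<ge> 1 \<Longrightarrow> int (p + move_index d - 1) = int p + shift d"
  by (cases d) auto

text \<open>The witness is read off the cells provided for it. By induction on the time, the rules
  then force all facts of the run on this witness to be true, in particular its state at time
  \<open>T\<close>; the clauses for acceptance leave only state 1.\<close>

lemma model_run:
  assumes model: "model M T Q y \<tau>"
  obtains w where "length w \<le> Q" "accepting (run M (y @ w) T)"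
proof -
  let ?m = "length y"
  define b where "b i = \<tau> [2, 0, 0, T + ?m + i, 0]" for i
  have mi: "\<tau> [0, 0, 0]" "\<And>j. j < num_tapes M \<Longrightarrow> \<tau> [1, 0, j, T]"
      "\<And>j p. 1 \<le> j \<Longrightarrow> j < num_tapes M \<Longrightarrow> p \<le> 2 * T \<Longrightarrow> \<tau> [2, 0, j, p, 0]" "\<And>p. p < T \<Longrightarrow> \<tau> [2, 0, 0, p, 0]"
      "\<And>i. i < ?m \<Longrightarrow> \<tau> [2, 0, 0, T + i, if y ! i then 2 else 1]"
      "\<And>p. T + ?m \<le> p \<Longrightarrow> p < T + ?m + Q \<Longrightarrow> \<tau> [2, 0, 0, p, 0] \<Longrightarrow> \<tau> [2, 0, 0, p + 1, 0]"
      "\<And>p. T + ?m + Q \<le> p \<Longrightarrow> p \<le> T + ?m + Q + 2 * T \<Longrightarrow> \<tau> [2, 0, 0, p, 0]"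
      "\<And>p. T + ?m \<le> p \<Longrightarrow> p < T + ?m + Q \<Longrightarrow> \<exists>s\<in>{0, 1, 2}. \<tau> [2, 0, 0, p, s]"
      "\<And>q. q < num_states M \<Longrightarrow> q \<noteq> 1 \<Longrightarrow> \<not> \<tau> [0, T, q]"
    using model unfolding model_def init_model_def by blast+
  have mv: "move_model M T \<tau> t" and st: "step_model M \<tau> t" if "t < T" for t
    using model that by (simp_all add: model_def)
  have ms: "\<And>j p s. j < num_tapes M \<Longrightarrow> p \<le> 2 * T \<Longrightarrow> s < num_symbols M \<Longrightarrow> \<tau> [1, t, j, p] \<Longrightarrow> \<tau> [2, t, j, p, s] \<Longrightarrow> \<tau> [3, t, j, s]"
      "\<And>j p s. j < num_tapes M \<Longrightarrow> p \<le> 2 * T \<Longrightarrow> s < num_symbols M \<Longrightarrow> \<tau> [1, t, j, p] \<Longrightarrow> \<tau> [4, t, j, s] \<Longrightarrow> \<tau> [2, t + 1, j, p, s]"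
      "\<And>j p p' s. j < num_tapes M \<Longrightarrow> p \<le> 2 * T \<Longrightarrow> s < num_symbols M \<Longrightarrow> p' \<le> 2 * T \<Longrightarrow> p \<noteq> p' \<Longrightarrow> \<tau> [2, t, j, p, s] \<Longrightarrow>
        \<tau> [1, t, j, p'] \<Longrightarrow> \<tau> [2, t + 1, j, p, s]"
      "\<And>j p d. j < num_tapes M \<Longrightarrow> p \<le> 2 * T \<Longrightarrow> d \<in> {0, 1, 2} \<Longrightarrow> \<tau> [1, t, j, p] \<Longrightarrow> \<tau> [5, t, j, d] \<Longrightarrow> \<tau> [1, t + 1, j, p + d - 1]" if "t < T" for t
    using mv[OF that] unfolding move_model_def by blast+
  have ms5: "\<And>q ss. q < num_states M \<Longrightarrow> length ss = num_tapes M \<Longrightarrow> set ss \<subseteq> {..<num_symbols M} \<Longrightarrow>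
          \<tau> [0, t, q] \<Longrightarrow> (\<forall>j<num_tapes M. \<tau> [3, t, j, ss ! j]) \<Longrightarrow>
          \<tau> [0, t + 1, fst (transition M q ss)] \<and>
          (\<forall>j<num_tapes M. \<tau> [4, t, j, fst (snd (transition M q ss) ! j)] \<and>
             \<tau> [5, t, j, move_index (snd (snd (transition M q ss) ! j))])" if "t < T" for t
    using st[OF that] unfolding step_model_def by blast
  have bQ: "b Q" unfolding b_def by (rule mi(7)) simp_all
  \<comment> \<open>The witness ends before its first blank cell, which exists within
    \<open>Q\<close> because the cells behind the witness are blank. A cell before it may carry both
    symbols 1 and 2; it is then read as 2.\<close>
  define n where "n = (LEAST i. b i)"
  have n: "b n" "n \<le> Q" "\<And>i. i < n \<Longrightarrow> \<not> b i"
    unfolding n_def using bQ by (auto intro: LeastI Least_le dest: not_less_Least)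
  have up: "b i" if "n \<le> i" "i \<le> Q" for i
    using that
  proof (induction i rule: dec_induct)
    case (step i)
    then show ?case using mi(6)[of "T + ?m + i"] by (simp add: b_def)
  qed (rule n)
  define w where "w = map (\<lambda>i. \<tau> [2, 0, 0, T + ?m + i, 2]) [0..<n]"
  have w: "length w = n" by (simp add: w_def)
  let ?c = "run M (y @ w)"
  have cell0: "\<tau> [2, 0, 0, p, contents (y @ w) (int p - int T)]" if "p \<le> 2 * T" for p
  proof -
    consider "p < T" | (y) i where "p = T + i" "i < ?m" | (w) i where "p = T + ?m + i" "i < n"
      | (b) i where "p = T + ?m + i" "n \<le> i"
      by (metis add.assoc le_add_diff_inverse not_less)
    then show ?thesis
    proof cases
      case 1
      then show ?thesis using mi(4) by (simp add: contents_def)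
    next
      case (y i)
      then show ?thesis using mi(5)[of i] by (auto simp: contents_def nth_append)
    next
      case (w i)
      have nb: "\<not> \<tau> [2, 0, 0, p, 0]" using n(3)[OF w(2)] by (simp add: b_def w(1))
      have "\<exists>s\<in>{0, 1, 2}. \<tau> [2, 0, 0, p, s]" by (rule mi(8)) (use w n(2) in simp_all)
      then have "\<tau> [2, 0, 0, p, if \<tau> [2, 0, 0, p, 2] then 2 else 1]" using nb by auto
      moreover have "contents (y @ w) (int p - int T) = (if \<tau> [2, 0, 0, p, 2] then 2 else 1)"
      proof -
        have "nat (int p - int T) = ?m + i" using w(1) by simp
        then show ?thesis using w \<open>length w = n\<close> by (simp add: contents_def nth_append w_def)
      qed
      ultimately show ?thesis by simp
    next
      case (b i)
      have "contents (y @ w) (int p - int T) = 0" using b w by (simp add: contents_def)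
      moreover have "\<tau> [2, 0, 0, p, 0]"
      proof (cases "i \<le> Q")
        case True
        then show ?thesis using up[OF b(2)] by (simp add: b_def b(1))
      next
        case False
        then show ?thesis using b(1) that by (intro mi(7)) auto
      qed
      ultimately show ?thesis by simp
    qed
  qed
  have "\<tau> [0, t, fst (?c t)] \<and> (\<forall>j<num_tapes M. \<tau> [1, t, j, nat (head_at (?c t) j + int T)]) \<and>
      (\<forall>j<num_tapes M. \<forall>p\<le>2 * T. \<tau> [2, t, j, p, cell_at (?c t) j (int p - int T)])" if "t \<le> T" for t
    using that
  proof (induction t)
    case 0
    show ?case
      using mi(1-3) cell0 by (auto simp: run_def initial_facts)
  next
    case (Suc t)
    let ?q = "fst (?c t)" and ?ss = "scanned (?c t)"
    have t: "t < T" using Suc.prems by simp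
    note v = run_facts(1)[of "y @ w" t]
    have IH: "\<tau> [0, t, ?q]" "\<And>j. j < num_tapes M \<Longrightarrow> \<tau> [1, t, j, nat (head_at (?c t) j + int T)]"
      "\<And>j p. j < num_tapes M \<Longrightarrow> p \<le> 2 * T \<Longrightarrow> \<tau> [2, t, j, p, cell_at (?c t) j (int p - int T)]"
      using Suc by simp_all
    define pos where "pos j = nat (head_at (?c t) j + int T)" for j
    \<comment> \<open>As \<open>t < T\<close>, the head is at least one cell away from both ends of
      the positions considered, and the subtraction in the new position is exact.\<close>
    have pos: "int (pos j) = head_at (?c t) j + int T" "1 \<le> pos j" "pos j \<le> 2 * T" if "j < num_tapes M" for j
      using run_facts(2)[OF that, of "y @ w" t] t by (auto simp: pos_def)
    have q: "?q < num_states M" using v by (simp add: valid_def)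
    have sym: "cell_at (?c t) j i < num_symbols M" if "j < num_tapes M" for i j using v that by (simp add: valid_def)
    have "\<tau> [3, t, j, ?ss ! j]" if j: "j < num_tapes M" for j
    proof -
      have "cell_at (?c t) j (int (pos j) - int T) = ?ss ! j"
        using valid_scanned(3)[OF v j] pos(1)[OF j] by simp
      then show ?thesis using ms(1)[OF t j pos(3)[OF j] _ _ ] IH(2)[OF j] IH(3)[OF j pos(3)[OF j]] sym[OF j]
        by (metis pos_def)
    qed
    then have tr: "\<tau> [0, t + 1, fst (transition M ?q ?ss)]"
        "\<And>j. j < num_tapes M \<Longrightarrow> \<tau> [4, t, j, fst (action (?c t) j)] \<and> \<tau> [5, t, j, move_index (snd (action (?c t) j))]"
      using ms5[OF t q valid_scanned(1,2)[OF v] IH(1)] by (simp_all add: action_def)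
    have "\<tau> [1, Suc t, j, nat (head_at (?c (Suc t)) j + int T)]" if j: "j < num_tapes M" for j
    proof -
      have "move_index d \<in> {0, 1, 2}" for d by (cases d) auto
      then have "\<tau> [1, t + 1, j, pos j + move_index (snd (action (?c t) j)) - 1]"
        using ms(4)[OF t j pos(3)[OF j]] IH(2)[OF j] tr(2)[OF j] by (simp add: pos_def)
      moreover have "int (pos j + move_index (snd (action (?c t) j)) - 1) = head_at (?c (Suc t)) j + int T"
        using move_index[OF pos(2)[OF j]] pos(1)[OF j] step_facts(2)[OF v j] by (simp add: run_Suc)
      ultimately show ?thesis by (metis Suc_eq_plus1 nat_int)
    qed
    moreover have "\<tau> [2, Suc t, j, p, cell_at (?c (Suc t)) j (int p - int T)]" if j: "j < num_tapes M" and p: "p \<le> 2 * T" for j p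
    proof (cases "p = pos j")
      case True
      have "fst (action (?c t) j) < num_symbols M"
        unfolding action_def by (rule transition_bounds(3)[OF q valid_scanned(1,2)[OF v] j])
      then show ?thesis
        using ms(2)[OF t j p _ _ ] IH(2)[OF j] tr(2)[OF j] True pos(1)[OF j] step_facts(3)[OF v j, of "int p - int T"]
        by (simp add: run_Suc pos_def)
    next
      case False
      then have "int p - int T \<noteq> head_at (?c t) j" using pos(1)[OF j] by auto
      then show ?thesis
        using ms(3)[OF t j p sym[OF j] pos(3)[OF j] False IH(3)[OF j p]] IH(2)[OF j] step_facts(3)[OF v j, of "int p - int T"]
        by (simp add: run_Suc pos_def)
    qed
    ultimately show ?case using tr(1) step_facts(1)[OF v] by (simp add: run_Suc)
  qed
  from this[of T] have "\<tau> [0, T, fst (?c T)]" by simp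
  moreover have "fst (?c T) < num_states M" using run_facts(1)[of "y @ w" T] by (simp add: valid_def)
  ultimately have "accepting (?c T)" using mi(9) by (auto simp: accepting_def)
  then show thesis using that n(2) w by auto
qed

lemma run_model:
  assumes "length w \<le> Q" "accepting (run M (y @ w) T)"
  shows "\<exists>\<tau>. model M T Q y \<tau>"
proof -
  let ?c = "run M (y @ w)" and ?m = "length y"
  define pos where "pos t j = nat (head_at (?c t) j + int T)" for t j
  define cell where "cell t j p = cell_at (?c t) j (int p - int T)" for t j p
  define \<tau> where "\<tau> v \<longleftrightarrow> (\<exists>t. v = [0, t, fst (?c t)]) \<or> (\<exists>t j. v = [1, t, j, pos t j]) \<or>
     (\<exists>t j p. v = [2, t, j, p, cell t j p]) \<or> (\<exists>t j. v = [3, t, j, cell t j (pos t j)]) \<or>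
     (\<exists>t j. v = [4, t, j, fst (action (?c t) j)]) \<or> (\<exists>t j. v = [5, t, j, move_index (snd (action (?c t) j))])" for v
  have \<tau>: "\<tau> [0, t, q] \<longleftrightarrow> q = fst (?c t)" "\<tau> [1, t, j, p] \<longleftrightarrow> p = pos t j" "\<tau> [2, t, j, p, s] \<longleftrightarrow> s = cell t j p"
      "\<tau> [3, t, j, s] \<longleftrightarrow> s = cell t j (pos t j)" "\<tau> [4, t, j, s] \<longleftrightarrow> s = fst (action (?c t) j)"
      "\<tau> [5, t, j, d] \<longleftrightarrow> d = move_index (snd (action (?c t) j))" for t q j p s d
    by (auto simp: \<tau>_def)
  have k: "0 < num_tapes M" using M by (simp add: turing_machine_def)
  have c0: "cell 0 0 p = contents (y @ w) (int p - int T)" for p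
    using k by (simp add: cell_def run_def initial_facts)
  have 1: "init_model M T Q y \<tau>"
    unfolding init_model_def
  proof (intro conjI allI impI)
    show "\<tau> [0, 0, 0]" by (simp add: \<tau> run_def initial_facts)
    show "\<tau> [1, 0, j, T]" if "j < num_tapes M" for j using that unfolding \<tau> by (simp add: run_def initial_facts pos_def)
    show "\<tau> [2, 0, j, p, 0]" if "1 \<le> j \<and> j < num_tapes M \<and> p \<le> 2 * T" for j p
      using that by (simp add: \<tau> cell_def run_def initial_facts)
    show "\<tau> [2, 0, 0, p, 0]" if "p < T" for p using that by (simp add: \<tau> c0 contents_def)
    show "\<tau> [2, 0, 0, T + i, if y ! i then 2 else 1]" if "i < ?m" for i
      using that by (simp add: \<tau> c0 contents_def nth_append)
    show "\<tau> [2, 0, 0, p + 1, 0]" if "T + ?m \<le> p \<and> p < T + ?m + Q" "\<tau> [2, 0, 0, p, 0]" for p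
      using that by (auto simp: \<tau> c0 contents_def split: if_splits)
    show "\<tau> [2, 0, 0, p, 0]" if "T + ?m + Q \<le> p \<and> p \<le> T + ?m + Q + 2 * T" for p
      using that assms(1) by (simp add: \<tau> c0 contents_def)
  qed
  have pos: "int (pos t j) = head_at (?c t) j + int T" "1 \<le> pos t j" if "t < T" "j < num_tapes M" for t j
    using run_facts(2)[OF that(2), of "y @ w" t] that(1) by (auto simp: pos_def)
  have cellS: "cell (Suc t) j p = (if p = pos t j then fst (action (?c t) j) else cell t j p)"
    if "t < T" "j < num_tapes M" for t j p
    using pos(1)[OF that] step_facts(3)[OF run_facts(1)[of "y @ w" t] that(2), of "int p - int T"]
    by (auto simp: cell_def run_Suc)
  have posS: "pos t j + move_index (snd (action (?c t) j)) - 1 = pos (Suc t) j" if "t < T" "j < num_tapes M" for t j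
  proof -
    have "int (pos t j + move_index (snd (action (?c t) j)) - 1) = head_at (?c (Suc t)) j + int T"
      using move_index[OF pos(2)[OF that]] pos(1)[OF that] step_facts(2)[OF run_facts(1)[of "y @ w" t] that(2)]
      by (simp add: run_Suc)
    then show ?thesis unfolding pos_def[of "Suc t"] by (metis nat_int)
  qed
  have 2: "move_model M T \<tau> t" if "t < T" for t
    unfolding move_model_def
    unfolding \<tau> using cellS[OF that] posS[OF that] by simp
  have tr: "fst (transition M q ss) = fst (?c (t + 1)) \<and>
          (\<forall>j<num_tapes M. fst (snd (transition M q ss) ! j) = fst (action (?c t) j) \<and>
             move_index (snd (snd (transition M q ss) ! j)) = move_index (snd (action (?c t) j)))"
    if t: "t < T" and ss: "length ss = num_tapes M" "q = fst (?c t)" "\<forall>j<num_tapes M. ss ! j = cell t j (pos t j)" for t q ss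
  proof -
    note v = run_facts(1)[of "y @ w" t]
    have "ss ! j = scanned (?c t) ! j" if "j < num_tapes M" for j
      using ss(3) that valid_scanned(3)[OF v that] pos(1)[OF t that] by (simp add: cell_def)
    then have "ss = scanned (?c t)" using ss(1) valid_scanned(1)[OF v] by (simp add: list_eq_iff_nth_eq)
    then show ?thesis using ss(2) step_facts(1)[OF v] by (simp add: run_Suc action_def)
  qed
  have 3: "step_model M \<tau> t" if t: "t < T" for t
    unfolding step_model_def \<tau> using tr[OF t] by blast
  have 4: "\<exists>s\<in>{0, 1, 2}. \<tau> [2, 0, 0, p, s]" for p by (auto simp: \<tau> c0 contents_def)
  have 5: "\<not> \<tau> [0, T, q]" if "q \<noteq> 1" for q using assms(2) that by (simp add: \<tau> accepting_def)
  have "model M T Q y \<tau>"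
    unfolding model_def using 1 2 3 4 5 by blast
  then show ?thesis by blast
qed

theorem satisfiable_tableau:
  "satisfiable (tableau M T Q y) \<longleftrightarrow> (\<exists>w. length w \<le> Q \<and> accepting (run M (y @ w) T))"
  unfolding satisfiable_def tableau_model using model_run run_model by metis

end

section \<open>Running time of the tableau and the theorem of Cook and Levin\<close>

lemma PF_upt_from [pf_intros]: "PF m \<Longrightarrow> PF n \<Longrightarrow> PF (\<lambda>x. [m x..<n x])"
proof -
  have *: "[a..<b] = filter (\<lambda>i. a \<le> i) [0..<b]" for a b by (induction b) auto
  have "(\<lambda>x. [m x..<n x]) = (\<lambda>x. filter (\<lambda>i. m x \<le> i) [0..<n x])" by (rule ext) (rule *)
  moreover assume "PF m" "PF n"
  moreover have "PF (\<lambda>p :: _ \<times> nat. m (fst p))" by (rule PF_comp[OF \<open>PF m\<close>]) (intro pf_intros)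
  ultimately show "PF (\<lambda>x. [m x..<n x])" by (simp only:) (intro pf_intros)
qed

lemma PF_tableau: "PF T \<Longrightarrow> PF Q \<Longrightarrow> PF y \<Longrightarrow> PF (\<lambda>x. tableau M (T x) (Q x) (y x))"
proof (rule PF_app3[where h = "tableau M"])
  have step: "PF (\<lambda>p. step_rules M (fst p) (snd p))"
    unfolding step_rules_def by (intro pf_intros)
  show "PF (\<lambda>p. tableau M (fst p) (fst (snd p)) (snd (snd p)))"
    unfolding tableau_def init_rules_def by (intro pf_intros PF_app2[where h = "step_rules M", OF step])
qed

lemma run_halted:
  assumes "halted (run M x s)" "s \<le> t"
  shows "run M x t = run M x s"
  using assms(2)
proof (induction t rule: dec_induct)
  case (step t)
  then show ?case using assms(1) by (simp add: run_def step_def)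
qed simp

lemma poly_mono_nat: "m \<le> n \<Longrightarrow> poly p m \<le> poly p n" for p :: "nat poly"
  by (induction p) (auto intro: add_mono mult_mono)

theorem Cook_Levin:
  assumes "in_NP L"
  obtains F :: "bool list \<Rightarrow> (bool \<times> nat list) list list" where "PF F" "\<And>x. x \<in> L \<longleftrightarrow> satisfiable (F x)"
proof -
  obtain R q where "poly_time_solvable UNIV R"
    and L: "\<And>x. x \<in> L \<longleftrightarrow> (\<exists>w. length w \<le> poly q (length x) \<and> pair_code x w \<in> R)"
    using assms unfolding in_NP_def by blast
  then obtain M p where tm: "turing_machine M" "\<And>x. halted (run M x (poly p (length x)))"
      "\<And>x. accepting (run M x (poly p (length x))) \<longleftrightarrow> x \<in> R"
    unfolding poly_time_solvable_def by blast
  interpret machine M by unfold_locales (rule tm)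
  \<comment> \<open>The clock is the time bound for the longest admissible witness. With a shorter
    witness the machine has halted earlier and its configuration has not changed since.\<close>
  define F where "F x = tableau M (poly p (2 * length x + 1 + poly q (length x))) (poly q (length x)) (pair_code x [])" for x
  have len: "length (pair_code x w) = 2 * length x + 1 + length w" for x w
    unfolding pair_code_def by (induction x) simp_all
  have pc: "pair_code x [] @ w = pair_code x w" for x w by (simp add: pair_code_def)
  have "accepting (run M (pair_code x w) (poly p (2 * length x + 1 + poly q (length x)))) \<longleftrightarrow> pair_code x w \<in> R"
    if "length w \<le> poly q (length x)" for x w
  proof -
    have "poly p (length (pair_code x w)) \<le> poly p (2 * length x + 1 + poly q (length x))"
      using that by (intro poly_mono_nat) (simp add: len)
    from run_halted[OF tm(2) this] show ?thesis using tm(3) by simp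
  qed
  then have "x \<in> L \<longleftrightarrow> satisfiable (F x)" for x
    unfolding L F_def satisfiable_tableau pc by blast
  moreover have "PF F" unfolding F_def pair_code_def by (intro PF_tableau pf_intros)
  ultimately show thesis using that by blast
qed

section \<open>Exactly one true variable\<close>

definition exactly_one :: "('x \<Rightarrow> bool) \<Rightarrow> 'x list \<Rightarrow> bool" where
  "exactly_one \<sigma> A \<longleftrightarrow> (\<exists>!x. x \<in> set A \<and> \<sigma> x)"

definition one_satisfiable :: "'x list list \<Rightarrow> bool" where
  "one_satisfiable S \<longleftrightarrow> (\<exists>\<sigma>. \<forall>A\<in>set S. exactly_one \<sigma> A)"

lemma exactly_one_simps:
  "exactly_one \<sigma> [a] \<longleftrightarrow> \<sigma> a"
  "a \<noteq> b \<Longrightarrow> exactly_one \<sigma> [a, b] \<longleftrightarrow> \<sigma> a \<noteq> \<sigma> b"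
  "a \<noteq> b \<Longrightarrow> a \<noteq> c \<Longrightarrow> b \<noteq> c \<Longrightarrow> exactly_one \<sigma> [a, b, c] \<longleftrightarrow>
    \<sigma> a \<and> \<not> \<sigma> b \<and> \<not> \<sigma> c \<or> \<not> \<sigma> a \<and> \<sigma> b \<and> \<not> \<sigma> c \<or> \<not> \<sigma> a \<and> \<not> \<sigma> b \<and> \<sigma> c"
  unfolding exactly_one_def by auto

text \<open>
  The variable \<open>(0, [l], 0)\<close> is the literal \<open>l\<close>; \<open>(1, c, i)\<close> says that the clause \<open>c\<close> is satisfied
  by one of its literals from the \<open>i\<close>-th on, \<open>(2, c, i)\<close> is its negation, and \<open>(3, c, i)\<close> and
  \<open>(4, c, i)\<close> are slack variables.
\<close>

type_synonym 'v var = "nat \<times> (bool \<times> 'v) list \<times> nat"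

definition clause_system :: "(bool \<times> 'v) list \<Rightarrow> 'v var list list" where
  "clause_system c = [[(1, c, 0)], [(2, c, length c)], [(2, c, length c), (1, c, length c)]] @
     concat (map (\<lambda>(i, l). [[(2, c, i), (1, c, i)], [(2, c, i), (1, c, i + 1), (3, c, i)],
       [(3, c, i), (4, c, i), (0, [(\<not> fst l, snd l)], 0)]]) (zip [0..<length c] c))"

definition system :: "(bool \<times> 'v) list list \<Rightarrow> 'v var list list" where
  "system F = remdups (concat (map clause_system F) @
     map (\<lambda>l. [(0, [(True, snd l)], 0), (0, [(False, snd l)], 0)]) (concat F))"

lemma ball_clause_system:
  "(\<forall>A\<in>set (clause_system c). P A) \<longleftrightarrow>
    P [(1, c, 0)] \<and> P [(2, c, length c)] \<and> P [(2, c, length c), (1, c, length c)] \<and>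
    (\<forall>i<length c. P [(2, c, i), (1, c, i)] \<and> P [(2, c, i), (1, c, i + 1), (3, c, i)] \<and>
      P [(3, c, i), (4, c, i), (0, [(\<not> fst (c ! i), snd (c ! i))], 0)])"
  unfolding clause_system_def set_append set_concat set_map ball_Un ball_UN ball_simps ball_zip_upt
  by simp

lemma ball_system:
  "(\<forall>A\<in>set (system F). P A) \<longleftrightarrow> (\<forall>c\<in>set F. (\<forall>A\<in>set (clause_system c). P A) \<and>
    (\<forall>l\<in>set c. P [(0, [(True, snd l)], 0), (0, [(False, snd l)], 0)]))"
  unfolding system_def set_remdups by auto

lemma system_shape: "distinct (system F)" "\<forall>A\<in>set (system F). distinct A \<and> A \<noteq> [] \<and> length A \<le> 3"
  unfolding ball_system ball_clause_system by (simp_all add: system_def)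

text \<open>As \<open>(2, c, i)\<close> negates \<open>(1, c, i)\<close>, the set with
  \<open>(3, c, i)\<close> and \<open>(1, c, i + 1)\<close> makes \<open>(3, c, i)\<close> true
  exactly where the truth of \<open>(1, c, i)\<close> ends. The set with the negated literal allows
  this only at a true literal, \<open>(4, c, i)\<close> taking up the slack. Since
  \<open>(1, c, 0)\<close> is true and \<open>(1, c, length c)\<close> is false, each clause has
  such an index.\<close>

theorem one_satisfiable_system: "one_satisfiable (system F) \<longleftrightarrow> satisfiable F"
proof
  assume "one_satisfiable (system F)"
  then obtain \<sigma> where \<sigma>: "\<forall>A\<in>set (system F). exactly_one \<sigma> A" unfolding one_satisfiable_def ..
  define \<tau> where "\<tau> v = \<sigma> (0, [(True, v)], 0)" for v
  have "holds \<tau> c" if c: "c \<in> set F" for c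
  proof (rule ccontr)
    assume not: "\<not> holds \<tau> c"
    have cs: "\<forall>A\<in>set (clause_system c). exactly_one \<sigma> A"
      and l: "\<forall>l\<in>set c. \<sigma> (0, [(True, snd l)], 0) \<noteq> \<sigma> (0, [(False, snd l)], 0)"
      using \<sigma> c unfolding ball_system by (auto simp: exactly_one_simps)
    have neg: "\<sigma> (0, [(\<not> fst (c ! i), snd (c ! i))], 0)" if i: "i < length c" for i
    proof -
      have "c ! i \<in> set c" using i by simp
      then have "\<tau> (snd (c ! i)) \<noteq> fst (c ! i)" using not by (auto simp: holds_def)
      then show ?thesis using l \<open>c ! i \<in> set c\<close> by (cases "fst (c ! i)") (auto simp: \<tau>_def)
    qed
    have s: "\<sigma> (1, c, 0)" "\<not> \<sigma> (1, c, length c)"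
        "\<And>i. i < length c \<Longrightarrow> \<sigma> (1, c, i) \<Longrightarrow> \<not> \<sigma> (3, c, i) \<Longrightarrow> \<sigma> (1, c, i + 1)"
        "\<And>i. i < length c \<Longrightarrow> \<sigma> (0, [(\<not> fst (c ! i), snd (c ! i))], 0) \<Longrightarrow> \<not> \<sigma> (3, c, i)"
      using cs unfolding ball_clause_system by (auto simp: exactly_one_simps)
    have "i \<le> length c \<Longrightarrow> \<sigma> (1, c, i)" for i
      by (induction i) (use s neg in auto)
    then show False using s(2) by simp
  qed
  then show "satisfiable F" unfolding satisfiable_def by blast
next
  assume "satisfiable F"
  then obtain \<tau> where \<tau>: "\<forall>c\<in>set F. holds \<tau> c" unfolding satisfiable_def ..
  define lit where "lit l \<longleftrightarrow> \<tau> (snd l) = fst l" for l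
  \<comment> \<open>With this choice, \<open>(3, c, i)\<close> marks the last true literal of the
    clause.\<close>
  define n where "n c i \<longleftrightarrow> (\<exists>j\<ge>i. j < length c \<and> lit (c ! j))" for c i
  define \<sigma> where "\<sigma> x = (case x of (k, c, i) \<Rightarrow> if k = 0 then lit (hd c) else if k = 1 then n c i else
     if k = 2 then \<not> n c i else if k = 3 then n c i \<and> \<not> n c (i + 1) else lit (c ! i) \<and> \<not> (n c i \<and> \<not> n c (i + 1)))" for x :: "_ var"
  have \<sigma>: "\<sigma> (0, [l], i) = lit l" "\<sigma> (1, c, i) = n c i" "\<sigma> (2, c, i) = (\<not> n c i)"
      "\<sigma> (3, c, i) \<longleftrightarrow> n c i \<and> \<not> n c (i + 1)" "\<sigma> (4, c, i) \<longleftrightarrow> lit (c ! i) \<and> \<not> (n c i \<and> \<not> n c (i + 1))" for l c i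
    by (simp_all add: \<sigma>_def)
  have \<sigma>': "\<sigma> (Suc 0, c, i) = n c i" for c i using \<sigma>(2) by simp
  have n: "n c i \<longleftrightarrow> lit (c ! i) \<or> n c (i + 1)" if "i < length c" for c i
    unfolding n_def using that by (metis Suc_eq_plus1 Suc_leD le_refl le_antisym not_less_eq_eq)
  have n0: "n c 0" if "c \<in> set F" for c
    using bspec[OF \<tau> that] unfolding holds_def n_def lit_def by (metis in_set_conv_nth le0)
  have nl: "\<not> n c (length c)" for c by (simp add: n_def)
  have lit: "lit (b, v) \<longleftrightarrow> (\<tau> v = b)" for b v by (simp add: lit_def)
  have "\<forall>A\<in>set (system F). exactly_one \<sigma> A"
    unfolding ball_system ball_clause_system
  proof (intro ballI conjI allI impI)
    fix c i assume "c \<in> set F" "i < length c"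
    then show "exactly_one \<sigma> [(3, c, i), (4, c, i), (0, [(\<not> fst (c ! i), snd (c ! i))], 0)]"
      using n[of i c] by (simp add: exactly_one_simps \<sigma> lit) (auto simp: lit_def)
    show "exactly_one \<sigma> [(2, c, i), (1, c, i + 1), (3, c, i)]"
      using n[OF \<open>i < length c\<close>] by (subst exactly_one_simps) (auto simp: \<sigma> \<sigma>')
  qed (use n0 nl in \<open>auto simp: exactly_one_simps \<sigma> \<sigma>' lit\<close>)
  then show "one_satisfiable (system F)" unfolding one_satisfiable_def by blast
qed

lemma PF_system: "PF F \<Longrightarrow> PF (\<lambda>x. system (F x))"
  by (rule PF_comp[of system]) (unfold system_def clause_system_def, intro pf_intros)


section \<open>The gadgets\<close>

type_synonym 'x name = "nat \<times> 'x list \<times> 'x list"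
type_synonym 'x graph = "('x name \<times> ('x name \<times> nat) list) list"

text \<open>
  A graph lists the right vertices with their neighbours; a left vertex is a name and a colour
  below 3. The fairness bound is 0.
\<close>

abbreviation triangle :: "'n \<Rightarrow> ('n \<times> nat) list" where
  "triangle n \<equiv> [(n, 0), (n, 1), (n, 2)]"

abbreviation rotations :: "(nat \<times> nat \<times> nat) set" where
  "rotations \<equiv> {(0, 1, 2), (1, 2, 0), (2, 0, 1)}"

definition balanced :: "('n \<times> nat \<Rightarrow> 'm) \<Rightarrow> 'm \<Rightarrow> ('n \<times> nat) list \<Rightarrow> bool" where
  "balanced f v N \<longleftrightarrow> (\<forall>c<3. \<forall>d<3. length (filter (\<lambda>u. f u = v \<and> snd u = c) N) =
     length (filter (\<lambda>u. f u = v \<and> snd u = d) N))"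

definition placement :: "('m \<times> ('n \<times> nat) list) list \<Rightarrow> ('n \<times> nat \<Rightarrow> 'm) \<Rightarrow> bool" where
  "placement H f \<longleftrightarrow> (\<forall>h\<in>set H. \<forall>u\<in>set (snd h). \<exists>N. (f u, N) \<in> set H \<and> u \<in> set N) \<and>
     (\<forall>h\<in>set H. balanced f (fst h) (snd h))"

lemma all_less_3: "(\<forall>c<3. P c) \<longleftrightarrow> P 0 \<and> P 1 \<and> P (2::nat)"
  by (auto simp: numeral_3_eq_3 less_Suc_eq numeral_2_eq_2)

lemma balanced_triple:
  "balanced f v [(a, 0), (b, 1), (c, 2)] \<longleftrightarrow> (f (a, 0) = v \<longleftrightarrow> f (b, 1) = v) \<and> (f (b, 1) = v \<longleftrightarrow> f (c, 2) = v)"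
  unfolding balanced_def all_less_3 by auto

text \<open>The two fillers have the colours other than \<open>c\<close>. They arrive together, and
  then exactly one of the vertices of colour \<open>c\<close> has to join them; without them none
  may come. This is how exactly one variable gets selected.\<close>

lemma balanced_fillers:
  assumes "(c, d, e) \<in> rotations"
  shows "balanced f v (map (\<lambda>x. (t x, c)) xs @ [(n, d), (n, e)]) \<longleftrightarrow>
    length (filter (\<lambda>x. f (t x, c) = v) xs) = of_bool (f (n, d) = v) \<and> (f (n, d) = v \<longleftrightarrow> f (n, e) = v)"
proof -
  have *: "length (filter (\<lambda>u. f u = v \<and> snd u = k) (map (\<lambda>x. (t x, c)) xs @ [(n, d), (n, e)])) =
      (if k = c then length (filter (\<lambda>x. f (t x, c) = v) xs) else 0) + of_bool (f (n, d) = v \<and> k = d) + of_bool (f (n, e) = v \<and> k = e)" for k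
    by (auto simp: filter_map comp_def)
  show ?thesis
    unfolding balanced_def all_less_3 * using assms by auto
qed

text \<open>Each element with its cyclic successor. The only element of a singleton is its own
  successor, so variables with one occurrence are no special case.\<close>

definition next_pairs :: "'a list \<Rightarrow> ('a \<times> 'a) list" where
  "next_pairs l = zip l (case l of [] \<Rightarrow> [] | x # xs \<Rightarrow> xs @ [x])"

lemma next_pairs_rotate: "next_pairs l = zip l (rotate1 l)"
  by (cases l) (simp_all add: next_pairs_def)

lemma next_pairs_mem: "(a, b) \<in> set (next_pairs l) \<Longrightarrow> a \<in> set l \<and> b \<in> set l"
  unfolding next_pairs_rotate by (metis set_rotate1 set_zip_leftD set_zip_rightD)

lemma next_pairs_ex: "a \<in> set l \<Longrightarrow> \<exists>b. (a, b) \<in> set (next_pairs l)" "b \<in> set l \<Longrightarrow> \<exists>a. (a, b) \<in> set (next_pairs l)"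
proof -
  have "map fst (next_pairs l) = l" "map snd (next_pairs l) = rotate1 l"
    unfolding next_pairs_rotate by simp_all
  then have "fst ` set (next_pairs l) = set l" "snd ` set (next_pairs l) = set l"
    by (metis list.set_map, metis list.set_map set_rotate1)
  then show "a \<in> set l \<Longrightarrow> \<exists>b. (a, b) \<in> set (next_pairs l)" "b \<in> set l \<Longrightarrow> \<exists>a. (a, b) \<in> set (next_pairs l)"
    by force+
qed

lemma next_pairs_unique:
  assumes "distinct l"
  shows "(a, b) \<in> set (next_pairs l) \<Longrightarrow> (a, c) \<in> set (next_pairs l) \<Longrightarrow> b = c"
    "(b, a) \<in> set (next_pairs l) \<Longrightarrow> (c, a) \<in> set (next_pairs l) \<Longrightarrow> b = c"
proof -
  have "map fst (next_pairs l) = l" "map snd (next_pairs l) = rotate1 l"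
    unfolding next_pairs_rotate by simp_all
  then have "distinct (map fst (next_pairs l))" "distinct (map snd (next_pairs l))"
    using assms by simp_all
  then have "inj_on fst (set (next_pairs l))" "inj_on snd (set (next_pairs l))"
    by (simp_all add: distinct_map)
  note inj = this
  show "(a, b) \<in> set (next_pairs l) \<Longrightarrow> (a, c) \<in> set (next_pairs l) \<Longrightarrow> b = c"
    using inj_onD[OF inj(1), of "(a, b)" "(a, c)"] by simp
  show "(b, a) \<in> set (next_pairs l) \<Longrightarrow> (c, a) \<in> set (next_pairs l) \<Longrightarrow> b = c"
    using inj_onD[OF inj(2), of "(b, a)" "(c, a)"] by simp
qed

lemma next_pairs_const:
  assumes "\<And>a b. (a, b) \<in> set (next_pairs l) \<Longrightarrow> P a = P b" "a \<in> set l" "b \<in> set l"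
  shows "P a = P b"
proof -
  have "P (l ! i) = P (l ! 0)" if "i < length l" for i
    using that
  proof (induction i)
    case (Suc i)
    have "(l ! i, rotate1 l ! i) \<in> set (next_pairs l)"
      unfolding next_pairs_rotate set_zip using Suc.prems by auto
    moreover have "rotate1 l ! i = l ! Suc i" using Suc.prems by (simp add: nth_rotate1)
    ultimately show ?case using assms(1) Suc by fastforce
  qed simp
  then show ?thesis using assms(2,3) by (metis in_set_conv_nth)
qed

definition incidences :: "'x list list \<Rightarrow> ('x \<times> 'x list \<times> 'x list) list" where
  "incidences S = concat (map (\<lambda>x. map (\<lambda>p. (x, fst p, snd p)) (next_pairs (filter (\<lambda>A. x \<in> set A) S))) (remdups (concat S)))"

lemma incidences_iff:
  "(x, A, B) \<in> set (incidences S) \<longleftrightarrow> (A, B) \<in> set (next_pairs (filter (\<lambda>A. x \<in> set A) S))"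
proof -
  have "A \<in> set S \<and> x \<in> set A" if "(A, B) \<in> set (next_pairs (filter (\<lambda>A. x \<in> set A) S))"
    using next_pairs_mem[OF that] by simp
  then show ?thesis by (force simp: incidences_def)
qed

text \<open>
  The triples \<open>(0, [x], A)\<close> at the occurrences \<open>A\<close> of \<open>x\<close> are either all full or all empty. In
  the latter case, the triples \<open>(1, [x], A)\<close> and \<open>(2, [x], A)\<close> are full and contain the tips \<open>t x A\<close>.
\<close>

definition gadget :: "('x \<Rightarrow> 'x list \<Rightarrow> 'x name) \<Rightarrow> 'x list list \<Rightarrow> 'x graph" where
  "gadget t S = concat (map (\<lambda>(x, A, B).
     [((0, [x], A), triangle (0, [x], A)),
      ((1, [x], A), [(t x A, 0), ((0, [x], A), 1), ((0, [x], B), 2)]),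
      ((2, [x], A), [((0, [x], A), 0), (t x A, 1), (t x A, 2)])]) (incidences S))"

lemma gadget_iff:
  "h \<in> set (gadget t S) \<longleftrightarrow> (\<exists>x A B. (x, A, B) \<in> set (incidences S) \<and>
     (h = ((0, [x], A), triangle (0, [x], A)) \<or>
      h = ((1, [x], A), [(t x A, 0), ((0, [x], A), 1), ((0, [x], B), 2)]) \<or>
      h = ((2, [x], A), [((0, [x], A), 0), (t x A, 1), (t x A, 2)])))"
  unfolding gadget_def by auto

locale exact_system =
  fixes S :: "'x list list"
  assumes S: "distinct S" "\<forall>A\<in>set S. distinct A \<and> A \<noteq> [] \<and> length A \<le> 3"
begin

lemma inc_mem: "(x, A, B) \<in> set (incidences S) \<Longrightarrow> A \<in> set S \<and> x \<in> set A \<and> B \<in> set S \<and> x \<in> set B"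
  unfolding incidences_iff using next_pairs_mem[of A B "filter (\<lambda>A. x \<in> set A) S"] by simp

lemma inc_ex: "A \<in> set S \<Longrightarrow> x \<in> set A \<Longrightarrow> \<exists>B. (x, A, B) \<in> set (incidences S)"
  "A \<in> set S \<Longrightarrow> x \<in> set A \<Longrightarrow> \<exists>B. (x, B, A) \<in> set (incidences S)"
  unfolding incidences_iff using next_pairs_ex[of A "filter (\<lambda>A. x \<in> set A) S"] by simp_all

lemma inc_unique:
  "(x, A, B) \<in> set (incidences S) \<Longrightarrow> (x, A, C) \<in> set (incidences S) \<Longrightarrow> B = C"
  "(x, B, A) \<in> set (incidences S) \<Longrightarrow> (x, C, A) \<in> set (incidences S) \<Longrightarrow> B = C"
  unfolding incidences_iff using S(1) by (blast intro: next_pairs_unique[OF distinct_filter])+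

lemma inc_const:
  assumes "\<And>A B. (x, A, B) \<in> set (incidences S) \<Longrightarrow> P A = P B"
    "A \<in> set S" "x \<in> set A" "B \<in> set S" "x \<in> set B"
  shows "P A = P B"
  using next_pairs_const[of "filter (\<lambda>A. x \<in> set A) S" P A B] assms unfolding incidences_iff by simp

definition before :: "'x \<Rightarrow> 'x list \<Rightarrow> 'x list" where
  "before x A = (SOME B. (x, B, A) \<in> set (incidences S))"

lemma before: "(x, B, A) \<in> set (incidences S) \<Longrightarrow> before x A = B"
  unfolding before_def by (rule some_equality) (auto intro: inc_unique(2))

text \<open>The vertex of colour 1 at the occurrence \<open>A\<close> and the vertex of colour 2 at
  the next occurrence \<open>B\<close> can leave their triples only for \<open>(1, [x], A)\<close>.
  Balance there makes both leave or both stay, together with the tip of colour 0, so the state is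
  passed on around the cycle. The assumption \<open>only\<close> says that the remaining graph does
  not touch the vertices of the triples.\<close>

lemma gadget_sound:
  assumes t: "\<And>x A. fst (t x A) = 1" and sub: "set (gadget t S) \<subseteq> set H"
    and only: "\<And>v N x A c. (v, N) \<in> set H \<Longrightarrow> ((0, [x], A), c) \<in> set N \<Longrightarrow> (v, N) \<in> set (gadget t S)"
    and f: "placement H f"
  obtains Y where "\<And>x A. A \<in> set S \<Longrightarrow> x \<in> set A \<Longrightarrow> f (t x A, 0) = (1, [x], A) \<longleftrightarrow> \<not> Y x"
proof -
  define R where "R x A \<longleftrightarrow> f ((0, [x], A), 0) = (0, [x], A)" for x A
  have t0: "t x A \<noteq> (0, a)" for x A a using t[of x A] by auto
  have in_gadget: "\<exists>N. (f u, N) \<in> set (gadget t S) \<and> u \<in> set N"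
    if u: "(v, N) \<in> set (gadget t S)" "u \<in> set N" "u = ((0, [x], A), c)" for v N u x A c
  proof -
    have "(v, N) \<in> set H" using u(1) sub by blast
    then obtain N' where "(f u, N') \<in> set H" "u \<in> set N'"
      using f u(2) unfolding placement_def by force
    then show ?thesis using only u(3) by blast
  qed
  have bal: "balanced f v N" if "(v, N) \<in> set (gadget t S)" for v N
    using f sub that unfolding placement_def by force
  have inc: "(f (t x A, 0) = (1, [x], A) \<longleftrightarrow> \<not> R x A) \<and> R x A = R x B" if i: "(x, A, B) \<in> set (incidences S)" for x A B
  proof -
    have y: "((0, [x], A), triangle (0, [x], A)) \<in> set (gadget t S)"
      and p: "((1, [x], A), [(t x A, 0), ((0, [x], A), 1), ((0, [x], B), 2)]) \<in> set (gadget t S)"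
      using i unfolding gadget_iff by blast+
    obtain C where "(x, B, C) \<in> set (incidences S)" using inc_ex(1)[of B x] inc_mem[OF i] by blast
    then have y': "((0, [x], B), triangle (0, [x], B)) \<in> set (gadget t S)"
      unfolding gadget_iff by blast
    have g: "f ((0, [x], A), 1) = (0, [x], A) \<or> f ((0, [x], A), 1) = (1, [x], A)"
    proof -
      have "\<exists>N. (f ((0, [x], A), 1), N) \<in> set (gadget t S) \<and> ((0, [x], A), 1) \<in> set N"
        by (rule in_gadget[OF y _ refl]) simp
      then show ?thesis unfolding gadget_iff using t0 t0[symmetric] by auto
    qed
    have b: "f ((0, [x], B), 2) = (0, [x], B) \<or> f ((0, [x], B), 2) = (1, [x], A)"
    proof -
      have "\<exists>N. (f ((0, [x], B), 2), N) \<in> set (gadget t S) \<and> ((0, [x], B), 2) \<in> set N"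
        by (rule in_gadget[OF y' _ refl]) simp
      then have "f ((0, [x], B), 2) = (0, [x], B) \<or> (\<exists>D. (x, D, B) \<in> set (incidences S) \<and> f ((0, [x], B), 2) = (1, [x], D))"
        unfolding gadget_iff using t0 t0[symmetric] by auto
      then show ?thesis using inc_unique(2)[OF i] by blast
    qed
    show ?thesis
      using bal[OF y] bal[OF y'] bal[OF p] g b unfolding balanced_triple R_def by auto
  qed
  have "f (t x A, 0) = (1, [x], A) \<longleftrightarrow> \<not> (\<exists>B\<in>set S. x \<in> set B \<and> R x B)" if "A \<in> set S" "x \<in> set A" for x A
    using inc inc_ex(1)[OF that] inc_const[of x "R x" A] that by blast
  then show thesis by (rule that)
qed

text \<open>If \<open>Y x\<close> holds, all triples of \<open>x\<close> are full. Otherwise the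
  vertex of colour 2 goes back to the preceding occurrence, whose vertex \<open>(1, [x], B)\<close>
  also receives its own vertex of colour 1.\<close>

definition place :: "('x \<Rightarrow> bool) \<Rightarrow> ('x name \<times> nat \<Rightarrow> 'x name) \<Rightarrow> 'x name \<times> nat \<Rightarrow> 'x name" where
  "place Y g u = (if fst (fst u) = 0 then
       (let xs = fst (snd (fst u)); A = snd (snd (fst u)) in
        if Y (hd xs) then (0, xs, A) else if snd u = 0 then (2, xs, A) else if snd u = 1 then (1, xs, A)
        else (1, xs, before (hd xs) A))
     else g u)"

lemma place_simps:
  "place Y g ((0, [x], A), 0) = (if Y x then (0, [x], A) else (2, [x], A))"
  "place Y g ((0, [x], A), 1) = (if Y x then (0, [x], A) else (1, [x], A))"
  "(x, B, A) \<in> set (incidences S) \<Longrightarrow> place Y g ((0, [x], A), 2) = (if Y x then (0, [x], A) else (1, [x], B))"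
  "n \<noteq> 0 \<Longrightarrow> place Y g ((n, a), c) = g ((n, a), c)"
  by (simp_all add: place_def before)

lemma gadget_complete:
  assumes t: "\<And>x A. fst (t x A) = 1"
    and g: "\<And>x A. A \<in> set S \<Longrightarrow> x \<in> set A \<Longrightarrow> (g (t x A, 0) = (1, [x], A) \<longleftrightarrow> \<not> Y x) \<and>
      (g (t x A, 1) = (2, [x], A) \<longleftrightarrow> \<not> Y x) \<and> (g (t x A, 2) = (2, [x], A) \<longleftrightarrow> \<not> Y x)"
    and h: "h \<in> set (gadget t S)"
  shows "balanced (place Y g) (fst h) (snd h)"
    "u \<in> set (snd h) \<Longrightarrow> fst (fst u) = 0 \<Longrightarrow> \<exists>N. (place Y g u, N) \<in> set (gadget t S) \<and> u \<in> set N"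
proof -
  obtain x A B where i: "(x, A, B) \<in> set (incidences S)" and
    h': "h = ((0, [x], A), triangle (0, [x], A)) \<or>
      h = ((1, [x], A), [(t x A, 0), ((0, [x], A), 1), ((0, [x], B), 2)]) \<or>
      h = ((2, [x], A), [((0, [x], A), 0), (t x A, 1), (t x A, 2)])"
    using h unfolding gadget_iff by blast
  have tt: "place Y g (t x A, c) = g (t x A, c)" for c
    using place_simps(4)[of 1 Y g "snd (t x A)" c] t[of x A] by (metis prod.collapse zero_neq_one)
  obtain D where D: "(x, D, A) \<in> set (incidences S)" using inc_ex(2) inc_mem[OF i] by blast
  obtain C where C: "(x, B, C) \<in> set (incidences S)" using inc_ex(1) inc_mem[OF i] by blast
  have gx: "(g (t x A, 0) = (1, [x], A) \<longleftrightarrow> \<not> Y x)" "(g (t x A, 1) = (2, [x], A) \<longleftrightarrow> \<not> Y x)" "(g (t x A, 2) = (2, [x], A) \<longleftrightarrow> \<not> Y x)"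
    using g inc_mem[OF i] by blast+
  show "balanced (place Y g) (fst h) (snd h)"
    using h' gx by (elim disjE) (simp_all add: balanced_triple place_simps(1,2) place_simps(3)[OF i] place_simps(3)[OF D] tt del: One_nat_def)
  have 1: "\<exists>N. (place Y g ((0, [x], A), c), N) \<in> set (gadget t S) \<and> ((0, [x], A), c) \<in> set N" if "c \<in> {0, 1}" for c
  proof (cases "Y x")
    case True
    then have "place Y g ((0, [x], A), c) = (0, [x], A)" using that by (auto simp: place_simps simp del: One_nat_def)
    then show ?thesis
      using i that by (intro exI[of _ "triangle (0, [x], A)"]) (auto simp: gadget_iff)
  next
    case False
    show ?thesis
    proof (cases "c = 0")
      case True
      then have "place Y g ((0, [x], A), c) = (2, [x], A)" using False by (simp add: place_simps)
      then show ?thesis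
        using i True by (intro exI[of _ "[((0, [x], A), 0), (t x A, 1), (t x A, 2)]"]) (auto simp: gadget_iff)
    next
      case c: False
      then have "place Y g ((0, [x], A), c) = (1, [x], A)" using False that by (auto simp: place_simps simp del: One_nat_def)
      then show ?thesis
        using i c that by (intro exI[of _ "[(t x A, 0), ((0, [x], A), 1), ((0, [x], B), 2)]"]) (auto simp: gadget_iff)
    qed
  qed
  have 2: "\<exists>N. (place Y g ((0, [x], E), 2), N) \<in> set (gadget t S) \<and> ((0, [x], E), 2) \<in> set N"
    if d: "(x, D, E) \<in> set (incidences S)" and e: "(x, E, C) \<in> set (incidences S)" for C D E
  proof (cases "Y x")
    case True
    then show ?thesis
      using e by (intro exI[of _ "triangle (0, [x], E)"])
        (auto simp: gadget_iff place_simps(3)[OF d])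
  next
    case False
    then show ?thesis
      using d by (intro exI[of _ "[(t x D, 0), ((0, [x], D), 1), ((0, [x], E), 2)]"])
        (auto simp: gadget_iff place_simps(3)[OF d])
  qed
  assume u: "u \<in> set (snd h)" "fst (fst u) = 0"
  have "fst (t x A) \<noteq> 0" using t by simp
  then have "u \<in> {((0, [x], A), 0), ((0, [x], A), 1), ((0, [x], A), 2), ((0, [x], B), 2)}"
    using u h' by auto
  then show "\<exists>N. (place Y g u, N) \<in> set (gadget t S) \<and> u \<in> set N"
    using 1[of 0] 1[of 1] 2[OF D i] 2[OF i C] by auto
qed

end

section \<open>The graphs with degrees (3, 3) and (2, 4)\<close>

definition first :: "'a list \<Rightarrow> 'a list" where
  "first A = (case A of [] \<Rightarrow> [] | x # _ \<Rightarrow> [x])"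

abbreviation clasp :: "'x list \<Rightarrow> 'x list \<Rightarrow> nat \<Rightarrow> nat \<Rightarrow> nat \<Rightarrow> ('x name \<times> nat) list" where
  "clasp xs A c d e \<equiv> map (\<lambda>x. ((1, [x], A), c)) xs @ [((2 + c, [], A), d), ((2 + c, [], A), e)]"

text \<open>
  In \<open>core3\<close> the tips of all variables of a constraint are the same vertex, which has to be
  matched to the gadget of exactly one of them. In \<open>core4\<close>, the tips of a true variable are
  matched outside of its gadget, and the fillers admit this for exactly one variable.
\<close>

definition core3 :: "'x list list \<Rightarrow> 'x graph" where
  "core3 S = gadget (\<lambda>x A. (1, [], A)) S"

definition core4 :: "'x list list \<Rightarrow> 'x graph" where
  "core4 S = gadget (\<lambda>x A. (1, [x], A)) S @ concat (map (\<lambda>A. concat (map (\<lambda>(c, d, e).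
     [((3 + c, [], A), clasp (first A) A c d e),
      ((6 + c, [], A), clasp (tl A) A c d e)])
     [(0, 1, 2), (1, 2, 0), (2, 0, 1)])) S)"

lemma core4_iff:
  "h \<in> set (core4 S) \<longleftrightarrow> h \<in> set (gadget (\<lambda>x A. (1, [x], A)) S) \<or>
    (\<exists>A\<in>set S. \<exists>c d e. (c, d, e) \<in> rotations \<and>
      (h = ((3 + c, [], A), clasp (first A) A c d e) \<or>
       h = ((6 + c, [], A), clasp (tl A) A c d e)))"
  unfolding core4_def by auto

lemma placementD:
  assumes "placement H f" "(v, N) \<in> set H"
  shows "u \<in> set N \<Longrightarrow> \<exists>N. (f u, N) \<in> set H \<and> u \<in> set N" "balanced f v N"
  using assms unfolding placement_def by force+

context exact_system
begin

lemma first_Cons: "A \<in> set S \<Longrightarrow> first A = [hd A]" "A \<in> set S \<Longrightarrow> x \<in> set (tl A) \<Longrightarrow> x \<noteq> hd A"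
  "A \<in> set S \<Longrightarrow> set A = insert (hd A) (set (tl A))"
  using S(2) by (cases A; force simp: first_def)+

text \<open>The polarity is reversed: the common tip has to be taken by a gadget whose triples are
  empty, and it can be taken only once. So exactly one variable of each constraint has empty
  triples, and the solution is the complement of \<open>Y\<close>.\<close>

theorem core3_iff: "(\<exists>f. placement (core3 S) f) \<longleftrightarrow> one_satisfiable S"
proof
  assume "\<exists>f. placement (core3 S) f"
  then obtain f where f: "placement (core3 S) f" by blast
  obtain Y where Y: "\<And>x A. A \<in> set S \<Longrightarrow> x \<in> set A \<Longrightarrow> f ((1, [], A), 0) = (1, [x], A) \<longleftrightarrow> \<not> Y x"
    by (rule gadget_sound[of "\<lambda>x A. (1, [], A)" "core3 S" f]) (use f in \<open>auto simp: core3_def\<close>)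
  have "exactly_one (\<lambda>x. \<not> Y x) A" if A: "A \<in> set S" for A
  proof -
    obtain x where x: "x \<in> set A" using S(2) A by (cases A) auto
    then obtain B where "(x, A, B) \<in> set (incidences S)" using inc_ex(1)[OF A] by blast
    then have "((1, [x], A), [((1, [], A), 0), ((0, [x], A), 1), ((0, [x], B), 2)]) \<in> set (core3 S)"
      unfolding core3_def gadget_iff by blast
    from placementD(1)[OF f this, of "((1, [], A), 0)"] obtain N
      where "(f ((1, [], A), 0), N) \<in> set (core3 S)" "((1, [], A), 0) \<in> set N" by auto
    then have "\<exists>z B. (z, A, B) \<in> set (incidences S) \<and> f ((1, [], A), 0) = (1, [z], A)"
      unfolding core3_def gadget_iff by auto
    then obtain z where z: "z \<in> set A" "f ((1, [], A), 0) = (1, [z], A)" using inc_mem by blast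
    have "y = z" if "y \<in> set A" "\<not> Y y" for y using Y[OF A that(1)] that(2) z(2) by simp
    then show ?thesis unfolding exactly_one_def using Y[OF A z(1)] z by blast
  qed
  then show "one_satisfiable S" unfolding one_satisfiable_def by blast
next
  assume "one_satisfiable S"
  then obtain \<sigma> where \<sigma>: "\<forall>A\<in>set S. exactly_one \<sigma> A" unfolding one_satisfiable_def by blast
  define z where "z A = (THE x. x \<in> set A \<and> \<sigma> x)" for A
  have z: "z A \<in> set A" "\<sigma> x \<longleftrightarrow> x = z A" if "A \<in> set S" "x \<in> set A" for A x
    using theI'[of "\<lambda>x. x \<in> set A \<and> \<sigma> x"] \<sigma> that unfolding exactly_one_def z_def by blast+
  define g :: "'x name \<times> nat \<Rightarrow> 'x name" where
    "g u = (let A = snd (snd (fst u)) in (if snd u = 0 then 1 else 2, [z A], A))" for u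
  have g: "(g ((1, [], A), 0) = (1, [x], A) \<longleftrightarrow> \<not> \<not> \<sigma> x) \<and> (g ((1, [], A), 1) = (2, [x], A) \<longleftrightarrow> \<not> \<not> \<sigma> x) \<and>
      (g ((1, [], A), 2) = (2, [x], A) \<longleftrightarrow> \<not> \<not> \<sigma> x)" if "A \<in> set S" "x \<in> set A" for x A
    using z(2)[OF that] by (auto simp: g_def Let_def)
  let ?f = "place (\<lambda>x. \<not> \<sigma> x) g"
  note complete = gadget_complete[of "\<lambda>x A. (1, [], A)" g "\<lambda>x. \<not> \<sigma> x", OF _ g]
  have "\<exists>N. (?f u, N) \<in> set (core3 S) \<and> u \<in> set N" if h: "h \<in> set (core3 S)" "u \<in> set (snd h)" for h u
  proof (cases "fst (fst u) = 0")
    case True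
    then show ?thesis using complete(2)[of h u] h unfolding core3_def by simp
  next
    case False
    obtain x A B c where i: "(x, A, B) \<in> set (incidences S)" "u = ((1, [], A), c)" "c \<in> {0, 1, 2}"
      using h False unfolding core3_def gadget_iff by auto
    then have A: "A \<in> set S" "x \<in> set A" using inc_mem by blast+
    then obtain C where C: "(z A, A, C) \<in> set (incidences S)" using inc_ex(1) z(1) by blast
    have f: "?f u = (if c = 0 then 1 else 2, [z A], A)"
      unfolding i(2) by (subst place_simps(4)) (simp_all add: g_def Let_def)
    show ?thesis
    proof (cases "c = 0")
      case True
      then show ?thesis
        using C i(2) f unfolding core3_def gadget_iff
        by (intro exI[of _ "[((1, [], A), 0), ((0, [z A], A), 1), ((0, [z A], C), 2)]"]) auto
    next
      case False
      then show ?thesis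
        using C i(2,3) f unfolding core3_def gadget_iff
        by (intro exI[of _ "[((0, [z A], A), 0), ((1, [], A), 1), ((1, [], A), 2)]"]) auto
    qed
  qed
  moreover have "balanced ?f (fst h) (snd h)" if "h \<in> set (core3 S)" for h
    using complete(1)[of h] that unfolding core3_def by simp
  ultimately have "placement (core3 S) ?f" unfolding placement_def by blast
  then show "\<exists>f. placement (core3 S) f" by blast
qed

text \<open>The tips of a true variable move to the vertex \<open>3 + c\<close> if the variable is
  \<open>hd A\<close>, and to \<open>6 + c\<close> otherwise. The fillers of colour class
  \<open>c\<close> choose one of these two vertices, and balance admits one tip there and none at
  the other, so exactly one variable is true. For soundness, the tips of colour 0 suffice.\<close>

theorem core4_iff_one: "(\<exists>f. placement (core4 S) f) \<longleftrightarrow> one_satisfiable S"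
proof
  assume "\<exists>f. placement (core4 S) f"
  then obtain f where f: "placement (core4 S) f" by blast
  obtain Y where Y: "\<And>x A. A \<in> set S \<Longrightarrow> x \<in> set A \<Longrightarrow> f ((1, [x], A), 0) = (1, [x], A) \<longleftrightarrow> \<not> Y x"
    by (rule gadget_sound[of "\<lambda>x A. (1, [x], A)" "core4 S" f]) (use f in \<open>auto simp: core4_iff\<close>)
  have "exactly_one Y A" if A: "A \<in> set S" for A
  proof -
    let ?n = "(2, [], A) :: 'x name" and ?t = "\<lambda>x. (1, [x], A) :: 'x name"
    let ?v = "(3, [], A) :: 'x name" and ?w = "(6, [], A) :: 'x name"
    have v: "(?v, map (\<lambda>x. (?t x, 0)) [hd A] @ [(?n, 1), (?n, 2)]) \<in> set (core4 S)"
      unfolding core4_iff using A first_Cons(1)[OF A]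
      by (intro disjI2 bexI[of _ A] exI[of _ 0] exI[of _ 1] exI[of _ 2] conjI disjI1) simp_all
    have w: "(?w, map (\<lambda>x. (?t x, 0)) (tl A) @ [(?n, 1), (?n, 2)]) \<in> set (core4 S)"
      unfolding core4_iff using A
      by (intro disjI2 bexI[of _ A] exI[of _ 0] exI[of _ 1] exI[of _ 2] conjI) simp_all
    have p: "(0, 1, 2) \<in> rotations" by simp
    have bv: "length (filter (\<lambda>x. f (?t x, 0) = ?v) [hd A]) = of_bool (f (?n, 1) = ?v)"
      using placementD(2)[OF f v] unfolding balanced_fillers[OF p] by blast
    have bw: "length (filter (\<lambda>x. f (?t x, 0) = ?w) (tl A)) = of_bool (f (?n, 1) = ?w)"
      using placementD(2)[OF f w] unfolding balanced_fillers[OF p] by blast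
    have "\<exists>N. (f (?n, 1), N) \<in> set (core4 S) \<and> (?n, 1) \<in> set N"
      by (rule placementD(1)[OF f w]) simp
    then have n: "f (?n, 1) = ?v \<or> f (?n, 1) = ?w"
      unfolding core4_iff gadget_iff by auto
    have t: "f (?t x, 0) = (1, [x], A) \<or> x = hd A \<and> f (?t x, 0) = ?v \<or> x \<in> set (tl A) \<and> f (?t x, 0) = ?w"
      if "x \<in> set A" for x
    proof -
      have "\<exists>N. (f (?t x, 0), N) \<in> set (core4 S) \<and> (?t x, 0) \<in> set N"
      proof (cases "x = hd A")
        case True
        then show ?thesis by (intro placementD(1)[OF f v]) simp
      next
        case False
        then have "x \<in> set (tl A)" using that first_Cons(3)[OF A] by blast
        then show ?thesis by (intro placementD(1)[OF f w]) simp
      qed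
      then show ?thesis
        unfolding core4_iff gadget_iff using first_Cons(1) by auto
    qed
    have hd: "hd A \<in> set A" using first_Cons(3)[OF A] by blast
    have bv': "f (?t (hd A), 0) = ?v \<longleftrightarrow> f (?n, 1) = ?v" using bv by (auto simp: of_bool_def split: if_splits)
    have Yhd: "Y (hd A) \<longleftrightarrow> f (?n, 1) = ?v"
      using t[OF hd] Y[OF A hd] bv' first_Cons(2)[OF A, of "hd A"] by auto
    have Ytl: "Y x \<longleftrightarrow> f (?t x, 0) = ?w" if "x \<in> set (tl A)" for x
    proof -
      have "x \<in> set A" "x \<noteq> hd A" using that first_Cons(2,3)[OF A] by blast+
      then show ?thesis using t[of x] Y[OF A, of x] by auto
    qed
    have len: "length (filter Y (tl A)) = of_bool (\<not> Y (hd A))"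
    proof -
      have "filter Y (tl A) = filter (\<lambda>x. f (?t x, 0) = ?w) (tl A)" using Ytl by (rule filter_cong[OF refl])
      then show ?thesis using bw n Yhd by auto
    qed
    show ?thesis
    proof (cases "Y (hd A)")
      case True
      then have "filter Y (tl A) = []" using len by simp
      then have "\<forall>x\<in>set (tl A). \<not> Y x" by (simp add: filter_empty_conv)
      then show ?thesis unfolding exactly_one_def first_Cons(3)[OF A] using True by blast
    next
      case False
      then have "length (filter Y (tl A)) = Suc 0" using len by simp
      then obtain y where "filter Y (tl A) = [y]" by (auto simp: length_Suc_conv)
      then have "set (filter Y (tl A)) = {y}" by simp
      then have y: "x \<in> set (tl A) \<and> Y x \<longleftrightarrow> x = y" for x by auto
      show ?thesis unfolding exactly_one_def first_Cons(3)[OF A]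
      proof (rule ex1I[of _ y])
        show "y \<in> insert (hd A) (set (tl A)) \<and> Y y" using y[of y] by simp
        show "x = y" if "x \<in> insert (hd A) (set (tl A)) \<and> Y x" for x using that y[of x] False by auto
      qed
    qed
  qed
  then show "one_satisfiable S" unfolding one_satisfiable_def by blast
next
  assume "one_satisfiable S"
  then obtain \<sigma> where \<sigma>: "\<forall>A\<in>set S. exactly_one \<sigma> A" unfolding one_satisfiable_def by blast
  define g :: "'x name \<times> nat \<Rightarrow> 'x name" where
    "g u = (case u of ((k, xs, A), c) \<Rightarrow> if k = 1 then
        (if \<sigma> (hd xs) then (if hd xs = hd A then 3 + c else 6 + c, [], A) else (if c = 0 then 1 else 2, xs, A))
      else (if \<sigma> (hd A) then k + 1 else k + 4, [], A))" for u
  have g_simps: "g ((1, [x], A), c) = (if \<sigma> x then (if x = hd A then 3 + c else 6 + c, [], A) else (if c = 0 then 1 else 2, [x], A))"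
      "g ((2 + c, [], A), d) = (if \<sigma> (hd A) then 3 + c else 6 + c, [], A)" for x A c d
    by (simp_all add: g_def)
  have g: "(g ((1, [x], A), 0) = (1, [x], A) \<longleftrightarrow> \<not> \<sigma> x) \<and> (g ((1, [x], A), 1) = (2, [x], A) \<longleftrightarrow> \<not> \<sigma> x) \<and>
      (g ((1, [x], A), 2) = (2, [x], A) \<longleftrightarrow> \<not> \<sigma> x)" for x A
    unfolding g_simps by auto
  let ?f = "place \<sigma> g" and ?G = "gadget (\<lambda>x A. (1, [x], A)) S"
  note complete = gadget_complete[of "\<lambda>x A. (1, [x], A)" g \<sigma>, OF _ g]
  note One_nat_def [simp del] add_2_eq_Suc [simp del] add_2_eq_Suc' [simp del]
  have f: "?f ((1, [x], A), c) = (if \<sigma> x then (if x = hd A then 3 + c else 6 + c, [], A) else (if c = 0 then 1 else 2, [x], A))"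
      "?f ((2 + c, [], A), d) = (if \<sigma> (hd A) then 3 + c else 6 + c, [], A)" for x A c d
    by (subst place_simps(4), simp, rule g_simps)+
  have N3: "((3 + c, [], A), clasp [hd A] A c d e) \<in> set (core4 S)" and N6: "((6 + c, [], A), clasp (tl A) A c d e) \<in> set (core4 S)"
    if A: "A \<in> set S" and "(c, d, e) \<in> rotations" for A and c d e :: nat
    unfolding core4_iff first_Cons(1)[OF A, symmetric] using that by blast+
  have core4_elim: "\<exists>A\<in>set S. \<exists>c d e. (c, d, e) \<in> rotations \<and>
      (h = ((3 + c, [], A), clasp [hd A] A c d e) \<or> h = ((6 + c, [], A), clasp (tl A) A c d e))"
    if h: "h \<in> set (core4 S)" "h \<notin> set ?G" for h
  proof -
    obtain A c d e where A: "A \<in> set S" "(c, d, e) \<in> rotations"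
      "h = ((3 + c, [], A), clasp (first A) A c d e) \<or>
       h = ((6 + c, [], A), clasp (tl A) A c d e)"
      using h unfolding core4_iff by blast
    then show ?thesis unfolding first_Cons(1)[OF A(1)] by blast
  qed
  have perm: "\<exists>d e :: nat. (c, d, e) \<in> rotations" if "c \<in> {0, 1, 2}" for c :: nat
    using that by auto
  have tip: "\<exists>N. (?f ((1, [x], A), c), N) \<in> set (core4 S) \<and> ((1, [x], A), c) \<in> set N"
    if A: "A \<in> set S" "x \<in> set A" and c: "c \<in> {0, 1, 2}" for x A and c :: nat
  proof (cases "\<sigma> x")
    case True
    obtain d e :: nat where p: "(c, d, e) \<in> rotations" using perm[OF c] by blast
    show ?thesis
    proof (cases "x = hd A")
      case hd: True
      show ?thesis using N3[OF A(1) p] True hd by (intro exI[of _ "clasp [hd A] A c d e"]) (simp add: f)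
    next
      case False
      then have "x \<in> set (tl A)" using A first_Cons(3)[OF A(1)] by blast
      then show ?thesis using N6[OF A(1) p] True False by (intro exI[of _ "clasp (tl A) A c d e"]) (simp add: f)
    qed
  next
    case False
    obtain B where B: "(x, A, B) \<in> set (incidences S)" using inc_ex(1)[OF A] by blast
    show ?thesis
    proof (cases "c = 0")
      case True
      then have "?f ((1, [x], A), c) = (1, [x], A)" using False by (simp add: f)
      then show ?thesis
        using B True unfolding core4_iff gadget_iff
        by (intro exI[of _ "[((1, [x], A), 0), ((0, [x], A), 1), ((0, [x], B), 2)]"]) auto
    next
      case c0: False
      then have "?f ((1, [x], A), c) = (2, [x], A)" using False by (simp add: f)
      then show ?thesis
        using B c c0 unfolding core4_iff gadget_iff
        by (intro exI[of _ "[((0, [x], A), 0), ((1, [x], A), 1), ((1, [x], A), 2)]"]) auto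
    qed
  qed
  have filler: "\<exists>N. (?f ((2 + c, [], A), k), N) \<in> set (core4 S) \<and> ((2 + c, [], A), k) \<in> set N"
    if A: "A \<in> set S" and p: "(c, d, e) \<in> rotations" and k: "k = d \<or> k = e" for A and c d e k :: nat
  proof (cases "\<sigma> (hd A)")
    case True
    show ?thesis using N3[OF A p] True k by (intro exI[of _ "clasp [hd A] A c d e"]) (auto simp only: f if_True, auto)
  next
    case False
    show ?thesis using N6[OF A p] False k by (intro exI[of _ "clasp (tl A) A c d e"]) (auto simp only: f if_False, auto)
  qed
  have "\<exists>N. (?f u, N) \<in> set (core4 S) \<and> u \<in> set N" if h: "h \<in> set (core4 S)" "u \<in> set (snd h)" for h u
  proof (cases "h \<in> set ?G")
    case G: True
    show ?thesis
    proof (cases "fst (fst u) = 0")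
      case True
      then show ?thesis using complete(2)[of h u] h G unfolding core4_iff by auto
    next
      case False
      obtain x A B c where i: "(x, A, B) \<in> set (incidences S)" "u = ((1, [x], A), c)" "c \<in> {0, 1, 2}"
        using h G False unfolding gadget_iff by auto
      then show ?thesis using tip inc_mem by blast
    qed
  next
    case False
    obtain A c d e where A: "A \<in> set S" and p: "(c, d, e) \<in> rotations"
        and h': "h = ((3 + c, [], A), clasp [hd A] A c d e) \<or> h = ((6 + c, [], A), clasp (tl A) A c d e)"
      using core4_elim[OF _ False] h by blast
    have "(\<exists>x\<in>set A. u = ((1, [x], A), c)) \<or> (\<exists>k. u = ((2 + c, [], A), k) \<and> (k = d \<or> k = e))"
      using h' h(2) first_Cons(3)[OF A] by auto
    moreover have "c \<in> {0, 1, 2}" using p by auto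
    ultimately show ?thesis using tip[OF A] filler[OF A p] by blast
  qed
  moreover have "balanced ?f (fst h) (snd h)" if h: "h \<in> set (core4 S)" for h
  proof (cases "h \<in> set ?G")
    case True
    then show ?thesis using complete(1)[of h] by simp
  next
    case False
    obtain A c d e where A: "A \<in> set S" and p: "(c, d, e) \<in> rotations"
        and h': "h = ((3 + c, [], A), clasp [hd A] A c d e) \<or> h = ((6 + c, [], A), clasp (tl A) A c d e)"
      using core4_elim[OF _ False] h by blast
    have ex: "\<exists>!x. x \<in> set A \<and> \<sigma> x" using \<sigma> A unfolding exactly_one_def by blast
    have hd: "hd A \<in> set A" using first_Cons(3)[OF A] by blast
    have c2: "c \<le> 2" using p by auto
    have "length (filter (\<lambda>x. ?f ((1, [x], A), c) = (6 + c, [], A)) (tl A)) = of_bool (\<not> \<sigma> (hd A))"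
    proof -
      have "?f ((1, [x], A), c) = (6 + c, [], A) \<longleftrightarrow> \<sigma> x" if "x \<in> set (tl A)" for x
        using first_Cons(2)[OF A that] by (auto simp: f)
      then have eq: "filter (\<lambda>x. ?f ((1, [x], A), c) = (6 + c, [], A)) (tl A) = filter \<sigma> (tl A)"
        by (rule filter_cong[OF refl])
      have "card {x\<in>set (tl A). \<sigma> x} = of_bool (\<not> \<sigma> (hd A))"
      proof (cases "\<sigma> (hd A)")
        case True
        have "{x\<in>set (tl A). \<sigma> x} = {}" using True ex hd first_Cons(2,3)[OF A] by blast
        then show ?thesis using True by simp
      next
        case False
        then obtain y where "y \<in> set (tl A)" "\<sigma> y" using ex first_Cons(3)[OF A] by auto
        then have "{x\<in>set (tl A). \<sigma> x} = {y}" using ex first_Cons(3)[OF A] by auto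
        then show ?thesis using False by simp
      qed
      moreover have "distinct (filter \<sigma> (tl A))" using S(2) A by (simp add: distinct_tl)
      ultimately show ?thesis unfolding eq by (metis distinct_card set_filter)
    qed
    then show ?thesis
      using h' by (elim disjE) (auto simp only: fst_conv snd_conv balanced_fillers[OF p] f, auto)
  qed
  ultimately have "placement (core4 S) ?f" unfolding placement_def by blast
  then show "\<exists>f. placement (core4 S) f" by blast
qed

end


section \<open>Exact maximum degrees\<close>

definition touching :: "('m \<times> 'u list) list \<Rightarrow> 'u \<Rightarrow> 'm set" where
  "touching H u = {v. \<exists>N. (v, N) \<in> set H \<and> u \<in> set N}"

definition shape :: "nat \<Rightarrow> nat \<Rightarrow> ('m \<times> ('n \<times> nat) list) list \<Rightarrow> bool" where
  "shape a b H \<longleftrightarrow> (\<forall>v N N'. (v, N) \<in> set H \<and> (v, N') \<in> set H \<longrightarrow> N = N') \<and>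
     (\<forall>v N. (v, N) \<in> set H \<longrightarrow> distinct N \<and> length N \<le> b \<and> (\<forall>u\<in>set N. snd u < 3)) \<and>
     (\<forall>u. finite (touching H u) \<and> card (touching H u) \<le> a)"

lemma card_touching:
  assumes "\<And>v N. (v, N) \<in> set H \<Longrightarrow> u \<in> set N \<Longrightarrow> v \<in> set l" "length l \<le> a"
  shows "finite (touching H u) \<and> card (touching H u) \<le> a"
proof -
  have "touching H u \<subseteq> set l" using assms(1) by (auto simp: touching_def)
  then show ?thesis
    using assms(2) card_mono[of "set l" "touching H u"] card_length[of l] by (auto intro: finite_subset)
qed

context exact_system
begin

text \<open>Left degree 3 is due to the common tips, which have one edge for each variable of their
  constraint; a vertex of a triple has only two edges.\<close>

lemma shape_core3: "shape 3 3 (core3 S)"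
  unfolding shape_def
proof (intro conjI allI impI)
  fix v N N' assume "(v, N) \<in> set (core3 S) \<and> (v, N') \<in> set (core3 S)"
  then show "N = N'" unfolding core3_def gadget_iff using inc_unique(1) by auto
next
  fix v N assume "(v, N) \<in> set (core3 S)"
  then show "distinct N" "length N \<le> 3" "\<forall>u\<in>set N. snd u < 3" unfolding core3_def gadget_iff by auto
next
  fix u :: "'x name \<times> nat"
  obtain k xs A c where u: "u = ((k, xs, A), c)" by (cases u) auto
  have "finite (touching (core3 S) u) \<and> card (touching (core3 S) u) \<le> 3"
  proof (cases "k = 0")
    case True
    show ?thesis
      by (rule card_touching[where l = "[(0, xs, A), (if c = 0 then 2 else 1, xs, if c = 2 then before (hd xs) A else A)]"])
        (use True in \<open>auto simp: u core3_def gadget_iff before\<close>)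
  next
    case False
    show ?thesis
      by (rule card_touching[where l = "if A \<in> set S then map (\<lambda>x. (if c = 0 then 1 else 2, [x], A)) A else []"])
        (use False S(2) inc_mem in \<open>auto simp: u core3_def gadget_iff\<close>)
  qed
  then show "finite (touching (core3 S) u)" "card (touching (core3 S) u) \<le> 3" by blast+
qed

text \<open>Splitting a constraint into its head and its tail is what keeps the right degree at 4: a
  tail consists of at most two tips, to which two fillers are added. Each tip is joined to its
  gadget and to one of the two parts, each filler to both parts, so the left degree is 2.\<close>

lemma shape_core4: "shape 2 4 (core4 S)"
  unfolding shape_def
proof (intro conjI allI impI)
  fix v N N' assume "(v, N) \<in> set (core4 S) \<and> (v, N') \<in> set (core4 S)"
  then show "N = N'" unfolding core4_iff gadget_iff using inc_unique(1) by auto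
next
  fix v N assume *: "(v, N) \<in> set (core4 S)"
  note One_nat_def [simp del] add_2_eq_Suc [simp del] add_2_eq_Suc' [simp del]
  have l: "length A \<le> 3" "distinct (tl A)" if "A \<in> set S" for A using S(2) that by (auto simp: distinct_tl)
  have d: "distinct (clasp xs A c d e)"
    if "distinct xs" "d \<noteq> e" for A :: "'x list" and c d e :: nat and xs :: "'x list"
    using that by (auto simp: distinct_map inj_on_def)
  show "distinct N" using * unfolding core4_iff
  proof (elim disjE)
    assume "(v, N) \<in> set (gadget (\<lambda>x A. (1, [x], A)) S)"
    then show ?thesis unfolding gadget_iff by auto
  next
    assume "\<exists>A\<in>set S. \<exists>c d e. (c, d, e) \<in> rotations \<and>
      ((v, N) = ((3 + c, [], A), clasp (first A) A c d e) \<or>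
       (v, N) = ((6 + c, [], A), clasp (tl A) A c d e))"
    then obtain A c d e where A: "A \<in> set S" "(c, d, e) \<in> rotations" and
      N: "N = clasp (first A) A c d e \<or>
        N = clasp (tl A) A c d e"
      by blast
    have "distinct (first A)" "d \<noteq> e" using A(2) by (auto simp: first_Cons(1)[OF A(1)])
    with N d l(2)[OF A(1)] show ?thesis by blast
  qed
  show "length N \<le> 4" using * l(1) first_Cons(1) unfolding core4_iff gadget_iff by fastforce
  show "\<forall>u\<in>set N. snd u < 3" using * unfolding core4_iff gadget_iff by auto
next
  fix u :: "'x name \<times> nat"
  obtain k xs A c where u: "u = ((k, xs, A), c)" by (cases u) auto
  have "finite (touching (core4 S) u) \<and> card (touching (core4 S) u) \<le> 2"
  proof (cases "k = 0")
    case True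
    show ?thesis
      by (rule card_touching[where l = "[(0, xs, A), (if c = 0 then 2 else 1, xs, if c = 2 then before (hd xs) A else A)]"])
        (use True in \<open>auto simp: u core4_iff gadget_iff before\<close>)
  next
    case False
    show ?thesis
    proof (cases "k = 1")
      case True
      have "hd A \<notin> set (tl A)" if "A \<in> set S" using first_Cons(2)[OF that] by blast
      then show ?thesis
        by (intro card_touching[where l = "[(if c = 0 then 1 else 2, xs, A), (if xs = [hd A] then 3 + c else 6 + c, [], A)]"])
          (use True first_Cons(1,2) in \<open>auto simp: u core4_iff gadget_iff\<close>)
    next
      case k1: False
      show ?thesis
        by (rule card_touching[where l = "[(k + 1, [], A), (k + 4, [], A)]"])
          (use False k1 in \<open>auto simp: u core4_iff gadget_iff\<close>)
    qed
  qed
  then show "finite (touching (core4 S) u)" "card (touching (core4 S) u) \<le> 2" by blast+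
qed

lemma tags_core3: "(v, N) \<in> set (core3 S) \<Longrightarrow> fst v < 10 \<and> (\<forall>u\<in>set N. fst (fst u) < 10)"
  unfolding core3_def gadget_iff by auto

lemma tags_core4: "(v, N) \<in> set (core4 S) \<Longrightarrow> fst v < 10 \<and> (\<forall>u\<in>set N. fst (fst u) < 10)"
  unfolding core4_iff gadget_iff by auto

end

text \<open>The star at tag 10 has right degree \<open>b\<close> and remains empty, as each of its
  leaves completes a triangle of its own. A further triangle of left vertices is offered by
  \<open>a\<close> right vertices, one of which takes it; this gives left degree
  \<open>a\<close>.\<close>

definition pad :: "nat \<Rightarrow> nat \<Rightarrow> 'x graph" where
  "pad a b = ((10, [], []), map (\<lambda>i. ((10 + i, [], []), 0)) [0..<b]) #
     map (\<lambda>i. ((11 + i, [], []), triangle (10 + i, [], []))) [0..<b] @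
     map (\<lambda>j. ((11 + b + j, [], []), triangle (10 + b, [], []))) [0..<a]"

lemma pad_iff:
  "h \<in> set (pad a b) \<longleftrightarrow> h = ((10, [], []), map (\<lambda>i. ((10 + i, [], []), 0)) [0..<b]) \<or>
    (\<exists>i<b. h = ((11 + i, [], []), triangle (10 + i, [], []))) \<or>
    (\<exists>j<a. h = ((11 + b + j, [], []), triangle (10 + b, [], [])))"
  unfolding pad_def by auto

lemma tags_pad: "(v, N) \<in> set (pad a b) \<Longrightarrow> 10 \<le> fst v \<and> (\<forall>u\<in>set N. 10 \<le> fst (fst u))"
  unfolding pad_iff by auto

lemma shape_pad:
  assumes "2 \<le> a" "3 \<le> b"
  shows "shape a b (pad a b :: 'x graph)"
  unfolding shape_def
proof (intro conjI allI impI)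
  fix v :: "'x name" and N N' assume "(v, N) \<in> set (pad a b) \<and> (v, N') \<in> set (pad a b)"
  then show "N = N'" unfolding pad_iff by auto
next
  fix v :: "'x name" and N assume N: "(v, N) \<in> set (pad a b)"
  then show "distinct N" unfolding pad_iff by (auto simp: distinct_map inj_on_def)
  show "length N \<le> b" "\<forall>u\<in>set N. snd u < 3" using N assms unfolding pad_iff by auto
next
  fix u :: "'x name \<times> nat"
  obtain k xs A c where u: "u = ((k, xs, A), c)" by (cases u) auto
  have "finite (touching (pad a b) u) \<and> card (touching (pad a b) u) \<le> a"
  proof (cases "k = 10 + b")
    case True
    show ?thesis
      by (rule card_touching[where l = "map (\<lambda>j. (11 + b + j, [], [])) [0..<a]"]) (use True in \<open>auto simp: u pad_iff\<close>)
  next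
    case False
    show ?thesis
      by (rule card_touching[where l = "[(10, [], []), (k + 1, [], [])]"]) (use False assms in \<open>auto simp: u pad_iff\<close>)
  qed
  then show "finite (touching (pad a b) u)" "card (touching (pad a b) u) \<le> a" by blast+
qed

lemma touching_pad: "card (touching (pad a b) ((10 + b, [], []), 0) :: 'x name set) = a"
proof -
  have "touching (pad a b) ((10 + b, [], []), 0) = (\<lambda>j. (11 + b + j, [], []) :: 'x name) ` {..<a}"
    unfolding touching_def pad_iff by auto
  then show ?thesis by (simp add: card_image inj_on_def)
qed

lemma placement_pad:
  assumes "1 \<le> a"
  shows "placement (pad a b) (\<lambda>u. (fst (fst u) + 1, [], []))"
  unfolding placement_def
proof (intro conjI ballI)
  fix h :: "'x name \<times> ('x name \<times> nat) list" and u assume "h \<in> set (pad a b)" "u \<in> set (snd h)"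
  then have "(\<exists>i<b. \<exists>c\<in>{0, 1, 2}. u = ((10 + i, [], []), c)) \<or> (\<exists>c\<in>{0, 1, 2}. u = ((10 + b, [], []), c))"
    unfolding pad_iff by (auto; blast)
  then show "\<exists>N. ((fst (fst u) + 1, [], []), N) \<in> set (pad a b) \<and> u \<in> set N"
  proof (elim disjE exE conjE bexE)
    fix i c assume "i < b" "c \<in> {0, 1, 2}" "u = ((10 + i, [], []), c)"
    then show ?thesis
      by (intro exI[of _ "triangle (10 + i, [], [])"]) (auto simp: pad_iff)
  next
    fix c assume "c \<in> {0, 1, 2}" "u = ((10 + b, [], []), c)"
    then show ?thesis
      using assms
      by (intro exI[of _ "triangle (10 + b, [], [])"])
        (auto simp: pad_iff intro!: exI[of _ 0])
  qed
next
  fix h :: "'x name \<times> ('x name \<times> nat) list" assume "h \<in> set (pad a b)"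
  then show "balanced (\<lambda>u. (fst (fst u) + 1, [], [])) (fst h) (snd h)"
    unfolding pad_iff
  proof (elim disjE exE conjE)
    assume h: "h = ((10, [], []), map (\<lambda>i. ((10 + i, [], []), 0)) [0..<b])"
    have "filter (\<lambda>u. (fst (fst u) + 1, [], []) = fst h \<and> snd u = c) (snd h) = []" for c
      unfolding h filter_empty_conv by auto
    then show ?thesis unfolding balanced_def by simp
  qed (simp_all only: fst_conv snd_conv balanced_triple)
qed

lemma placement_cong:
  assumes "\<And>v N u. (v, N) \<in> set H \<Longrightarrow> u \<in> set N \<Longrightarrow> f u = g u" "placement H f"
  shows "placement H g"
  unfolding placement_def
proof (intro conjI ballI)
  fix h u assume "h \<in> set H" "u \<in> set (snd h)"
  then show "\<exists>N. (g u, N) \<in> set H \<and> u \<in> set N"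
    using assms placementD(1)[OF assms(2), of "fst h" "snd h" u] by (metis prod.collapse)
next
  fix h assume h: "h \<in> set H"
  have eq: "filter (\<lambda>u. g u = fst h \<and> snd u = c) (snd h) = filter (\<lambda>u. f u = fst h \<and> snd u = c) (snd h)" for c
    by (rule filter_cong[OF refl]) (metis assms(1) h prod.collapse)
  have "balanced f (fst h) (snd h)"
    using placementD(2)[OF assms(2), of "fst h" "snd h"] h by simp
  then show "balanced g (fst h) (snd h)"
    unfolding balanced_def eq .
qed

text \<open>The tags, below 10 in the one graph and from 10 on in the other, keep the two parts
  disjoint. Placements can therefore be restricted and combined, and no vertex has edges in both
  parts.\<close>

lemma append_pad:
  fixes H :: "'x graph"
  assumes tags: "\<And>v N. (v, N) \<in> set H \<Longrightarrow> fst v < 10 \<and> (\<forall>u\<in>set N. fst (fst u) < 10)"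
    and shape: "shape a' b' H" and ab: "a' \<le> a" "b' \<le> b" "2 \<le> a" "3 \<le> b"
  shows "(\<exists>f. placement (H @ pad a b) f) \<longleftrightarrow> (\<exists>f. placement H f)" "shape a b (H @ pad a b)"
    "card (touching (H @ pad a b) ((10 + b, [], []), 0)) = a"
proof -
  have old: "u \<notin> set N'" if "(v, N) \<in> set H" "u \<in> set N" "(v', N') \<in> set (pad a b)" for v N u v' N'
    using tags[OF that(1)] tags_pad[OF that(3)] that(2) by force
  show "(\<exists>f. placement (H @ pad a b) f) \<longleftrightarrow> (\<exists>f. placement H f)"
  proof
    assume "\<exists>f. placement (H @ pad a b) f"
    then obtain f where f: "placement (H @ pad a b) f" by blast
    have "placement H f"
      unfolding placement_def
    proof (intro conjI ballI)
      fix h u assume h: "h \<in> set H" "u \<in> set (snd h)"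
      then have "\<exists>N. (f u, N) \<in> set (H @ pad a b) \<and> u \<in> set N"
        using placementD(1)[OF f, of "fst h" "snd h" u] by simp
      then obtain N where N: "(f u, N) \<in> set H \<union> set (pad a b)" "u \<in> set N" by auto
      have "(f u, N) \<notin> set (pad a b)"
        using old[of "fst h" "snd h" u "f u" N] h N(2) by (simp only: prod.collapse) blast
      then show "\<exists>N. (f u, N) \<in> set H \<and> u \<in> set N" using N by blast
    qed (use f in \<open>simp add: placement_def\<close>)
    then show "\<exists>f. placement H f" by blast
  next
    assume "\<exists>f. placement H f"
    then obtain f where f: "placement H f" by blast
    let ?g = "\<lambda>u. if fst (fst u) < 10 then f u else (fst (fst u) + 1, [], [])"
    have "placement H ?g"
      by (rule placement_cong[OF _ f]) (use tags in auto)
    moreover have "placement (pad a b) ?g"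
      by (rule placement_cong[OF _ placement_pad]) (use tags_pad ab in fastforce)+
    ultimately have "placement (H @ pad a b) ?g"
      unfolding placement_def set_append ball_Un by (meson UnCI)
    then show "\<exists>f. placement (H @ pad a b) f" by blast
  qed
  have pd: "shape a b (pad a b :: 'x graph)" by (rule shape_pad[OF ab(3,4)])
  have split: "touching (H @ pad a b) u = touching H u \<union> touching (pad a b) u" for u
    by (auto simp: touching_def)
  have one: "touching H u = {} \<or> touching (pad a b) u = {}" for u
    unfolding touching_def using old by blast
  show "shape a b (H @ pad a b)"
    unfolding shape_def
  proof (intro conjI allI impI)
    fix v N N' assume "(v, N) \<in> set (H @ pad a b) \<and> (v, N') \<in> set (H @ pad a b)"
    moreover have "(v, N) \<in> set H \<Longrightarrow> (v, N') \<notin> set (pad a b)" for N N' using tags[of v N] tags_pad[of v N' a b] by auto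
    ultimately show "N = N'" using shape pd unfolding shape_def set_append by blast
  next
    fix v N assume *: "(v, N) \<in> set (H @ pad a b)"
    have "\<forall>v N. (v, N) \<in> set H \<longrightarrow> distinct N \<and> length N \<le> b' \<and> (\<forall>u\<in>set N. snd u < 3)"
      "\<forall>v N. (v, N) \<in> set (pad a b) \<longrightarrow> distinct N \<and> length N \<le> b \<and> (\<forall>u\<in>set N. snd (u :: 'x name \<times> nat) < 3)"
      using shape pd unfolding shape_def by blast+
    with * ab(2) have "distinct N \<and> length N \<le> b \<and> (\<forall>u\<in>set N. snd u < 3)"
      unfolding set_append Un_iff by (meson le_trans)
    then show "distinct N" "length N \<le> b" "\<forall>u\<in>set N. snd u < 3" by simp_all
  next
    fix u
    have *: "finite (touching H u)" "card (touching H u) \<le> a'" "finite (touching (pad a b) u)" "card (touching (pad a b) u) \<le> a"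
      using shape pd unfolding shape_def by blast+
    then show "finite (touching (H @ pad a b) u)" unfolding split by blast
    show "card (touching (H @ pad a b) u) \<le> a" using one[of u] * ab unfolding split by auto
  qed
  have "touching H ((10 + b, [], []), 0) = {}"
    using tags by (fastforce simp: touching_def)
  then show "card (touching (H @ pad a b) ((10 + b, [], []), 0)) = a"
    unfolding split by (simp only: Un_empty_left touching_pad)
qed

section \<open>From graphs to instances\<close>

definition number :: "bool list \<Rightarrow> nat" where
  "number bs = foldr (\<lambda>b k. of_bool b + 2 * k) bs 0"

text \<open>The final \<open>True\<close> is the most significant digit, so no leading zeros get
  lost. The binary digits of a name are thus available without computing the number.\<close>

lemma bits_number: "bits (number (bs @ [True])) = bs @ [True]"
proof (induction bs)
  case Nil
  show ?case by (simp add: number_def bits.simps)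
next
  case (Cons b bs)
  let ?m = "number (bs @ [True])"
  have m: "?m > 0" using Cons by (cases ?m) (simp_all add: bits.simps)
  have "number ((b # bs) @ [True]) = of_bool b + 2 * ?m" by (simp add: number_def)
  moreover have "bits (of_bool b + 2 * ?m) = b # bits ?m" by (subst bits.simps) (use m in auto)
  ultimately show ?case using Cons by simp
qed

definition left_name :: "'n :: enc \<Rightarrow> nat" where
  "left_name u = number (code (enc (True, u)) @ [True])"

definition right_name :: "'n :: enc \<Rightarrow> nat" where
  "right_name v = number (code (enc (False, v)) @ [True])"

lemma names_eq_iff:
  "left_name u = left_name u' \<longleftrightarrow> u = u'" "right_name v = right_name v' \<longleftrightarrow> v = v'" "left_name u \<noteq> right_name v"
  for u u' :: "'n :: enc" and v v' :: "'m :: enc"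
proof -
  have *: "number (code (enc x) @ [True]) = number (code (enc y) @ [True]) \<Longrightarrow> enc x = enc y"
    for x :: "'a :: enc" and y :: "'b :: enc"
    by (metis append1_eq_conv bits_number code_eq_iff)
  show "left_name u = left_name u' \<longleftrightarrow> u = u'"
    unfolding left_name_def using *[of "(True, u)" "(True, u')"] by auto
  show "right_name v = right_name v' \<longleftrightarrow> v = v'"
    unfolding right_name_def using *[of "(False, v)" "(False, v')"] by auto
  have "enc (True, u) \<noteq> enc (False, v)" by (simp add: enc_prod_def enc_bool_def)
  then show "left_name u \<noteq> right_name v"
    unfolding left_name_def right_name_def using *[of "(True, u)" "(False, v)"] by blast
qed

definition lefts :: "('m \<times> 'u list) list \<Rightarrow> 'u set" where
  "lefts H = (\<Union>h\<in>set H. set (snd h))"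

definition graph_instance :: "('m :: enc \<times> ('n :: enc \<times> nat) list) list \<Rightarrow> (nat, nat) fm_instance" where
  "graph_instance H = \<lparr>lside = left_name ` lefts H, rside = right_name ` fst ` set H,
     edges = {{left_name u, right_name v} | u v. v \<in> touching H u}, colors = {0, 1, 2},
     col = (\<lambda>n. snd (inv (left_name :: 'n \<times> nat \<Rightarrow> nat) n)), ell = 0\<rparr>"

lemma touching_lefts: "v \<in> touching H u \<Longrightarrow> u \<in> lefts H \<and> v \<in> fst ` set H"
  unfolding touching_def lefts_def by force

lemma shape_less_3:
  assumes "shape a b H" "u \<in> lefts H"
  shows "snd u < 3"
proof -
  obtain h where h: "h \<in> set H" "u \<in> set (snd h)" using assms(2) unfolding lefts_def by blast
  then have "(fst h, snd h) \<in> set H" by simp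
  then show ?thesis using assms(1) h(2) unfolding shape_def by blast
qed

lemma inv_left_name: "inv left_name (left_name u) = u"
  by (rule inv_f_f) (simp add: inj_def names_eq_iff)

lemma graph_edges: "{left_name u, right_name v} \<in> edges (graph_instance H) \<longleftrightarrow> v \<in> touching H u"
  by (cases u) (auto simp: graph_instance_def doubleton_eq_iff names_eq_iff)

lemma graph_fm_instance:
  assumes "\<And>u. u \<in> lefts H \<Longrightarrow> snd u < 3"
  shows "fm_instance (graph_instance H)"
proof -
  have "left_name ` lefts H \<inter> right_name ` fst ` set H = {}" using names_eq_iff(3) by blast
  moreover have "\<exists>x\<in>left_name ` lefts H. \<exists>y\<in>right_name ` fst ` set H. e = {x, y}"
    if e: "e \<in> {{left_name u, right_name v} | u v. v \<in> touching H u}" for e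
  proof -
    obtain u v where uv: "e = {left_name u, right_name v}" "v \<in> touching H u" using e by blast
    show ?thesis using touching_lefts[OF uv(2)] unfolding uv(1) by blast
  qed
  moreover have "snd u \<in> {0, 1, 2}" if "u \<in> lefts H" for u using assms[OF that] by auto
  moreover have "finite (lefts H)" by (simp add: lefts_def)
  ultimately show ?thesis
    unfolding fm_instance_def graph_instance_def by (simp add: image_subset_iff inv_left_name)
qed

theorem graph_matching:
  fixes H :: "('m :: enc \<times> ('n :: enc \<times> nat) list) list"
  assumes shape: "shape a b H"
  shows "max_min_fair_matching (graph_instance H) \<longleftrightarrow> (\<exists>f. placement H f)"
proof -
  let ?I = "graph_instance H"
  have uniq: "N = N'" if "(v, N) \<in> set H" "(v, N') \<in> set H" for v N N'
    using shape that unfolding shape_def by blast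
  have dist: "distinct N" if "(v, N) \<in> set H" for v N
    using shape that unfolding shape_def by blast+
  have fm: "fm_instance ?I"
    by (rule graph_fm_instance, rule shape_less_3[OF shape])
  have I: "lside ?I = left_name ` lefts H" "rside ?I = right_name ` fst ` set H" "colors ?I = {0, 1, 2}" "ell ?I = 0"
    "col ?I (left_name u) = snd u" for u :: "'n \<times> nat"
    by (simp_all add: graph_instance_def inv_left_name)
  have bal: "fair_set ?I {n\<in>lside ?I. h n = right_name v} \<longleftrightarrow> balanced f v N"
    if hf: "\<forall>u\<in>lefts H. h (left_name u) = right_name (f u) \<and> f u \<in> touching H u" and N: "(v, N) \<in> set H" for h f v N
  proof -
    have "{n\<in>lside ?I. h n = right_name v} = left_name ` {u\<in>set N. f u = v}"
      unfolding I
    proof (intro equalityI subsetI)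
      fix n assume "n \<in> {n\<in>left_name ` lefts H. h n = right_name v}"
      then obtain u where u: "u \<in> lefts H" "n = left_name u" "h n = right_name v" by blast
      then have "f u = v" using hf names_eq_iff(2)[of "f u" v] by simp
      have "v \<in> touching H u" using hf u(1) \<open>f u = v\<close> by blast
      then have "u \<in> set N" using uniq N unfolding touching_def by blast
      then show "n \<in> left_name ` {u\<in>set N. f u = v}" using u \<open>f u = v\<close> by blast
    next
      fix n assume "n \<in> left_name ` {u\<in>set N. f u = v}"
      then obtain u where u: "u \<in> set N" "f u = v" "n = left_name u" by blast
      then have "u \<in> lefts H" unfolding lefts_def using N by force
      then show "n \<in> {n\<in>left_name ` lefts H. h n = right_name v}" using hf u by auto
    qed
    moreover have "card {n\<in>left_name ` {u\<in>set N. f u = v}. col ?I n = c} = length (filter (\<lambda>u. f u = v \<and> snd u = c) N)" for c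
    proof -
      have "{n\<in>left_name ` {u\<in>set N. f u = v}. col ?I n = c} = left_name ` set (filter (\<lambda>u. f u = v \<and> snd u = c) N)"
        by (auto simp: I)
      moreover have "card (left_name ` set (filter (\<lambda>u. f u = v \<and> snd u = c) N)) = card (set (filter (\<lambda>u. f u = v \<and> snd u = c) N))"
        by (rule card_image) (simp add: inj_on_def names_eq_iff)
      ultimately show ?thesis using distinct_card[OF distinct_filter[OF dist[OF N]]] by simp
    qed
    ultimately show ?thesis
      unfolding fair_set_iff[OF fm] balanced_def all_less_3 I by (simp add: le_antisym) linarith
  qed
  have iff: "assignment ?I h \<longleftrightarrow> placement H f"
    if hf: "\<forall>u\<in>lefts H. h (left_name u) = right_name (f u) \<and> f u \<in> touching H u" for h f
  proof -
    have "h n \<in> rside ?I \<and> {n, h n} \<in> edges ?I" if n: "n \<in> lside ?I" for n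
    proof -
      obtain u where u: "u \<in> lefts H" "n = left_name u" using n unfolding I by blast
      then have fu: "h n = right_name (f u)" "f u \<in> touching H u" using hf by blast+
      show ?thesis unfolding u(2) fu(1)[unfolded u(2)] graph_edges I using fu(2) touching_lefts[OF fu(2)] by blast
    qed
    then have A: "\<forall>n\<in>lside ?I. h n \<in> rside ?I \<and> {n, h n} \<in> edges ?I" by blast
    have "assignment ?I h \<longleftrightarrow> (\<forall>v\<in>rside ?I. fair_set ?I {n\<in>lside ?I. h n = v})"
      unfolding assignment_def by (rule iffI, erule conjunct2, rule conjI[OF A])
    also have "\<dots> \<longleftrightarrow> (\<forall>x\<in>set H. fair_set ?I {n\<in>lside ?I. h n = right_name (fst x)})"
      unfolding I(2) image_image by (rule ball_simps)
    also have "\<dots> \<longleftrightarrow> (\<forall>x\<in>set H. balanced f (fst x) (snd x))"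
      using bal[OF hf] by (intro ball_cong refl) (metis prod.collapse)
    also have "\<dots> \<longleftrightarrow> placement H f"
    proof -
      have "\<exists>N. (f u, N) \<in> set H \<and> u \<in> set N" if x: "x \<in> set H" "u \<in> set (snd x)" for x u
      proof -
        have "u \<in> lefts H" using x unfolding lefts_def by blast
        then have "f u \<in> touching H u" using hf by blast
        then show ?thesis unfolding touching_def by blast
      qed
      then show ?thesis unfolding placement_def by blast
    qed
    finally show ?thesis .
  qed
  show ?thesis
    unfolding max_min_fair_matching_iff[OF fm]
  proof
    assume "\<exists>h. assignment ?I h"
    then obtain h where h: "assignment ?I h" by blast
    have "\<exists>v. h (left_name u) = right_name v \<and> v \<in> touching H u" if "u \<in> lefts H" for u
    proof -
      have *: "h (left_name u) \<in> right_name ` fst ` set H" "{left_name u, h (left_name u)} \<in> edges ?I"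
        using h that unfolding assignment_def I by blast+
      then obtain v :: 'm where v: "h (left_name u) = right_name v" by blast
      then have "v \<in> touching H u" using *(2) graph_edges[of u v H] by simp
      then show ?thesis using v by blast
    qed
    then obtain f where "\<forall>u\<in>lefts H. h (left_name u) = right_name (f u) \<and> f u \<in> touching H u" by metis
    then show "\<exists>f. placement H f" using iff h by blast
  next
    assume "\<exists>f. placement H f"
    then obtain f where f: "placement H f" by blast
    have "f u \<in> touching H u" if "u \<in> lefts H" for u
      using f that unfolding placement_def lefts_def touching_def by blast
    then have "\<forall>u\<in>lefts H. (right_name (f (inv left_name (left_name u))) = right_name (f u)) \<and> f u \<in> touching H u"
      by (simp add: inv_left_name)
    then show "\<exists>h. assignment ?I h" using iff[of "\<lambda>n. right_name (f (inv left_name n))" f] f by blast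
  qed
qed

lemma max_degree_eq:
  assumes "finite W" "\<And>w. w \<in> W \<Longrightarrow> card (nbrs E w) \<le> k" "w \<in> W" "card (nbrs E w) = k"
  shows "max_degree E W = k"
  unfolding max_degree_def using assms by (intro Max_eqI) auto

lemma graph_degrees:
  fixes H :: "('m :: enc \<times> ('n :: enc \<times> nat) list) list"
  assumes shape: "shape a b H" and u: "card (touching H u) = a" "a > 0" and v: "(v, N) \<in> set H" "length N = b"
  shows "Delta_U (graph_instance H) = a" "Delta_V (graph_instance H) = b"
proof -
  let ?I = "graph_instance H"
  have uniq: "N = N'" if "(v, N) \<in> set H" "(v, N') \<in> set H" for v N N'
    using shape that unfolding shape_def by blast
  have dist: "distinct N" "length N \<le> b" if "(v, N) \<in> set H" for v N
    using shape that unfolding shape_def by blast+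
  have fm: "fm_instance ?I"
    by (rule graph_fm_instance, rule shape_less_3[OF shape])
  have I: "lside ?I = left_name ` lefts H" "rside ?I = right_name ` fst ` set H"
    by (simp_all add: graph_instance_def)
  have fin: "finite (lside ?I)" "finite (rside ?I)" by (simp_all add: I lefts_def)
  have U: "card (nbrs (edges ?I) (left_name w)) = card (touching H w)" if w: "w \<in> lefts H" for w
  proof -
    have "nbrs (edges ?I) (left_name w) = right_name ` touching H w"
      using w by (subst nbrs_edges(1)[OF fm]) (auto simp: I graph_edges dest: touching_lefts)
    then show ?thesis by (simp add: card_image inj_on_def names_eq_iff)
  qed
  have V: "card (nbrs (edges ?I) (right_name w)) = length M" if w: "(w, M) \<in> set H" for w M
  proof -
    have "w \<in> touching H x \<longleftrightarrow> x \<in> set M" for x using w uniq unfolding touching_def by blast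
    moreover have "set M \<subseteq> lefts H" using w unfolding lefts_def by force
    moreover have "right_name w \<in> rside ?I" using w unfolding I by force
    ultimately have "nbrs (edges ?I) (right_name w) = left_name ` set M"
      by (subst nbrs_edges(2)[OF fm]) (auto simp: I graph_edges names_eq_iff)
    then show ?thesis using distinct_card[OF dist(1)[OF w]] by (simp add: card_image inj_on_def names_eq_iff)
  qed
  have "touching H u \<noteq> {}" using u by auto
  then obtain y where "y \<in> touching H u" by (meson ex_in_conv)
  from touching_lefts[OF this] have ul: "u \<in> lefts H" ..
  show "Delta_U ?I = a"
    unfolding Delta_U_def
  proof (rule max_degree_eq[OF fin(1)])
    show "left_name u \<in> lside ?I" using ul by (simp add: I)
    show "card (nbrs (edges ?I) (left_name u)) = a" using U[OF ul] u by simp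
    show "card (nbrs (edges ?I) w) \<le> a" if "w \<in> lside ?I" for w
      using that U shape unfolding I shape_def by force
  qed
  show "Delta_V ?I = b"
    unfolding Delta_V_def
  proof (rule max_degree_eq[OF fin(2)])
    show "right_name v \<in> rside ?I" using v by (force simp: I)
    show "card (nbrs (edges ?I) (right_name v)) = b" using V[OF v(1)] v(2) by simp
    show "card (nbrs (edges ?I) w) \<le> b" if "w \<in> rside ?I" for w
      using that V dist(2) unfolding I by force
  qed
qed

text \<open>The code of a name is written down directly from the tree; the number itself, held in
  unary, could be exponentially large.\<close>

definition name_code :: "tree \<Rightarrow> bool list" where
  "name_code t = concat (map (\<lambda>b. [True, b]) (code t @ [True])) @ [False, False]"

definition emit :: "('m :: enc \<times> ('n :: enc \<times> nat) list) list \<Rightarrow> bool list" where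
  "emit H = concat (map (\<lambda>u. name_code (enc (True, u)) @
       (if snd u = 0 then nat_code 0 else if snd u = 1 then nat_code 1 else nat_code 2)) (remdups (concat (map snd H)))) @
     [False, True] @
     concat (map (\<lambda>v. name_code (enc (False, v))) (remdups (map fst H))) @ [False, True] @
     concat (map (\<lambda>e. name_code (enc (True, fst e)) @ name_code (enc (False, snd e)))
       (remdups (concat (map (\<lambda>h. map (\<lambda>u. (u, fst h)) (snd h)) H)))) @ [False, True] @
     list_code [0, 1, 2] @ nat_code 0"

lemma name_code: "name_code (enc (True, u)) = nat_code (left_name u)" "name_code (enc (False, v)) = nat_code (right_name v)"
  unfolding name_code_def nat_code_def left_name_def right_name_def bits_number by (rule refl)+

lemma pairs_code_concat: "pairs_code ps = concat (map (\<lambda>p. nat_code (fst p) @ nat_code (snd p)) ps) @ [False, True]"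
proof -
  have "concat (map nat_code (concat (map (\<lambda>(m, n). [m, n]) ps))) = concat (map (\<lambda>p. nat_code (fst p) @ nat_code (snd p)) ps)"
    by (induction ps) auto
  then show ?thesis by (simp add: pairs_code_def list_code_def)
qed

lemma emit_encodes:
  assumes shape: "shape a b H"
  shows "encodes (emit H) (graph_instance H)"
proof -
  let ?I = "graph_instance H"
  let ?U = "remdups (concat (map snd H))" and ?V = "remdups (map fst H)"
  let ?E = "remdups (concat (map (\<lambda>h. map (\<lambda>u. (u, fst h)) (snd h)) H))"
  have U: "set ?U = lefts H" by (simp add: lefts_def)
  have E: "set ?E = {(u, v). v \<in> touching H u}" by (force simp: touching_def)
  have inj: "inj_on left_name A" "inj_on right_name B" "inj_on (map_prod left_name right_name) C" for A B C
    by (auto simp: inj_on_def names_eq_iff)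
  have col: "(if snd u = 0 then nat_code 0 else if snd u = 1 then nat_code 1 else nat_code 2) = nat_code (col ?I (left_name u))"
    if "u \<in> lefts H" for u
  proof -
    have "snd u < 3" using that shape unfolding lefts_def shape_def by force
    then have "snd u \<in> {0, 1, 2}" by auto
    then show ?thesis by (auto simp: graph_instance_def inv_left_name)
  qed
  show ?thesis
    unfolding encodes_def
  proof (intro exI conjI)
    show "distinct (map left_name ?U)" "distinct (map right_name ?V)" "distinct (map (map_prod left_name right_name) ?E)"
      using inj by (simp_all add: distinct_map)
    show "set (map left_name ?U) = lside ?I" "set (map right_name ?V) = rside ?I" "set [0, 1, 2] = colors ?I"
      using U by (simp_all add: graph_instance_def)
    show "distinct [0, 1, 2 :: nat]" by simp
    show "set (map (map_prod left_name right_name) ?E) = {(u, v). u \<in> lside ?I \<and> v \<in> rside ?I \<and> {u, v} \<in> edges ?I}"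
      unfolding set_map E
      by (auto simp: graph_instance_def doubleton_eq_iff names_eq_iff image_iff dest: touching_lefts)
    have "concat (map (\<lambda>u. name_code (enc (True, u)) @
       (if snd u = 0 then nat_code 0 else if snd u = 1 then nat_code 1 else nat_code 2)) ?U) =
       concat (map (\<lambda>u. nat_code (left_name u) @ nat_code (col ?I (left_name u))) ?U)"
      by (intro arg_cong[where f = concat] map_cong refl) (simp only: name_code col U)
    then show "emit H = pairs_code (map (\<lambda>u. (u, col ?I u)) (map left_name ?U)) @ list_code (map right_name ?V) @
        pairs_code (map (map_prod left_name right_name) ?E) @ list_code [0, 1, 2] @ nat_code (ell ?I)"
      unfolding emit_def pairs_code_concat name_code
      by (simp add: list_code_def comp_def graph_instance_def)
  qed
qed

lemma PF_emit: "PF H \<Longrightarrow> PF (\<lambda>x. emit (H x))"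
  by (rule PF_comp[of emit]) (unfold emit_def name_code_def, intro pf_intros)

lemma PF_core3: "PF S \<Longrightarrow> PF (\<lambda>x. core3 (S x))"
  by (rule PF_comp[of core3]) (unfold core3_def gadget_def incidences_def next_pairs_def, intro pf_intros)

lemma PF_core4: "PF S \<Longrightarrow> PF (\<lambda>x. core4 (S x))"
  by (rule PF_comp[of core4])
    (unfold core4_def gadget_def incidences_def next_pairs_def first_def, intro pf_intros)

theorem NP_hard_degrees:
  assumes "a \<ge> 2" "b \<ge> 3" "(a, b) \<noteq> (2, 3)"
  shows "NP_hard (encodings (\<lambda>I. Delta_U I = a \<and> Delta_V I = b)) (encodings max_min_fair_matching)"
  unfolding NP_hard_def
proof (intro allI impI)
  fix L assume "in_NP L"
  then obtain F :: "bool list \<Rightarrow> (bool \<times> nat list) list list" where F: "PF F" "\<And>x. x \<in> L \<longleftrightarrow> satisfiable (F x)"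
    by (rule Cook_Levin) blast
  \<comment> \<open>If \<open>a < 3\<close>, then \<open>a = 2\<close> and the excluded pair leaves
    \<open>b \<ge> 4\<close>, as required for \<open>core4\<close>.\<close>
  define G where "G S = (if a \<ge> 3 then core3 S else core4 S) @ pad a b" for S :: "nat list var list list"
  have G: "(\<exists>f. placement (G (system P)) f) \<longleftrightarrow> satisfiable P" "shape a b (G (system P))"
      "card (touching (G (system P)) ((10 + b, [], []), 0)) = a" for P :: "(bool \<times> nat list) list list"
  proof -
    interpret exact_system "system P" by unfold_locales (rule system_shape)+
    consider "a \<ge> 3" | "\<not> a \<ge> 3" "b \<ge> 4" using assms by fastforce
    then have "((\<exists>f. placement (G (system P)) f) \<longleftrightarrow> one_satisfiable (system P)) \<and>
      shape a b (G (system P)) \<and> card (touching (G (system P)) ((10 + b, [], []), 0)) = a"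
    proof cases
      case 1
      then show ?thesis
        using append_pad[OF tags_core3 shape_core3 1 assms(2,1,2)] core3_iff unfolding G_def by simp
    next
      case 2
      then show ?thesis
        using append_pad[OF tags_core4 shape_core4 assms(1) 2(2) assms(1,2)] core4_iff_one unfolding G_def by simp
    qed
    then show "(\<exists>f. placement (G (system P)) f) \<longleftrightarrow> satisfiable P" "shape a b (G (system P))"
      "card (touching (G (system P)) ((10 + b, [], []), 0)) = a" by (simp_all add: one_satisfiable_system)
  qed
  define f where "f x = emit (G (system (F x)))" for x
  have "PF (\<lambda>x. G (system (F x)))"
  proof (cases "a \<ge> 3")
    case True
    then show ?thesis unfolding G_def if_P[OF True] by (intro pf_intros PF_core3 PF_system F)
  next
    case False
    then show ?thesis unfolding G_def if_not_P[OF False] by (intro pf_intros PF_core4 PF_system F)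
  qed
  then have "PF f" unfolding f_def by (rule PF_emit)
  moreover have "f x \<in> encodings (\<lambda>I. Delta_U I = a \<and> Delta_V I = b) \<and>
      (x \<in> L \<longleftrightarrow> f x \<in> encodings max_min_fair_matching)" for x
  proof -
    let ?H = "G (system (F x))"
    have star: "((10, [], []), map (\<lambda>i. ((10 + i, [], []), 0)) [0..<b]) \<in> set ?H"
      by (simp add: G_def pad_iff)
    have fm: "fm_instance (graph_instance ?H)"
      by (rule graph_fm_instance, rule shape_less_3[OF G(2)])
    have deg: "Delta_U (graph_instance ?H) = a" "Delta_V (graph_instance ?H) = b"
      using graph_degrees[OF G(2,3) _ star] assms by simp_all
    have enc: "encodes (f x) (graph_instance ?H)" unfolding f_def by (rule emit_encodes[OF G(2)])
    have "x \<in> L \<longleftrightarrow> max_min_fair_matching (graph_instance ?H)"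
      unfolding F(2) graph_matching[OF G(2)] G(1) ..
    moreover have "f x \<in> encodings max_min_fair_matching \<longleftrightarrow> max_min_fair_matching (graph_instance ?H)"
    proof
      assume "f x \<in> encodings max_min_fair_matching"
      then obtain I where I: "fm_instance I" "max_min_fair_matching I" "encodes (f x) I"
        unfolding encodings_def by blast
      \<comment> \<open>The instance \<open>I\<close> that witnesses membership need not be the one
        constructed, but both have the same string, and \<open>parse\<close> of that string
        determines the answer.\<close>
      show "max_min_fair_matching (graph_instance ?H)"
        using I(2) instance_lists.matching_iff(1)[OF parse_instance_lists[OF I(1,3)]]
          instance_lists.matching_iff(1)[OF parse_instance_lists[OF fm enc]] by simp
    qed (use fm enc in \<open>auto simp: encodings_def\<close>)
    ultimately show ?thesis using fm enc deg unfolding encodings_def by blast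
  qed
  ultimately show "\<exists>f. poly_time_computable f \<and> (\<forall>x. f x \<in> encodings (\<lambda>I. Delta_U I = a \<and> Delta_V I = b) \<and>
      (x \<in> L \<longleftrightarrow> f x \<in> encodings max_min_fair_matching))"
    using PF_poly_time_computable by blast
qed

theorem theorem22:
  shows "(\<forall>P \<in> {max_min_fair_matching, max_min_fair_matching_nonempty}.
            poly_time_solvable (encodings (\<lambda>I. Delta_U I \<le> 1)) (encodings P) \<and>
            poly_time_solvable (encodings (\<lambda>I. Delta_V I \<le> 2)) (encodings P) \<and>
            poly_time_solvable (encodings (\<lambda>I. Delta_U I = 2 \<and> Delta_V I = 3)) (encodings P)) \<and>
         (\<forall>a b. a \<ge> 2 \<and> b \<ge> 3 \<and> (a, b) \<noteq> (2, 3) \<longrightarrow>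
            NP_hard (encodings (\<lambda>I. Delta_U I = a \<and> Delta_V I = b))
                    (encodings max_min_fair_matching))"
  using poly_time_cases[of False] poly_time_cases[of True] NP_hard_degrees
  by (simp add: problem_def)

end
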